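(* Let $d=1$ and $\alpha\in(0,1]$, and let $\xi$ be the Lévy process in the Lamperti representation of the radial process $R=|Z|$ of the real symmetric stable process $Z$ of index $\alpha$. Then the characteristic exponent $\Psi$ of $\xi$ satisfies \[ \Psi(\lambda)=\int_{\mathbb{R}}\big(e^{i\lambda y}-1\big)\Pi_1(dy)+\int_{\mathbb{R}}\big(e^{i\lambda y}-1\big)\Pi_2(dy), \] where \[ \Pi_1(dy)=\frac{2^{\alpha-1}\alpha(1/2)_{\alpha/2}}{\Gamma(1-\alpha/2)}\left(\frac{e^y}{(e^y-1)^{\alpha+1}}\mathbf{1}_{\{y>0\}}+\frac{e^y}{(1-e^y)^{\alpha+1}}\mathbf{1}_{\{y<0\}}\right)dy \] is the Lévy measure of a Lamperti Lévy process with characteristics $(0,1,\alpha)$, and \[ \Pi_2(dy)=\frac{2^{\alpha-1}\alpha(1/2)_{\alpha/2}}{\Gamma(1-\alpha/2)}\,\frac{e^y}{(e^y+1)^{\alpha+1}}\,dy \] is the Lévy measure of a compound Poisson process.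
   Context: $Z$ is the real Lévy process with $\mathbb{E}_0[e^{i\theta Z_t}]=e^{-t|\theta|^\alpha}$. For $\alpha\le1$, started away from $0$, $R=|Z|$ is a positive self-similar Markov process of index $\alpha$ which never hits $0$. Its Lamperti representation is: if $R_0=r>0$, then $R_t=r\exp\{\xi_{\tau(tr^{-\alpha})}\}$, $t\ge0$, where $\xi$ is a real Lévy process started from $0$ (with law not depending on $r$) and $\tau(t)=\inf\{s\ge0:\int_0^se^{\alpha\xi_u}du\ge t\}$. Here the characteristic exponent is defined by $E[e^{i\lambda\xi_t}]=e^{t\Psi(\lambda)}$, $\lambda\in\mathbb{R}$. $(z)_s=\Gamma(z+s)/\Gamma(z)$. "Lamperti Lévy process with characteristics $(0,1,\alpha)$" is the name used for a Lévy process whose Lévy measure has the displayed form $\Pi_1$.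
   Formalization: For α=1 the integral of e^{iλy}−1 against Π₁ does not converge absolutely at 0, so it is taken there as a principal value at the origin; for α<1 it is the ordinary, absolutely convergent integral as stated. *)

theory Defs
  imports "HOL-Probability.Probability"
begin

definition cadlag :: "(real \<Rightarrow> real) \<Rightarrow> bool" where
  "cadlag f \<longleftrightarrow>
     (\<forall>t\<ge>0. (f \<longlongrightarrow> f t) (at_right t)) \<and>
     (\<forall>t>0. \<exists>l. (f \<longlongrightarrow> l) (at_left t))"

text \<open>Processes are indexed by \<open>real\<close>, but only times \<open>t \<ge> 0\<close> are meaningful.
  Finitely many times \<open>0 \<le> t 0 \<le> \<dots> \<le> t n\<close> extend to a monotone sequence by repeating
  \<open>t n\<close>, so the condition on monotone sequences is the usual one on finite families.\<close>

definition levy_process :: "'a measure \<Rightarrow> (real \<Rightarrow> 'a \<Rightarrow> real) \<Rightarrow> bool" where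
  "levy_process M X \<longleftrightarrow>
     prob_space M \<and>
     (\<forall>t\<ge>0. X t \<in> borel_measurable M) \<and>
     (AE \<omega> in M. X 0 \<omega> = 0) \<and>
     (\<forall>t::nat \<Rightarrow> real. 0 \<le> t 0 \<and> mono t \<longrightarrow>
        prob_space.indep_vars M (\<lambda>_. borel) (\<lambda>k \<omega>. X (t (Suc k)) \<omega> - X (t k) \<omega>) UNIV) \<and>
     (\<forall>s t. 0 \<le> s \<and> s \<le> t \<longrightarrow>
        distr M borel (\<lambda>\<omega>. X t \<omega> - X s \<omega>) = distr M borel (X (t - s))) \<and>
     (AE \<omega> in M. cadlag (\<lambda>t. X t \<omega>))"

definition has_char_exponent ::
    "'a measure \<Rightarrow> (real \<Rightarrow> 'a \<Rightarrow> real) \<Rightarrow> (real \<Rightarrow> complex) \<Rightarrow> bool" where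
  "has_char_exponent M X \<Psi> \<longleftrightarrow>
     (\<forall>t\<ge>0. \<forall>\<theta>. char (distr M borel (X t)) \<theta> = exp (complex_of_real t * \<Psi> \<theta>))"

definition levy_measure :: "real measure \<Rightarrow> bool" where
  "levy_measure \<nu> \<longleftrightarrow>
     sets \<nu> = sets borel \<and> emeasure \<nu> {0} = 0 \<and>
     (\<integral>\<^sup>+ y. ennreal (min 1 (y\<^sup>2)) \<partial>\<nu>) < \<infinity>"

text \<open>The Levy measure of a Levy process is its jump measure in the Levy--Khintchine formula,
  with an arbitrary drift \<open>b\<close> and Gaussian coefficient \<open>\<sigma>\<close>.\<close>

definition has_levy_measure ::
    "'a measure \<Rightarrow> (real \<Rightarrow> 'a \<Rightarrow> real) \<Rightarrow> real measure \<Rightarrow> bool" where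
  "has_levy_measure M X \<nu> \<longleftrightarrow>
     levy_process M X \<and> levy_measure \<nu> \<and>
     (\<exists>b \<sigma>. has_char_exponent M X (\<lambda>\<theta>.
        \<i> * complex_of_real (b * \<theta>) - complex_of_real (\<sigma>\<^sup>2 * \<theta>\<^sup>2 / 2) +
        (CLINT y|\<nu>. iexp (\<theta> * y) - 1 -
           \<i> * complex_of_real (\<theta> * y * indicator {-1<..<1} y))))"

definition poisson_process :: "'a measure \<Rightarrow> real \<Rightarrow> (real \<Rightarrow> 'a \<Rightarrow> nat) \<Rightarrow> bool" where
  "poisson_process M q N \<longleftrightarrow>
     q > 0 \<and> levy_process M (\<lambda>t \<omega>. real (N t \<omega>)) \<and>
     (\<forall>t>0. distr M (count_space UNIV) (N t) = measure_pmf (poisson_pmf (q * t)))"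

definition compound_poisson_process ::
    "'a measure \<Rightarrow> (real \<Rightarrow> 'a \<Rightarrow> real) \<Rightarrow> bool" where
  "compound_poisson_process M X \<longleftrightarrow>
     (\<exists>q N (J :: nat \<Rightarrow> 'a \<Rightarrow> real) \<mu>.
        poisson_process M q N \<and>
        prob_space.indep_vars M (\<lambda>_. borel) J UNIV \<and>
        (\<forall>k. distr M borel (J k) = \<mu>) \<and>
        prob_space.indep_set M
          (sets (vimage_algebra (space M) (\<lambda>\<omega>. \<lambda>t\<in>{0..}. N t \<omega>)
             (\<Pi>\<^sub>M t\<in>{0..}. count_space UNIV)))
          (sets (vimage_algebra (space M) (\<lambda>\<omega> k. J k \<omega>) (\<Pi>\<^sub>M k\<in>UNIV. borel))) \<and>
        (AE \<omega> in M. \<forall>t\<ge>0. X t \<omega> = (\<Sum>k<N t \<omega>. J k \<omega>)))"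

definition symmetric_stable_process ::
    "'a measure \<Rightarrow> real \<Rightarrow> real \<Rightarrow> (real \<Rightarrow> 'a \<Rightarrow> real) \<Rightarrow> bool" where
  "symmetric_stable_process M \<alpha> x Z \<longleftrightarrow>
     levy_process M (\<lambda>t \<omega>. Z t \<omega> - x) \<and>
     has_char_exponent M (\<lambda>t \<omega>. Z t \<omega> - x) (\<lambda>\<theta>. - complex_of_real (\<bar>\<theta>\<bar> powr \<alpha>))"

definition lamperti_set :: "real \<Rightarrow> (real \<Rightarrow> real) \<Rightarrow> real \<Rightarrow> real set" where
  "lamperti_set \<alpha> f t = {s. 0 \<le> s \<and> t \<le> (LINT u:{0..s}|lborel. exp (\<alpha> * f u))}"

definition lamperti_time :: "real \<Rightarrow> (real \<Rightarrow> real) \<Rightarrow> real \<Rightarrow> real" where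
  "lamperti_time \<alpha> f t = Inf (lamperti_set \<alpha> f t)"

text \<open>Nonemptiness of \<open>lamperti_set\<close> says that the time change is finite, without which its
  real-valued infimum, and hence the representation, has no meaning.\<close>

definition lamperti_representation ::
    "'a measure \<Rightarrow> real \<Rightarrow> real \<Rightarrow> (real \<Rightarrow> 'a \<Rightarrow> real) \<Rightarrow> (real \<Rightarrow> 'a \<Rightarrow> real) \<Rightarrow> bool" where
  "lamperti_representation M \<alpha> r R \<xi> \<longleftrightarrow>
     levy_process M \<xi> \<and>
     (AE \<omega> in M. \<forall>t\<ge>0.
        lamperti_set \<alpha> (\<lambda>u. \<xi> u \<omega>) (t * r powr (-\<alpha>)) \<noteq> {} \<and>
        R t \<omega> = r * exp (\<xi> (lamperti_time \<alpha> (\<lambda>u. \<xi> u \<omega>) (t * r powr (-\<alpha>))) \<omega>))"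

definition pochhammer_real :: "real \<Rightarrow> real \<Rightarrow> real" where
  "pochhammer_real z s = Gamma (z + s) / Gamma z"

definition jump_const :: "real \<Rightarrow> real" where
  "jump_const \<alpha> =
     2 powr (\<alpha> - 1) * \<alpha> * pochhammer_real (1/2) (\<alpha>/2) / Gamma (1 - \<alpha>/2)"

definition Pi1 :: "real \<Rightarrow> real measure" where
  "Pi1 \<alpha> = density lborel (\<lambda>y. ennreal (jump_const \<alpha> *
     (exp y / (exp y - 1) powr (\<alpha> + 1) * indicator {0<..} y +
      exp y / (1 - exp y) powr (\<alpha> + 1) * indicator {..<0} y)))"

definition Pi2 :: "real \<Rightarrow> real measure" where
  "Pi2 \<alpha> = density lborel (\<lambda>y. ennreal (jump_const \<alpha> *
     (exp y / (exp y + 1) powr (\<alpha> + 1))))"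

definition lamperti_levy_process_0_1 ::
    "real \<Rightarrow> 'a measure \<Rightarrow> (real \<Rightarrow> 'a \<Rightarrow> real) \<Rightarrow> bool" where
  "lamperti_levy_process_0_1 \<alpha> M X \<longleftrightarrow> has_levy_measure M X (Pi1 \<alpha>)"

text \<open>Principal value at the origin. It is needed for \<open>\<alpha> = 1\<close>, where \<open>Pi1\<close> behaves like a
  multiple of \<open>dy / y\<^sup>2\<close> near \<open>0\<close> and \<open>iexp (\<theta> * y) - 1\<close> is not absolutely integrable.\<close>

definition has_pv_integral ::
    "real measure \<Rightarrow> (real \<Rightarrow> complex) \<Rightarrow> complex \<Rightarrow> bool" where
  "has_pv_integral \<mu> f I \<longleftrightarrow>
     (\<forall>\<epsilon>>0. set_integrable \<mu> {y. \<epsilon> < \<bar>y\<bar>} f) \<and>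
     ((\<lambda>\<epsilon>. CLINT y:{y. \<epsilon> < \<bar>y\<bar>}|\<mu>. f y) \<longlongrightarrow> I) (at_right 0)"

end

theory Submission
  imports Defs
begin

text \<open>
  The exponent \<open>\<Psi>\<close> of \<open>\<xi>\<close> is read off in two ways from the small-time behaviour of the
  characteristic function of \<open>ln (R / r)\<close>, where \<open>r = |x|\<close> is the starting point of \<open>R = |Z|\<close>.

  On the one hand, \<open>ln (R / r)\<close> at time \<open>t r powr \<alpha>\<close> is \<open>\<xi>\<close> stopped when its clock
  \<open>\<integral> exp (\<alpha> \<xi>)\<close> reaches \<open>t\<close>. Dynkin's formula (\<open>dynkin_clock\<close>) writes the expectation of
  \<open>iexp (\<theta> ln (R / r)) - 1\<close> as \<open>\<Psi> \<theta>\<close> times the expected integral of \<open>iexp (\<theta> \<xi>)\<close> up to the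
  stopping time. The clock starts with speed \<open>1\<close>, so that this integral is \<open>t\<close> up to \<open>o(t)\<close>. The formula
  needs a bounded stopping time; the event that the clock is still below \<open>t\<close> at time \<open>K t\<close> has a
  probability of at most \<open>\<epsilon> t + O(t\<^sup>2)\<close> for large \<open>K\<close> (\<open>clock_late_prob\<close>). Hence the expectation
  divided by \<open>t\<close> tends to \<open>\<Psi> \<theta>\<close> (\<open>lamperti_exponent_limit\<close>).

  On the other hand, by scaling, \<open>R / r = |1 + W|\<close> for a stable variable \<open>W\<close> at time \<open>t\<close>, and away from
  \<open>0\<close> the law of \<open>W\<close> divided by \<open>t\<close> converges to the jump measure \<open>jump_const \<alpha> |w| powr (-1 - \<alpha>) dw\<close>
  of \<open>Z\<close> (\<open>stable_exponent\<close>, \<open>jump_measure_limit\<close>). As \<open>W\<close> is symmetric, the odd function \<open>sin\<close> can be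
  subtracted at no cost, which makes the integrand \<open>O(w\<^sup>2)\<close> at \<open>0\<close>. So the same limit is the integral of
  \<open>iexp (\<theta> ln |1 + w|) - 1 - \<i> \<theta> sin w\<close> with respect to the jump measure (\<open>radial_exponent\<close>).

  The jump measure restricted to \<open>w > -1\<close> is carried to \<open>Pi1\<close> by \<open>ln (1 + w)\<close>, and restricted to
  \<open>w < -1\<close>, the jumps across the origin, it is carried to \<open>Pi2\<close> by \<open>ln (-1 - w)\<close>. When \<open>Pi1\<close> is cut
  off at \<open>|y| \<le> \<epsilon>\<close>, the removed values of \<open>w\<close> form an interval that is symmetric up to an error of
  order \<open>\<epsilon>\<^sup>2\<close>, so the integral of the compensator \<open>sin\<close> over the rest vanishes in the limit. This gives
  the principal value (\<open>Pi1_has_pv_integral\<close>), which for \<open>\<alpha> < 1\<close> is an ordinary integral.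

  The remaining claims are existence theorems. A finite Levy measure belongs to a compound Poisson
  process (\<open>finite_levy_measure_compound_poisson\<close>), and any Levy measure to an infinite sum of
  compensated compound Poisson processes, one for each annulus of jump sizes
  (\<open>levy_process_exists\<close>). Independence of increments is derived from the joint characteristic
  functions throughout (\<open>indep_vars_if_char\<close>), and the sample spaces are finally replaced by the space of
  real sequences (\<open>sequence_coded\<close>).
\<close>

section \<open>Characteristic functions, independence and tails\<close>

lemma (in prob_space) char_distr:
  "X \<in> borel_measurable M \<Longrightarrow> char (distr M borel X) \<theta> = (CLINT \<omega>|M. iexp (\<theta> * X \<omega>))"
  unfolding char_def by (rule integral_distr) auto

text \<open>Uniqueness of the characteristic function of the image of a signed measure with bounded
  density.\<close>

lemma (in prob_space) real_weight_char_zero: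
  fixes w X :: "'a \<Rightarrow> real"
  assumes [measurable]: "w \<in> borel_measurable M" "X \<in> borel_measurable M" "A \<in> sets borel"
    and bounded: "\<And>\<omega>. \<bar>w \<omega>\<bar> \<le> C"
    and zero: "\<And>\<theta>. (CLINT \<omega>|M. complex_of_real (w \<omega>) * iexp (\<theta> * X \<omega>)) = 0"
  shows "(LINT \<omega>|M. w \<omega> * indicator A (X \<omega>)) = 0"
proof -
  \<comment> \<open>Adding a constant turns the weight into a probability density.\<close>
  define c where "c = C + 1"
  have "0 \<le> C" using bounded[of undefined] by linarith
  hence c: "c > 0" "\<And>\<omega>. 0 \<le> c + w \<omega>" using bounded by (auto simp: c_def abs_le_iff add.commute)
     (smt (verit) bounded)
  have int_w [simp]: "integrable M w"
    by (rule integrable_const_bound[of _ C]) (use bounded in auto)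
  have int_we [simp]: "integrable M (\<lambda>\<omega>. complex_of_real (w \<omega>) * iexp (\<theta> * X \<omega>))" for \<theta>
    by (rule integrable_const_bound[of _ C]) (use bounded in \<open>auto simp: norm_mult\<close>)
  have w0: "(LINT \<omega>|M. w \<omega>) = 0"
    using zero[of 0] by simp
  define D where "D = density M (\<lambda>\<omega>. ennreal ((c + w \<omega>) / c))"
  have int_D: "integrable M (\<lambda>\<omega>. (c + w \<omega>) / c)" by simp
  have "emeasure D (space D) = 1"
  proof -
    have "emeasure D (space D) = (\<integral>\<^sup>+ \<omega>. ennreal ((c + w \<omega>) / c) \<partial>M)"
      unfolding D_def by (auto simp: emeasure_density intro!: nn_integral_cong)
    also have "\<dots> = ennreal (LINT \<omega>|M. (c + w \<omega>) / c)"
      using c by (intro nn_integral_eq_integral int_D) auto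
    finally show ?thesis using c w0 by (simp add: prob_space)
  qed
  then interpret D: prob_space D by (rule prob_spaceI)
  have [measurable]: "X \<in> borel_measurable D" by (simp add: D_def)
  have "distr D borel X = distr M borel X"
  proof (rule Levy_uniqueness)
    show "char (distr D borel X) = char (distr M borel X)"
    proof
      fix \<theta>
      have "char (distr D borel X) \<theta> = (CLINT \<omega>|M. ((c + w \<omega>) / c) *\<^sub>R iexp (\<theta> * X \<omega>))"
        unfolding char_def D_def using c
        by (subst integral_distr) (auto intro!: integral_density)
      also have "\<dots> = (CLINT \<omega>|M. iexp (\<theta> * X \<omega>) + complex_of_real (w \<omega>) * iexp (\<theta> * X \<omega>) / c)"
        by (rule Bochner_Integration.integral_cong) (use c in \<open>auto simp: field_simps scaleR_conv_of_real\<close>)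
      also have "\<dots> = (CLINT \<omega>|M. iexp (\<theta> * X \<omega>))"
        using zero[of \<theta>] by (subst Bochner_Integration.integral_add) (auto intro!: integrable_iexp simp del: of_real_mult)
      also have "\<dots> = char (distr M borel X) \<theta>"
        unfolding char_def by (subst integral_distr) auto
      finally show "char (distr D borel X) \<theta> = char (distr M borel X) \<theta>" .
    qed
  qed auto
  hence "(LINT y|distr D borel X. indicator A y :: real) = (LINT y|distr M borel X. indicator A y)"
    by simp
  hence "(LINT \<omega>|M. ((c + w \<omega>) / c) *\<^sub>R indicator A (X \<omega>) :: real) = (LINT \<omega>|M. indicator A (X \<omega>))"
    unfolding D_def using c
    by (subst (asm) (1 2) integral_distr) (auto simp: integral_density)
  also have "(LINT \<omega>|M. ((c + w \<omega>) / c) *\<^sub>R indicator A (X \<omega>) :: real)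
      = (LINT \<omega>|M. indicator A (X \<omega>) + w \<omega> * indicator A (X \<omega>) / c)"
    by (rule Bochner_Integration.integral_cong) (use c in \<open>auto simp: field_simps\<close>)
  also have "\<dots> = (LINT \<omega>|M. indicator A (X \<omega>)) + (LINT \<omega>|M. w \<omega> * indicator A (X \<omega>)) / c"
  proof -
    have "integrable M (\<lambda>\<omega>. indicator A (X \<omega>) :: real)"
      by (rule integrable_const_bound[of _ 1]) auto
    moreover have "integrable M (\<lambda>\<omega>. w \<omega> * indicator A (X \<omega>))"
      by (rule integrable_const_bound[of _ C]) (auto simp: bounded indicator_def \<open>0 \<le> C\<close>)
    ultimately show ?thesis by simp
  qed
  finally show ?thesis using c by simp
qed

lemma (in prob_space) weight_char_zero:
  fixes w :: "'a \<Rightarrow> complex" and X :: "'a \<Rightarrow> real"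
  assumes [measurable]: "w \<in> borel_measurable M" "X \<in> borel_measurable M" "A \<in> sets borel"
    and bounded: "\<And>\<omega>. norm (w \<omega>) \<le> C"
    and zero: "\<And>\<theta>. (CLINT \<omega>|M. w \<omega> * iexp (\<theta> * X \<omega>)) = 0"
  shows "(CLINT \<omega>|M. w \<omega> * indicator A (X \<omega>)) = 0"
proof -
  have [measurable]: "(\<lambda>\<omega>. cnj (w \<omega>)) \<in> borel_measurable M"
    by (rule borel_measurable_continuous_on[where f=cnj]) (auto intro!: continuous_intros)
  have int [simp]: "integrable M (\<lambda>\<omega>. w \<omega> * iexp (\<theta> * X \<omega>))"
    "integrable M (\<lambda>\<omega>. cnj (w \<omega>) * iexp (\<theta> * X \<omega>))" for \<theta>
    by (rule integrable_const_bound[of _ C]; use bounded in \<open>auto simp: norm_mult\<close>)+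
  have conj: "(CLINT \<omega>|M. cnj (w \<omega>) * iexp (\<theta> * X \<omega>)) = 0" for \<theta>
  proof -
    have "(CLINT \<omega>|M. cnj (w \<omega>) * iexp (\<theta> * X \<omega>)) = (CLINT \<omega>|M. cnj (w \<omega> * iexp ((-\<theta>) * X \<omega>)))"
      by (rule Bochner_Integration.integral_cong) (auto simp: exp_cnj)
    also have "\<dots> = 0" using Bochner_Integration.integral_cnj[of M "\<lambda>\<omega>. w \<omega> * iexp ((-\<theta>) * X \<omega>)"] zero[of "-\<theta>"]
      by (simp only: complex_cnj_zero)
    finally show ?thesis .
  qed
  have "(CLINT \<omega>|M. complex_of_real (Re (w \<omega>)) * iexp (\<theta> * X \<omega>)) = 0" for \<theta>
  proof -
    have "(CLINT \<omega>|M. complex_of_real (Re (w \<omega>)) * iexp (\<theta> * X \<omega>))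
       = (CLINT \<omega>|M. (w \<omega> * iexp (\<theta> * X \<omega>) + cnj (w \<omega>) * iexp (\<theta> * X \<omega>)) / 2)"
      by (rule Bochner_Integration.integral_cong)
         (auto simp: complex_add_cnj distrib_right[symmetric])
    thus ?thesis using zero conj int by (simp del: of_real_mult)
  qed
  moreover have "(CLINT \<omega>|M. complex_of_real (Im (w \<omega>)) * iexp (\<theta> * X \<omega>)) = 0" for \<theta>
  proof -
    have "(CLINT \<omega>|M. complex_of_real (Im (w \<omega>)) * iexp (\<theta> * X \<omega>))
       = (CLINT \<omega>|M. (w \<omega> * iexp (\<theta> * X \<omega>) - cnj (w \<omega>) * iexp (\<theta> * X \<omega>)) / (2 * \<i>))"
    proof (rule Bochner_Integration.integral_cong)
      fix \<omega>
      have "complex_of_real (Im (w \<omega>)) = (w \<omega> - cnj (w \<omega>)) / (2 * \<i>)"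
        by (simp add: complex_eq_iff)
      thus "complex_of_real (Im (w \<omega>)) * iexp (\<theta> * X \<omega>)
          = (w \<omega> * iexp (\<theta> * X \<omega>) - cnj (w \<omega>) * iexp (\<theta> * X \<omega>)) / (2 * \<i>)"
        by (simp only: left_diff_distrib[symmetric] times_divide_eq_left)
    qed simp
    thus ?thesis using zero conj int by (simp del: of_real_mult)
  qed
  ultimately have "(LINT \<omega>|M. Re (w \<omega>) * indicator A (X \<omega>)) = 0"
    "(LINT \<omega>|M. Im (w \<omega>) * indicator A (X \<omega>)) = 0"
    using order_trans[OF abs_Re_le_cmod bounded] order_trans[OF abs_Im_le_cmod bounded]
    by (auto intro!: real_weight_char_zero)
  moreover have "integrable M (\<lambda>\<omega>. w \<omega> * indicator A (X \<omega>))"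
    by (rule integrable_const_bound[of _ C])
       (use bounded order_trans[OF norm_ge_zero bounded] in \<open>auto simp: indicator_def\<close>)
  ultimately show ?thesis
    by (intro complex_eqI; subst integral_Re[symmetric] integral_Im[symmetric])
       (auto simp: indicator_def of_bool_def if_distrib cong: if_cong)
qed

text \<open>A family of real random variables is independent as soon as all its joint characteristic
  functions factorise. Exponentials are replaced by indicators one at a time, each time by
  uniqueness of the characteristic function of a complex measure.\<close>

lemma (in prob_space) indep_vars_if_char:
  fixes X :: "nat \<Rightarrow> 'a \<Rightarrow> real"
  assumes [measurable]: "\<And>k. X k \<in> borel_measurable M"
    and char: "\<And>n \<theta>. (CLINT \<omega>|M. (\<Prod>k<n. iexp (\<theta> k * X k \<omega>)))
                      = (\<Prod>k<n. CLINT \<omega>|M. iexp (\<theta> k * X k \<omega>))"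
  shows "indep_vars (\<lambda>_. borel) X UNIV"
proof -
  have mixed: "(CLINT \<omega>|M. (\<Prod>k<j. indicator (A k) (X k \<omega>)) * (\<Prod>k\<in>{j..<n}. iexp (\<theta> k * X k \<omega>)))
      = (\<Prod>k<j. CLINT \<omega>|M. indicator (A k) (X k \<omega>)) * (\<Prod>k\<in>{j..<n}. CLINT \<omega>|M. iexp (\<theta> k * X k \<omega>))"
    if "j \<le> n" "\<And>k. A k \<in> sets borel" for j n \<theta> A
    using that(1)
  proof (induction j arbitrary: \<theta>)
    case 0
    show ?case using char by (simp add: atLeast0LessThan)
  next
    case (Suc j)
    note [measurable] = that(2)
    define a where "a \<omega> = (\<Prod>k<j. indicator (A k) (X k \<omega>)) * (\<Prod>k\<in>{Suc j..<n}. iexp (\<theta> k * X k \<omega>))" for \<omega>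
    have [measurable]: "a \<in> borel_measurable M" unfolding a_def by measurable
    have a1: "norm (a \<omega>) \<le> 1" for \<omega>
    proof -
      have "norm (\<Prod>k<j. indicator (A k) (X k \<omega>) :: complex) \<le> (\<Prod>k<j. 1)"
        unfolding prod_norm[symmetric] by (rule prod_mono) (auto simp: indicator_def)
      moreover have "norm (\<Prod>k\<in>{Suc j..<n}. iexp (\<theta> k * X k \<omega>)) = 1"
        unfolding prod_norm[symmetric] by simp
      ultimately show ?thesis by (simp add: a_def norm_mult)
    qed
    have [simp]: "integrable M a" "integrable M (\<lambda>\<omega>. a \<omega> * iexp (s * X j \<omega>))"
      "integrable M (\<lambda>\<omega>. a \<omega> * indicator (A j) (X j \<omega>))" for s
      using a1 by (auto intro!: integrable_const_bound[of _ 1] simp: norm_mult indicator_def)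
    have [simp]: "integrable M (\<lambda>\<omega>. indicator (A j) (X j \<omega>) :: complex)"
      by (rule integrable_const_bound[of _ 1]) (auto simp: indicator_def)
    define c where "c = (\<Prod>k<j. CLINT \<omega>|M. indicator (A k) (X k \<omega>))
         * (\<Prod>k\<in>{Suc j..<n}. CLINT \<omega>|M. iexp (\<theta> k * X k \<omega>))"
    have E: "(CLINT \<omega>|M. a \<omega> * iexp (s * X j \<omega>)) = c * (CLINT \<omega>|M. iexp (s * X j \<omega>))" for s
    proof -
      have "{j..<n} = insert j {Suc j..<n}" using Suc.prems by auto
      hence "(CLINT \<omega>|M. a \<omega> * iexp (s * X j \<omega>)) = (CLINT \<omega>|M. (\<Prod>k<j. indicator (A k) (X k \<omega>))
            * (\<Prod>k\<in>{j..<n}. iexp ((\<theta>(j := s)) k * X k \<omega>)))"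
        by (auto simp: a_def mult_ac intro!: Bochner_Integration.integral_cong)
      also have "\<dots> = (\<Prod>k<j. CLINT \<omega>|M. indicator (A k) (X k \<omega>))
            * (\<Prod>k\<in>{j..<n}. CLINT \<omega>|M. iexp ((\<theta>(j := s)) k * X k \<omega>))"
        using Suc by auto
      also have "\<dots> = c * (CLINT \<omega>|M. iexp (s * X j \<omega>))"
        using \<open>{j..<n} = _\<close> by (simp add: c_def mult_ac)
      finally show ?thesis .
    qed
    have "(CLINT \<omega>|M. (a \<omega> - c) * indicator (A j) (X j \<omega>)) = 0"
    proof (rule weight_char_zero)
      show "norm (a \<omega> - c) \<le> 1 + norm c" for \<omega>
        using a1[of \<omega>] norm_triangle_ineq4[of "a \<omega>" c] by linarith
      show "(CLINT \<omega>|M. (a \<omega> - c) * iexp (s * X j \<omega>)) = 0" for s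
        using E[of s] by (simp add: left_diff_distrib integrable_iexp del: of_real_mult)
    qed auto
    hence "(CLINT \<omega>|M. a \<omega> * indicator (A j) (X j \<omega>)) = c * (CLINT \<omega>|M. indicator (A j) (X j \<omega>))"
      by (subst (asm) left_diff_distrib, subst (asm) Bochner_Integration.integral_diff)
         (auto intro!: integrable_mult_right)
    thus ?case by (simp add: a_def c_def mult_ac)
  qed
  show ?thesis
    unfolding indep_vars_def2
  proof (intro conjI ballI indep_setsI)
    fix A :: "nat \<Rightarrow> 'a set" and J :: "nat set"
    assume J: "J \<noteq> {}" "finite J" "\<forall>j\<in>J. A j \<in> {X j -` B \<inter> space M |B. B \<in> sets borel}"
    then obtain B where B: "\<And>j. j \<in> J \<Longrightarrow> A j = X j -` B j \<inter> space M \<and> B j \<in> sets borel"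
      by (auto simp: subset_eq) metis
    define C where "C j = (if j \<in> J then B j else UNIV)" for j
    have [measurable]: "C j \<in> sets borel" for j using B by (auto simp: C_def)
    obtain n where n: "J \<subseteq> {..<n}" using J(2) finite_nat_iff_bounded by blast
    have AJ: "A j = X j -` C j \<inter> space M" if "j \<in> J" for j using B that by (auto simp: C_def)
    have pC: "prob (X j -` C j \<inter> space M) = (LINT \<omega>|M. indicator (C j) (X j \<omega>))" for j
      by (subst Bochner_Integration.integral_cong[OF refl, of _ _ "indicator (X j -` C j \<inter> space M)"])
         (auto simp: indicator_def)
    have inter: "(\<Inter>j\<in>J. A j) \<inter> space M = {\<omega>\<in>space M. \<forall>k<n. X k \<omega> \<in> C k}"
      using n AJ by (auto simp: C_def split: if_splits)
    have "complex_of_real (prob (\<Inter>j\<in>J. A j)) = complex_of_real (LINT \<omega>|M. (\<Prod>k<n. indicator (C k) (X k \<omega>)))"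
    proof -
      have "(\<Inter>j\<in>J. A j) \<subseteq> space M" using J AJ by blast
      hence "(\<Inter>j\<in>J. A j) = {\<omega>\<in>space M. \<forall>k<n. X k \<omega> \<in> C k}" using inter by blast
      moreover have "(LINT \<omega>|M. (\<Prod>k<n. indicator (C k) (X k \<omega>)) :: real)
         = (LINT \<omega>|M. indicator {\<omega>\<in>space M. \<forall>k<n. X k \<omega> \<in> C k} \<omega>)"
        by (rule Bochner_Integration.integral_cong) (auto simp: indicator_def prod_zero_iff)
      ultimately show ?thesis by simp
    qed
    also have "\<dots> = (CLINT \<omega>|M. (\<Prod>k<n. indicator (C k) (X k \<omega>)))"
      by (subst integral_complex_of_real[symmetric])
         (auto intro!: Bochner_Integration.integral_cong prod.cong simp: indicator_def)
    also have "\<dots> = (\<Prod>k<n. CLINT \<omega>|M. indicator (C k) (X k \<omega>))"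
      using mixed[of n n C] by simp
    also have "\<dots> = complex_of_real (\<Prod>k<n. prob (X k -` C k \<inter> space M))"
      unfolding pC of_real_prod integral_complex_of_real[symmetric]
      by (intro prod.cong Bochner_Integration.integral_cong) (auto simp: indicator_def)
    also have "(\<Prod>k<n. prob (X k -` C k \<inter> space M)) = (\<Prod>j\<in>J. prob (A j))"
      by (rule prod.mono_neutral_cong_right) (use n AJ in \<open>auto simp: C_def prob_space\<close>)
    finally show "prob (\<Inter>j\<in>J. A j) = (\<Prod>j\<in>J. prob (A j))" by (simp only: of_real_eq_iff)
  qed auto
qed

text \<open>The process has independent stationary increments with exponent \<open>\<Psi>\<close>, stated through the joint
  characteristic functions of the increments over consecutive intervals.\<close>

definition increments_exponent :: "'a measure \<Rightarrow> (real \<Rightarrow> 'a \<Rightarrow> real) \<Rightarrow> (real \<Rightarrow> complex) \<Rightarrow> bool" where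
  "increments_exponent M X \<Psi> \<longleftrightarrow>
     (\<forall>(t::nat \<Rightarrow> real) \<theta> n. 0 \<le> t 0 \<and> mono t \<longrightarrow>
        (CLINT \<omega>|M. (\<Prod>k<n. iexp (\<theta> k * (X (t (Suc k)) \<omega> - X (t k) \<omega>))))
          = (\<Prod>k<n. exp (complex_of_real (t (Suc k) - t k) * \<Psi> (\<theta> k))))"

lemma increments_exponentD:
  assumes "increments_exponent M X \<Psi>" "0 \<le> t (0::nat)" "mono t"
  shows "(CLINT \<omega>|M. (\<Prod>k<n. iexp (\<theta> k * (X (t (Suc k)) \<omega> - X (t k) \<omega>))))
          = (\<Prod>k<n. exp (complex_of_real (t (Suc k) - t k) * \<Psi> (\<theta> k)))"
  using assms unfolding increments_exponent_def by blast

lemma increments_exponent_single: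
  assumes "increments_exponent M X \<Psi>" "0 \<le> s" "s \<le> u"
  shows "(CLINT \<omega>|M. iexp (\<theta> * (X u \<omega> - X s \<omega>))) = exp (complex_of_real (u - s) * \<Psi> \<theta>)"
  using increments_exponentD[OF assms(1), of "\<lambda>k. if k = 0 then s else u" "\<lambda>_. \<theta>" 1] assms(2,3)
  by (auto simp: mono_def)

lemma mono_nonneg: "0 \<le> t 0 \<Longrightarrow> mono t \<Longrightarrow> 0 \<le> (t (k::nat) :: real)"
  by (meson le0 monoD order_trans)

text \<open>The joint exponent of the increments carries independence, stationarity and the
  characteristic exponent at once.\<close>

lemma levy_processI:
  assumes "prob_space M" and meas: "\<And>t. 0 \<le> t \<Longrightarrow> X t \<in> borel_measurable M"
    and X0: "AE \<omega> in M. X 0 \<omega> = 0" and cadlag: "AE \<omega> in M. cadlag (\<lambda>t. X t \<omega>)"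
    and incr: "increments_exponent M X \<Psi>"
  shows "levy_process M X" and "has_char_exponent M X \<Psi>"
proof -
  interpret prob_space M by fact
  have [measurable]: "X t \<in> borel_measurable M" if "0 \<le> t" for t using meas that .
  have char0: "char (distr M borel (X t)) \<theta> = exp (complex_of_real t * \<Psi> \<theta>)" if t: "0 \<le> t" for t \<theta>
  proof -
    have "char (distr M borel (X t)) \<theta> = (CLINT \<omega>|M. iexp (\<theta> * X t \<omega>))"
      unfolding char_def using t by (subst integral_distr) auto
    also have "\<dots> = (CLINT \<omega>|M. iexp (\<theta> * (X t \<omega> - X 0 \<omega>)))"
      by (rule integral_cong_AE) (use t X0 in \<open>auto elim: eventually_mono\<close>)
    finally show ?thesis using increments_exponent_single[OF incr, of 0 t] t by simp
  qed
  thus "has_char_exponent M X \<Psi>" unfolding has_char_exponent_def by auto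
  show "levy_process M X"
    unfolding levy_process_def
  proof (intro conjI allI impI)
    fix t :: "nat \<Rightarrow> real" assume t: "0 \<le> t 0 \<and> mono t"
    have [simp]: "0 \<le> t k" for k using t mono_nonneg[of t k] by blast
    show "indep_vars (\<lambda>_. borel) (\<lambda>k \<omega>. X (t (Suc k)) \<omega> - X (t k) \<omega>) UNIV"
    proof (rule indep_vars_if_char)
      show "(\<lambda>\<omega>. X (t (Suc k)) \<omega> - X (t k) \<omega>) \<in> borel_measurable M" for k
by (intro borel_measurable_diff meas) auto
      fix n \<theta>
      show "(CLINT \<omega>|M. (\<Prod>k<n. iexp (\<theta> k * (X (t (Suc k)) \<omega> - X (t k) \<omega>))))
         = (\<Prod>k<n. CLINT \<omega>|M. iexp (\<theta> k * (X (t (Suc k)) \<omega> - X (t k) \<omega>)))"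
        using t by (subst increments_exponentD[OF incr])
          (auto intro!: prod.cong simp: monoD increments_exponent_single[OF incr] simp del: of_real_diff of_real_mult)
    qed
  next
    fix s t :: real assume st: "0 \<le> s \<and> s \<le> t"
    hence [measurable]: "X s \<in> borel_measurable M" "X t \<in> borel_measurable M"
      "X (t - s) \<in> borel_measurable M" by auto
    show "distr M borel (\<lambda>\<omega>. X t \<omega> - X s \<omega>) = distr M borel (X (t - s))"
    proof (rule Levy_uniqueness)
      show "char (distr M borel (\<lambda>\<omega>. X t \<omega> - X s \<omega>)) = char (distr M borel (X (t - s)))"
      proof
        fix \<theta>
        have "char (distr M borel (\<lambda>\<omega>. X t \<omega> - X s \<omega>)) \<theta> = exp (complex_of_real (t - s) * \<Psi> \<theta>)"
          using st increments_exponent_single[OF incr, of s t \<theta>] by (subst char_distr) auto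
        thus "char (distr M borel (\<lambda>\<omega>. X t \<omega> - X s \<omega>)) \<theta> = char (distr M borel (X (t - s))) \<theta>"
          using st char0[of "t - s" \<theta>] by simp
      qed
    qed auto
  qed (use assms in auto)
qed

lemma levy_process_increments:
  assumes levy: "levy_process M X" and char: "has_char_exponent M X \<Psi>"
  shows "increments_exponent M X \<Psi>"
  unfolding increments_exponent_def
proof (intro allI impI)
  fix t :: "nat \<Rightarrow> real" and \<theta> :: "nat \<Rightarrow> real" and n assume t: "0 \<le> t 0 \<and> mono t"
  interpret prob_space M using levy by (simp add: levy_process_def)
  have [measurable]: "X t \<in> borel_measurable M" if "0 \<le> t" for t
    using levy that by (simp add: levy_process_def)
  have [simp]: "0 \<le> t k" for k using t mono_nonneg[of t k] by blast
  have "indep_vars (\<lambda>_. borel) (\<lambda>k \<omega>. X (t (Suc k)) \<omega> - X (t k) \<omega>) UNIV"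
    using levy t by (simp add: levy_process_def)
  hence "indep_vars (\<lambda>_. borel) (\<lambda>k \<omega>. X (t (Suc k)) \<omega> - X (t k) \<omega>) {..<n}"
    by (rule indep_vars_subset) auto
  hence "indep_vars (\<lambda>_. borel) (\<lambda>k \<omega>. iexp (\<theta> k * (X (t (Suc k)) \<omega> - X (t k) \<omega>))) {..<n}"
    by (rule indep_vars_compose2) measurable
  hence "(CLINT \<omega>|M. (\<Prod>k<n. iexp (\<theta> k * (X (t (Suc k)) \<omega> - X (t k) \<omega>))))
      = (\<Prod>k<n. CLINT \<omega>|M. iexp (\<theta> k * (X (t (Suc k)) \<omega> - X (t k) \<omega>)))"
    using t by (intro indep_vars_lebesgue_integral) (auto intro!: integrable_const_bound[of _ 1])
  also have "\<dots> = (\<Prod>k<n. exp (complex_of_real (t (Suc k) - t k) * \<Psi> (\<theta> k)))"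
  proof (rule prod.cong[OF refl])
    fix k
    have le: "0 \<le> t k" "t k \<le> t (Suc k)" using t by (auto simp: monoD)
    hence [measurable]: "X (t k) \<in> borel_measurable M" "X (t (Suc k)) \<in> borel_measurable M" by auto
    have "(CLINT \<omega>|M. iexp (\<theta> k * (X (t (Suc k)) \<omega> - X (t k) \<omega>)))
       = char (distr M borel (\<lambda>\<omega>. X (t (Suc k)) \<omega> - X (t k) \<omega>)) (\<theta> k)"
      unfolding char_def by (subst integral_distr) auto
    also have "distr M borel (\<lambda>\<omega>. X (t (Suc k)) \<omega> - X (t k) \<omega>) = distr M borel (X (t (Suc k) - t k))"
      using levy le by (simp add: levy_process_def)
    finally show "(CLINT \<omega>|M. iexp (\<theta> k * (X (t (Suc k)) \<omega> - X (t k) \<omega>)))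
       = exp (complex_of_real (t (Suc k) - t k) * \<Psi> (\<theta> k))"
      using char le by (simp add: has_char_exponent_def)
  qed
  finally show "(CLINT \<omega>|M. (\<Prod>k<n. iexp (\<theta> k * (X (t (Suc k)) \<omega> - X (t k) \<omega>))))
      = (\<Prod>k<n. exp (complex_of_real (t (Suc k) - t k) * \<Psi> (\<theta> k)))" .
qed

lemma cmod_one_minus_exp_le:
  assumes "Re z \<le> 0"
  shows "cmod (1 - exp z) \<le> cmod z"
proof -
  have "cmod (exp 0 - exp z) \<le> 1 * cmod (0 - z)"
  proof (rule field_differentiable_bound)
    show "convex {z. Re z \<le> 0}" by (rule convex_halfspace_Re_le)
    show "(exp has_field_derivative exp x) (at x within {z. Re z \<le> 0})" for x :: complex
      by (auto intro!: derivative_eq_intros)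
  qed (use assms in auto)
  thus ?thesis by simp
qed

text \<open>The truncation inequality: \<open>1 - cos (\<theta> X)\<close> averaged over \<open>|\<theta>| \<le> \<delta>\<close> is at least \<open>1 / 2\<close> if
  \<open>|X| \<ge> 2 / \<delta>\<close>.\<close>

lemma (in prob_space) prob_abs_ge_le_char:
  fixes X :: "'a \<Rightarrow> real"
  assumes [measurable]: "X \<in> borel_measurable M" and \<delta>: "0 < \<delta>"
    and B: "\<And>\<theta>. \<bar>\<theta>\<bar> \<le> \<delta> \<Longrightarrow> cmod (1 - (CLINT \<omega>|M. iexp (\<theta> * X \<omega>))) \<le> B"
  shows "prob {\<omega>\<in>space M. 2 / \<delta> \<le> \<bar>X \<omega>\<bar>} \<le> 2 * B"
proof -
  define N where "N = density lborel (\<lambda>\<theta>. ennreal (indicator {-\<delta>..\<delta>} \<theta>))"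
  have N: "emeasure N (space N) = ennreal (2 * \<delta>)"
    using \<delta> by (simp add: N_def emeasure_density ennreal_indicator)
  interpret N: finite_measure N by (rule finite_measureI) (simp add: N)
  interpret P: pair_sigma_finite M N ..
  interpret MN: finite_measure "M \<Otimes>\<^sub>M N"
    by (rule finite_measureI)
       (simp add: space_pair_measure N.emeasure_pair_measure_Times emeasure_space_1 N)
  have [measurable_cong]: "sets N = sets borel" by (simp add: N_def)
  have cos1: "\<bar>1 - cos y\<bar> \<le> 2" for y :: real
    using cos_le_one[of y] cos_ge_minus_one[of y] by linarith
  have int: "integrable (M \<Otimes>\<^sub>M N) (\<lambda>(\<omega>, \<theta>). 1 - cos (\<theta> * X \<omega>))"
    by (rule MN.integrable_const_bound[of _ 2]) (use cos1 in \<open>auto simp: split_beta\<close>)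
  have lower: "\<delta> * indicator {\<omega>\<in>space M. 2 / \<delta> \<le> \<bar>X \<omega>\<bar>} \<omega> \<le> (LINT \<theta>|N. 1 - cos (\<theta> * X \<omega>))" for \<omega>
  proof (cases "2 / \<delta> \<le> \<bar>X \<omega>\<bar>")
    case True
    hence X: "X \<omega> \<noteq> 0" using \<delta> by auto
    have "(LINT \<theta>|N. 1 - cos (\<theta> * X \<omega>)) = (LINT \<theta>|lborel. indicator {-\<delta>..\<delta>} \<theta> *\<^sub>R (1 - cos (\<theta> * X \<omega>)))"
      unfolding N_def by (subst integral_density) auto
    also have "\<dots> = (\<delta> - sin (\<delta> * X \<omega>) / X \<omega>) - (-\<delta> - sin (-\<delta> * X \<omega>) / X \<omega>)"
      using \<delta> X by (intro integral_FTC_atLeastAtMost)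
        (auto intro!: derivative_eq_intros continuous_intros
           simp: has_real_derivative_iff_has_vector_derivative[symmetric])
    also have "\<dots> = 2 * \<delta> - 2 * (sin (\<delta> * X \<omega>) / X \<omega>)" using X by (simp add: field_simps)
    also have "2 * \<delta> - 2 * (sin (\<delta> * X \<omega>) / X \<omega>) \<ge> \<delta>"
    proof -
    have "sin (\<delta> * X \<omega>) / X \<omega> \<le> \<bar>sin (\<delta> * X \<omega>) / X \<omega>\<bar>" by (rule abs_ge_self)
    also have "\<bar>sin (\<delta> * X \<omega>) / X \<omega>\<bar> \<le> 1 / \<bar>X \<omega>\<bar>"
      unfolding abs_divide by (rule divide_right_mono) auto
    also have "1 / \<bar>X \<omega>\<bar> \<le> \<delta> / 2"
      using True \<delta> X by (simp add: field_simps)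
    finally show ?thesis by linarith
    qed
    finally show ?thesis using True \<delta> by (simp add: indicator_def)
  qed (auto intro!: Bochner_Integration.integral_nonneg)
  have "\<delta> * prob {\<omega>\<in>space M. 2 / \<delta> \<le> \<bar>X \<omega>\<bar>}
      = (LINT \<omega>|M. \<delta> * indicator {\<omega>\<in>space M. 2 / \<delta> \<le> \<bar>X \<omega>\<bar>} \<omega>)" by simp
  also have "\<dots> \<le> (LINT \<omega>|M. (LINT \<theta>|N. 1 - cos (\<theta> * X \<omega>)))"
    proof (rule integral_mono[OF _ _ lower])
    show "integrable M (\<lambda>\<omega>. \<delta> * indicator {\<omega>\<in>space M. 2 / \<delta> \<le> \<bar>X \<omega>\<bar>} \<omega>)"
      by (intro integrable_mult_right integrable_const_bound[of _ 1]) auto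
    show "integrable M (\<lambda>\<omega>. LINT \<theta>|N. 1 - cos (\<theta> * X \<omega>))"
      using P.integrable_fst'[OF int] by simp
  qed
  also have "\<dots> = (LINT \<theta>|N. (LINT \<omega>|M. 1 - cos (\<theta> * X \<omega>)))"
    using P.Fubini_integral[OF int] by simp
  also have "\<dots> \<le> (LINT \<theta>|N. B)"
  proof (rule integral_mono_AE)
    show "integrable N (\<lambda>\<theta>. LINT \<omega>|M. 1 - cos (\<theta> * X \<omega>))"
      using P.integrable_snd[OF int] by simp
    have "(LINT \<omega>|M. 1 - cos (\<theta> * X \<omega>)) \<le> B" if "\<bar>\<theta>\<bar> \<le> \<delta>" for \<theta>
    proof -
      have "(LINT \<omega>|M. 1 - cos (\<theta> * X \<omega>)) = (LINT \<omega>|M. Re (1 - iexp (\<theta> * X \<omega>)))"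
        by (rule Bochner_Integration.integral_cong) (simp_all add: Re_exp)
      also have "\<dots> = Re (CLINT \<omega>|M. 1 - iexp (\<theta> * X \<omega>))"
        by (rule integral_Re) (auto intro!: Bochner_Integration.integrable_diff integrable_iexp)
      also have "\<dots> = Re (1 - (CLINT \<omega>|M. iexp (\<theta> * X \<omega>)))"
        by (subst Bochner_Integration.integral_diff) (auto intro!: integrable_iexp simp: prob_space)
      also have "\<dots> \<le> B" using order_trans[OF complex_Re_le_cmod B[OF that]] .
      finally show ?thesis .
    qed
    thus "AE \<theta> in N. (LINT \<omega>|M. 1 - cos (\<theta> * X \<omega>)) \<le> B"
      unfolding N_def by (subst AE_density) (auto simp: indicator_def)
  qed auto
  also have "\<dots> = \<delta> * (2 * B)" using \<delta> N by (simp add: measure_def)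
  finally show ?thesis using \<delta> by simp
qed

lemma levy_process_Re_nonpos:
  assumes "levy_process M X" "has_char_exponent M X \<Psi>"
  shows "Re (\<Psi> \<theta>) \<le> 0"
proof -
  interpret prob_space M using assms by (simp add: levy_process_def)
  have "X 1 \<in> borel_measurable M" using assms by (simp add: levy_process_def)
  then interpret D: real_distribution "distr M borel (X 1)" by simp
  have "cmod (exp (\<Psi> \<theta>)) \<le> 1"
    using D.cmod_char_le_1[of \<theta>] assms(2) by (simp add: has_char_exponent_def)
  thus ?thesis by simp
qed

lemma levy_process_tail:
  assumes levy: "levy_process M X" and char: "has_char_exponent M X \<Psi>"
    and a: "0 < a" and u: "0 \<le> u" and B: "\<And>\<theta>. \<bar>\<theta>\<bar> \<le> 2 / a \<Longrightarrow> cmod (\<Psi> \<theta>) \<le> B"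
  shows "measure M {\<omega>\<in>space M. a \<le> \<bar>X u \<omega>\<bar>} \<le> 2 * (u * B)"
proof -
  interpret prob_space M using levy by (simp add: levy_process_def)
  have [measurable]: "X u \<in> borel_measurable M" using levy u by (simp add: levy_process_def)
  have "prob {\<omega>\<in>space M. 2 / (2 / a) \<le> \<bar>X u \<omega>\<bar>} \<le> 2 * (u * B)"
  proof (rule prob_abs_ge_le_char)
    fix \<theta> assume \<theta>: "\<bar>\<theta>\<bar> \<le> 2 / a"
    have "(CLINT \<omega>|M. iexp (\<theta> * X u \<omega>)) = exp (complex_of_real u * \<Psi> \<theta>)"
      using char u char_distr[of "X u" \<theta>] by (simp add: has_char_exponent_def del: of_real_mult)
    hence "cmod (1 - (CLINT \<omega>|M. iexp (\<theta> * X u \<omega>))) = cmod (1 - exp (complex_of_real u * \<Psi> \<theta>))"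
      by (simp only:)
    also have "\<dots> \<le> cmod (complex_of_real u * \<Psi> \<theta>)"
      using levy_process_Re_nonpos[OF levy char, of \<theta>] u
      by (intro cmod_one_minus_exp_le) (simp add: mult_nonneg_nonpos)
    also have "\<dots> \<le> u * B" using B[OF \<theta>] u by (simp add: norm_mult mult_left_mono)
    finally show "cmod (1 - (CLINT \<omega>|M. iexp (\<theta> * X u \<omega>))) \<le> u * B" .
  qed (use a in auto)
  thus ?thesis using a by simp
qed

text \<open>Ottaviani's inequality bounds the maximum of partial sums by the tails of the remaining sums.\<close>

lemma (in prob_space) ottaviani:
  fixes Y :: "nat \<Rightarrow> 'a \<Rightarrow> real"
  defines "S \<equiv> \<lambda>k \<omega>. \<Sum>j<k. Y j \<omega>"
  assumes indep: "indep_vars (\<lambda>_. borel) Y UNIV" and a: "0 \<le> a" and p: "p \<le> 1 / 2"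
    and tail: "\<And>k. k \<le> n \<Longrightarrow> prob {\<omega>\<in>space M. a \<le> \<bar>S n \<omega> - S k \<omega>\<bar>} \<le> p"
  shows "prob {\<omega>\<in>space M. \<exists>k\<le>n. 2 * a \<le> \<bar>S k \<omega>\<bar>} \<le> 2 * p"
proof -
  have [measurable]: "Y k \<in> borel_measurable M" for k using indep by (auto simp: indep_vars_def2)
  have [measurable]: "S k \<in> borel_measurable M" for k unfolding S_def by measurable
  \<comment> \<open>The events of first exceeding the level are disjoint; each is independent of what follows.\<close>
  define H where "H k = {\<omega>\<in>space M. 2 * a \<le> \<bar>S k \<omega>\<bar> \<and> (\<forall>i<k. \<bar>S i \<omega>\<bar> < 2 * a)}" for k
  define G where "G k = {\<omega>\<in>space M. \<bar>S n \<omega> - S k \<omega>\<bar> < a}" for k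
  have [measurable]: "H k \<in> sets M" "G k \<in> sets M" for k unfolding H_def G_def by measurable
  have HG: "prob (H k) \<le> 2 * prob (H k \<inter> G k)" if k: "k \<le> n" for k
  proof -
    define f1 where "f1 y = (if 2 * a \<le> \<bar>\<Sum>j<k. y j\<bar> \<and> (\<forall>i\<in>{..<k}. \<bar>\<Sum>j<i. y j\<bar> < 2 * a) then 1 else 0 :: real)"
      for y :: "nat \<Rightarrow> real"
    define f2 where "f2 y = (\<Sum>j\<in>{k..<n}. y j)" for y :: "nat \<Rightarrow> real"
    have "indep_var borel (f1 \<circ> (\<lambda>\<omega>. \<lambda>i\<in>{..<k}. Y i \<omega>)) borel (f2 \<circ> (\<lambda>\<omega>. \<lambda>i\<in>{k..<n}. Y i \<omega>))"
    proof (rule indep_var_compose[OF indep_var_restrict[OF indep]])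
      have *: "(\<lambda>y. \<Sum>j<i. y j) \<in> borel_measurable (Pi\<^sub>M {..<k} (\<lambda>_. borel :: real measure))" if "i \<le> k" for i
        using that by (intro borel_measurable_sum measurable_component_singleton) auto
      show "f1 \<in> borel_measurable (Pi\<^sub>M {..<k} (\<lambda>_. borel))"
      proof -
        have "Measurable.pred (Pi\<^sub>M {..<k} (\<lambda>_. borel)) (\<lambda>y. \<bar>\<Sum>j<i. y j :: real\<bar> < 2 * a)" if "i < k" for i
        proof -
          have [measurable]: "(\<lambda>y. \<Sum>j<i. y j) \<in> borel_measurable (Pi\<^sub>M {..<k} (\<lambda>_. borel :: real measure))"
            using that by (intro *) auto
          show ?thesis by measurable
        qed
        hence [measurable]: "Measurable.pred (Pi\<^sub>M {..<k} (\<lambda>_. borel)) (\<lambda>y. \<forall>i\<in>{..<k}. \<bar>\<Sum>j<i. y j :: real\<bar> < 2 * a)"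
          by (intro pred_intros_countable_bounded) auto
        note [measurable] = *[OF order.refl]
        show ?thesis unfolding f1_def[abs_def] by measurable
      qed
      show "f2 \<in> borel_measurable (Pi\<^sub>M {k..<n} (\<lambda>_. borel))"
        unfolding f2_def by (intro borel_measurable_sum measurable_component_singleton)
    qed auto
    hence "indep_var borel (\<lambda>\<omega>. f1 (\<lambda>i\<in>{..<k}. Y i \<omega>)) borel (\<lambda>\<omega>. f2 (\<lambda>i\<in>{k..<n}. Y i \<omega>))"
      by (simp add: comp_def)
    from indep_varD[OF this, of "{1}" "{-a<..<a}"]
    have "prob ((\<lambda>\<omega>. (f1 (\<lambda>i\<in>{..<k}. Y i \<omega>), f2 (\<lambda>i\<in>{k..<n}. Y i \<omega>))) -` ({1} \<times> {-a<..<a}) \<inter> space M)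
      = prob ((\<lambda>\<omega>. f1 (\<lambda>i\<in>{..<k}. Y i \<omega>)) -` {1} \<inter> space M)
        * prob ((\<lambda>\<omega>. f2 (\<lambda>i\<in>{k..<n}. Y i \<omega>)) -` {-a<..<a} \<inter> space M)" by simp
    moreover have HE: "(\<lambda>\<omega>. f1 (\<lambda>i\<in>{..<k}. Y i \<omega>)) -` {1} \<inter> space M = H k"
      by (auto simp: f1_def H_def S_def split: if_splits)
    moreover have "(\<Sum>i\<in>{k..<n}. Y i \<omega>) = S n \<omega> - S k \<omega>" for \<omega>
      using k sum.atLeastLessThan_concat[of 0 k n "\<lambda>i. Y i \<omega>"] by (simp add: S_def lessThan_atLeast0)
    hence GE: "(\<lambda>\<omega>. f2 (\<lambda>i\<in>{k..<n}. Y i \<omega>)) -` {-a<..<a} \<inter> space M = G k"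
      by (auto simp: f2_def G_def)
    moreover have "(\<lambda>\<omega>. (f1 (\<lambda>i\<in>{..<k}. Y i \<omega>), f2 (\<lambda>i\<in>{k..<n}. Y i \<omega>))) -` ({1} \<times> {-a<..<a}) \<inter> space M
        = H k \<inter> G k"
      unfolding HE[symmetric] GE[symmetric] by blast
    ultimately have "prob (H k \<inter> G k) = prob (H k) * prob (G k)" by simp
    moreover have "1 / 2 \<le> prob (G k)"
    proof -
      have "G k = space M - {\<omega>\<in>space M. a \<le> \<bar>S n \<omega> - S k \<omega>\<bar>}" by (auto simp: G_def)
      hence "prob (G k) = 1 - prob {\<omega>\<in>space M. a \<le> \<bar>S n \<omega> - S k \<omega>\<bar>}"
        by (simp add: prob_compl)
      thus ?thesis using tail[OF k] p by linarith
    qed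
    ultimately show ?thesis
      using mult_left_mono[of "1/2" "prob (G k)" "prob (H k)"] by simp
  qed
  have "{\<omega>\<in>space M. \<exists>k\<le>n. 2 * a \<le> \<bar>S k \<omega>\<bar>} = (\<Union>k\<in>{..n}. H k)"
  proof (intro set_eqI iffI)
    fix \<omega> assume "\<omega> \<in> {\<omega>\<in>space M. \<exists>k\<le>n. 2 * a \<le> \<bar>S k \<omega>\<bar>}"
    then obtain k where k: "k \<le> n" "2 * a \<le> \<bar>S k \<omega>\<bar>" "\<omega> \<in> space M" by auto
    define l where "l = (LEAST k. 2 * a \<le> \<bar>S k \<omega>\<bar>)"
    have "2 * a \<le> \<bar>S l \<omega>\<bar>" unfolding l_def using k(2) by (rule LeastI)
    moreover have "\<bar>S i \<omega>\<bar> < 2 * a" if "i < l" for i using not_less_Least[of i] that unfolding l_def by force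
    moreover have "l \<le> k" unfolding l_def using k(2) by (rule Least_le)
    ultimately have "\<omega> \<in> H l" "l \<le> n" using k by (auto simp: H_def)
    thus "\<omega> \<in> (\<Union>k\<in>{..n}. H k)" by auto
  qed (auto simp: H_def)
  moreover have disj: "disjoint_family_on H {..n}"
    unfolding disjoint_family_on_def H_def by (auto simp: not_less[symmetric]) (metis linorder_neqE_nat not_le)
  ultimately have "prob {\<omega>\<in>space M. \<exists>k\<le>n. 2 * a \<le> \<bar>S k \<omega>\<bar>} = (\<Sum>k\<le>n. prob (H k))"
    by (simp add: finite_measure_finite_Union subset_eq)
  also have "\<dots> \<le> (\<Sum>k\<le>n. 2 * prob (H k \<inter> G k))" by (intro sum_mono HG) auto
  also have "\<dots> = 2 * prob (\<Union>k\<in>{..n}. H k \<inter> G k)"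
    using disj by (subst finite_measure_finite_Union)
      (auto simp: sum_distrib_left disjoint_family_on_def)
  also have "prob (\<Union>k\<in>{..n}. H k \<inter> G k) \<le> prob {\<omega>\<in>space M. a \<le> \<bar>S n \<omega> - S 0 \<omega>\<bar>}"
  proof (rule finite_measure_mono)
    show "(\<Union>k\<in>{..n}. H k \<inter> G k) \<subseteq> {\<omega>\<in>space M. a \<le> \<bar>S n \<omega> - S 0 \<omega>\<bar>}"
    proof
      fix \<omega> assume "\<omega> \<in> (\<Union>k\<in>{..n}. H k \<inter> G k)"
      then obtain k where "2 * a \<le> \<bar>S k \<omega>\<bar>" "\<bar>S n \<omega> - S k \<omega>\<bar> < a" "\<omega> \<in> space M"
        by (auto simp: H_def G_def)
      thus "\<omega> \<in> {\<omega>\<in>space M. a \<le> \<bar>S n \<omega> - S 0 \<omega>\<bar>}" by (simp add: S_def)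
    qed
  qed auto
  also have "\<dots> \<le> p" by (rule tail) simp
  finally show ?thesis by simp
qed

text \<open>Dyadic approximation of a time from the right.\<close>

definition dyadic_above :: "real \<Rightarrow> nat \<Rightarrow> real \<Rightarrow> real" where
  "dyadic_above h m t = (real_of_int \<lfloor>t * 2 ^ m / h\<rfloor> + 1) * h / 2 ^ m"

lemma dyadic_above:
  assumes "0 < h"
  shows "t < dyadic_above h m t" "dyadic_above h m t \<le> t + h / 2 ^ m"
proof -
  define x where "x = t * 2 ^ m / h"
  have x: "t = x * h / 2 ^ m" using assms by (simp add: x_def)
  have "x < real_of_int \<lfloor>x\<rfloor> + 1" "real_of_int \<lfloor>x\<rfloor> + 1 \<le> x + 1"
    by linarith+
  hence "x * h < (real_of_int \<lfloor>x\<rfloor> + 1) * h" "(real_of_int \<lfloor>x\<rfloor> + 1) * h \<le> (x + 1) * h"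
    using assms by (auto intro!: mult_strict_right_mono mult_right_mono)
  thus "t < dyadic_above h m t" "dyadic_above h m t \<le> t + h / 2 ^ m"
    unfolding dyadic_above_def x_def[symmetric] unfolding x
    by (simp_all add: add_divide_distrib[symmetric] divide_strict_right_mono divide_right_mono distrib_right)
qed

lemma filterlim_dyadic_above:
  assumes "0 < h"
  shows "filterlim (\<lambda>m. dyadic_above h m t) (at_right t) sequentially"
  unfolding filterlim_at
proof
  show "((\<lambda>m. dyadic_above h m t) \<longlongrightarrow> t) sequentially"
  proof (rule tendsto_sandwich[of "\<lambda>_. t" _ _ "\<lambda>m. t + h / 2 ^ m"])
    have "(\<lambda>m. t + h * (1 / 2) ^ m) \<longlonglongrightarrow> t + h * 0"
      by (intro tendsto_intros LIMSEQ_realpow_zero) auto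
    thus "(\<lambda>m. t + h / 2 ^ m) \<longlonglongrightarrow> t" by (simp add: power_one_over field_simps)
  qed (use dyadic_above[OF assms] in \<open>auto intro!: always_eventually less_imp_le\<close>)
  show "\<forall>\<^sub>F m in sequentially. dyadic_above h m t \<in> {t<..} \<and> dyadic_above h m t \<noteq> t"
    using dyadic_above(1)[OF assms, of t] by (auto intro!: always_eventually simp: less_imp_neq[symmetric])
qed

text \<open>A cadlag path exceeds a level as soon as it does so on the dyadic grids, where Ottaviani's
  inequality applies.\<close>

lemma levy_process_maximal:
  assumes levy: "levy_process M X" and T: "0 < T" and a: "0 < a" and p: "p \<le> 1 / 2"
    and tail: "\<And>u. 0 \<le> u \<Longrightarrow> u \<le> T \<Longrightarrow> measure M {\<omega>\<in>space M. a \<le> \<bar>X u \<omega>\<bar>} \<le> p"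
  obtains B where "B \<in> sets M" "measure M B \<le> 2 * p"
    "AE \<omega> in M. \<omega> \<notin> B \<longrightarrow> (\<forall>t\<in>{0..T}. \<bar>X t \<omega>\<bar> \<le> 2 * a)"
proof
  interpret prob_space M using levy by (simp add: levy_process_def)
  have meas [measurable]: "X t \<in> borel_measurable M" if "0 \<le> t" for t
    using levy that by (simp add: levy_process_def)
  define E where "E m = {\<omega>\<in>space M. \<exists>k\<le>2^m. 2 * a \<le> \<bar>X (real k * T / 2 ^ m) \<omega> - X 0 \<omega>\<bar>}" for m :: nat
  have [measurable]: "X (real k * T / 2 ^ m) \<in> borel_measurable M" for k m using T by (intro meas) auto
  have [measurable]: "X 0 \<in> borel_measurable M" by (intro meas) auto
  have [measurable]: "E m \<in> sets M" for m unfolding E_def by measurable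
  show "(\<Union>m. E m) \<in> sets M" by measurable
  have E: "prob (E m) \<le> 2 * p" for m
  proof -
    define t where "t k = real k * T / 2 ^ m" for k
    have t: "0 \<le> t 0" "mono t" using T by (auto simp: t_def mono_def intro!: divide_right_mono)
    define Y where "Y k \<omega> = X (t (Suc k)) \<omega> - X (t k) \<omega>" for k \<omega>
    have S: "(\<Sum>j<k. Y j \<omega>) = X (t k) \<omega> - X 0 \<omega>" for k \<omega>
      unfolding Y_def by (subst sum_lessThan_telescope) (simp add: t_def)
    have "prob {\<omega>\<in>space M. \<exists>k\<le>2^m. 2 * a \<le> \<bar>\<Sum>j<k. Y j \<omega>\<bar>} \<le> 2 * p"
    proof (rule ottaviani)
      show "indep_vars (\<lambda>_. borel) Y UNIV" using levy t by (simp add: levy_process_def Y_def[abs_def])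
      fix k :: nat assume k: "k \<le> 2 ^ m"
      have le: "0 \<le> t k" "t k \<le> t (2 ^ m)" "t (2 ^ m) = T"
        using mono_nonneg[OF t] monoD[OF t(2) k] by (auto simp: t_def)
      have [measurable]: "X (t (2^m)) \<in> borel_measurable M" "X (t k) \<in> borel_measurable M"
        "X (t (2^m) - t k) \<in> borel_measurable M"
        using le by (auto intro!: meas)
      have "prob {\<omega>\<in>space M. a \<le> \<bar>(\<Sum>j<2^m. Y j \<omega>) - (\<Sum>j<k. Y j \<omega>)\<bar>}
          = measure (distr M borel (\<lambda>\<omega>. X (t (2^m)) \<omega> - X (t k) \<omega>)) {y. a \<le> \<bar>y\<bar>}"
        unfolding S by (subst measure_distr) (auto intro!: arg_cong[where f=prob])
      also have "distr M borel (\<lambda>\<omega>. X (t (2^m)) \<omega> - X (t k) \<omega>) = distr M borel (X (t (2^m) - t k))"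
        using levy le by (simp add: levy_process_def)
      also have "measure \<dots> {y. a \<le> \<bar>y\<bar>} = prob {\<omega>\<in>space M. a \<le> \<bar>X (t (2^m) - t k) \<omega>\<bar>}"
        by (subst measure_distr) (auto intro!: arg_cong[where f=prob])
      also have "\<dots> \<le> p" using le by (intro tail) auto
      finally show "prob {\<omega>\<in>space M. a \<le> \<bar>(\<Sum>j<2^m. Y j \<omega>) - (\<Sum>j<k. Y j \<omega>)\<bar>} \<le> p" .
    qed (use a p in auto)
    thus ?thesis unfolding S E_def t_def .
  qed
  have "incseq E"
  proof (rule incseq_SucI, rule subsetI)
    fix m \<omega> assume "\<omega> \<in> E m"
    then obtain k where k: "k \<le> 2^m" "2 * a \<le> \<bar>X (real k * T / 2 ^ m) \<omega> - X 0 \<omega>\<bar>" "\<omega> \<in> space M"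
      by (auto simp: E_def)
    hence "2 * k \<le> 2 ^ Suc m" "2 * a \<le> \<bar>X (real (2 * k) * T / 2 ^ Suc m) \<omega> - X 0 \<omega>\<bar>" by auto
    thus "\<omega> \<in> E (Suc m)" using k(3) unfolding E_def by blast
  qed
  hence "(\<lambda>m. prob (E m)) \<longlonglongrightarrow> prob (\<Union>m. E m)"
    by (intro finite_Lim_measure_incseq) auto
  thus "prob (\<Union>m. E m) \<le> 2 * p" by (rule LIMSEQ_le_const2) (use E in auto)
  have "AE \<omega> in M. cadlag (\<lambda>t. X t \<omega>)" "AE \<omega> in M. X 0 \<omega> = 0" "AE \<omega> in M. \<omega> \<in> space M"
    using levy by (auto simp: levy_process_def)
  thus "AE \<omega> in M. \<omega> \<notin> (\<Union>m. E m) \<longrightarrow> (\<forall>t\<in>{0..T}. \<bar>X t \<omega>\<bar> \<le> 2 * a)"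
  proof eventually_elim
    case (elim \<omega>)
    show ?case
    proof (intro impI ballI)
      fix t assume out: "\<omega> \<notin> (\<Union>m. E m)" and t: "t \<in> {0..T}"
      have grid: "\<bar>X (real k * T / 2 ^ m) \<omega>\<bar> \<le> 2 * a" if "k \<le> 2 ^ m" for k m
        using out that elim by (force simp: E_def)
      show "\<bar>X t \<omega>\<bar> \<le> 2 * a"
      proof (cases "t = T")
        case True thus ?thesis using grid[of 1 0] by simp
      next
        case False
        have lim: "(\<lambda>m. \<bar>X (dyadic_above T m t) \<omega>\<bar>) \<longlonglongrightarrow> \<bar>X t \<omega>\<bar>"
          using elim(1) t by (intro tendsto_rabs filterlim_compose[OF _ filterlim_dyadic_above[OF T]])
             (auto simp: cadlag_def)
        have "\<bar>X (dyadic_above T m t) \<omega>\<bar> \<le> 2 * a" for m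
        proof -
          define k where "k = nat \<lfloor>t * 2 ^ m / T\<rfloor> + 1"
          have nn: "0 \<le> \<lfloor>t * 2 ^ m / T\<rfloor>" using t T by simp
          have "t * 2 ^ m / T < 2 ^ m" using False t T by (simp add: field_simps)
          hence "\<lfloor>t * 2 ^ m / T\<rfloor> < 2 ^ m" by (simp add: floor_less_iff)
          hence "k \<le> 2 ^ m" using nn by (simp add: k_def nat_less_iff Suc_le_eq)
          moreover have "dyadic_above T m t = real k * T / 2 ^ m"
            using nn by (simp add: dyadic_above_def k_def)
          ultimately show ?thesis using grid by simp
        qed
        thus ?thesis by (intro LIMSEQ_le_const2[OF lim]) auto
      qed
    qed
  qed
qed

section \<open>Product spaces and realisation on the space of real sequences\<close>

lemma increments_exponent_pullback:
  assumes S: "S \<in> measurable M' M" "distr M' M S = M"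
    and X: "\<And>t. 0 \<le> t \<Longrightarrow> X t \<in> borel_measurable M" and incr: "increments_exponent M X \<Psi>"
  shows "increments_exponent M' (\<lambda>t \<omega>. X t (S \<omega>)) \<Psi>"
  unfolding increments_exponent_def
proof (intro allI impI)
  fix t :: "nat \<Rightarrow> real" and \<theta> :: "nat \<Rightarrow> real" and n assume t: "0 \<le> t 0 \<and> mono t"
  have [measurable]: "X (t k) \<in> borel_measurable M" for k
    using t mono_nonneg[of t k] by (intro X) auto
  have "(CLINT \<omega>|M'. (\<Prod>k<n. iexp (\<theta> k * (X (t (Suc k)) (S \<omega>) - X (t k) (S \<omega>)))))
    = (CLINT \<omega>|distr M' M S. (\<Prod>k<n. iexp (\<theta> k * (X (t (Suc k)) \<omega> - X (t k) \<omega>))))"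
    by (rule integral_distr[symmetric]) (use S in measurable)
  thus "(CLINT \<omega>|M'. (\<Prod>k<n. iexp (\<theta> k * (X (t (Suc k)) (S \<omega>) - X (t k) (S \<omega>)))))
      = (\<Prod>k<n. exp (complex_of_real (t (Suc k) - t k) * \<Psi> (\<theta> k)))"
    using increments_exponentD[OF incr] t S(2) by simp
qed

lemma measurable_PiM_component:
  "f \<in> measurable (D i) N \<Longrightarrow> (\<lambda>\<omega>. f (\<omega> i)) \<in> measurable (PiM UNIV D) N"
  by (rule measurable_compose[of "\<lambda>\<omega>. \<omega> i" _ "D i"]) auto

lemma distr_pair_snd:
  assumes "prob_space M" "prob_space N"
  shows "distr (M \<Otimes>\<^sub>M N) N snd = N"
proof (rule measure_eqI)
  interpret M: prob_space M by fact
  interpret N: prob_space N by fact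
  fix A assume "A \<in> sets (distr (M \<Otimes>\<^sub>M N) N snd)"
  hence A: "A \<in> sets N" by simp
  have "snd -` A \<inter> space (M \<Otimes>\<^sub>M N) = space M \<times> A"
    using sets.sets_into_space[OF A] by (auto simp: space_pair_measure)
  thus "emeasure (distr (M \<Otimes>\<^sub>M N) N snd) A = emeasure N A"
    using A by (simp add: emeasure_distr N.emeasure_pair_measure_Times M.emeasure_space_1)
qed simp

lemma indep_vars_PiM_component:
  assumes "\<And>i::nat. prob_space (D i)"
  shows "prob_space.indep_vars (PiM UNIV D) D (\<lambda>i \<omega>. \<omega> i) UNIV"
proof -
  interpret prob_space "PiM UNIV D" by (rule prob_space_PiM) (rule assms)
  have "distr (PiM UNIV D) (PiM UNIV D) (\<lambda>x. \<lambda>i\<in>UNIV. x i) = PiM UNIV D"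
    by (simp add: restrict_def distr_id[unfolded id_def])
  also have "\<dots> = PiM UNIV (\<lambda>i. distr (PiM UNIV D) (D i) (\<lambda>\<omega>. \<omega> i))"
    using assms by (simp add: distr_PiM_component)
  finally show ?thesis
    by (subst indep_vars_iff_distr_eq_PiM) auto
qed

lemma integral_PiM_prod:
  fixes f :: "nat \<Rightarrow> 'b \<Rightarrow> complex"
  assumes D: "\<And>i. prob_space (D i)"
    and f: "\<And>i. f i \<in> borel_measurable (D i)" and bound: "\<And>i y. norm (f i y) \<le> 1"
  shows "(CLINT \<omega>|PiM UNIV D. \<Prod>i<n. f i (\<omega> i)) = (\<Prod>i<n. CLINT y|D i. f i y)"
proof -
  interpret prob_space "PiM UNIV D" by (rule prob_space_PiM) (rule D)
  have "indep_vars (\<lambda>_. borel) (\<lambda>i \<omega>. f i (\<omega> i)) UNIV"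
    by (rule indep_vars_compose2[OF indep_vars_PiM_component]) (use D f in auto)
  hence "indep_vars (\<lambda>_. borel) (\<lambda>i \<omega>. f i (\<omega> i)) {..<n}" by (rule indep_vars_subset) auto
  moreover have "integrable (PiM UNIV D) (\<lambda>\<omega>. f i (\<omega> i))" for i
    by (rule integrable_const_bound[of _ 1]) (use f bound in \<open>auto intro: measurable_PiM_component\<close>)
  ultimately have "(CLINT \<omega>|PiM UNIV D. \<Prod>i<n. f i (\<omega> i)) = (\<Prod>i<n. CLINT \<omega>|PiM UNIV D. f i (\<omega> i))"
    by (intro indep_vars_lebesgue_integral) auto
  also have "\<dots> = (\<Prod>i<n. CLINT y|D i. f i y)"
  proof (rule prod.cong[OF refl])
    fix i
    have "(CLINT y|distr (PiM UNIV D) (D i) (\<lambda>\<omega>. \<omega> i). f i y) = (CLINT \<omega>|PiM UNIV D. f i (\<omega> i))"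
      by (rule integral_distr) (use f in auto)
    thus "(CLINT \<omega>|PiM UNIV D. f i (\<omega> i)) = (CLINT y|D i. f i y)"
      using D by (simp add: distr_PiM_component)
  qed
  finally show ?thesis .
qed

text \<open>A probability space is coded by real sequences if it is the image of a probability measure
  on \<open>nat \<Rightarrow> real\<close>.\<close>

definition sequence_coded :: "'b measure \<Rightarrow> bool" where
  "sequence_coded \<Omega> \<longleftrightarrow> (\<exists>(P :: (nat \<Rightarrow> real) measure) S. prob_space P \<and>
     sets P = sets (PiM UNIV (\<lambda>_. borel)) \<and> S \<in> measurable P \<Omega> \<and> distr P \<Omega> S = \<Omega>)"

lemma sequence_coded_image:
  assumes D: "real_distribution D" and f: "f \<in> measurable borel \<Omega>" and \<Omega>: "distr D \<Omega> f = \<Omega>"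
  shows "sequence_coded \<Omega>"
proof -
  interpret real_distribution D by fact
  let ?P = "PiM (UNIV :: nat set) (\<lambda>_. D)"
  have f': "f \<in> measurable D \<Omega>" using f by simp
  have "prob_space ?P" by (rule prob_space_PiM) (rule prob_space_axioms)
  moreover have "sets ?P = sets (PiM UNIV (\<lambda>_. borel))" by (rule sets_PiM_cong) auto
  moreover have "(\<lambda>\<omega>. f (\<omega> 0)) \<in> measurable ?P \<Omega>"
    by (rule measurable_PiM_component) (rule f')
  moreover have "distr ?P \<Omega> (\<lambda>\<omega>. f (\<omega> 0)) = distr (distr ?P D (\<lambda>\<omega>. \<omega> 0)) \<Omega> f"
    by (subst distr_distr) (auto simp: f' comp_def)
  hence "distr ?P \<Omega> (\<lambda>\<omega>. f (\<omega> 0)) = \<Omega>"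
    using \<Omega> by (simp only: distr_PiM_component[OF prob_space_axioms UNIV_I])
  ultimately show ?thesis unfolding sequence_coded_def by blast
qed

text \<open>Two sequences are interleaved into one.\<close>

lemma sequence_coded_pair:
  assumes "sequence_coded \<Omega>1" "sequence_coded \<Omega>2"
  shows "sequence_coded (\<Omega>1 \<Otimes>\<^sub>M \<Omega>2)"
proof -
  obtain P1 S1 where 1: "prob_space P1" "sets P1 = sets (PiM UNIV (\<lambda>_::nat. borel :: real measure))"
    "S1 \<in> measurable P1 \<Omega>1" "distr P1 \<Omega>1 S1 = \<Omega>1" using assms(1) unfolding sequence_coded_def by blast
  obtain P2 S2 where 2: "prob_space P2" "sets P2 = sets (PiM UNIV (\<lambda>_::nat. borel :: real measure))"
    "S2 \<in> measurable P2 \<Omega>2" "distr P2 \<Omega>2 S2 = \<Omega>2" using assms(2) unfolding sequence_coded_def by blast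
  interpret P1: prob_space P1 by fact
  interpret P2: prob_space P2 by fact
  interpret P: pair_prob_space P1 P2 ..
  let ?B = "PiM UNIV (\<lambda>_::nat. borel :: real measure)"
  note [measurable_cong] = 1(2) 2(2)
  define T where "T p = (\<lambda>i. if even i then fst p (i div 2) else snd p (i div 2))"
    for p :: "(nat \<Rightarrow> real) \<times> (nat \<Rightarrow> real)"
  define S where "S \<eta> = (S1 (\<lambda>i. \<eta> (2 * i)), S2 (\<lambda>i. \<eta> (2 * i + 1)))" for \<eta>
  have T [measurable]: "T \<in> measurable (P1 \<Otimes>\<^sub>M P2) ?B"
    unfolding T_def by (rule measurable_PiM_single') (auto simp: space_PiM)
  have "(\<lambda>\<eta>. \<lambda>i. \<eta> (2 * i)) \<in> measurable ?B P1" "(\<lambda>\<eta>. \<lambda>i. \<eta> (2 * i + 1)) \<in> measurable ?B P2"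
    unfolding measurable_cong_sets[OF refl 1(2)] measurable_cong_sets[OF refl 2(2)]
    by (auto intro!: measurable_PiM_single' simp: space_PiM)
  hence S: "S \<in> measurable ?B (\<Omega>1 \<Otimes>\<^sub>M \<Omega>2)"
    unfolding S_def using 1(3) 2(3) by (intro measurable_Pair measurable_compose[OF _ 1(3)] measurable_compose[OF _ 2(3)])
  have "prob_space (distr P1 \<Omega>1 S1)" "prob_space (distr P2 \<Omega>2 S2)"
    by (auto intro!: P1.prob_space_distr P2.prob_space_distr 1 2 simp del: 1 2)
  hence "sigma_finite_measure (distr P2 \<Omega>2 S2)"
    by (intro prob_space_imp_sigma_finite)
  have "distr (distr (P1 \<Otimes>\<^sub>M P2) ?B T) (\<Omega>1 \<Otimes>\<^sub>M \<Omega>2) S = distr (P1 \<Otimes>\<^sub>M P2) (\<Omega>1 \<Otimes>\<^sub>M \<Omega>2) (S \<circ> T)"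
    by (rule distr_distr) (rule S, rule T)
  also have "S \<circ> T = (\<lambda>(x, y). (S1 x, S2 y))"
    by (auto simp: S_def T_def fun_eq_iff)
  also have "distr (P1 \<Otimes>\<^sub>M P2) (\<Omega>1 \<Otimes>\<^sub>M \<Omega>2) (\<lambda>(x, y). (S1 x, S2 y)) = \<Omega>1 \<Otimes>\<^sub>M \<Omega>2"
    using pair_measure_distr[OF 1(3) 2(3)] \<open>sigma_finite_measure _\<close> 1(4) 2(4) by simp
  finally have "distr (distr (P1 \<Otimes>\<^sub>M P2) ?B T) (\<Omega>1 \<Otimes>\<^sub>M \<Omega>2) S = \<Omega>1 \<Otimes>\<^sub>M \<Omega>2" .
  moreover have "prob_space (distr (P1 \<Otimes>\<^sub>M P2) ?B T)" by (rule P.prob_space_distr) (rule T)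
  ultimately show ?thesis unfolding sequence_coded_def using S
    by (intro exI[of _ "distr (P1 \<Otimes>\<^sub>M P2) ?B T"] exI[of _ S]) auto
qed

text \<open>A sequence of sequences is flattened along an enumeration of the pairs of indices.\<close>

lemma sequence_coded_PiM:
  assumes "\<And>n::nat. sequence_coded (\<Omega> n)"
  shows "sequence_coded (PiM UNIV \<Omega>)"
proof -
  let ?B = "PiM UNIV (\<lambda>_::nat. borel :: real measure)"
  have "\<forall>n. \<exists>(P :: (nat \<Rightarrow> real) measure) S. prob_space P \<and>
     sets P = sets ?B \<and> S \<in> measurable P (\<Omega> n) \<and> distr P (\<Omega> n) S = \<Omega> n"
    using assms unfolding sequence_coded_def by blast
  then obtain P :: "nat \<Rightarrow> (nat \<Rightarrow> real) measure" and S where PS: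
    "\<And>n. prob_space (P n)" "\<And>n. sets (P n) = sets ?B" "\<And>n. S n \<in> measurable (P n) (\<Omega> n)"
    "\<And>n. distr (P n) (\<Omega> n) (S n) = \<Omega> n" by metis
  interpret PP: prob_space "PiM UNIV P" by (rule prob_space_PiM) (rule PS)
  define T where "T \<omega> = (\<lambda>i. \<omega> (fst (prod_decode i)) (snd (prod_decode i)))"
    for \<omega> :: "nat \<Rightarrow> nat \<Rightarrow> real"
  define R where "R \<eta> = (\<lambda>n. S n (\<lambda>i. \<eta> (prod_encode (n, i))))" for \<eta>
  have comp: "(\<lambda>\<omega>. \<omega> n i) \<in> borel_measurable (PiM UNIV P)" for n i
    by (rule measurable_PiM_component) (auto simp: measurable_cong_sets[OF PS(2) refl])
  have T: "T \<in> measurable (PiM UNIV P) ?B"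
    unfolding T_def by (rule measurable_PiM_single') (auto simp: space_PiM comp)
  have "(\<lambda>\<eta>. \<lambda>i. \<eta> (prod_encode (n, i))) \<in> measurable ?B (P n)" for n
    unfolding measurable_cong_sets[OF refl PS(2)]
    by (auto intro!: measurable_PiM_single' simp: space_PiM)
  hence "(\<lambda>\<eta>. S n (\<lambda>i. \<eta> (prod_encode (n, i)))) \<in> measurable ?B (\<Omega> n)" for n
    by (rule measurable_compose) (rule PS)
  hence R: "R \<in> measurable ?B (PiM UNIV \<Omega>)"
    unfolding R_def by (intro measurable_PiM_single') (auto simp: space_PiM intro: measurable_space)
  have SX: "(\<lambda>\<omega>. S n (\<omega> n)) \<in> measurable (PiM UNIV P) (\<Omega> n)" for n
    by (rule measurable_PiM_component) (rule PS)
  have "PP.indep_vars \<Omega> (\<lambda>n \<omega>. S n (\<omega> n)) UNIV"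
    by (rule PP.indep_vars_compose2[OF indep_vars_PiM_component]) (use PS in auto)
  hence "distr (PiM UNIV P) (PiM UNIV \<Omega>) (\<lambda>\<omega>. \<lambda>n\<in>UNIV. S n (\<omega> n))
      = PiM UNIV (\<lambda>n. distr (PiM UNIV P) (\<Omega> n) (\<lambda>\<omega>. S n (\<omega> n)))"
    by (subst (asm) PP.indep_vars_iff_distr_eq_PiM) (auto simp: SX)
  also have "\<dots> = PiM UNIV \<Omega>"
  proof (rule PiM_cong[OF refl])
    fix n
    have "distr (distr (PiM UNIV P) (P n) (\<lambda>\<omega>. \<omega> n)) (\<Omega> n) (S n) = distr (PiM UNIV P) (\<Omega> n) (\<lambda>\<omega>. S n (\<omega> n))"
      by (subst distr_distr) (use PS in \<open>auto simp: comp_def\<close>)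
    thus "distr (PiM UNIV P) (\<Omega> n) (\<lambda>\<omega>. S n (\<omega> n)) = \<Omega> n"
      using PS by (simp add: distr_PiM_component)
  qed
  finally have "distr (PiM UNIV P) (PiM UNIV \<Omega>) (R \<circ> T) = PiM UNIV \<Omega>"
    by (simp add: comp_def R_def T_def restrict_def)
  hence "distr (distr (PiM UNIV P) ?B T) (PiM UNIV \<Omega>) R = PiM UNIV \<Omega>"
    by (subst distr_distr) (auto simp: R T)
  moreover have "prob_space (distr (PiM UNIV P) ?B T)" by (rule PP.prob_space_distr) (rule T)
  ultimately show ?thesis unfolding sequence_coded_def using R
    by (intro exI[of _ "distr (PiM UNIV P) ?B T"] exI[of _ R]) auto
qed

section \<open>Poisson and compound Poisson processes\<close>

lemma poisson_pgf:
  fixes z :: complex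
  assumes q: "0 < q"
  shows "(CLINT k|measure_pmf (poisson_pmf q). z ^ k) = exp (complex_of_real q * (z - 1))"
proof -
  have sums: "(\<lambda>k. complex_of_real (exp (-q)) * ((complex_of_real q * z) ^ k /\<^sub>R fact k))
      sums (complex_of_real (exp (-q)) * exp (complex_of_real q * z))"
    by (intro sums_mult exp_converges)
  have eq: "pmf (poisson_pmf q) k *\<^sub>R z ^ k
      = complex_of_real (exp (-q)) * ((complex_of_real q * z) ^ k /\<^sub>R fact k)" for k
    using q by (simp add: scaleR_conv_of_real field_simps power_mult_distrib)
  have "summable (\<lambda>k. norm (pmf (poisson_pmf q) k *\<^sub>R z ^ k))"
    unfolding eq norm_mult by (intro summable_mult summable_norm_exp)
  hence int: "integrable (count_space UNIV) (\<lambda>k. pmf (poisson_pmf q) k *\<^sub>R z ^ k)"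
    by (simp add: integrable_count_space_nat_iff)
  have "(CLINT k|measure_pmf (poisson_pmf q). z ^ k)
      = (CLINT k|count_space UNIV. pmf (poisson_pmf q) k *\<^sub>R z ^ k)"
    unfolding measure_pmf_eq_density by (rule integral_density) auto
  also have "\<dots> = (\<Sum>k. pmf (poisson_pmf q) k *\<^sub>R z ^ k)"
    by (rule integral_count_space_nat[OF int])
  also have "\<dots> = complex_of_real (exp (-q)) * exp (complex_of_real q * z)"
    unfolding eq using sums by (rule sums_unique[symmetric])
  finally show ?thesis
    by (simp add: exp_of_real[symmetric] exp_add[symmetric] right_diff_distrib)
qed

text \<open>The uniform distribution on the unit interval.\<close>

definition uniform01 :: "real measure" where
  "uniform01 = density lborel (\<lambda>u. ennreal (indicator {0..1} u))"

text \<open>A Poisson point process in windows: window \<open>m\<close> consists of a Poisson number of points and of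
  their positions, an independent sequence of uniform variables to be shifted by \<open>m\<close>.\<close>

definition poisson_windows :: "real \<Rightarrow> (nat \<Rightarrow> nat \<times> (nat \<Rightarrow> real)) measure" where
  "poisson_windows q = PiM UNIV (\<lambda>_. measure_pmf (poisson_pmf q) \<Otimes>\<^sub>M PiM UNIV (\<lambda>_. uniform01))"

text \<open>The number of points up to time \<open>t\<close>. The absolute value makes window \<open>m\<close> contribute nothing
  before time \<open>m\<close> on the whole sample space.\<close>

definition points_until :: "real \<Rightarrow> (nat \<Rightarrow> nat \<times> (nat \<Rightarrow> real)) \<Rightarrow> nat" where
  "points_until t \<omega> = (\<Sum>m\<le>nat \<lfloor>t\<rfloor>. \<Sum>k<fst (\<omega> m). of_bool (real m + \<bar>snd (\<omega> m) k\<bar> \<le> t))"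

lemma real_distribution_uniform01: "real_distribution uniform01"
proof -
  have "emeasure uniform01 (space uniform01) = 1"
    by (simp add: uniform01_def emeasure_density ennreal_indicator)
  hence "prob_space uniform01" by (rule prob_spaceI)
  thus ?thesis by (simp add: real_distribution_def real_distribution_axioms_def uniform01_def)
qed

lemma sets_uniform01 [measurable_cong, simp]: "sets uniform01 = sets borel"
  by (simp add: uniform01_def)

lemma prob_space_windows:
  "prob_space (PiM (UNIV :: nat set) (\<lambda>_. uniform01))"
  "prob_space (measure_pmf (poisson_pmf q) \<Otimes>\<^sub>M PiM (UNIV :: nat set) (\<lambda>_. uniform01))"
  "prob_space (poisson_windows q)"
proof -
  show 1: "prob_space (PiM (UNIV :: nat set) (\<lambda>_. uniform01))"
    using real_distribution_uniform01 by (intro prob_space_PiM) (auto simp: real_distribution_def)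
  interpret U: prob_space "PiM (UNIV :: nat set) (\<lambda>_. uniform01)" by (rule 1)
  interpret Q: prob_space "measure_pmf (poisson_pmf q)" by (rule measure_pmf.prob_space_axioms)
  interpret QU: pair_prob_space "measure_pmf (poisson_pmf q)" "PiM (UNIV :: nat set) (\<lambda>_. uniform01)" ..
  show 2: "prob_space (measure_pmf (poisson_pmf q) \<Otimes>\<^sub>M PiM (UNIV :: nat set) (\<lambda>_. uniform01))"
    by (rule QU.prob_space_axioms)
  show "prob_space (poisson_windows q)"
    unfolding poisson_windows_def by (rule prob_space_PiM) (rule 2)
qed

lemma points_until_eq:
  assumes "t < real L"
  shows "points_until t \<omega> = (\<Sum>m<L. \<Sum>k<fst (\<omega> m). of_bool (real m + \<bar>snd (\<omega> m) k\<bar> \<le> t))"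
  unfolding points_until_def
proof (rule sum.mono_neutral_cong)
  show "(\<Sum>k<fst (\<omega> m). of_bool (real m + \<bar>snd (\<omega> m) k\<bar> \<le> t)) = (0::nat)" if "m \<in> {..<L} - {..nat \<lfloor>t\<rfloor>}" for m
  proof -
    have "t < real m" using that by (simp add: floor_less_iff nat_less_iff) linarith
    thus ?thesis by (auto intro!: sum.neutral)
  qed
  show "(\<Sum>k<fst (\<omega> m). of_bool (real m + \<bar>snd (\<omega> m) k\<bar> \<le> t)) = (0::nat)" if "m \<in> {..nat \<lfloor>t\<rfloor>} - {..<L}" for m
    using that assms by (auto intro!: sum.neutral)
qed auto

lemma points_until_measurable [measurable]: "points_until t \<in> measurable (poisson_windows q) (count_space UNIV)"
proof -
  have F: "(\<lambda>\<omega>. fst (\<omega> m)) \<in> measurable (poisson_windows q) (count_space UNIV)" for m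
    unfolding poisson_windows_def by (rule measurable_PiM_component) auto
  have U [measurable]: "(\<lambda>\<omega>. snd (\<omega> m) k) \<in> borel_measurable (poisson_windows q)" for m k
  proof -
    have "(\<lambda>p. snd p k) \<in> borel_measurable (measure_pmf (poisson_pmf q) \<Otimes>\<^sub>M PiM (UNIV :: nat set) (\<lambda>_. uniform01))"
      by (rule measurable_compose[OF measurable_snd]) (rule measurable_PiM_component, simp)
    thus ?thesis unfolding poisson_windows_def by (rule measurable_PiM_component)
  qed
  have "(\<lambda>\<omega>. \<Sum>k<n. of_bool (real m + \<bar>snd (\<omega> m) k\<bar> \<le> t)) \<in> measurable (poisson_windows q) (count_space (UNIV :: nat set))" for m n
    by measurable
  hence "(\<lambda>\<omega>. \<Sum>k<fst (\<omega> m). of_bool (real m + \<bar>snd (\<omega> m) k\<bar> \<le> t)) \<in> measurable (poisson_windows q) (count_space (UNIV :: nat set))" for m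
    by (rule measurable_compose_countable[OF _ F])
  thus ?thesis unfolding points_until_def[abs_def] by measurable
qed

lemma points_until_mono: "s \<le> t \<Longrightarrow> points_until s \<omega> \<le> points_until t \<omega>"
proof -
  assume st: "s \<le> t"
  obtain L :: nat where L: "t < real L" using reals_Archimedean2 by blast
  thus ?thesis using st unfolding points_until_eq[OF L] points_until_eq[OF order.strict_trans1[OF st L]]
    by (intro sum_mono) auto
qed

lemma points_until_right: "eventually (\<lambda>s. points_until s \<omega> = points_until t \<omega>) (at_right t)"
proof -
  obtain L :: nat where L: "t < real L" using reals_Archimedean2 by blast
  have "eventually (\<lambda>s. \<forall>m\<in>{..<L}. \<forall>k\<in>{..<fst (\<omega> m)}.
      (real m + \<bar>snd (\<omega> m) k\<bar> \<le> s) = (real m + \<bar>snd (\<omega> m) k\<bar> \<le> t)) (at_right t)"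
  proof (intro eventually_ball_finite ballI)
    fix m k
    define p where "p = real m + \<bar>snd (\<omega> m) k\<bar>"
    show "eventually (\<lambda>s. (real m + \<bar>snd (\<omega> m) k\<bar> \<le> s) = (real m + \<bar>snd (\<omega> m) k\<bar> \<le> t)) (at_right t)"
      unfolding p_def[symmetric]
    proof (cases "p \<le> t")
      case True thus "eventually (\<lambda>s. (p \<le> s) = (p \<le> t)) (at_right t)"
        by (intro eventually_mono[OF eventually_at_right_less[of t]]) auto
    next
      case False thus "eventually (\<lambda>s. (p \<le> s) = (p \<le> t)) (at_right t)"
        using eventually_at_right_real[of t p] by (auto elim: eventually_mono)
    qed
  qed auto
  moreover have "eventually (\<lambda>s. s < real L) (at_right t)"
    using eventually_at_right_real[OF L] by (auto elim: eventually_mono)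
  ultimately show ?thesis
  proof eventually_elim
    case (elim s)
    show ?case unfolding points_until_eq[OF L] points_until_eq[OF elim(2)]
      using elim(1) by (intro sum.cong refl) auto
  qed
qed

lemma points_until_left: "\<exists>n. eventually (\<lambda>s. points_until s \<omega> = n) (at_left t)"
proof -
  obtain L :: nat where L: "t < real L" using reals_Archimedean2 by blast
  have "eventually (\<lambda>s. \<forall>m\<in>{..<L}. \<forall>k\<in>{..<fst (\<omega> m)}.
      (real m + \<bar>snd (\<omega> m) k\<bar> \<le> s) = (real m + \<bar>snd (\<omega> m) k\<bar> < t)) (at_left t)"
  proof (intro eventually_ball_finite ballI)
    fix m k
    define p where "p = real m + \<bar>snd (\<omega> m) k\<bar>"
    show "eventually (\<lambda>s. (real m + \<bar>snd (\<omega> m) k\<bar> \<le> s) = (real m + \<bar>snd (\<omega> m) k\<bar> < t)) (at_left t)"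
      unfolding p_def[symmetric]
    proof (cases "p < t")
      case True thus "eventually (\<lambda>s. (p \<le> s) = (p < t)) (at_left t)"
        using eventually_at_left_real[of p t] by (auto elim: eventually_mono)
    next
      case False thus "eventually (\<lambda>s. (p \<le> s) = (p < t)) (at_left t)"
        using eventually_at_left_real[of "t - 1" t] by (auto elim: eventually_mono)
    qed
  qed auto
  moreover have "eventually (\<lambda>s. s < real L) (at_left t)"
    using L eventually_at_left_real[of "t - 1" t] by (auto elim!: eventually_mono)
  ultimately have "eventually (\<lambda>s. points_until s \<omega> =
     (\<Sum>m<L. \<Sum>k<fst (\<omega> m). of_bool (real m + \<bar>snd (\<omega> m) k\<bar> < t))) (at_left t)"
  proof eventually_elim
    case (elim s)
    show ?case unfolding points_until_eq[OF elim(2)]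
      using elim(1) by (intro sum.cong refl) auto
  qed
  thus ?thesis by blast
qed

lemma cadlag_points_until: "cadlag (\<lambda>t. f (points_until t \<omega>))"
  unfolding cadlag_def
proof (intro conjI allI impI)
  fix t :: real
  show "((\<lambda>t. f (points_until t \<omega>)) \<longlongrightarrow> f (points_until t \<omega>)) (at_right t)"
    by (rule tendsto_eventually) (use points_until_right[of \<omega> t] in \<open>auto elim: eventually_mono\<close>)
  obtain n where "eventually (\<lambda>s. points_until s \<omega> = n) (at_left t)" using points_until_left by blast
  hence "((\<lambda>t. f (points_until t \<omega>)) \<longlongrightarrow> f n) (at_left t)"
    by (intro tendsto_eventually) (auto elim: eventually_mono)
  thus "\<exists>l. ((\<lambda>t. f (points_until t \<omega>)) \<longlongrightarrow> l) (at_left t)" by blast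
qed

lemma points_until_0: "AE \<omega> in poisson_windows q. points_until 0 \<omega> = 0"
proof -
  let ?U = "PiM (UNIV :: nat set) (\<lambda>_. uniform01)"
  have "AE u in uniform01. u \<noteq> 0"
    unfolding uniform01_def using AE_lborel_singleton[of 0] by (subst AE_density) (auto elim: eventually_mono)
  hence "AE \<omega> in ?U. \<omega> k \<noteq> 0" for k
    using real_distribution_uniform01 by (intro AE_PiM_component) (auto simp: real_distribution_def)
  hence "AE \<omega> in ?U. \<forall>k. \<omega> k \<noteq> 0" by (simp add: AE_all_countable)
  hence "AE p in measure_pmf (poisson_pmf q) \<Otimes>\<^sub>M ?U. \<forall>k. snd p k \<noteq> 0"
    by (intro AE_distrD[OF measurable_snd])
       (simp only: distr_pair_snd[OF measure_pmf.prob_space_axioms prob_space_windows(1)])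
  hence "AE \<omega> in poisson_windows q. \<forall>k. snd (\<omega> 0) k \<noteq> 0"
    unfolding poisson_windows_def by (intro AE_PiM_component prob_space_windows) auto
  thus ?thesis by eventually_elim (auto simp: points_until_def)
qed

text \<open>The joint generating function of the increments: each window contributes a Poisson power,
  and the mean number of its points falling between two times adds up to the time elapsed.\<close>

lemma points_until_joint_pgf:
  assumes q: "0 < q" and t0: "0 \<le> t 0" and mono: "mono t" and z: "\<And>k. norm (z k :: complex) \<le> 1"
  shows "(CLINT \<omega>|poisson_windows q. \<Prod>k<n. z k ^ (points_until (t (Suc k)) \<omega> - points_until (t k) \<omega>))
       = (\<Prod>k<n. exp (complex_of_real (t (Suc k) - t k) * (complex_of_real q * (z k - 1))))"
proof -
  let ?U = "PiM (UNIV :: nat set) (\<lambda>_. uniform01)"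
  interpret U1: real_distribution uniform01 by (rule real_distribution_uniform01)
  interpret U: prob_space ?U by (rule prob_space_windows)
  interpret QU: pair_prob_space "measure_pmf (poisson_pmf q)" ?U
    by (intro pair_prob_space.intro pair_sigma_finite.intro prob_space_imp_sigma_finite
        measure_pmf.prob_space_axioms U.prob_space_axioms)
  obtain L :: nat where L: "t n < real L" using reals_Archimedean2 by blast
  have tL: "t k < real L" if "k \<le> n" for k using monoD[OF mono that] L by linarith
  define c where "c m k u = (of_bool (t k < real m + \<bar>u\<bar> \<and> real m + \<bar>u\<bar> \<le> t (Suc k)) :: nat)" for m k and u :: real
  define g where "g m u = (\<Prod>k<n. z k ^ c m k u)" for m u
  have [measurable]: "g m \<in> borel_measurable borel" for m
  proof -
    have "(\<lambda>u. z k ^ c m k u) \<in> borel_measurable borel" for k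
    proof -
      have "(\<lambda>u. z k ^ c m k u) = (\<lambda>u. if t k < real m + \<bar>u\<bar> \<and> real m + \<bar>u\<bar> \<le> t (Suc k) then z k else 1)"
        by (auto simp: c_def)
      thus ?thesis by simp
    qed
    thus ?thesis unfolding g_def[abs_def] by measurable
  qed
  have g1: "norm (g m u) \<le> 1" for m u
    unfolding g_def prod_norm[symmetric] norm_power
    by (intro prod_le_1) (auto intro: power_le_one z)
  have diff: "points_until (t (Suc k)) \<omega> - points_until (t k) \<omega> = (\<Sum>m<L. \<Sum>j<fst (\<omega> m). c m k (snd (\<omega> m) j))"
    if k: "k < n" for k \<omega>
  proof -
    have "points_until (t (Suc k)) \<omega> = points_until (t k) \<omega> + (\<Sum>m<L. \<Sum>j<fst (\<omega> m). c m k (snd (\<omega> m) j))"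
      using monoD[OF mono, of k "Suc k"]
      unfolding points_until_eq[OF tL[OF less_imp_le[OF k]]] points_until_eq[OF tL[OF Suc_leI[OF k]]] sum.distrib[symmetric]
      by (intro sum.cong refl) (auto simp: c_def)
    thus ?thesis by simp
  qed
  have disj: "c m j u = 0" if "c m k u = 1" "j \<noteq> k" for m j k u
  proof -
    have "t (Suc j) \<le> t k" if "j < k" using that by (intro monoD[OF mono]) auto
    moreover have "t (Suc k) \<le> t j" if "k < j" using that by (intro monoD[OF mono]) auto
    ultimately show ?thesis using that by (auto simp: c_def neq_iff split: if_splits)
  qed
  have g_sum: "g m u = 1 + (\<Sum>k<n. (z k - 1) * of_nat (c m k u))" for m u
  proof (cases "\<exists>k<n. c m k u = 1")
    case True
    then obtain k where k: "k < n" "c m k u = 1" by blast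
    have "g m u = z k ^ c m k u * (\<Prod>j\<in>{..<n} - {k}. z j ^ c m j u)"
      unfolding g_def using k by (subst prod.remove[of _ k]) auto
    also have "(\<Prod>j\<in>{..<n} - {k}. z j ^ c m j u) = 1"
      by (intro prod.neutral) (use disj[OF k(2)] in auto)
    finally have "g m u = z k" using k by simp
    moreover have "(\<Sum>k<n. (z k - 1) * of_nat (c m k u)) = (z k - 1) * of_nat (c m k u)"
      using k disj[OF k(2)] by (subst sum.remove[of _ k]) (auto intro!: sum.neutral)
    ultimately show ?thesis using k by simp
  next
    case False
    hence "c m k u = 0" if "k < n" for k using that by (auto simp: c_def split: if_splits)
    thus ?thesis by (simp add: g_def)
  qed
  define clamp where "clamp x = max 0 (min 1 x)" for x :: real
  have int_clamp: "(LINT u|uniform01. of_bool (real m + \<bar>u\<bar> \<le> x)) = clamp (x - real m)" for m x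
  proof -
    have "(LINT u|uniform01. of_bool (real m + \<bar>u\<bar> \<le> x) :: real)
       = (LINT u|lborel. indicator {0..1} u *\<^sub>R of_bool (real m + \<bar>u\<bar> \<le> x))"
      unfolding uniform01_def by (rule integral_density) auto
    also have "\<dots> = (LINT u|lborel. indicator {0..min 1 (x - real m)} u)"
      by (rule Bochner_Integration.integral_cong) (auto simp: indicator_def)
    finally show ?thesis by (simp add: clamp_def max_def)
  qed
  have int_c: "(CLINT u|uniform01. of_nat (c m k u)) = complex_of_real (clamp (t (Suc k) - real m) - clamp (t k - real m))" for m k
  proof -
    have int: "integrable uniform01 (\<lambda>u. of_bool (real m + \<bar>u\<bar> \<le> x) :: real)" for x
      by (rule U1.integrable_const_bound[of _ 1]) auto
    have "of_nat (c m k u) = complex_of_real (of_bool (real m + \<bar>u\<bar> \<le> t (Suc k)) - of_bool (real m + \<bar>u\<bar> \<le> t k))" for u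
      using monoD[OF mono, of k "Suc k"] by (auto simp: c_def)
    hence "(CLINT u|uniform01. of_nat (c m k u)) = complex_of_real (LINT u|uniform01. of_bool (real m + \<bar>u\<bar> \<le> t (Suc k)) - of_bool (real m + \<bar>u\<bar> \<le> t k))"
      by (simp only: integral_complex_of_real)
    thus ?thesis by (simp only: Bochner_Integration.integral_diff[OF int int] int_clamp)
  qed
  have int_c': "integrable uniform01 (\<lambda>u. of_nat (c m k u) :: complex)" for m k
  proof (rule U1.integrable_const_bound[of _ 1])
    show "(\<lambda>u. of_nat (c m k u) :: complex) \<in> borel_measurable uniform01"
      unfolding c_def of_nat_of_bool by measurable
  qed (auto simp: c_def)
  have G: "(CLINT u|uniform01. g m u) - 1
      = (\<Sum>k<n. (z k - 1) * complex_of_real (clamp (t (Suc k) - real m) - clamp (t k - real m)))" for m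
    unfolding g_sum using int_c' by (simp add: int_c U1.prob_space[unfolded U1.space_eq_univ] del: of_real_diff)
  have window: "(CLINT p|measure_pmf (poisson_pmf q) \<Otimes>\<^sub>M ?U. \<Prod>j<fst p. g m (snd p j))
      = exp (complex_of_real q * ((CLINT u|uniform01. g m u) - 1))" for m
  proof -
    have [measurable]: "(\<lambda>p. \<Prod>j<fst p. g m (snd p j)) \<in> borel_measurable (measure_pmf (poisson_pmf q) \<Otimes>\<^sub>M ?U)"
    proof (rule measurable_compose_countable[of "\<lambda>n p. \<Prod>j<n. g m (snd p j)" _ _ fst])
      have "(\<lambda>v. g m (v j)) \<in> borel_measurable ?U" for j
        by (rule measurable_PiM_component) simp
      thus "(\<lambda>p. \<Prod>j<i. g m (snd p j)) \<in> borel_measurable (measure_pmf (poisson_pmf q) \<Otimes>\<^sub>M ?U)" for i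
        by (intro borel_measurable_prod measurable_compose[OF measurable_snd])
    qed simp
    have "integrable (measure_pmf (poisson_pmf q) \<Otimes>\<^sub>M ?U) (\<lambda>p. \<Prod>j<fst p. g m (snd p j))"
      by (rule QU.integrable_const_bound[of _ 1]) (auto simp: prod_norm[symmetric] intro!: prod_le_1 g1)
    from QU.integral_fst'[OF this]
    have "(CLINT p|measure_pmf (poisson_pmf q) \<Otimes>\<^sub>M ?U. \<Prod>j<fst p. g m (snd p j))
       = (CLINT k|measure_pmf (poisson_pmf q). CLINT v|?U. \<Prod>j<k. g m (v j))" by simp
    also have "(\<lambda>k. CLINT v|?U. \<Prod>j<k. g m (v j)) = (\<lambda>k. (CLINT u|uniform01. g m u) ^ k)"
      by (subst integral_PiM_prod) (auto simp: g1 U1.prob_space_axioms)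
    finally show ?thesis using poisson_pgf[OF q] by simp
  qed
  have "(CLINT \<omega>|poisson_windows q. \<Prod>k<n. z k ^ (points_until (t (Suc k)) \<omega> - points_until (t k) \<omega>))
      = (CLINT \<omega>|poisson_windows q. \<Prod>m<L. \<Prod>j<fst (\<omega> m). g m (snd (\<omega> m) j))"
  proof (rule Bochner_Integration.integral_cong[OF refl])
    fix \<omega>
    have "(\<Prod>k<n. z k ^ (points_until (t (Suc k)) \<omega> - points_until (t k) \<omega>))
        = (\<Prod>k<n. \<Prod>m<L. \<Prod>j<fst (\<omega> m). z k ^ c m k (snd (\<omega> m) j))"
      by (intro prod.cong refl) (simp add: diff power_sum)
    also have "\<dots> = (\<Prod>m<L. \<Prod>k<n. \<Prod>j<fst (\<omega> m). z k ^ c m k (snd (\<omega> m) j))"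
      by (rule prod.swap)
    also have "\<dots> = (\<Prod>m<L. \<Prod>j<fst (\<omega> m). g m (snd (\<omega> m) j))"
      unfolding g_def by (intro prod.cong refl prod.swap)
    finally show "(\<Prod>k<n. z k ^ (points_until (t (Suc k)) \<omega> - points_until (t k) \<omega>))
        = (\<Prod>m<L. \<Prod>j<fst (\<omega> m). g m (snd (\<omega> m) j))" .
  qed
  also have "\<dots> = (\<Prod>m<L. CLINT p|measure_pmf (poisson_pmf q) \<Otimes>\<^sub>M ?U. \<Prod>j<fst p. g m (snd p j))"
    unfolding poisson_windows_def
  proof (rule integral_PiM_prod)
    show "(\<lambda>p. \<Prod>j<fst p. g m (snd p j)) \<in> borel_measurable (measure_pmf (poisson_pmf q) \<Otimes>\<^sub>M ?U)" for m
    proof (rule measurable_compose_countable[of "\<lambda>n p. \<Prod>j<n. g m (snd p j)" _ _ fst])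
      have "(\<lambda>v. g m (v j)) \<in> borel_measurable ?U" for j
        by (rule measurable_PiM_component) simp
      thus "(\<lambda>p. \<Prod>j<i. g m (snd p j)) \<in> borel_measurable (measure_pmf (poisson_pmf q) \<Otimes>\<^sub>M ?U)" for i
        by (intro borel_measurable_prod measurable_compose[OF measurable_snd])
    qed simp
    show "prob_space (measure_pmf (poisson_pmf q) \<Otimes>\<^sub>M ?U)" by (rule QU.prob_space_axioms)
  qed (auto simp: prod_norm[symmetric] intro!: prod_le_1 g1)
  also have "\<dots> = (\<Prod>m<L. exp (complex_of_real q * (\<Sum>k<n. (z k - 1) * complex_of_real (clamp (t (Suc k) - real m) - clamp (t k - real m)))))"
    unfolding window G ..
  also have "\<dots> = exp (\<Sum>m<L. complex_of_real q * (\<Sum>k<n. (z k - 1) * complex_of_real (clamp (t (Suc k) - real m) - clamp (t k - real m))))"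
    by (rule exp_sum[symmetric]) simp
  also have "(\<Sum>m<L. complex_of_real q * (\<Sum>k<n. (z k - 1) * complex_of_real (clamp (t (Suc k) - real m) - clamp (t k - real m))))
     = (\<Sum>k<n. complex_of_real q * (z k - 1) * complex_of_real (\<Sum>m<L. clamp (t (Suc k) - real m) - clamp (t k - real m)))"
    unfolding sum_distrib_left of_real_sum by (subst sum.swap) (simp add: mult_ac)
  also have "\<dots> = (\<Sum>k<n. complex_of_real (t (Suc k) - t k) * (complex_of_real q * (z k - 1)))"
  proof (rule sum.cong[OF refl])
    fix k assume k: "k \<in> {..<n}"
    have clamp_sum: "(\<Sum>m<l. clamp (x - real m)) = max 0 (min (real l) x)" for l x
    proof (induction l)
      case (Suc l)
      have "(\<Sum>m<Suc l. clamp (x - real m)) = max 0 (min (real l) x) + clamp (x - real l)" using Suc by simp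
      also have "\<dots> = max 0 (min (real (Suc l)) x)" by (auto simp: clamp_def max_def min_def)
      finally show ?case .
    qed (simp add: max_def min_def)
    have "(\<Sum>m<L. clamp (t j - real m)) = t j" if "j \<le> n" for j
      unfolding clamp_sum using tL[OF that] mono_nonneg[OF t0 mono, of j] by simp
    hence "(\<Sum>m<L. clamp (t (Suc k) - real m) - clamp (t k - real m)) = t (Suc k) - t k"
      using k by (simp add: sum_subtractf)
    thus "complex_of_real q * (z k - 1) * complex_of_real (\<Sum>m<L. clamp (t (Suc k) - real m) - clamp (t k - real m))
       = complex_of_real (t (Suc k) - t k) * (complex_of_real q * (z k - 1))"
      by (simp only: mult_ac)
  qed
  also have "exp \<dots> = (\<Prod>k<n. exp (complex_of_real (t (Suc k) - t k) * (complex_of_real q * (z k - 1))))"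
    by (rule exp_sum) simp
  finally show ?thesis .
qed

lemma increments_exponent_points_until:
  assumes q: "0 < q"
  shows "increments_exponent (poisson_windows q) (\<lambda>t \<omega>. real (points_until t \<omega>)) (\<lambda>\<theta>. complex_of_real q * (iexp \<theta> - 1))"
  unfolding increments_exponent_def
proof (intro allI impI)
  fix t :: "nat \<Rightarrow> real" and \<theta> n assume t: "0 \<le> t 0 \<and> mono t"
  have "(CLINT \<omega>|poisson_windows q. \<Prod>k<n. iexp (\<theta> k * (real (points_until (t (Suc k)) \<omega>) - real (points_until (t k) \<omega>))))
    = (CLINT \<omega>|poisson_windows q. \<Prod>k<n. iexp (\<theta> k) ^ (points_until (t (Suc k)) \<omega> - points_until (t k) \<omega>))"
  proof (intro Bochner_Integration.integral_cong prod.cong refl)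
    fix \<omega> k
    have "points_until (t k) \<omega> \<le> points_until (t (Suc k)) \<omega>"
      using t by (intro points_until_mono) (simp add: monoD)
    thus "iexp (\<theta> k * (real (points_until (t (Suc k)) \<omega>) - real (points_until (t k) \<omega>)))
        = iexp (\<theta> k) ^ (points_until (t (Suc k)) \<omega> - points_until (t k) \<omega>)"
      by (simp add: exp_of_nat_mult[symmetric] of_nat_diff mult_ac)
  qed
  thus "(CLINT \<omega>|poisson_windows q. \<Prod>k<n. iexp (\<theta> k * (real (points_until (t (Suc k)) \<omega>) - real (points_until (t k) \<omega>))))
    = (\<Prod>k<n. exp (complex_of_real (t (Suc k) - t k) * (complex_of_real q * (iexp (\<theta> k) - 1))))"
    using t points_until_joint_pgf[OF q, of t "\<lambda>k. iexp (\<theta> k)" n] by simp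
qed

lemma poisson_process_points_until:
  assumes q: "0 < q" and M: "prob_space M"
    and S: "S \<in> measurable M (poisson_windows q)" "distr M (poisson_windows q) S = poisson_windows q"
  shows "poisson_process M q (\<lambda>t \<omega>. points_until t (S \<omega>))"
proof -
  interpret prob_space M by fact
  have meas [measurable]: "(\<lambda>\<omega>. points_until t (S \<omega>)) \<in> measurable M (count_space UNIV)" for t
    by (rule measurable_compose[OF S(1) points_until_measurable])
  have incr: "increments_exponent M (\<lambda>t \<omega>. real (points_until t (S \<omega>))) (\<lambda>\<theta>. complex_of_real q * (iexp \<theta> - 1))"
    by (rule increments_exponent_pullback[OF S _ increments_exponent_points_until[OF q]]) measurable
  have "AE \<omega> in M. points_until 0 (S \<omega>) = 0"
    by (intro AE_distrD[OF S(1)]) (simp only: S(2) points_until_0)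
  hence 0: "AE \<omega> in M. real (points_until 0 (S \<omega>)) = 0" by simp
  have levy: "levy_process M (\<lambda>t \<omega>. real (points_until t (S \<omega>)))"
    and char: "has_char_exponent M (\<lambda>t \<omega>. real (points_until t (S \<omega>))) (\<lambda>\<theta>. complex_of_real q * (iexp \<theta> - 1))"
    by (rule levy_processI[OF M _ 0 _ incr]; simp add: cadlag_points_until)+
  have "distr M (count_space UNIV) (\<lambda>\<omega>. points_until t (S \<omega>)) = measure_pmf (poisson_pmf (q * t))"
    if t: "0 < t" for t
  proof -
    have qt: "0 < q * t" using q t by simp
    have eq: "distr M borel (\<lambda>\<omega>. real (points_until t (S \<omega>))) = distr (measure_pmf (poisson_pmf (q * t))) borel real"
    proof (rule Levy_uniqueness)
      show "char (distr M borel (\<lambda>\<omega>. real (points_until t (S \<omega>)))) = char (distr (measure_pmf (poisson_pmf (q * t))) borel real)"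
      proof
        fix \<theta>
        have "char (distr (measure_pmf (poisson_pmf (q * t))) borel real) \<theta>
            = (CLINT k|measure_pmf (poisson_pmf (q * t)). iexp (\<theta> * real k))"
          by (rule prob_space.char_distr[OF measure_pmf.prob_space_axioms]) simp
        also have "\<dots> = (CLINT k|measure_pmf (poisson_pmf (q * t)). iexp \<theta> ^ k)"
          by (simp add: exp_of_nat_mult[symmetric] mult_ac)
        also have "\<dots> = exp (complex_of_real t * (complex_of_real q * (iexp \<theta> - 1)))"
          using poisson_pgf[OF qt] by (simp add: mult_ac)
        finally show "char (distr M borel (\<lambda>\<omega>. real (points_until t (S \<omega>)))) \<theta>
            = char (distr (measure_pmf (poisson_pmf (q * t))) borel real) \<theta>"
          using char t by (simp add: has_char_exponent_def)
      qed
    qed (auto intro: prob_space.real_distribution_distr[OF measure_pmf.prob_space_axioms])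
    show ?thesis
    proof (rule measure_eqI)
      fix A :: "nat set" assume "A \<in> sets (distr M (count_space UNIV) (\<lambda>\<omega>. points_until t (S \<omega>)))"
      have [measurable]: "real ` A \<in> sets borel" by (rule sets.countable) auto
      have "emeasure (distr M (count_space UNIV) (\<lambda>\<omega>. points_until t (S \<omega>))) A
          = emeasure (distr M borel (\<lambda>\<omega>. real (points_until t (S \<omega>)))) (real ` A)"
        by (subst (1 2) emeasure_distr) (auto intro!: arg_cong[where f="emeasure M"])
      also have "\<dots> = emeasure (measure_pmf (poisson_pmf (q * t))) A"
        unfolding eq by (subst emeasure_distr) (auto intro!: arg_cong[where f="emeasure _"])
      finally show "emeasure (distr M (count_space UNIV) (\<lambda>\<omega>. points_until t (S \<omega>))) A
          = emeasure (measure_pmf (poisson_pmf (q * t))) A" .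
    qed simp
  qed
  thus ?thesis unfolding poisson_process_def using q levy by simp
qed

text \<open>Sums of an independent sequence over consecutive blocks of indices.\<close>

lemma integral_PiM_blocks:
  fixes a :: "nat \<Rightarrow> nat" and G :: "nat \<Rightarrow> real \<Rightarrow> complex"
  assumes "prob_space \<mu>" "mono a" and G: "\<And>k. G k \<in> borel_measurable \<mu>" "\<And>k y. norm (G k y) \<le> 1"
  shows "(CLINT \<eta>|PiM UNIV (\<lambda>_. \<mu>). \<Prod>k<n. \<Prod>i\<in>{a k..<a (Suc k)}. G k (\<eta> i))
       = (\<Prod>k<n. (CLINT y|\<mu>. G k y) ^ (a (Suc k) - a k))"
proof -
  interpret prob_space \<mu> by fact
  have "\<exists>h. (\<forall>i. h i \<in> borel_measurable \<mu>) \<and> (\<forall>i y. norm (h i y) \<le> 1) \<and>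
      (\<forall>\<eta>. (\<Prod>k<n. \<Prod>i\<in>{a k..<a (Suc k)}. G k (\<eta> i)) = (\<Prod>i<a n. h i (\<eta> i))) \<and>
      (\<Prod>k<n. (CLINT y|\<mu>. G k y) ^ (a (Suc k) - a k)) = (\<Prod>i<a n. CLINT y|\<mu>. h i y)"
  proof (induction n)
    case 0
    show ?case by (rule exI[of _ "\<lambda>_ _. 1"]) (simp add: prob_space)
  next
    case (Suc n)
    then obtain h where h: "\<And>i. h i \<in> borel_measurable \<mu>" "\<And>i y. norm (h i y) \<le> 1"
      "\<And>\<eta>. (\<Prod>k<n. \<Prod>i\<in>{a k..<a (Suc k)}. G k (\<eta> i)) = (\<Prod>i<a n. h i (\<eta> i))"
      "(\<Prod>k<n. (CLINT y|\<mu>. G k y) ^ (a (Suc k) - a k)) = (\<Prod>i<a n. CLINT y|\<mu>. h i y)" by blast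
    define h' where "h' i = (if i < a n then h i else G n)" for i
    have split: "(\<Prod>i<a (Suc n). F i) = (\<Prod>i<a n. F i) * (\<Prod>i\<in>{a n..<a (Suc n)}. F i)" for F :: "nat \<Rightarrow> complex"
      using prod.atLeastLessThan_concat[of 0 "a n" "a (Suc n)" F] monoD[OF assms(2), of n "Suc n"]
      by (simp add: lessThan_atLeast0)
    show ?case
    proof (intro exI[of _ h'] conjI allI)
      show "h' i \<in> borel_measurable \<mu>" for i using h G by (simp add: h'_def)
      show "norm (h' i y) \<le> 1" for i y using h G by (simp add: h'_def)
      show "(\<Prod>k<Suc n. \<Prod>i\<in>{a k..<a (Suc k)}. G k (\<eta> i)) = (\<Prod>i<a (Suc n). h' i (\<eta> i))" for \<eta>
        unfolding split using h(3) by (simp add: h'_def)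
      show "(\<Prod>k<Suc n. (CLINT y|\<mu>. G k y) ^ (a (Suc k) - a k)) = (\<Prod>i<a (Suc n). CLINT y|\<mu>. h' i y)"
        unfolding split using h(4) by (simp add: h'_def)
    qed
  qed
  then obtain h where h: "\<And>i. h i \<in> borel_measurable \<mu>" "\<And>i y. norm (h i y) \<le> 1"
    "\<And>\<eta>. (\<Prod>k<n. \<Prod>i\<in>{a k..<a (Suc k)}. G k (\<eta> i)) = (\<Prod>i<a n. h i (\<eta> i))"
    "(\<Prod>k<n. (CLINT y|\<mu>. G k y) ^ (a (Suc k) - a k)) = (\<Prod>i<a n. CLINT y|\<mu>. h i y)" by blast
  show ?thesis unfolding h(3,4) by (rule integral_PiM_prod) (use h assms in auto)
qed

text \<open>The sample space and the paths of a compound Poisson process with jump rate \<open>q\<close> and jump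
  law \<open>\<mu>\<close>: a Poisson process and an independent sequence of jumps.\<close>

definition compound_space :: "real \<Rightarrow> real measure \<Rightarrow> ((nat \<Rightarrow> nat \<times> (nat \<Rightarrow> real)) \<times> (nat \<Rightarrow> real)) measure" where
  "compound_space q \<mu> = poisson_windows q \<Otimes>\<^sub>M PiM UNIV (\<lambda>_. \<mu>)"

definition compound_sum :: "real \<Rightarrow> (nat \<Rightarrow> nat \<times> (nat \<Rightarrow> real)) \<times> (nat \<Rightarrow> real) \<Rightarrow> real" where
  "compound_sum t p = (\<Sum>k<points_until t (fst p). snd p k)"

lemma compound_sum_measurable:
  assumes "real_distribution \<mu>"
  shows "compound_sum t \<in> borel_measurable (compound_space q \<mu>)"
proof -
  interpret real_distribution \<mu> by fact
  have *: "(\<lambda>p. snd p k) \<in> borel_measurable (compound_space q \<mu>)" for k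
    unfolding compound_space_def by (rule measurable_compose[OF measurable_snd]) (rule measurable_PiM_component, simp)
  have N: "(\<lambda>p. points_until t (fst p)) \<in> measurable (compound_space q \<mu>) (count_space UNIV)"
    unfolding compound_space_def by (rule measurable_compose[OF measurable_fst points_until_measurable])
  show ?thesis
    unfolding compound_sum_def[abs_def]
    by (rule measurable_compose_countable[OF borel_measurable_sum N]) (rule *)
qed

lemma prob_space_compound_space:
  assumes "real_distribution \<mu>"
  shows "pair_prob_space (poisson_windows q) (PiM (UNIV :: nat set) (\<lambda>_. \<mu>))" "prob_space (compound_space q \<mu>)"
proof -
  have "prob_space \<mu>" using assms by (simp add: real_distribution_def)
  hence B: "prob_space (PiM (UNIV :: nat set) (\<lambda>_. \<mu>))" by (intro prob_space_PiM) auto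
  thus 1: "pair_prob_space (poisson_windows q) (PiM (UNIV :: nat set) (\<lambda>_. \<mu>))"
    by (intro pair_prob_space.intro pair_sigma_finite.intro prob_space_imp_sigma_finite prob_space_windows)
  interpret pair_prob_space "poisson_windows q" "PiM (UNIV :: nat set) (\<lambda>_. \<mu>)" by (rule 1)
  show "prob_space (compound_space q \<mu>)" unfolding compound_space_def by (rule prob_space_axioms)
qed

text \<open>Given the points, the jumps fall into consecutive blocks, one for each time interval.\<close>

lemma increments_exponent_compound_sum:
  assumes q: "0 < q" and \<mu>: "real_distribution \<mu>"
  shows "increments_exponent (compound_space q \<mu>) compound_sum (\<lambda>\<theta>. complex_of_real q * (char \<mu> \<theta> - 1))"
  unfolding increments_exponent_def
proof (intro allI impI)
  fix t :: "nat \<Rightarrow> real" and \<theta> n assume t: "0 \<le> t 0 \<and> mono t"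
  let ?B = "PiM (UNIV :: nat set) (\<lambda>_. \<mu>)"
  interpret real_distribution \<mu> by fact
  interpret P: pair_prob_space "poisson_windows q" ?B by (rule prob_space_compound_space) fact
  have X [measurable]: "compound_sum u \<in> borel_measurable (poisson_windows q \<Otimes>\<^sub>M ?B)" for u
    using compound_sum_measurable[OF \<mu>] by (simp add: compound_space_def)
  define F where "F p = (\<Prod>k<n. iexp (\<theta> k * (compound_sum (t (Suc k)) p - compound_sum (t k) p)))" for p
  have "integrable (poisson_windows q \<Otimes>\<^sub>M ?B) F"
    unfolding F_def by (rule P.integrable_const_bound[of _ 1]) (auto simp: prod_norm[symmetric])
  from P.integral_fst'[OF this]
  have "(CLINT p|compound_space q \<mu>. F p) = (CLINT \<omega>|poisson_windows q. CLINT \<eta>|?B. F (\<omega>, \<eta>))"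
    by (simp add: compound_space_def)
  also have "(\<lambda>\<omega>. CLINT \<eta>|?B. F (\<omega>, \<eta>))
     = (\<lambda>\<omega>. \<Prod>k<n. char \<mu> (\<theta> k) ^ (points_until (t (Suc k)) \<omega> - points_until (t k) \<omega>))"
  proof
    fix \<omega>
    define a where "a k = points_until (t k) \<omega>" for k
    have a: "mono a" unfolding a_def mono_def using t by (auto intro!: points_until_mono simp: monoD)
    have "F (\<omega>, \<eta>) = (\<Prod>k<n. \<Prod>i\<in>{a k..<a (Suc k)}. iexp (\<theta> k * \<eta> i))" for \<eta>
      unfolding F_def
    proof (intro prod.cong refl)
      fix k
      have "compound_sum (t (Suc k)) (\<omega>, \<eta>) - compound_sum (t k) (\<omega>, \<eta>) = (\<Sum>i\<in>{a k..<a (Suc k)}. \<eta> i)"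
        using sum.atLeastLessThan_concat[of 0 "a k" "a (Suc k)" \<eta>] monoD[OF a, of k "Suc k"]
        by (simp add: compound_sum_def a_def lessThan_atLeast0)
      thus "iexp (\<theta> k * (compound_sum (t (Suc k)) (\<omega>, \<eta>) - compound_sum (t k) (\<omega>, \<eta>)))
          = (\<Prod>i\<in>{a k..<a (Suc k)}. iexp (\<theta> k * \<eta> i))"
        by (simp add: exp_sum[symmetric] sum_distrib_left)
    qed
    hence "(CLINT \<eta>|?B. F (\<omega>, \<eta>)) = (\<Prod>k<n. (CLINT y|\<mu>. iexp (\<theta> k * y)) ^ (a (Suc k) - a k))"
      using integral_PiM_blocks[OF prob_space_axioms a, of "\<lambda>k y. iexp (\<theta> k * y)" n] by simp
    thus "(CLINT \<eta>|?B. F (\<omega>, \<eta>)) = (\<Prod>k<n. char \<mu> (\<theta> k) ^ (points_until (t (Suc k)) \<omega> - points_until (t k) \<omega>))"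
      by (simp add: char_def a_def)
  qed
  also have "(CLINT \<omega>|poisson_windows q. (\<Prod>k<n. char \<mu> (\<theta> k) ^ (points_until (t (Suc k)) \<omega> - points_until (t k) \<omega>)))
     = (\<Prod>k<n. exp (complex_of_real (t (Suc k) - t k) * (complex_of_real q * (char \<mu> (\<theta> k) - 1))))"
    by (rule points_until_joint_pgf) (use q t cmod_char_le_1 in auto)
  finally show "(CLINT \<omega>|compound_space q \<mu>. \<Prod>k<n. iexp (\<theta> k * (compound_sum (t (Suc k)) \<omega> - compound_sum (t k) \<omega>)))
     = (\<Prod>k<n. exp (complex_of_real (t (Suc k) - t k) * (complex_of_real q * (char \<mu> (\<theta> k) - 1))))"
    unfolding F_def .
qed

lemma cadlag_compound_sum: "cadlag (\<lambda>t. compound_sum t p)"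
  unfolding compound_sum_def by (rule cadlag_points_until)

lemma compound_sum_0:
  assumes "real_distribution \<mu>"
  shows "AE p in compound_space q \<mu>. compound_sum 0 p = 0"
proof -
  interpret P: pair_prob_space "poisson_windows q" "PiM (UNIV :: nat set) (\<lambda>_. \<mu>)"
    by (rule prob_space_compound_space) fact
  have "AE p in compound_space q \<mu>. points_until 0 (fst p) = 0"
    unfolding compound_space_def
    by (intro AE_distrD[OF measurable_fst]) (simp only: P.M2.distr_pair_fst points_until_0)
  thus ?thesis by eventually_elim (simp add: compound_sum_def)
qed

lemma sequence_coded_compound_space:
  assumes "real_distribution \<mu>"
  shows "sequence_coded (compound_space q \<mu>)"
proof -
  have U: "sequence_coded uniform01"
    by (rule sequence_coded_image[OF real_distribution_uniform01, of "\<lambda>x. x"]) (auto intro: distr_id2)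
  have B: "sequence_coded \<mu>"
  proof (rule sequence_coded_image[OF assms])
    show "(\<lambda>x. x) \<in> measurable borel \<mu>"
      using real_distribution.events_eq_borel[OF assms] by (simp cong: measurable_cong_sets)
    show "distr \<mu> \<mu> (\<lambda>x. x) = \<mu>" by (rule distr_id2) simp
  qed
  have "sequence_coded (measure_pmf (poisson_pmf q))"
  proof (rule sequence_coded_image)
    show "real_distribution (distr (measure_pmf (poisson_pmf q)) borel real)"
      by (rule prob_space.real_distribution_distr[OF measure_pmf.prob_space_axioms]) simp
    have "(\<lambda>x. nat \<lfloor>x\<rfloor>) \<in> measurable (borel :: real measure) (count_space UNIV)"
      by (rule measurable_compose[OF measurable_real_floor]) simp
    thus "(\<lambda>x::real. nat \<lfloor>x\<rfloor>) \<in> measurable borel (measure_pmf (poisson_pmf q))" by simp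
    show "distr (distr (measure_pmf (poisson_pmf q)) borel real) (measure_pmf (poisson_pmf q)) (\<lambda>x::real. nat \<lfloor>x\<rfloor>) = measure_pmf (poisson_pmf q)"
      by (subst distr_distr) (auto simp: comp_def intro: distr_id2)
  qed
  thus ?thesis unfolding compound_space_def poisson_windows_def
    by (intro sequence_coded_pair sequence_coded_PiM U B)
qed

text \<open>The Poisson process and the jumps live on the two factors of the sample space, so they are
  independent.\<close>

lemma compound_poisson_exists:
  assumes q: "0 < q" and \<mu>: "real_distribution \<mu>"
  obtains M :: "(nat \<Rightarrow> real) measure" and X where
    "compound_poisson_process M X" "levy_process M X"
    "has_char_exponent M X (\<lambda>\<theta>. complex_of_real q * (char \<mu> \<theta> - 1))"
proof -
  let ?W = "poisson_windows q" and ?B = "PiM (UNIV :: nat set) (\<lambda>_. \<mu>)"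
  let ?R = "PiM (UNIV :: nat set) (\<lambda>_. borel :: real measure)"
  interpret \<mu>: real_distribution \<mu> by fact
  interpret P: pair_prob_space ?W ?B by (rule prob_space_compound_space) fact
  obtain M :: "(nat \<Rightarrow> real) measure" and S where MS: "prob_space M"
    "S \<in> measurable M (compound_space q \<mu>)" "distr M (compound_space q \<mu>) S = compound_space q \<mu>"
    using sequence_coded_compound_space[OF \<mu>, of q] unfolding sequence_coded_def by blast
  interpret M: prob_space M by fact
  have S': "S \<in> measurable M (?W \<Otimes>\<^sub>M ?B)" using MS(2) by (simp add: compound_space_def)
  define S1 where "S1 \<omega> = fst (S \<omega>)" for \<omega>
  define S2 where "S2 \<omega> = snd (S \<omega>)" for \<omega>
  have S1: "S1 \<in> measurable M ?W" and S2: "S2 \<in> measurable M ?B"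
    using S' unfolding S1_def S2_def by measurable
  have "distr M ?W S1 = distr (distr M (?W \<Otimes>\<^sub>M ?B) S) ?W fst"
    by (subst distr_distr) (use S' in \<open>auto simp: comp_def S1_def[abs_def]\<close>)
  hence d1: "distr M ?W S1 = ?W" using MS(3) P.M2.distr_pair_fst by (simp add: compound_space_def)
  have "distr M ?B S2 = distr (distr M (?W \<Otimes>\<^sub>M ?B) S) ?B snd"
    by (subst distr_distr) (use S' in \<open>auto simp: comp_def S2_def[abs_def]\<close>)
  hence d2: "distr M ?B S2 = ?B"
    using MS(3) distr_pair_snd[OF P.M1.prob_space_axioms P.M2.prob_space_axioms] by (simp add: compound_space_def)
  define N where "N t \<omega> = points_until t (S1 \<omega>)" for t \<omega>
  define J where "J k \<omega> = S2 \<omega> k" for k \<omega>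
  define X where "X t \<omega> = compound_sum t (S \<omega>)" for t \<omega>
  have poisson: "poisson_process M q N"
    unfolding N_def[abs_def] by (rule poisson_process_points_until[OF q MS(1) S1 d1])
  have "?B \<rightarrow>\<^sub>M ?R = ?R \<rightarrow>\<^sub>M ?R" by (intro measurable_cong_sets sets_PiM_cong) auto
  hence id: "(\<lambda>\<eta>. \<eta>) \<in> measurable ?B ?R" by simp
  have path: "(\<lambda>\<omega>. \<lambda>t\<in>{0..}. points_until t \<omega>) \<in> measurable ?W (\<Pi>\<^sub>M t\<in>{0::real..}. count_space UNIV)"
    by (rule measurable_restrict) (rule points_until_measurable)
  have path': "(\<lambda>\<omega>. \<lambda>t\<in>{0..}. N t \<omega>) \<in> measurable M (\<Pi>\<^sub>M t\<in>{0::real..}. count_space UNIV)"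
    unfolding N_def by (rule measurable_compose[OF S1 path])
  have Jseq: "(\<lambda>\<omega> k. J k \<omega>) \<in> measurable M ?R"
    unfolding J_def by (rule measurable_compose[OF S2 id])
  have path'': "(\<lambda>\<omega>. \<lambda>t\<in>{0..}. N t \<omega>) \<in> space M \<rightarrow> space (\<Pi>\<^sub>M t\<in>{0::real..}. count_space UNIV)"
    by (rule Pi_I) (rule measurable_space[OF path'])
  have Jseq': "(\<lambda>\<omega> k. J k \<omega>) \<in> space M \<rightarrow> space ?R"
    by (rule Pi_I) (rule measurable_space[OF Jseq])
  have "M.indep_set (sets (vimage_algebra (space M) (\<lambda>\<omega>. \<lambda>t\<in>{0..}. N t \<omega>) (\<Pi>\<^sub>M t\<in>{0..}. count_space UNIV)))
          (sets (vimage_algebra (space M) (\<lambda>\<omega> k. J k \<omega>) ?R))"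
    unfolding sets_vimage_algebra2[OF path''] sets_vimage_algebra2[OF Jseq']
  proof (rule M.indep_setI)
    fix a b assume "a \<in> {(\<lambda>\<omega>. \<lambda>t\<in>{0..}. N t \<omega>) -` A \<inter> space M |A. A \<in> sets (\<Pi>\<^sub>M t\<in>{0::real..}. count_space UNIV)}"
      and "b \<in> {(\<lambda>\<omega> k. J k \<omega>) -` A \<inter> space M |A. A \<in> sets ?R}"
    then obtain A B where A: "A \<in> sets (\<Pi>\<^sub>M t\<in>{0::real..}. count_space UNIV)" "a = (\<lambda>\<omega>. \<lambda>t\<in>{0..}. N t \<omega>) -` A \<inter> space M"
      and B: "B \<in> sets ?R" "b = (\<lambda>\<omega> k. J k \<omega>) -` B \<inter> space M" by blast
    define A' where "A' = (\<lambda>\<omega>. \<lambda>t\<in>{0..}. points_until t \<omega>) -` A \<inter> space ?W"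
    define B' where "B' = (\<lambda>\<eta>. \<eta>) -` B \<inter> space ?B"
    have AB': "A' \<in> sets ?W" "B' \<in> sets ?B"
      unfolding A'_def B'_def by (rule measurable_sets[OF path A(1)], rule measurable_sets[OF id B(1)])
    have a: "a = S1 -` A' \<inter> space M" and b: "b = S2 -` B' \<inter> space M"
      using measurable_space[OF S1] measurable_space[OF S2] unfolding A(2) B(2) A'_def B'_def N_def J_def by blast+
    have "a \<inter> b = S -` (A' \<times> B') \<inter> space M"
      unfolding a b S1_def S2_def by (auto simp: mem_Times_iff)
    hence "emeasure M (a \<inter> b) = emeasure (distr M (?W \<Otimes>\<^sub>M ?B) S) (A' \<times> B')"
      using S' AB' by (simp add: emeasure_distr)
    also have "\<dots> = emeasure ?W A' * emeasure ?B B'"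
      using MS(3) AB' by (simp add: compound_space_def P.M2.emeasure_pair_measure_Times)
    also have "emeasure ?W A' = emeasure M a"
      unfolding a by (subst d1[symmetric]) (rule emeasure_distr[OF S1 AB'(1)])
    also have "emeasure ?B B' = emeasure M b"
      unfolding b by (subst d2[symmetric]) (rule emeasure_distr[OF S2 AB'(2)])
    finally show "M.prob (a \<inter> b) = M.prob a * M.prob b"
      by (simp add: measure_def enn2real_mult)
  next
    show "{(\<lambda>\<omega>. \<lambda>t\<in>{0..}. N t \<omega>) -` A \<inter> space M |A. A \<in> sets (\<Pi>\<^sub>M t\<in>{0::real..}. count_space UNIV)} \<subseteq> sets M"
      using measurable_sets[OF path'] by blast
    show "{(\<lambda>\<omega> k. J k \<omega>) -` A \<inter> space M |A. A \<in> sets ?R} \<subseteq> sets M"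
      using measurable_sets[OF Jseq] by blast
  qed
  moreover have J_law: "distr M borel (J k) = \<mu>" for k
  proof -
    have "distr (distr M ?B S2) \<mu> (\<lambda>\<eta>. \<eta> k) = distr M \<mu> (J k)"
      by (subst distr_distr) (use S2 in \<open>auto simp: comp_def J_def[abs_def]\<close>)
    hence "distr M \<mu> (J k) = \<mu>"
      unfolding d2 distr_PiM_component[OF \<mu>.prob_space_axioms UNIV_I] by (rule sym)
    moreover have "distr M \<mu> (J k) = distr M borel (J k)" by (rule distr_cong) auto
    ultimately show ?thesis by simp
  qed
  moreover have "M.indep_vars (\<lambda>_. borel) J UNIV"
  proof -
    have "distr M ?R (\<lambda>\<omega>. \<lambda>k\<in>UNIV. J k \<omega>) = distr M ?B S2"
      by (rule distr_cong) (auto simp: J_def restrict_def intro!: sets_PiM_cong)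
    also have "\<dots> = PiM UNIV (\<lambda>k. distr M borel (J k))"
      unfolding J_law by (rule d2)
    finally show ?thesis
      using measurable_compose[OF Jseq measurable_component_singleton]
      by (subst M.indep_vars_iff_distr_eq_PiM) auto
  qed
  moreover have "X t \<omega> = (\<Sum>k<N t \<omega>. J k \<omega>)" for t \<omega>
    by (simp add: X_def N_def J_def S1_def S2_def compound_sum_def)
  ultimately have compound: "compound_poisson_process M X"
    unfolding compound_poisson_process_def using poisson by blast
  have incr: "increments_exponent M X (\<lambda>\<theta>. complex_of_real q * (char \<mu> \<theta> - 1))"
    unfolding X_def[abs_def]
    by (rule increments_exponent_pullback[OF MS(2,3) compound_sum_measurable[OF \<mu>] increments_exponent_compound_sum[OF q \<mu>]])
  have 0: "AE \<omega> in M. X 0 \<omega> = 0"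
    unfolding X_def by (intro AE_distrD[OF MS(2)]) (simp only: MS(3) compound_sum_0[OF \<mu>])
  have meas: "X t \<in> borel_measurable M" for t
    unfolding X_def[abs_def] by (rule measurable_compose[OF MS(2) compound_sum_measurable[OF \<mu>]])
  have cadlag: "AE \<omega> in M. cadlag (\<lambda>t. X t \<omega>)" unfolding X_def by (simp add: cadlag_compound_sum)
  show ?thesis using that[OF compound] levy_processI[OF MS(1) meas 0 cadlag incr] by blast
qed

section \<open>Existence of a Levy process with a given Levy measure\<close>

lemma cmod_iexp_minus_1_le: "cmod (iexp x - 1) \<le> \<bar>x\<bar>" "cmod (iexp x - 1) \<le> 2"
proof -
  show "cmod (iexp x - 1) \<le> \<bar>x\<bar>" using iexp_approx1[of x 0] by simp
  show "cmod (iexp x - 1) \<le> 2" using iexp_approx2[of x 0] by simp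
qed

lemma cmod_iexp_minus_linear_le: "cmod (iexp x - 1 - \<i> * complex_of_real x) \<le> x\<^sup>2 / 2"
  using iexp_approx1[of x 1] by (simp add: diff_diff_eq power2_eq_square)

text \<open>The integrand of the Levy--Khintchine formula.\<close>

definition levy_integrand :: "real \<Rightarrow> real \<Rightarrow> complex" where
  "levy_integrand \<theta> y = iexp (\<theta> * y) - 1 - \<i> * complex_of_real (\<theta> * y * indicator {-1<..<1} y)"

lemma levy_integrand_measurable [measurable]: "levy_integrand \<theta> \<in> borel_measurable borel"
  unfolding levy_integrand_def[abs_def] by measurable

lemma cmod_levy_integrand_le: "cmod (levy_integrand \<theta> y) \<le> (\<theta>\<^sup>2 / 2 + 2) * min 1 (y\<^sup>2)"
proof (cases "\<bar>y\<bar> < 1")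
  case True
  hence "levy_integrand \<theta> y = iexp (\<theta> * y) - 1 - \<i> * complex_of_real (\<theta> * y)"
    by (simp add: levy_integrand_def abs_less_iff)
  hence "cmod (levy_integrand \<theta> y) \<le> (\<theta> * y)\<^sup>2 / 2"
    using cmod_iexp_minus_linear_le[of "\<theta> * y"] by simp
  also have "\<dots> \<le> (\<theta>\<^sup>2 / 2 + 2) * y\<^sup>2" by (simp add: power_mult_distrib distrib_right)
  also have "y\<^sup>2 = min 1 (y\<^sup>2)" using True abs_square_le_1[of y] by simp
  finally show ?thesis .
next
  case False
  hence "levy_integrand \<theta> y = iexp (\<theta> * y) - 1" by (auto simp: levy_integrand_def indicator_def)
  hence "cmod (levy_integrand \<theta> y) \<le> 2" using cmod_iexp_minus_1_le(2)[of "\<theta> * y"] by simp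
  also have "\<dots> \<le> (\<theta>\<^sup>2 / 2 + 2) * 1" by simp
  also have "1 = min 1 (y\<^sup>2)" using False abs_square_less_1[of y] by simp
  finally show ?thesis .
qed

lemma levy_measure_integrable:
  assumes "levy_measure \<nu>"
  shows "integrable \<nu> (\<lambda>y. min 1 (y\<^sup>2))"
proof (rule integrableI_nonneg)
  have [measurable_cong]: "sets \<nu> = sets borel" using assms by (simp add: levy_measure_def)
  show "(\<lambda>y. min 1 (y\<^sup>2)) \<in> borel_measurable \<nu>" by measurable
qed (use assms in \<open>auto simp: levy_measure_def\<close>)

lemma levy_measure_integrable_integrand:
  assumes "levy_measure \<nu>"
  shows "integrable \<nu> (levy_integrand \<theta>)"
proof (rule Bochner_Integration.integrable_bound)
  have [measurable_cong]: "sets \<nu> = sets borel" using assms by (simp add: levy_measure_def)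
  show "integrable \<nu> (\<lambda>y. (\<theta>\<^sup>2 / 2 + 2) * min 1 (y\<^sup>2))"
    using levy_measure_integrable[OF assms] by simp
  show "levy_integrand \<theta> \<in> borel_measurable \<nu>" by measurable
  show "AE y in \<nu>. cmod (levy_integrand \<theta> y) \<le> norm ((\<theta>\<^sup>2 / 2 + 2) * min 1 (y\<^sup>2))"
    using cmod_levy_integrand_le[of \<theta>] by (auto intro: order_trans)
qed

text \<open>A finite piece of a measure as a jump rate and a jump law. If the piece vanishes, the jumps
  are zero.\<close>

lemma finite_part_jumps:
  fixes \<nu> :: "real measure"
  assumes sets: "sets \<nu> = sets borel" and A: "A \<in> sets borel" and fin: "emeasure \<nu> A < \<infinity>"
  obtains q \<mu> where "0 < q" "real_distribution \<mu>"
    "\<And>f :: real \<Rightarrow> complex. f \<in> borel_measurable borel \<Longrightarrow> f 0 = 0 \<Longrightarrow>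
        complex_of_real q * (CLINT y|\<mu>. f y) = (CLINT y:A|\<nu>. f y)"
proof (cases "emeasure \<nu> A = 0")
  case True
  have "AE y in \<nu>. y \<notin> A" using True sets A by (intro AE_not_in) (auto simp: null_sets_def)
  hence "(CLINT y:A|\<nu>. f y) = 0" for f :: "real \<Rightarrow> complex"
    unfolding set_lebesgue_integral_def by (intro integral_eq_zero_AE) (auto elim: eventually_mono)
  moreover have "real_distribution (return borel 0)"
    by (auto simp: real_distribution_def real_distribution_axioms_def intro: prob_space_return)
  ultimately show ?thesis using that[of 1 "return borel 0"] by (auto simp: integral_return)
next
  case False
  define q where "q = measure \<nu> A"
  have q: "0 < q" "emeasure \<nu> A = ennreal q"
    using False fin by (auto simp: q_def measure_def enn2real_positive_iff zero_less_iff_neq_zero less_top)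
  define \<mu> where "\<mu> = density \<nu> (\<lambda>y. ennreal (indicator A y / q))"
  note [measurable_cong] = sets
  note [measurable] = A
  have "emeasure \<mu> (space \<mu>) = (\<integral>\<^sup>+ y. ennreal (1 / q) * indicator A y \<partial>\<nu>)"
    unfolding \<mu>_def by (auto simp: emeasure_density indicator_def intro!: nn_integral_cong)
  also have "\<dots> = ennreal (1 / q) * emeasure \<nu> A" using A sets by (intro nn_integral_cmult_indicator) simp
  also have "\<dots> = 1" using q by (simp add: ennreal_mult[symmetric])
  finally have "prob_space \<mu>" by (rule prob_spaceI)
  moreover have "sets \<mu> = sets borel" by (simp add: \<mu>_def sets)
  ultimately have "real_distribution \<mu>" by (simp add: real_distribution_def real_distribution_axioms_def)
  moreover have "complex_of_real q * (CLINT y|\<mu>. f y) = (CLINT y:A|\<nu>. f y)"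
    if [measurable]: "f \<in> borel_measurable borel" for f :: "real \<Rightarrow> complex"
  proof -
    have "(CLINT y|\<mu>. f y) = (CLINT y|\<nu>. (indicator A y / q) *\<^sub>R f y)"
      unfolding \<mu>_def using q by (intro integral_density) auto
    also have "\<dots> = (CLINT y|\<nu>. complex_of_real (1 / q) * (indicator A y *\<^sub>R f y))"
      by (rule Bochner_Integration.integral_cong) (auto simp: indicator_def scaleR_conv_of_real)
    also have "\<dots> = complex_of_real (1 / q) * (CLINT y:A|\<nu>. f y)"
      unfolding set_lebesgue_integral_def by (rule integral_mult_right_zero)
    finally show ?thesis using q by simp
  qed
  ultimately show ?thesis using that q by blast
qed

theorem finite_levy_measure_compound_poisson:
  assumes \<nu>: "levy_measure \<nu>" and fin: "finite_measure \<nu>"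
  shows "\<exists>(M :: (nat \<Rightarrow> real) measure) X. compound_poisson_process M X \<and> has_levy_measure M X \<nu>"
proof -
  interpret finite_measure \<nu> by fact
  have sets [measurable_cong]: "sets \<nu> = sets borel" using \<nu> by (simp add: levy_measure_def)
  have space: "space \<nu> = UNIV" using sets_eq_imp_space_eq[OF sets] by simp
  obtain q \<mu> where q: "0 < q" and \<mu>: "real_distribution \<mu>" and int:
    "\<And>f :: real \<Rightarrow> complex. f \<in> borel_measurable borel \<Longrightarrow> f 0 = 0 \<Longrightarrow>
        complex_of_real q * (CLINT y|\<mu>. f y) = (CLINT y:UNIV|\<nu>. f y)"
  proof -
    have "emeasure \<nu> UNIV < \<infinity>" using emeasure_finite[of UNIV] by (simp add: less_top[symmetric])
    hence "\<exists>q \<mu>. 0 < q \<and> real_distribution \<mu> \<and> (\<forall>f :: real \<Rightarrow> complex. f \<in> borel_measurable borel \<longrightarrow> f 0 = 0 \<longrightarrow>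
        complex_of_real q * (CLINT y|\<mu>. f y) = (CLINT y:UNIV|\<nu>. f y))"
      by (rule finite_part_jumps[OF sets, of UNIV, rotated 1]) (blast, simp)
    thus ?thesis using that by blast
  qed
  interpret \<mu>: real_distribution \<mu> by fact
  obtain M :: "(nat \<Rightarrow> real) measure" and X where X: "compound_poisson_process M X" "levy_process M X"
    "has_char_exponent M X (\<lambda>\<theta>. complex_of_real q * (char \<mu> \<theta> - 1))"
    using compound_poisson_exists[OF q \<mu>] .
  define b where "b = (LINT y|\<nu>. y * indicator {-1<..<1} y)"
  have int_b: "integrable \<nu> (\<lambda>y. y * indicator {-1<..<1} y)"
    by (rule integrable_const_bound[of _ 1]) (auto simp: indicator_def)
  have "complex_of_real q * (char \<mu> \<theta> - 1) = \<i> * complex_of_real (b * \<theta>) - complex_of_real (0\<^sup>2 * \<theta>\<^sup>2 / 2) +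
      (CLINT y|\<nu>. iexp (\<theta> * y) - 1 - \<i> * complex_of_real (\<theta> * y * indicator {-1<..<1} y))" for \<theta>
  proof -
    have "char \<mu> \<theta> - 1 = (CLINT y|\<mu>. iexp (\<theta> * y) - 1)"
      unfolding char_def
      by (subst Bochner_Integration.integral_diff)
         (auto simp: \<mu>.integrable_iexp \<mu>.prob_space[unfolded \<mu>.space_eq_univ] simp del: of_real_mult)
    hence "complex_of_real q * (char \<mu> \<theta> - 1) = (CLINT y|\<nu>. iexp (\<theta> * y) - 1)"
      using int[of "\<lambda>y. iexp (\<theta> * y) - 1"] by (simp add: set_lebesgue_integral_def)
    also have "\<dots> = (CLINT y|\<nu>. levy_integrand \<theta> y + (\<i> * complex_of_real \<theta>) * complex_of_real (y * indicator {-1<..<1} y))"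
      by (rule Bochner_Integration.integral_cong) (auto simp: levy_integrand_def)
    also have "\<dots> = (CLINT y|\<nu>. levy_integrand \<theta> y) + (\<i> * complex_of_real \<theta>) * complex_of_real b"
      using levy_measure_integrable_integrand[OF \<nu>] int_b unfolding b_def
      by (subst Bochner_Integration.integral_add) (auto simp del: of_real_mult)
    finally show ?thesis by (simp add: levy_integrand_def[abs_def] mult_ac)
  qed
  hence "has_levy_measure M X \<nu>"
    unfolding has_levy_measure_def using X(2,3) \<nu> by (intro conjI exI[of _ b] exI[of _ 0]) auto
  thus ?thesis using X(1) by blast
qed

lemma increments_exponent_drift:
  assumes "increments_exponent M X \<Psi>"
  shows "increments_exponent M (\<lambda>t \<omega>. X t \<omega> - c * t) (\<lambda>\<theta>. \<Psi> \<theta> - \<i> * complex_of_real (\<theta> * c))"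
  unfolding increments_exponent_def
proof (intro allI impI)
  fix t :: "nat \<Rightarrow> real" and \<theta> n assume t: "0 \<le> t 0 \<and> mono t"
  have "(CLINT \<omega>|M. \<Prod>k<n. iexp (\<theta> k * (X (t (Suc k)) \<omega> - c * t (Suc k) - (X (t k) \<omega> - c * t k))))
     = (CLINT \<omega>|M. (\<Prod>k<n. iexp (- \<theta> k * c * (t (Suc k) - t k))) * (\<Prod>k<n. iexp (\<theta> k * (X (t (Suc k)) \<omega> - X (t k) \<omega>))))"
    unfolding prod.distrib[symmetric] exp_add[symmetric]
    by (intro Bochner_Integration.integral_cong prod.cong refl arg_cong[where f=exp]) (simp add: algebra_simps)
  also have "\<dots> = (\<Prod>k<n. iexp (- \<theta> k * c * (t (Suc k) - t k))) * (\<Prod>k<n. exp (complex_of_real (t (Suc k) - t k) * \<Psi> (\<theta> k)))"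
    using t by (subst integral_mult_right_zero) (simp only: increments_exponentD[OF assms])
  also have "\<dots> = (\<Prod>k<n. exp (complex_of_real (t (Suc k) - t k) * (\<Psi> (\<theta> k) - \<i> * complex_of_real (\<theta> k * c))))"
    unfolding prod.distrib[symmetric] exp_add[symmetric]
    by (intro prod.cong refl arg_cong[where f=exp]) (simp add: algebra_simps)
  finally show "(CLINT \<omega>|M. \<Prod>k<n. iexp (\<theta> k * (X (t (Suc k)) \<omega> - c * t (Suc k) - (X (t k) \<omega> - c * t k))))
     = (\<Prod>k<n. exp (complex_of_real (t (Suc k) - t k) * (\<Psi> (\<theta> k) - \<i> * complex_of_real (\<theta> k * c))))" .
qed

lemma cadlag_minus_linear: "cadlag f \<Longrightarrow> cadlag (\<lambda>t. f t - c * t)"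
  unfolding cadlag_def
proof (intro conjI allI impI; elim conjE)
  fix t :: real assume "0 \<le> t" "\<forall>t\<ge>0. (f \<longlongrightarrow> f t) (at_right t)"
  thus "((\<lambda>t. f t - c * t) \<longlongrightarrow> f t - c * t) (at_right t)" by (intro tendsto_intros) auto
next
  fix t :: real assume "0 < t" "\<forall>t>0. \<exists>l. (f \<longlongrightarrow> l) (at_left t)"
  then obtain l where "(f \<longlongrightarrow> l) (at_left t)" by auto
  hence "((\<lambda>t. f t - c * t) \<longlongrightarrow> l - c * t) (at_left t)" by (intro tendsto_intros) auto
  thus "\<exists>l. ((\<lambda>t. f t - c * t) \<longlongrightarrow> l) (at_left t)" by blast
qed

text \<open>Uniform convergence on bounded intervals, in the form of a summable bound on all but finitely
  many terms, preserves cadlag paths.\<close>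

lemma cadlag_suminf:
  fixes f :: "nat \<Rightarrow> real \<Rightarrow> real"
  assumes cadlag: "\<And>n. cadlag (f n)" and b: "summable b"
    and bound: "\<And>K::nat. eventually (\<lambda>n. \<forall>t\<in>{0..real K}. \<bar>f n t\<bar> \<le> b n) sequentially"
  shows "cadlag (\<lambda>t. \<Sum>n. f n t)"
proof -
  have lim: "((\<lambda>t. \<Sum>n. f n t) \<longlongrightarrow> (\<Sum>n. l n)) F"
    if "\<And>n. (f n \<longlongrightarrow> l n) F" "eventually (\<lambda>t. t \<in> {0..real K}) F" "F \<noteq> bot" for l F K
  proof -
    have "eventually (\<lambda>(n, t). norm (f n t) \<le> b n) (at_top \<times>\<^sub>F F)"
      unfolding eventually_prod_filter
      by (rule exI, rule exI[of _ "\<lambda>t. t \<in> {0..real K}"], rule conjI[OF bound[of K]]) (use that in auto)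
    thus ?thesis using tannerys_theorem[where a = f and b = l, OF that(1) _ b that(3)] by blast
  qed
  show ?thesis
    unfolding cadlag_def
  proof (intro conjI allI impI)
    fix t :: real assume t: "0 \<le> t"
    obtain K :: nat where K: "t < real K" using reals_Archimedean2 by blast
    show "((\<lambda>t. \<Sum>n. f n t) \<longlongrightarrow> (\<Sum>n. f n t)) (at_right t)"
    proof (rule lim[of "\<lambda>n. f n t" _ K])
      show "eventually (\<lambda>s. s \<in> {0..real K}) (at_right t)"
        using eventually_at_right_real[OF K] by eventually_elim (use t in auto)
    qed (use cadlag t in \<open>auto simp: cadlag_def\<close>)
  next
    fix t :: real assume t: "0 < t"
    obtain K :: nat where K: "t < real K" using reals_Archimedean2 by blast
    have "\<forall>n. \<exists>l. (f n \<longlongrightarrow> l) (at_left t)" using cadlag t by (auto simp: cadlag_def)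
    then obtain l where l: "\<And>n. (f n \<longlongrightarrow> l n) (at_left t)" by metis
    have "((\<lambda>t. \<Sum>n. f n t) \<longlongrightarrow> (\<Sum>n. l n)) (at_left t)"
    proof (rule lim[of l _ K])
      show "eventually (\<lambda>s. s \<in> {0..real K}) (at_left t)"
        using eventually_at_left_real[OF t] by eventually_elim (use K in auto)
    qed (use l in auto)
    thus "\<exists>l. ((\<lambda>t. \<Sum>n. f n t) \<longlongrightarrow> l) (at_left t)" by blast
  qed
qed

text \<open>Radii for which the second moment of the smaller jumps decays geometrically.\<close>

lemma levy_measure_radii:
  assumes \<nu>: "levy_measure \<nu>"
  obtains r :: "nat \<Rightarrow> real" where "r 0 = 1" "antimono r" "\<And>n. 0 < r n" "r \<longlonglongrightarrow> 0"
    "\<And>n. (LINT y:{y. \<bar>y\<bar> < r (Suc n)}|\<nu>. min 1 (y\<^sup>2)) \<le> (1/8) ^ n"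
proof -
  have sets [measurable_cong]: "sets \<nu> = sets borel" using \<nu> by (simp add: levy_measure_def)
  have int: "integrable \<nu> (\<lambda>y. min 1 (y\<^sup>2))" by (rule levy_measure_integrable[OF \<nu>])
  define g where "g k = (LINT y:{y. \<bar>y\<bar> < 1 / (real k + 1)}|\<nu>. min 1 (y\<^sup>2))" for k :: nat
  have "g \<longlonglongrightarrow> (LINT y|\<nu>. 0)"
    unfolding g_def set_lebesgue_integral_def
  proof (rule integral_dominated_convergence[where w = "\<lambda>y. min 1 (y\<^sup>2)"])
    show "AE y in \<nu>. (\<lambda>k. indicator {y. \<bar>y\<bar> < 1 / (real k + 1)} y *\<^sub>R min 1 (y\<^sup>2)) \<longlonglongrightarrow> 0"
    proof (rule AE_I2)
      fix y :: real
      show "(\<lambda>k. indicator {y. \<bar>y\<bar> < 1 / (real k + 1)} y *\<^sub>R min 1 (y\<^sup>2)) \<longlonglongrightarrow> 0"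
      proof (cases "y = 0")
        case False
        obtain K :: nat where K: "1 / \<bar>y\<bar> < real K" using reals_Archimedean2 by blast
        have "eventually (\<lambda>k. indicator {y. \<bar>y\<bar> < 1 / (real k + 1)} y *\<^sub>R min 1 (y\<^sup>2) = 0) sequentially"
          using eventually_ge_at_top[of K]
        proof eventually_elim
          case (elim k)
          have "1 / \<bar>y\<bar> < real k + 1" using K elim by linarith
          hence "1 / (real k + 1) < \<bar>y\<bar>" using False by (simp add: field_simps)
          thus ?case by simp
        qed
        thus ?thesis by (rule tendsto_eventually)
      qed simp
    qed
  qed (use int in \<open>auto simp: indicator_def\<close>)
  hence g0: "g \<longlonglongrightarrow> 0" by simp
  have "\<exists>k. g k \<le> (1/8) ^ n" for n
  proof -
    have "eventually (\<lambda>k. g k < (1/8) ^ n) sequentially" by (rule order_tendstoD(2)[OF g0]) simp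
    thus ?thesis by (auto simp: eventually_sequentially intro: less_imp_le)
  qed
  then obtain k where k: "\<And>n. g (k n) \<le> (1/8) ^ n" by metis
  define l where "l n = n + (\<Sum>i<n. k i)" for n
  have l_mono: "mono l" unfolding l_def mono_def by (auto intro!: add_mono sum_mono2)
  have g_anti: "g j \<le> g i" if "i \<le> j" for i j
    unfolding g_def set_lebesgue_integral_def
  proof -
    have int_k: "integrable \<nu> (\<lambda>y. indicator {y. \<bar>y\<bar> < 1 / (real k + 1)} y *\<^sub>R min 1 (y\<^sup>2))" for k :: nat
      by (rule integrable_mult_indicator[OF _ int]) measurable
    have "1 / (real j + 1) \<le> 1 / (real i + 1)" using that by (simp add: frac_le)
    thus "(LINT y|\<nu>. indicator {y. \<bar>y\<bar> < 1 / (real j + 1)} y *\<^sub>R min 1 (y\<^sup>2))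
        \<le> (LINT y|\<nu>. indicator {y. \<bar>y\<bar> < 1 / (real i + 1)} y *\<^sub>R min 1 (y\<^sup>2))"
      by (intro integral_mono int_k) (auto simp: indicator_def)
  qed
  define r where "r n = 1 / (real (l n) + 1)" for n
  show ?thesis
  proof
    show "r 0 = 1" by (simp add: r_def l_def)
    show "antimono r" unfolding r_def antimono_def using l_mono by (auto intro!: frac_le simp: mono_def)
    show "0 < r n" for n by (simp add: r_def)
    show "r \<longlonglongrightarrow> 0"
    proof (rule tendsto_sandwich[of "\<lambda>_. 0" _ _ "\<lambda>n. 1 / (real n + 1)"])
      show "eventually (\<lambda>n. r n \<le> 1 / (real n + 1)) sequentially"
        by (rule always_eventually) (auto simp: r_def l_def intro!: frac_le sum_nonneg)
      show "(\<lambda>n. 1 / (real n + 1)) \<longlonglongrightarrow> 0"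
        using lim_inverse_n' LIMSEQ_inverse_real_of_nat by (simp add: inverse_eq_divide add.commute)
    qed (auto simp: r_def)
    show "(LINT y:{y. \<bar>y\<bar> < r (Suc n)}|\<nu>. min 1 (y\<^sup>2)) \<le> (1/8) ^ n" for n
      using g_anti[of "k n" "l (Suc n)"] k[of n] by (simp add: r_def g_def l_def)
  qed
qed

text \<open>The jumps are cut into annuli. Each annulus gives a compound Poisson process, compensated
  if its jumps are smaller than \<open>1\<close>. The radii make the second moments decay geometrically, so
  that by the maximal inequality the paths of these processes are almost surely summable,
  uniformly on bounded time intervals.\<close>

theorem levy_process_exists:
  assumes \<nu>: "levy_measure \<nu>"
  shows "\<exists>(M :: (nat \<Rightarrow> real) measure) X. has_levy_measure M X \<nu>"
proof -
  have sets [measurable_cong]: "sets \<nu> = sets borel" using \<nu> by (simp add: levy_measure_def)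
  have space: "space \<nu> = UNIV" using sets_eq_imp_space_eq[OF sets] by simp
  have int_min: "integrable \<nu> (\<lambda>y. min 1 (y\<^sup>2))" by (rule levy_measure_integrable[OF \<nu>])
  obtain r :: "nat \<Rightarrow> real" where r: "r 0 = 1" "antimono r" "\<And>n. 0 < r n" "r \<longlonglongrightarrow> 0"
    "\<And>n. (LINT y:{y. \<bar>y\<bar> < r (Suc n)}|\<nu>. min 1 (y\<^sup>2)) \<le> (1/8) ^ n"
    using levy_measure_radii[OF \<nu>] by blast
  have r_le: "r n \<le> 1" for n using antimonoD[OF r(2), of 0 n] r(1) by simp
  define A where "A n = (case n of 0 \<Rightarrow> {y. 1 \<le> \<bar>y\<bar>} | Suc m \<Rightarrow> {y. r (Suc m) \<le> \<bar>y\<bar> \<and> \<bar>y\<bar> < r m})" for n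
  have A_borel [measurable]: "A n \<in> sets borel" for n by (cases n) (auto simp: A_def)
  have A_ge: "r n \<le> \<bar>y\<bar>" if "y \<in> A n" for n y using that r(1) by (cases n) (auto simp: A_def)
  have A_fin: "emeasure \<nu> (A n) < \<infinity>" for n
  proof -
    have rn: "0 < min 1 ((r n)\<^sup>2)" using r(3)[of n] by simp
    have "indicator (A n) y \<le> min 1 (y\<^sup>2) / min 1 ((r n)\<^sup>2)" for y
    proof (cases "y \<in> A n")
      case True
      hence "(r n)\<^sup>2 \<le> y\<^sup>2" using A_ge[OF True] r(3)[of n] by (simp add: abs_le_square_iff[symmetric])
      hence "min 1 ((r n)\<^sup>2) \<le> min 1 (y\<^sup>2)" by (simp add: min_le_iff_disj)
      thus ?thesis using rn True by (simp add: le_divide_eq)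
    qed (use rn in auto)
    hence "integrable \<nu> (indicator (A n) :: real \<Rightarrow> real)"
      by (intro Bochner_Integration.integrable_bound[OF integrable_divide[OF int_min, of "min 1 ((r n)\<^sup>2)"]])
         (use rn in \<open>auto simp: abs_of_nonneg\<close>)
    thus ?thesis by (simp add: integrable_indicator_iff space)
  qed
  have "\<exists>q \<mu>. 0 < q \<and> real_distribution \<mu> \<and> (\<forall>f :: real \<Rightarrow> complex. f \<in> borel_measurable borel \<longrightarrow> f 0 = 0 \<longrightarrow>
        complex_of_real q * (CLINT y|\<mu>. f y) = (CLINT y:A n|\<nu>. f y))" for n
    by (rule finite_part_jumps[OF sets A_borel A_fin, of n]) blast
  then obtain q \<mu> where q: "\<And>n. 0 < q n" and \<mu>: "\<And>n. real_distribution (\<mu> n)" and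
    \<mu>_int: "\<And>n (f :: real \<Rightarrow> complex). f \<in> borel_measurable borel \<Longrightarrow> f 0 = 0 \<Longrightarrow>
       complex_of_real (q n) * (CLINT y|\<mu> n. f y) = (CLINT y:A n|\<nu>. f y)"
    by metis
  define \<Omega> where "\<Omega> = PiM UNIV (\<lambda>n. compound_space (q n) (\<mu> n))"
  have prob_n: "prob_space (compound_space (q n) (\<mu> n))" for n using \<mu> by (rule prob_space_compound_space)
  have prob_\<Omega>: "prob_space \<Omega>" unfolding \<Omega>_def by (rule prob_space_PiM) (rule prob_n)
  interpret \<Omega>: prob_space \<Omega> by (rule prob_\<Omega>)
  \<comment> \<open>The compensating drift; it vanishes for \<open>n = 0\<close>, where all jumps have absolute value at least \<open>1\<close>.\<close>
  define c where "c n = (LINT y:A n|\<nu>. y * indicator {-1<..<1} y)" for n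
  define Y where "Y n t \<omega> = compound_sum t (\<omega> n) - c n * t" for n t and \<omega> :: "nat \<Rightarrow> (nat \<Rightarrow> nat \<times> (nat \<Rightarrow> real)) \<times> (nat \<Rightarrow> real)"
  define \<psi> where "\<psi> n \<theta> = (CLINT y:A n|\<nu>. levy_integrand \<theta> y)" for n \<theta>
  have int_A: "set_integrable \<nu> (A n) (levy_integrand \<theta>)" for n \<theta>
    unfolding set_integrable_def by (intro integrable_mult_indicator levy_measure_integrable_integrand[OF \<nu>]) simp
  have exponent: "complex_of_real (q n) * (char (\<mu> n) \<theta> - 1) - \<i> * complex_of_real (\<theta> * c n) = \<psi> n \<theta>" for n \<theta>
  proof -
    interpret \<mu>: real_distribution "\<mu> n" by (rule \<mu>)
    have int_y: "set_integrable \<nu> (A n) (\<lambda>y. y * indicator {-1<..<1} y)"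
      unfolding set_integrable_def
    proof (rule Bochner_Integration.integrable_bound)
      show "integrable \<nu> (indicator (A n) :: real \<Rightarrow> real)"
        using A_fin[of n] by (simp add: integrable_indicator_iff space)
    qed (auto simp: indicator_def)
    have "char (\<mu> n) \<theta> - 1 = (CLINT y|\<mu> n. iexp (\<theta> * y) - 1)"
      unfolding char_def
      by (subst Bochner_Integration.integral_diff)
         (auto simp: \<mu>.integrable_iexp \<mu>.prob_space[unfolded \<mu>.space_eq_univ] simp del: of_real_mult)
    hence "complex_of_real (q n) * (char (\<mu> n) \<theta> - 1) = (CLINT y:A n|\<nu>. iexp (\<theta> * y) - 1)"
      using \<mu>_int[of "\<lambda>y. iexp (\<theta> * y) - 1"] by simp
    also have "\<dots> = (CLINT y|\<nu>. indicator (A n) y *\<^sub>R levy_integrand \<theta> y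
        + (\<i> * complex_of_real \<theta>) * complex_of_real (indicator (A n) y *\<^sub>R (y * indicator {-1<..<1} y)))"
      unfolding set_lebesgue_integral_def
      by (rule Bochner_Integration.integral_cong) (auto simp: levy_integrand_def indicator_def)
    also have "\<dots> = \<psi> n \<theta> + (\<i> * complex_of_real \<theta>) * complex_of_real (c n)"
      using int_A[of n \<theta>] int_y unfolding \<psi>_def c_def set_lebesgue_integral_def set_integrable_def
      by (subst Bochner_Integration.integral_add) (auto simp del: of_real_mult)
    finally show ?thesis by (simp add: algebra_simps)
  qed
  have comp_meas: "compound_sum t \<in> borel_measurable (compound_space (q n) (\<mu> n))" for t n
    by (rule compound_sum_measurable) (rule \<mu>)
  have Y_meas [measurable]: "Y n t \<in> borel_measurable \<Omega>" for n t
    unfolding Y_def \<Omega>_def by (intro borel_measurable_diff measurable_PiM_component comp_meas) simp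
  have coord: "(\<lambda>\<omega>. \<omega> n) \<in> measurable \<Omega> (compound_space (q n) (\<mu> n))"
    "distr \<Omega> (compound_space (q n) (\<mu> n)) (\<lambda>\<omega>. \<omega> n) = compound_space (q n) (\<mu> n)" for n
    unfolding \<Omega>_def using distr_PiM_component[of UNIV "\<lambda>n. compound_space (q n) (\<mu> n)" n] prob_n by auto
  have incr0: "increments_exponent (compound_space (q n) (\<mu> n)) (\<lambda>t p. compound_sum t p - c n * t) (\<psi> n)" for n
    using increments_exponent_drift[OF increments_exponent_compound_sum[OF q \<mu>], of n n "c n"]
    by (simp only: exponent)
  have Y_levy: "levy_process \<Omega> (Y n)" and Y_char: "has_char_exponent \<Omega> (Y n) (\<psi> n)" for n
  proof -
    have incr: "increments_exponent \<Omega> (Y n) (\<psi> n)"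
      unfolding Y_def by (rule increments_exponent_pullback[OF coord _ incr0]) (intro borel_measurable_diff comp_meas borel_measurable_const)
    have "AE \<omega> in \<Omega>. compound_sum 0 (\<omega> n) = 0"
      by (intro AE_distrD[OF coord(1)]) (simp only: coord(2) compound_sum_0[OF \<mu>])
    hence 0: "AE \<omega> in \<Omega>. Y n 0 \<omega> = 0" by (simp add: Y_def)
    have cadlag: "AE \<omega> in \<Omega>. cadlag (\<lambda>t. Y n t \<omega>)"
      unfolding Y_def by (simp add: cadlag_minus_linear cadlag_compound_sum)
    show "levy_process \<Omega> (Y n)" "has_char_exponent \<Omega> (Y n) (\<psi> n)"
      using levy_processI[OF prob_\<Omega> Y_meas 0 cadlag incr] by blast+
  qed
  \<comment> \<open>The estimates start at the third annulus, where the second moment bound applies.\<close>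
  have \<psi>_bound: "cmod (\<psi> (Suc (Suc n)) \<theta>) \<le> \<theta>\<^sup>2 * (1/8) ^ n" for n \<theta>
  proof -
    let ?A = "A (Suc (Suc n))"
    have "cmod (\<psi> (Suc (Suc n)) \<theta>) \<le> (LINT y|\<nu>. cmod (indicator ?A y *\<^sub>R levy_integrand \<theta> y))"
      unfolding \<psi>_def set_lebesgue_integral_def by (rule integral_norm_bound)
    also have "\<dots> \<le> (LINT y|\<nu>. \<theta>\<^sup>2 * (indicator {y. \<bar>y\<bar> < r (Suc n)} y *\<^sub>R min 1 (y\<^sup>2)))"
    proof (rule integral_mono)
      show "integrable \<nu> (\<lambda>y. cmod (indicator ?A y *\<^sub>R levy_integrand \<theta> y))"
        using int_A[of "Suc (Suc n)" \<theta>] unfolding set_integrable_def by (rule integrable_norm)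
      show "integrable \<nu> (\<lambda>y. \<theta>\<^sup>2 * (indicator {y. \<bar>y\<bar> < r (Suc n)} y *\<^sub>R min 1 (y\<^sup>2)))"
        by (intro integrable_mult_right integrable_mult_indicator int_min) measurable
      show "cmod (indicator ?A y *\<^sub>R levy_integrand \<theta> y) \<le> \<theta>\<^sup>2 * (indicator {y. \<bar>y\<bar> < r (Suc n)} y *\<^sub>R min 1 (y\<^sup>2))" for y
      proof (cases "y \<in> ?A")
        case True
        hence y: "\<bar>y\<bar> < r (Suc n)" by (simp add: A_def)
        hence y1: "\<bar>y\<bar> < 1" using r_le[of "Suc n"] by linarith
        hence "levy_integrand \<theta> y = iexp (\<theta> * y) - 1 - \<i> * complex_of_real (\<theta> * y)"
          by (auto simp: levy_integrand_def indicator_def)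
        hence "cmod (levy_integrand \<theta> y) \<le> (\<theta> * y)\<^sup>2 / 2"
          using cmod_iexp_minus_linear_le[of "\<theta> * y"] by simp
        also have "\<dots> \<le> \<theta>\<^sup>2 * y\<^sup>2" by (simp add: power_mult_distrib)
        also have "y\<^sup>2 = min 1 (y\<^sup>2)" using y1 abs_square_le_1[of y] by simp
        finally show ?thesis using True y by simp
      qed auto
    qed
    also have "\<dots> = \<theta>\<^sup>2 * (LINT y:{y. \<bar>y\<bar> < r (Suc n)}|\<nu>. min 1 (y\<^sup>2))"
      unfolding set_lebesgue_integral_def by (rule integral_mult_right_zero)
    also have "\<dots> \<le> \<theta>\<^sup>2 * (1/8) ^ n" by (intro mult_left_mono r(5)) simp
    finally show ?thesis .
  qed
  \<comment> \<open>The maximal inequality bounds the path of index \<open>n + 2\<close> by \<open>2 (1/2)^n = b (n + 2)\<close>, except on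
     an event of probability at most \<open>2 p n\<close>, for all large \<open>n\<close>.\<close>
  define b :: "nat \<Rightarrow> real" where "b n = 8 * (1/2) ^ n" for n
  have summable_b: "summable b" unfolding b_def by (intro summable_mult summable_geometric) simp
  have small: "AE \<omega> in \<Omega>. eventually (\<lambda>n. \<forall>t\<in>{0..real K}. \<bar>Y n t \<omega>\<bar> \<le> b n) sequentially" for K
  proof (cases "K = 0")
    case True
    have "AE \<omega> in \<Omega>. \<forall>n. Y n 0 \<omega> = 0"
      unfolding AE_all_countable using Y_levy by (simp add: levy_process_def)
    thus ?thesis by eventually_elim (auto simp: True b_def)
  next
    case False
    hence K: "0 < real K" by simp
    define p where "p n = 8 * real K * (1/2) ^ n" for n :: nat
    have tail: "\<Omega>.prob {\<omega>\<in>space \<Omega>. (1/2) ^ n \<le> \<bar>Y (Suc (Suc n)) u \<omega>\<bar>} \<le> p n" if "0 \<le> u" "u \<le> real K" for n u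
    proof -
      have "\<Omega>.prob {\<omega>\<in>space \<Omega>. (1/2) ^ n \<le> \<bar>Y (Suc (Suc n)) u \<omega>\<bar>} \<le> 2 * (u * (4 * (1/2) ^ n))"
      proof (rule levy_process_tail[OF Y_levy Y_char])
        fix \<theta> :: real assume "\<bar>\<theta>\<bar> \<le> 2 / (1/2) ^ n"
        hence "\<bar>\<theta>\<bar>\<^sup>2 \<le> (2 / (1/2) ^ n)\<^sup>2" by (intro power_mono) auto
        hence "\<theta>\<^sup>2 * (1/8) ^ n \<le> (2 / (1/2) ^ n)\<^sup>2 * (1/8) ^ n" by (intro mult_right_mono) auto
        also have "\<dots> = 4 * (((2 * 2) ^ n) * (1/8) ^ n)"
          unfolding power_mult_distrib by (simp add: power2_eq_square power_one_over field_simps)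
        also have "\<dots> = 4 * (1/2) ^ n" by (simp add: power_mult_distrib[symmetric])
        finally show "cmod (\<psi> (Suc (Suc n)) \<theta>) \<le> 4 * (1/2) ^ n" using \<psi>_bound[of n \<theta>] by linarith
      qed (use that in auto)
      also have "\<dots> \<le> p n" using that by (simp add: p_def mult_right_mono)
      finally show ?thesis .
    qed
    have p0: "p \<longlonglongrightarrow> 8 * real K * 0" unfolding p_def by (intro tendsto_intros LIMSEQ_realpow_zero) auto
    have "eventually (\<lambda>n. p n < 1 / 2) sequentially" by (rule order_tendstoD(2)[OF p0]) simp
    then obtain n0 where n0: "\<And>n. n0 \<le> n \<Longrightarrow> p n \<le> 1 / 2" by (auto simp: eventually_sequentially intro: less_imp_le)
    have "\<exists>B. \<forall>n. B n \<in> sets \<Omega> \<and> \<Omega>.prob (B n) \<le> 2 * p (n + n0) \<and>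
      (AE \<omega> in \<Omega>. \<omega> \<notin> B n \<longrightarrow> (\<forall>t\<in>{0..real K}. \<bar>Y (Suc (Suc (n + n0))) t \<omega>\<bar> \<le> 2 * (1/2) ^ (n + n0)))"
    proof (rule choice, rule allI)
      fix n
      show "\<exists>B. B \<in> sets \<Omega> \<and> \<Omega>.prob B \<le> 2 * p (n + n0) \<and>
        (AE \<omega> in \<Omega>. \<omega> \<notin> B \<longrightarrow> (\<forall>t\<in>{0..real K}. \<bar>Y (Suc (Suc (n + n0))) t \<omega>\<bar> \<le> 2 * (1/2) ^ (n + n0)))"
        by (rule levy_process_maximal[OF Y_levy K, of "(1/2) ^ (n + n0)" "p (n + n0)" "Suc (Suc (n + n0))"])
           (use n0[of "n + n0"] tail in auto)
    qed
    then obtain B where "\<forall>n. B n \<in> sets \<Omega> \<and> \<Omega>.prob (B n) \<le> 2 * p (n + n0) \<and>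
      (AE \<omega> in \<Omega>. \<omega> \<notin> B n \<longrightarrow> (\<forall>t\<in>{0..real K}. \<bar>Y (Suc (Suc (n + n0))) t \<omega>\<bar> \<le> 2 * (1/2) ^ (n + n0)))" ..
    hence B: "\<And>n. B n \<in> sets \<Omega>" "\<And>n. \<Omega>.prob (B n) \<le> 2 * p (n + n0)"
      "\<And>n. AE \<omega> in \<Omega>. \<omega> \<notin> B n \<longrightarrow> (\<forall>t\<in>{0..real K}. \<bar>Y (Suc (Suc (n + n0))) t \<omega>\<bar> \<le> 2 * (1/2) ^ (n + n0))"
      by simp_all
    have "summable (\<lambda>n. 2 * p (n + n0))"
      unfolding p_def power_add by (intro summable_mult summable_mult2 summable_geometric) simp
    hence "summable (\<lambda>n. \<Omega>.prob (B n))"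
      by (rule summable_comparison_test[rotated]) (use B(2) in auto)
    hence "AE \<omega> in \<Omega>. eventually (\<lambda>n. \<omega> \<in> space \<Omega> - B n) sequentially"
      by (intro borel_cantelli_AE1 B) (auto simp: \<Omega>.emeasure_eq_measure)
    moreover have "AE \<omega> in \<Omega>. \<forall>n. \<omega> \<notin> B n \<longrightarrow> (\<forall>t\<in>{0..real K}. \<bar>Y (Suc (Suc (n + n0))) t \<omega>\<bar> \<le> 2 * (1/2) ^ (n + n0))"
      unfolding AE_all_countable using B(3) by blast
    ultimately show ?thesis
    proof eventually_elim
      case (elim \<omega>)
      have "eventually (\<lambda>n. \<forall>t\<in>{0..real K}. \<bar>Y (n + (2 + n0)) t \<omega>\<bar> \<le> b (n + (2 + n0))) sequentially"
        using elim(1) by eventually_elim (use elim(2) in \<open>auto simp: b_def add_ac power_add\<close>)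
      thus ?case by (rule eventually_sequentially_seg[THEN iffD1])
    qed
  qed
  hence good: "AE \<omega> in \<Omega>. \<forall>K::nat. eventually (\<lambda>n. \<forall>t\<in>{0..real K}. \<bar>Y n t \<omega>\<bar> \<le> b n) sequentially"
    unfolding AE_all_countable by blast
  have summable_Y: "AE \<omega> in \<Omega>. \<forall>t\<ge>0. summable (\<lambda>n. Y n t \<omega>)"
    using good
  proof eventually_elim
    case (elim \<omega>)
    show ?case
    proof (intro allI impI)
      fix t :: real assume t: "0 \<le> t"
      obtain K :: nat where K: "t < real K" using reals_Archimedean2 by blast
      have "eventually (\<lambda>n. norm (Y n t \<omega>) \<le> b n) sequentially"
        using elim[rule_format, of K] by eventually_elim (use t K in auto)
      thus "summable (\<lambda>n. Y n t \<omega>)" by (rule summable_comparison_test_ev[OF _ summable_b])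
    qed
  qed
  define X where "X t \<omega> = (\<Sum>n. Y n t \<omega>)" for t \<omega>
  have X_meas: "X t \<in> borel_measurable \<Omega>" for t unfolding X_def by measurable
  have X_cadlag: "AE \<omega> in \<Omega>. cadlag (\<lambda>t. X t \<omega>)"
    using good unfolding X_def
    by eventually_elim
       (rule cadlag_suminf[OF _ summable_b], auto simp: Y_def cadlag_minus_linear cadlag_compound_sum)
  have "AE \<omega> in \<Omega>. \<forall>n. Y n 0 \<omega> = 0"
    unfolding AE_all_countable using Y_levy by (simp add: levy_process_def)
  hence X0: "AE \<omega> in \<Omega>. X 0 \<omega> = 0" unfolding X_def by eventually_elim simp
  \<comment> \<open>The annuli exhaust the line without the origin, which contributes nothing.\<close>
  define \<Psi> where "\<Psi> \<theta> = (CLINT y|\<nu>. levy_integrand \<theta> y)" for \<theta>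
  have \<psi>_sums: "(\<lambda>N. \<Sum>n<N. \<psi> n \<theta>) \<longlonglongrightarrow> \<Psi> \<theta>" for \<theta>
  proof -
    have partial: "(\<Sum>n<Suc N. indicator (A n) y) = (indicator {y. r N \<le> \<bar>y\<bar>} y :: real)" for N y
    proof (induction N)
      case (Suc N)
      have "r (Suc N) \<le> r N" by (rule antimonoD[OF r(2)]) simp
      thus ?case unfolding sum.lessThan_Suc[of _ "Suc N"] Suc by (auto simp: A_def indicator_def)
    qed (simp add: A_def r(1))
    have "(\<lambda>N. CLINT y|\<nu>. indicator {y. r N \<le> \<bar>y\<bar>} y *\<^sub>R levy_integrand \<theta> y) \<longlonglongrightarrow> (CLINT y|\<nu>. levy_integrand \<theta> y)"
    proof (rule integral_dominated_convergence[where w = "\<lambda>y. cmod (levy_integrand \<theta> y)"])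
      show "integrable \<nu> (\<lambda>y. cmod (levy_integrand \<theta> y))"
        by (intro integrable_norm levy_measure_integrable_integrand[OF \<nu>])
      show "AE y in \<nu>. (\<lambda>N. indicator {y. r N \<le> \<bar>y\<bar>} y *\<^sub>R levy_integrand \<theta> y) \<longlonglongrightarrow> levy_integrand \<theta> y"
      proof (rule AE_I2)
        fix y
        show "(\<lambda>N. indicator {y. r N \<le> \<bar>y\<bar>} y *\<^sub>R levy_integrand \<theta> y) \<longlonglongrightarrow> levy_integrand \<theta> y"
        proof (cases "y = 0")
          case False
          hence "eventually (\<lambda>N. r N < \<bar>y\<bar>) sequentially" by (intro order_tendstoD(2)[OF r(4)]) simp
          hence "eventually (\<lambda>N. indicator {y. r N \<le> \<bar>y\<bar>} y *\<^sub>R levy_integrand \<theta> y = levy_integrand \<theta> y) sequentially"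
            by eventually_elim simp
          thus ?thesis by (rule tendsto_eventually)
        qed (simp add: levy_integrand_def)
      qed
    qed (auto simp: indicator_def)
    moreover have "(CLINT y|\<nu>. indicator {y. r N \<le> \<bar>y\<bar>} y *\<^sub>R levy_integrand \<theta> y) = (\<Sum>n<Suc N. \<psi> n \<theta>)" for N
      unfolding partial[symmetric] scaleR_sum_left \<psi>_def set_lebesgue_integral_def
      using int_A by (intro Bochner_Integration.integral_sum) (auto simp: set_integrable_def)
    ultimately have "(\<lambda>N. \<Sum>n<Suc N. \<psi> n \<theta>) \<longlonglongrightarrow> \<Psi> \<theta>" by (simp add: \<Psi>_def)
    thus ?thesis by (rule LIMSEQ_imp_Suc)
  qed
  have incr: "increments_exponent \<Omega> X \<Psi>"
    unfolding increments_exponent_def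
  proof (intro allI impI)
    fix t :: "nat \<Rightarrow> real" and \<theta> m assume t: "0 \<le> t 0 \<and> mono t"
    have t_nonneg: "0 \<le> t k" for k using t mono_nonneg[of t k] by blast
    define G where "G N \<omega> = (\<Prod>k<m. iexp (\<theta> k * ((\<Sum>n<N. Y n (t (Suc k)) \<omega>) - (\<Sum>n<N. Y n (t k) \<omega>))))" for N \<omega>
    define g where "g n p = (\<Prod>k<m. iexp (\<theta> k * ((compound_sum (t (Suc k)) p - c n * t (Suc k)) - (compound_sum (t k) p - c n * t k))))" for n p
    note [measurable] = comp_meas X_meas
    have g_meas: "g n \<in> borel_measurable (compound_space (q n) (\<mu> n))" for n
      unfolding g_def[abs_def] by measurable
    have "G N \<omega> = (\<Prod>n<N. g n (\<omega> n))" for N \<omega>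
      unfolding G_def g_def Y_def sum_subtractf[symmetric] sum_distrib_left of_real_sum exp_sum[OF finite_lessThan]
      by (rule prod.swap)
    hence "(CLINT \<omega>|\<Omega>. G N \<omega>) = (\<Prod>n<N. CLINT p|compound_space (q n) (\<mu> n). g n p)" for N
      unfolding \<Omega>_def
      by (simp, intro integral_PiM_prod prob_n g_meas) (simp add: g_def prod_norm[symmetric])
    also have "(\<Prod>n<N. CLINT p|compound_space (q n) (\<mu> n). g n p) = (\<Prod>k<m. exp (complex_of_real (t (Suc k) - t k) * (\<Sum>n<N. \<psi> n (\<theta> k))))" for N
      unfolding g_def using t
      by (simp only: increments_exponentD[OF incr0] sum_distrib_left exp_sum[OF finite_lessThan]) (rule prod.swap)
    finally have G_int: "(CLINT \<omega>|\<Omega>. G N \<omega>) = (\<Prod>k<m. exp (complex_of_real (t (Suc k) - t k) * (\<Sum>n<N. \<psi> n (\<theta> k))))" for N .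
    have "(\<lambda>N. CLINT \<omega>|\<Omega>. G N \<omega>) \<longlonglongrightarrow> (CLINT \<omega>|\<Omega>. \<Prod>k<m. iexp (\<theta> k * (X (t (Suc k)) \<omega> - X (t k) \<omega>)))"
    proof (rule integral_dominated_convergence[where w = "\<lambda>_. 1"])
      show "G N \<in> borel_measurable \<Omega>" for N unfolding G_def by measurable
      show "AE \<omega> in \<Omega>. (\<lambda>N. G N \<omega>) \<longlonglongrightarrow> (\<Prod>k<m. iexp (\<theta> k * (X (t (Suc k)) \<omega> - X (t k) \<omega>)))"
        using summable_Y
      proof eventually_elim
        case (elim \<omega>)
        have "(\<lambda>N. \<Sum>n<N. Y n (t k) \<omega>) \<longlonglongrightarrow> X (t k) \<omega>" for k
          unfolding X_def using elim t_nonneg by (intro summable_LIMSEQ) auto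
        thus ?case unfolding G_def by (intro tendsto_intros)
      qed
      show "(\<lambda>\<omega>. \<Prod>k<m. iexp (\<theta> k * (X (t (Suc k)) \<omega> - X (t k) \<omega>))) \<in> borel_measurable \<Omega>" by measurable
    qed (auto simp: G_def prod_norm[symmetric])
    moreover have "(\<lambda>N. CLINT \<omega>|\<Omega>. G N \<omega>) \<longlonglongrightarrow> (\<Prod>k<m. exp (complex_of_real (t (Suc k) - t k) * \<Psi> (\<theta> k)))"
      unfolding G_int by (intro tendsto_intros \<psi>_sums)
    ultimately show "(CLINT \<omega>|\<Omega>. \<Prod>k<m. iexp (\<theta> k * (X (t (Suc k)) \<omega> - X (t k) \<omega>)))
        = (\<Prod>k<m. exp (complex_of_real (t (Suc k) - t k) * \<Psi> (\<theta> k)))"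
      by (rule LIMSEQ_unique)
  qed
  have "sequence_coded \<Omega>" unfolding \<Omega>_def by (intro sequence_coded_PiM sequence_coded_compound_space \<mu>)
  then obtain M :: "(nat \<Rightarrow> real) measure" and S where MS: "prob_space M" "S \<in> measurable M \<Omega>" "distr M \<Omega> S = \<Omega>"
    unfolding sequence_coded_def by blast
  define X' where "X' t \<omega> = X t (S \<omega>)" for t \<omega>
  have "AE \<omega> in M. X' 0 \<omega> = 0" "AE \<omega> in M. cadlag (\<lambda>t. X' t \<omega>)"
    unfolding X'_def by (intro AE_distrD[OF MS(2)], simp only: MS(3) X0 X_cadlag)+
  moreover have "increments_exponent M X' \<Psi>"
    unfolding X'_def[abs_def] by (rule increments_exponent_pullback[OF MS(2,3) X_meas incr])
  moreover have "X' t \<in> borel_measurable M" for t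
    unfolding X'_def[abs_def] by (rule measurable_compose[OF MS(2) X_meas])
  ultimately have "levy_process M X'" "has_char_exponent M X' \<Psi>"
    using levy_processI[OF MS(1), of X' \<Psi>] by blast+
  hence "has_levy_measure M X' \<nu>"
    unfolding has_levy_measure_def using \<nu>
    by (intro conjI exI[of _ 0]) (auto simp: \<Psi>_def[abs_def] levy_integrand_def[abs_def])
  thus ?thesis by blast
qed

section \<open>The Lamperti time change at small times\<close>

text \<open>A Riemann sum with mesh \<open>h\<close> is the integral of a step function.\<close>

lemma set_integral_step:
  fixes c :: "nat \<Rightarrow> 'b :: {banach, second_countable_topology}"
  assumes h: "0 < h"
  shows "set_integrable lborel {0..<real k * h} (\<lambda>u. c (nat \<lfloor>u / h\<rfloor>))"
    "(LINT u:{0..<real k * h}|lborel. c (nat \<lfloor>u / h\<rfloor>)) = h *\<^sub>R (\<Sum>j<k. c j)"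
proof (induction k)
  case 0
  { case 1 show ?case by (simp add: set_integrable_def) }
  { case 2 show ?case by (simp add: set_lebesgue_integral_def) }
next
  case (Suc k)
  have U: "{0..<real (Suc k) * h} = {0..<real k * h} \<union> {real k * h..<real (Suc k) * h}"
    using h by (intro ivl_disj_un(17)[symmetric]) (auto simp: mult_right_mono)
  have eq: "indicator {real k * h..<real (Suc k) * h} u *\<^sub>R c (nat \<lfloor>u / h\<rfloor>) = indicator {real k * h..<real (Suc k) * h} u *\<^sub>R c k" for u
  proof (cases "u \<in> {real k * h..<real (Suc k) * h}")
    case True
    hence "real k \<le> u / h" "u / h < real k + 1" using h by (auto simp: field_simps)
    hence "\<lfloor>u / h\<rfloor> = int k" by (simp add: floor_eq_iff)
    thus ?thesis by simp
  qed simp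
  have int: "set_integrable lborel {real k * h..<real (Suc k) * h} (\<lambda>u. c (nat \<lfloor>u / h\<rfloor>))"
    unfolding set_integrable_def eq by (intro integrable_scaleR_left integrable_real_indicator emeasure_bounded_finite) auto
  have val: "(LINT u:{real k * h..<real (Suc k) * h}|lborel. c (nat \<lfloor>u / h\<rfloor>)) = h *\<^sub>R c k"
  proof -
    have "real k * h \<le> real (Suc k) * h" "real (Suc k) * h - real k * h = h" using h by (auto simp: algebra_simps)
    thus ?thesis unfolding set_lebesgue_integral_def eq by simp
  qed
  { case 1 show ?case unfolding U by (intro set_integrable_Un Suc.IH int) auto }
  { case 2
    have "{0..<real k * h} \<inter> {real k * h..<real (Suc k) * h} = {}" by auto
    thus ?case unfolding U by (subst set_integral_Un) (use Suc.IH int val in \<open>auto simp: scaleR_add_right\<close>) }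
qed

lemma grid_point:
  assumes "0 < h" "0 \<le> u"
  shows "real (nat \<lfloor>u / h\<rfloor>) * h \<le> u" "u < (real (nat \<lfloor>u / h\<rfloor>) + 1) * h"
    "u - h < real (nat \<lfloor>u / h\<rfloor>) * h"
proof -
  have "real (nat \<lfloor>u / h\<rfloor>) = real_of_int \<lfloor>u / h\<rfloor>" using assms by simp
  hence "real (nat \<lfloor>u / h\<rfloor>) \<le> u / h" "u / h < real (nat \<lfloor>u / h\<rfloor>) + 1" by linarith+
  from this[unfolded pos_le_divide_eq[OF assms(1)] pos_divide_less_eq[OF assms(1)]]
  show "real (nat \<lfloor>u / h\<rfloor>) * h \<le> u" "u < (real (nat \<lfloor>u / h\<rfloor>) + 1) * h"
by auto
  thus "u - h < real (nat \<lfloor>u / h\<rfloor>) * h" by (simp add: algebra_simps)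
qed

lemma tendsto_mesh: "(\<lambda>m. S / real (Suc m)) \<longlonglongrightarrow> 0"
  using tendsto_mult[OF tendsto_const LIMSEQ_inverse_real_of_nat, of S] by (simp add: divide_inverse)

lemma tendsto_grid_left:
  assumes "0 < S" "0 \<le> u"
  shows "(\<lambda>m. real (nat \<lfloor>u / (S / real (Suc m))\<rfloor>) * (S / real (Suc m))) \<longlonglongrightarrow> u"
proof (rule tendsto_sandwich[where f = "\<lambda>m. u - S / real (Suc m)" and h = "\<lambda>_. u"])
  have h: "0 < S / real (Suc m)" for m using assms by simp
  show "eventually (\<lambda>m. u - S / real (Suc m) \<le> real (nat \<lfloor>u / (S / real (Suc m))\<rfloor>) * (S / real (Suc m))) sequentially"
    by (intro always_eventually allI less_imp_le grid_point(3) h assms)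
  show "eventually (\<lambda>m. real (nat \<lfloor>u / (S / real (Suc m))\<rfloor>) * (S / real (Suc m)) \<le> u) sequentially"
    by (intro always_eventually allI grid_point(1) h assms)
qed (use tendsto_diff[OF tendsto_const tendsto_mesh, of u S] in simp_all)

lemma filterlim_grid_right:
  assumes "0 < S" "0 \<le> u"
  shows "filterlim (\<lambda>m. (real (nat \<lfloor>u / (S / real (Suc m))\<rfloor>) + 1) * (S / real (Suc m))) (at_right u) sequentially"
  unfolding filterlim_at
proof
  show "((\<lambda>m. (real (nat \<lfloor>u / (S / real (Suc m))\<rfloor>) + 1) * (S / real (Suc m))) \<longlongrightarrow> u) sequentially"
    using tendsto_add[OF tendsto_grid_left[OF assms] tendsto_mesh, of S] by (simp only: distrib_right mult_1 add_0_right)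
  have "u < (real (nat \<lfloor>u / (S / real (Suc m))\<rfloor>) + 1) * (S / real (Suc m))" for m
    by (rule grid_point(2)) (use assms in auto)
  thus "\<forall>\<^sub>F m in sequentially. (real (nat \<lfloor>u / (S / real (Suc m))\<rfloor>) + 1) * (S / real (Suc m)) \<in> {u<..} \<and>
      (real (nat \<lfloor>u / (S / real (Suc m))\<rfloor>) + 1) * (S / real (Suc m)) \<noteq> u"
    by (intro always_eventually allI conjI less_imp_neq[symmetric]) (simp_all only: greaterThan_iff)
qed

text \<open>A Levy process all of whose paths are cadlag and vanish up to time \<open>0\<close>. Every Levy process has
  such a modification.\<close>

locale cadlag_levy = prob_space M for M :: "'a measure" +
  fixes X :: "real \<Rightarrow> 'a \<Rightarrow> real" and \<Psi> :: "real \<Rightarrow> complex"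
  assumes X_meas [measurable]: "\<And>t. X t \<in> borel_measurable M"
    and X_cadlag: "\<And>\<omega>. cadlag (\<lambda>t. X t \<omega>)"
    and X_nonpos: "\<And>t \<omega>. t \<le> 0 \<Longrightarrow> X t \<omega> = 0"
    and X_incr: "increments_exponent M X \<Psi>"
begin

lemma X_levy: "levy_process M X" and X_char: "has_char_exponent M X \<Psi>"
  by (rule levy_processI[OF prob_space_axioms _ _ _ X_incr]; simp add: X_cadlag X_nonpos)+

lemma X_right: "((\<lambda>s. X s \<omega>) \<longlongrightarrow> X t \<omega>) (at_right t)"
proof (cases "0 \<le> t")
  case False
  hence "eventually (\<lambda>s. X s \<omega> = X t \<omega>) (at_right t)"
    using eventually_at_right_real[of t 0] by (auto elim!: eventually_mono simp: X_nonpos)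
  thus ?thesis by (rule tendsto_eventually)
qed (use X_cadlag[of \<omega>] in \<open>simp add: cadlag_def\<close>)

lemma X_left: "\<exists>l. ((\<lambda>s. X s \<omega>) \<longlongrightarrow> l) (at_left t)"
proof (cases "0 < t")
  case False
  hence "eventually (\<lambda>s. X s \<omega> = 0) (at_left t)"
    using eventually_at_left_real[of "t - 1" t] by (auto elim!: eventually_mono simp: X_nonpos)
  thus ?thesis by (intro exI[of _ 0] tendsto_eventually)
qed (use X_cadlag[of \<omega>] in \<open>simp add: cadlag_def\<close>)

text \<open>Right-continuous paths are limits of their dyadic discretizations, which are jointly
  measurable.\<close>

lemma X_joint_meas [measurable]: "(\<lambda>p. X (fst p) (snd p)) \<in> borel_measurable (lborel \<Otimes>\<^sub>M M)"
proof (rule borel_measurable_LIMSEQ_metric)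
  fix m :: nat
  have "(\<lambda>p. X ((real_of_int i + 1) * 1 / 2 ^ m) (snd p)) \<in> borel_measurable (lborel \<Otimes>\<^sub>M M)" for i
    by (rule measurable_compose[OF measurable_snd X_meas])
  moreover have "(\<lambda>p. \<lfloor>fst p * 2 ^ m / 1 :: real\<rfloor>) \<in> measurable (lborel \<Otimes>\<^sub>M M) (count_space UNIV)"
    by (rule measurable_compose[OF _ measurable_real_floor]) measurable
  ultimately show "(\<lambda>p. X (dyadic_above 1 m (fst p)) (snd p)) \<in> borel_measurable (lborel \<Otimes>\<^sub>M M)"
    unfolding dyadic_above_def by (rule measurable_compose_countable)
next
  fix p
  show "(\<lambda>m. X (dyadic_above 1 m (fst p)) (snd p)) \<longlonglongrightarrow> X (fst p) (snd p)"
    by (rule filterlim_compose[OF X_right filterlim_dyadic_above]) simp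
qed

lemma X_path_meas: "\<omega> \<in> space M \<Longrightarrow> (\<lambda>u. X u \<omega>) \<in> borel_measurable borel"
  using measurable_compose[OF measurable_Pair2'[of \<omega> M lborel] X_joint_meas] by simp

lemma X_bounded:
  obtains C where "\<And>u. u \<in> {0..S} \<Longrightarrow> \<bar>X u \<omega>\<bar> \<le> C"
proof -
  have local: "\<exists>d>0. \<exists>C. \<forall>u\<in>{t - d<..<t + d}. \<bar>X u \<omega>\<bar> \<le> C" for t
  proof -
    obtain l where l: "((\<lambda>s. X s \<omega>) \<longlongrightarrow> l) (at_left t)" using X_left by blast
    have "eventually (\<lambda>s. dist (X s \<omega>) l < 1) (at_left t)" using l by (rule tendstoD) simp
    then obtain a where a: "a < t" "\<And>s. a < s \<Longrightarrow> s < t \<Longrightarrow> dist (X s \<omega>) l < 1"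
      unfolding eventually_at_left_field by blast
    have "eventually (\<lambda>s. dist (X s \<omega>) (X t \<omega>) < 1) (at_right t)" using X_right by (rule tendstoD) simp
    then obtain b where b: "t < b" "\<And>s. t < s \<Longrightarrow> s < b \<Longrightarrow> dist (X s \<omega>) (X t \<omega>) < 1"
      unfolding eventually_at_right_field by blast
    show ?thesis
    proof (rule exI[of _ "min (t - a) (b - t)"], rule conjI, use a b in simp, rule exI, rule ballI)
      fix u assume u: "u \<in> {t - min (t - a) (b - t)<..<t + min (t - a) (b - t)}"
      consider "u < t" | "u = t" | "t < u" by linarith
      thus "\<bar>X u \<omega>\<bar> \<le> \<bar>l\<bar> + \<bar>X t \<omega>\<bar> + 1"
        by cases (use u a(2)[of u] b(2)[of u] in \<open>auto simp: dist_real_def min_def split: if_splits\<close>)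
    qed
  qed
  then obtain d C where dC: "\<And>t. 0 < d t" "\<And>t u. u \<in> {t - d t<..<t + d t} \<Longrightarrow> \<bar>X u \<omega>\<bar> \<le> C t" by metis
  obtain T where T: "T \<subseteq> {0..S}" "finite T" "{0..S} \<subseteq> (\<Union>t\<in>T. {t - d t<..<t + d t})"
    by (rule compactE_image[of "{0..S}" "{0..S}" "\<lambda>t. {t - d t<..<t + d t}"])
       (use dC(1) in \<open>auto intro!: bexI[of _ "_ :: real"]\<close>)
  show ?thesis
  proof
    fix u assume "u \<in> {0..S}"
    then obtain t where t: "t \<in> T" "u \<in> {t - d t<..<t + d t}" using T by blast
    hence "0 \<le> C t" if "t \<in> T" for t using dC(2)[of t t] dC(1)[of t] by force
    hence "C t \<le> (\<Sum>t\<in>T. C t)" using t T by (intro member_le_sum) auto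
    thus "\<bar>X u \<omega>\<bar> \<le> (\<Sum>t\<in>T. C t)" using dC(2)[OF t(2)] by linarith
  qed
qed

text \<open>Continuity of the exponent, from \<open>1 / (1 - \<Psi>)\<close> being the Laplace transform in time of the
  characteristic functions.\<close>

lemma isCont_exponent: "isCont \<Psi> \<theta>" and exponent_0: "\<Psi> 0 = 0"
proof -
  define \<phi> where "\<phi> t \<theta> = exp (complex_of_real t * \<Psi> \<theta>)" for t \<theta>
  have \<phi>: "\<phi> t \<theta> = char (distr M borel (X t)) \<theta>" if "0 \<le> t" for t \<theta>
    using X_char that by (simp add: has_char_exponent_def \<phi>_def)
  have \<phi>1: "cmod (\<phi> t \<theta>) \<le> 1" if "0 \<le> t" for t \<theta>
    unfolding \<phi>[OF that] by (intro real_distribution.cmod_char_le_1) simp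
  have Re: "Re (\<Psi> \<theta>) \<le> 0" for \<theta> by (rule levy_process_Re_nonpos[OF X_levy X_char])
  define J where "J \<theta> = (CLINT t:{0<..}|lborel. exp (-t) *\<^sub>R \<phi> t \<theta>)" for \<theta>
  have int_exp: "set_integrable lborel {0::real<..} (\<lambda>t. exp (-t))"
    using integrable_I0i_exp_mscale[of 1] by simp
  have J: "J \<theta> = 1 / (1 - \<Psi> \<theta>)" for \<theta>
  proof -
    have z: "Re (\<Psi> \<theta> - 1) < 0" using Re[of \<theta>] by simp
    hence nz: "\<Psi> \<theta> - 1 \<noteq> 0" by (metis less_irrefl zero_complex.simps(1))
    have eq: "exp (-t) *\<^sub>R \<phi> t \<theta> = exp (complex_of_real t * (\<Psi> \<theta> - 1))" for t
      by (simp add: \<phi>_def scaleR_conv_of_real exp_of_real[symmetric] exp_add[symmetric] algebra_simps)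
    have "(LBINT t=ereal 0..\<infinity>. exp (complex_of_real t * (\<Psi> \<theta> - 1))) = 0 - 1 / (\<Psi> \<theta> - 1)"
    proof (rule interval_integral_FTC_integrable[where F = "\<lambda>t. exp (complex_of_real t * (\<Psi> \<theta> - 1)) / (\<Psi> \<theta> - 1)"])
      fix t
      show "((\<lambda>t. exp (complex_of_real t * (\<Psi> \<theta> - 1)) / (\<Psi> \<theta> - 1)) has_vector_derivative exp (complex_of_real t * (\<Psi> \<theta> - 1))) (at t)"
        using nz by (auto intro!: derivative_eq_intros has_vector_derivative_real_field)
      show "isCont (\<lambda>t. exp (complex_of_real t * (\<Psi> \<theta> - 1))) t" by (intro continuous_intros)
    next
      have "set_integrable lborel {0<..} (\<lambda>t. exp (complex_of_real t * (\<Psi> \<theta> - 1)))"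
      proof (rule set_integrable_bound[OF int_exp])
        show "set_borel_measurable lborel {0<..} (\<lambda>t. exp (complex_of_real t * (\<Psi> \<theta> - 1)))"
          unfolding set_borel_measurable_def by measurable
        show "AE t in lborel. t \<in> {0<..} \<longrightarrow> norm (exp (complex_of_real t * (\<Psi> \<theta> - 1))) \<le> norm (exp (-t))"
          using Re[of \<theta>] by (auto simp: mult_nonneg_nonpos algebra_simps)
      qed
      thus "set_integrable lborel (einterval (ereal 0) \<infinity>) (\<lambda>t. exp (complex_of_real t * (\<Psi> \<theta> - 1)))"
        by (simp add: einterval_def greaterThan_def)
      show "(((\<lambda>t. exp (complex_of_real t * (\<Psi> \<theta> - 1)) / (\<Psi> \<theta> - 1)) \<circ> real_of_ereal) \<longlongrightarrow> 1 / (\<Psi> \<theta> - 1)) (at_right (ereal 0))"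
        unfolding ereal_tendsto_simps1 using nz
        by (auto intro!: tendsto_eq_intros)
      have "((\<lambda>t. exp (complex_of_real t * (\<Psi> \<theta> - 1))) \<longlongrightarrow> 0) at_top"
      proof (rule tendsto_norm_zero_cancel, rule tendsto_sandwich[where f = "\<lambda>_. 0" and h = "\<lambda>t. exp (-t)"])
        show "((\<lambda>t::real. exp (-t)) \<longlongrightarrow> 0) at_top"
          by (rule filterlim_compose[OF exp_at_bot]) (rule filterlim_uminus_at_bot_at_top)
        show "eventually (\<lambda>t. norm (exp (complex_of_real t * (\<Psi> \<theta> - 1))) \<le> exp (-t)) at_top"
          using eventually_ge_at_top[of 0] by eventually_elim (use Re[of \<theta>] in \<open>auto simp: mult_nonneg_nonpos algebra_simps\<close>)
      qed auto
      from tendsto_divide[OF this tendsto_const[of "\<Psi> \<theta> - 1"] nz]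
      show "(((\<lambda>t. exp (complex_of_real t * (\<Psi> \<theta> - 1)) / (\<Psi> \<theta> - 1)) \<circ> real_of_ereal) \<longlongrightarrow> 0) (at_left \<infinity>)"
        unfolding ereal_tendsto_simps1 by simp
    qed simp
    moreover have "J \<theta> = (CLINT t:{0<..}|lborel. exp (complex_of_real t * (\<Psi> \<theta> - 1)))"
      unfolding J_def eq ..
    ultimately show ?thesis
      using nz by (simp add: interval_integral_to_infinity_eq field_simps)
  qed
  have J_cont: "isCont J \<theta>" for \<theta>
    unfolding isCont_def tendsto_at_iff_sequentially comp_def
  proof (intro allI impI)
    fix x assume x: "\<forall>i. x i \<in> UNIV - {\<theta>}" "x \<longlonglongrightarrow> \<theta>"
    show "(\<lambda>n. J (x n)) \<longlonglongrightarrow> J \<theta>"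
      unfolding J_def set_lebesgue_integral_def
    proof (rule integral_dominated_convergence[where w = "\<lambda>t. indicator {0<..} t * exp (-t)"])
      show "integrable lborel (\<lambda>t::real. indicator {0<..} t * exp (-t))"
        using int_exp by (simp add: set_integrable_def)
      have "(\<lambda>n. \<phi> t (x n)) \<longlonglongrightarrow> \<phi> t \<theta>" if "0 \<le> t" for t
        unfolding \<phi>[OF that] by (rule isCont_tendsto_compose[OF real_distribution.isCont_char x(2)]) simp
      thus "AE t in lborel. (\<lambda>n. indicator {0<..} t *\<^sub>R exp (-t) *\<^sub>R \<phi> t (x n)) \<longlonglongrightarrow> indicator {0<..} t *\<^sub>R exp (-t) *\<^sub>R \<phi> t \<theta>"
        by (intro AE_I2) (auto simp: indicator_def intro!: tendsto_intros)
      show "AE t in lborel. norm (indicator {0<..} t *\<^sub>R exp (-t) *\<^sub>R \<phi> t (x n)) \<le> indicator {0<..} t * exp (-t)" for n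
        by (intro AE_I2) (auto simp: indicator_def \<phi>1 mult_left_le)
    qed (auto simp: \<phi>_def)
  qed
  have nz: "1 - \<Psi> \<theta> \<noteq> 0" for \<theta> using Re[of \<theta>] by (auto simp: complex_eq_iff)
  have "\<Psi> \<theta> = 1 - 1 / J \<theta>" for \<theta> using nz[of \<theta>] unfolding J by simp
  hence "\<Psi> = (\<lambda>\<theta>. 1 - 1 / J \<theta>)" by blast
  moreover have "isCont (\<lambda>\<theta>. 1 - 1 / J \<theta>) \<theta>"
    by (intro continuous_intros J_cont) (use nz J in auto)
  ultimately show "isCont \<Psi> \<theta>" by simp
  have "\<phi> t 0 = 1" if "0 \<le> t" for t
    unfolding \<phi>[OF that] by (intro real_distribution.char_zero) simp
  hence "J 0 = (CLINT t:{0<..}|lborel. complex_of_real (exp (-t)))"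
    unfolding J_def set_lebesgue_integral_def
    by (intro Bochner_Integration.integral_cong) (auto simp: indicator_def scaleR_conv_of_real)
  also have "\<dots> = complex_of_real (LINT t:{0<..}|lborel. exp (-t))"
    unfolding set_lebesgue_integral_def integral_complex_of_real[symmetric]
    by (intro Bochner_Integration.integral_cong) (auto simp: indicator_def scaleR_conv_of_real)
  also have "(LINT t:{0::real<..}|lborel. exp (-t)) = 1"
    using LBINT_I0i_exp_mscale[of 1] by (simp add: zero_ereal_def interval_integral_to_infinity_eq)
  finally have "1 / (1 - \<Psi> 0) = 1" using J[of 0] by simp
  thus "\<Psi> 0 = 0" by simp
qed

text \<open>The clock of the Lamperti time change.\<close>

definition clock :: "real \<Rightarrow> real \<Rightarrow> 'a \<Rightarrow> real" where
  "clock \<alpha> s \<omega> = (LINT u:{0..s}|lborel. exp (\<alpha> * X u \<omega>))"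

lemma clock_integrable:
  assumes \<omega>: "\<omega> \<in> space M"
  shows "set_integrable lborel {0..S} (\<lambda>u. exp (\<alpha> * X u \<omega>))"
proof -
  obtain C where C: "\<And>u. u \<in> {0..S} \<Longrightarrow> \<bar>X u \<omega>\<bar> \<le> C" using X_bounded by blast
  note [measurable] = X_path_meas[OF \<omega>]
  show ?thesis
    unfolding set_integrable_def
  proof (rule integrableI_bounded_set_indicator[where B = "exp (\<bar>\<alpha>\<bar> * C)"])
    show "AE u in lborel. u \<in> {0..S} \<longrightarrow> norm (exp (\<alpha> * X u \<omega>)) \<le> exp (\<bar>\<alpha>\<bar> * C)"
    proof (intro AE_I2 impI)
      fix u assume "u \<in> {0..S}"
      hence "\<bar>\<alpha>\<bar> * \<bar>X u \<omega>\<bar> \<le> \<bar>\<alpha>\<bar> * C" by (intro mult_left_mono C) auto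
      thus "norm (exp (\<alpha> * X u \<omega>)) \<le> exp (\<bar>\<alpha>\<bar> * C)"
        using abs_ge_self[of "\<alpha> * X u \<omega>"] by (simp add: abs_mult)
    qed
  qed (auto simp: emeasure_lborel_Icc_eq)
qed

lemma clock_split:
  assumes \<omega>: "\<omega> \<in> space M" and ab: "0 \<le> a" "a \<le> b"
  shows "clock \<alpha> b \<omega> = clock \<alpha> a \<omega> + (LINT u:{a<..b}|lborel. exp (\<alpha> * X u \<omega>))"
    "set_integrable lborel {a<..b} (\<lambda>u. exp (\<alpha> * X u \<omega>))"
proof -
  show I: "set_integrable lborel {a<..b} (\<lambda>u. exp (\<alpha> * X u \<omega>))"
    by (rule set_integrable_subset[OF clock_integrable[OF \<omega>, of b]]) (use ab in auto)
  have "{0..b} = {0..a} \<union> {a<..b}" using ab by auto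
  thus "clock \<alpha> b \<omega> = clock \<alpha> a \<omega> + (LINT u:{a<..b}|lborel. exp (\<alpha> * X u \<omega>))"
    unfolding clock_def using clock_integrable[OF \<omega>, of a \<alpha>] I set_integral_Un[of "{0..a}" "{a<..b}"] ivl_disj_int_two(4)[of 0 a b]
    by (simp add: disjoint_iff)
qed

lemma clock_bounds:
  assumes \<omega>: "\<omega> \<in> space M" and ab: "0 \<le> a" "a \<le> b"
    and bound: "\<And>u. a < u \<Longrightarrow> u \<le> b \<Longrightarrow> c \<le> exp (\<alpha> * X u \<omega>) \<and> exp (\<alpha> * X u \<omega>) \<le> C"
  shows "c * (b - a) \<le> clock \<alpha> b \<omega> - clock \<alpha> a \<omega>" "clock \<alpha> b \<omega> - clock \<alpha> a \<omega> \<le> C * (b - a)"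
proof -
  have const: "set_integrable lborel {a<..b} (\<lambda>u. x)" "(LINT u:{a<..b}|lborel. x) = x * (b - a)" for x :: real
    using ab by (auto simp: set_integrable_def set_lebesgue_integral_def)
  note * = clock_split[OF \<omega> ab, of \<alpha>]
  show "c * (b - a) \<le> clock \<alpha> b \<omega> - clock \<alpha> a \<omega>" "clock \<alpha> b \<omega> - clock \<alpha> a \<omega> \<le> C * (b - a)"
    unfolding const(2)[symmetric] *(1) using bound
    by (auto intro!: set_integral_mono const *(2))
qed

lemma clock_lipschitz:
  assumes \<omega>: "\<omega> \<in> space M"
  obtains c C where "0 < c" "0 < C" "\<And>a b. 0 \<le> a \<Longrightarrow> a \<le> b \<Longrightarrow> b \<le> S \<Longrightarrow>
    c * (b - a) \<le> clock \<alpha> b \<omega> - clock \<alpha> a \<omega> \<and> clock \<alpha> b \<omega> - clock \<alpha> a \<omega> \<le> C * (b - a)"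
proof -
  obtain B where B: "\<And>u. u \<in> {0..S} \<Longrightarrow> \<bar>X u \<omega>\<bar> \<le> B" using X_bounded by blast
  show ?thesis
  proof (rule that[of "exp (- (\<bar>\<alpha>\<bar> * B))" "exp (\<bar>\<alpha>\<bar> * B)"])
    fix a b assume ab: "0 \<le> a" "a \<le> b" "b \<le> S"
    have "\<bar>\<alpha> * X u \<omega>\<bar> \<le> \<bar>\<alpha>\<bar> * B" if "a < u" "u \<le> b" for u
      unfolding abs_mult using B[of u] that ab by (intro mult_left_mono) auto
    hence "exp (- (\<bar>\<alpha>\<bar> * B)) \<le> exp (\<alpha> * X u \<omega>) \<and> exp (\<alpha> * X u \<omega>) \<le> exp (\<bar>\<alpha>\<bar> * B)" if "a < u" "u \<le> b" for u
      using that by (auto simp: abs_le_iff minus_le_iff)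
    thus "exp (- (\<bar>\<alpha>\<bar> * B)) * (b - a) \<le> clock \<alpha> b \<omega> - clock \<alpha> a \<omega> \<and> clock \<alpha> b \<omega> - clock \<alpha> a \<omega> \<le> exp (\<bar>\<alpha>\<bar> * B) * (b - a)"
      using clock_bounds[OF \<omega> ab(1,2)] by blast
  qed auto
qed

lemma clock_0: "clock \<alpha> s \<omega> = 0" if "s \<le> 0"
proof -
  have "AE u in lborel. indicator {0..s} u *\<^sub>R exp (\<alpha> * X u \<omega>) = 0"
    using AE_lborel_singleton[of 0] by eventually_elim (use that in \<open>auto simp: indicator_def\<close>)
  thus ?thesis unfolding clock_def set_lebesgue_integral_def by (rule integral_eq_zero_AE)
qed

lemma clock_strict_mono:
  assumes \<omega>: "\<omega> \<in> space M" and "0 \<le> a" "a < b"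
  shows "clock \<alpha> a \<omega> < clock \<alpha> b \<omega>"
proof -
  obtain c C where "0 < c" "0 < C" "\<And>a' b'. 0 \<le> a' \<Longrightarrow> a' \<le> b' \<Longrightarrow> b' \<le> b \<Longrightarrow>
    c * (b' - a') \<le> clock \<alpha> b' \<omega> - clock \<alpha> a' \<omega> \<and> clock \<alpha> b' \<omega> - clock \<alpha> a' \<omega> \<le> C * (b' - a')"
    using clock_lipschitz[OF \<omega>, of b \<alpha>] by blast
  hence "c * (b - a) \<le> clock \<alpha> b \<omega> - clock \<alpha> a \<omega>" "0 < c * (b - a)" using assms by auto
  thus ?thesis by linarith
qed

lemma clock_mono:
  assumes \<omega>: "\<omega> \<in> space M"
  shows "mono (\<lambda>s. clock \<alpha> s \<omega>)"
proof
  fix a b :: real assume "a \<le> b"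
  have pos: "0 \<le> clock \<alpha> b \<omega>" unfolding clock_def by (simp add: set_lebesgue_integral_def)
  show "clock \<alpha> a \<omega> \<le> clock \<alpha> b \<omega>"
    using clock_strict_mono[OF \<omega>, of a b \<alpha>] clock_0[of a \<alpha> \<omega>] pos \<open>a \<le> b\<close> by (cases "0 \<le> a"; cases "a = b") auto
qed

lemma clock_continuous:
  assumes \<omega>: "\<omega> \<in> space M" and "0 < S"
  shows "continuous_on {0..S} (\<lambda>s. clock \<alpha> s \<omega>)"
proof -
  obtain c C where C: "0 < c" "0 < C" "\<And>a b. 0 \<le> a \<Longrightarrow> a \<le> b \<Longrightarrow> b \<le> S \<Longrightarrow>
    c * (b - a) \<le> clock \<alpha> b \<omega> - clock \<alpha> a \<omega> \<and> clock \<alpha> b \<omega> - clock \<alpha> a \<omega> \<le> C * (b - a)"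
    using clock_lipschitz[OF \<omega>, of S \<alpha>] by blast
  have "\<bar>clock \<alpha> b \<omega> - clock \<alpha> a \<omega>\<bar> \<le> C * \<bar>b - a\<bar>" if "a \<in> {0..S}" "b \<in> {0..S}" for a b
  proof -
    have *: "\<bar>clock \<alpha> b \<omega> - clock \<alpha> a \<omega>\<bar> \<le> C * \<bar>b - a\<bar>" if "0 \<le> a" "a \<le> b" "b \<le> S" for a b
      using C(3)[OF that] monoD[OF clock_mono[OF \<omega>] that(2), of \<alpha>] that by simp
    show ?thesis using *[of a b] *[of b a] that by (cases "a \<le> b") (auto simp: abs_minus_commute)
  qed
  thus ?thesis
    by (intro lipschitz_on_continuous_on[of C] lipschitz_onI) (use C in \<open>auto simp: dist_real_def\<close>)
qed

lemma clock_meas [measurable]: "clock \<alpha> s \<in> borel_measurable M"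
proof -
  have "(\<lambda>p. X (snd p) (fst p)) \<in> borel_measurable (M \<Otimes>\<^sub>M lborel)"
    using measurable_compose[OF measurable_Pair[OF measurable_snd measurable_fst] X_joint_meas] by simp
  hence "(\<lambda>\<omega>. LINT u|lborel. indicator {0..s} u *\<^sub>R exp (\<alpha> * X u \<omega>)) \<in> borel_measurable M"
    by (intro lborel.borel_measurable_lebesgue_integral) (simp add: split_beta')
  thus ?thesis by (simp add: clock_def[abs_def] set_lebesgue_integral_def)
qed

lemma clock_path_meas: "\<omega> \<in> space M \<Longrightarrow> (\<lambda>v. clock \<alpha> v \<omega>) \<in> borel_measurable borel"
  by (rule borel_measurable_mono) (rule clock_mono)

text \<open>Over the interval \<open>{0..<S}\<close>, grid sums are integrals of step functions.\<close>

lemma mesh_interval: "real (Suc m) * (S / real (Suc m)) = S"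
  by simp

lemma clock_riemann:
  assumes \<omega>: "\<omega> \<in> space M" and S: "0 < S"
  shows "(\<lambda>m. S / real (Suc m) * (\<Sum>j<Suc m. exp (\<alpha> * X ((real j + 1) * (S / real (Suc m))) \<omega>))) \<longlonglongrightarrow> clock \<alpha> S \<omega>"
proof -
  obtain C where C: "\<And>u. u \<in> {0..S} \<Longrightarrow> \<bar>X u \<omega>\<bar> \<le> C" using X_bounded by blast
  define hi where "hi m u = (real (nat \<lfloor>u / (S / real (Suc m))\<rfloor>) + 1) * (S / real (Suc m))" for m u
  have sum: "S / real (Suc m) * (\<Sum>j<Suc m. exp (\<alpha> * X ((real j + 1) * (S / real (Suc m))) \<omega>))
      = (LINT u|lborel. indicator {0..<S} u *\<^sub>R exp (\<alpha> * X (hi m u) \<omega>))" for m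
    using set_integral_step(2)[of "S / real (Suc m)" "Suc m" "\<lambda>j. exp (\<alpha> * X ((real j + 1) * (S / real (Suc m))) \<omega>)"] S
    unfolding mesh_interval set_lebesgue_integral_def hi_def by simp
  have meas: "(\<lambda>u. indicator {0..<S} u *\<^sub>R exp (\<alpha> * X (hi m u) \<omega>)) \<in> borel_measurable lborel" for m
    using set_integral_step(1)[of "S / real (Suc m)" "Suc m" "\<lambda>j. exp (\<alpha> * X ((real j + 1) * (S / real (Suc m))) \<omega>)"] S
    unfolding mesh_interval set_integrable_def hi_def by simp
  have "(\<lambda>m. LINT u|lborel. indicator {0..<S} u *\<^sub>R exp (\<alpha> * X (hi m u) \<omega>)) \<longlonglongrightarrow> (LINT u|lborel. indicator {0..<S} u *\<^sub>R exp (\<alpha> * X u \<omega>))"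
  proof (rule integral_dominated_convergence[where w = "\<lambda>u. indicator {0..<S} u *\<^sub>R exp (\<bar>\<alpha>\<bar> * C)"])
    show "(\<lambda>u. indicator {0..<S} u *\<^sub>R exp (\<alpha> * X u \<omega>)) \<in> borel_measurable lborel"
      using X_path_meas[OF \<omega>] by measurable
    show "integrable lborel (\<lambda>u. indicator {0..<S} u *\<^sub>R exp (\<bar>\<alpha>\<bar> * C))"
      using S by (intro integrable_scaleR_left integrable_real_indicator) auto
    show "AE u in lborel. (\<lambda>m. indicator {0..<S} u *\<^sub>R exp (\<alpha> * X (hi m u) \<omega>)) \<longlonglongrightarrow> indicator {0..<S} u *\<^sub>R exp (\<alpha> * X u \<omega>)"
    proof (rule AE_I2)
      fix u
      show "(\<lambda>m. indicator {0..<S} u *\<^sub>R exp (\<alpha> * X (hi m u) \<omega>)) \<longlonglongrightarrow> indicator {0..<S} u *\<^sub>R exp (\<alpha> * X u \<omega>)"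
      proof (cases "u \<in> {0..<S}")
        case True
        hence "(\<lambda>m. X (hi m u) \<omega>) \<longlonglongrightarrow> X u \<omega>"
          unfolding hi_def using S by (intro filterlim_compose[OF X_right filterlim_grid_right]) auto
        thus ?thesis by (intro tendsto_intros)
      qed simp
    qed
    show "AE u in lborel. norm (indicator {0..<S} u *\<^sub>R exp (\<alpha> * X (hi m u) \<omega>)) \<le> indicator {0..<S} u *\<^sub>R exp (\<bar>\<alpha>\<bar> * C)" for m
    proof (rule AE_I2)
      fix u
      show "norm (indicator {0..<S} u *\<^sub>R exp (\<alpha> * X (hi m u) \<omega>)) \<le> indicator {0..<S} u *\<^sub>R exp (\<bar>\<alpha>\<bar> * C)"
      proof (cases "u \<in> {0..<S}")
        case True
        define h where "h = S / real (Suc m)"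
        have h: "0 < h" "real (Suc m) * h = S" using S by (auto simp: h_def)
        have "real (nat \<lfloor>u / h\<rfloor>) * h < real (Suc m) * h"
          using grid_point(1)[OF h(1), of u] True h(2) by auto
        hence "nat \<lfloor>u / h\<rfloor> < Suc m" using h(1) by simp
        hence "(real (nat \<lfloor>u / h\<rfloor>) + 1) * h \<le> real (Suc m) * h" using h(1) by (intro mult_right_mono) auto
        hence "hi m u \<in> {0..S}" using h unfolding hi_def h_def[symmetric] by auto
        hence "\<bar>\<alpha>\<bar> * \<bar>X (hi m u) \<omega>\<bar> \<le> \<bar>\<alpha>\<bar> * C" by (intro mult_left_mono C) auto
        thus ?thesis using abs_ge_self[of "\<alpha> * X (hi m u) \<omega>"] True by (simp add: abs_mult)
      qed simp
    qed
  qed (rule meas)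
  moreover have "(LINT u|lborel. indicator {0..<S} u *\<^sub>R exp (\<alpha> * X u \<omega>)) = clock \<alpha> S \<omega>"
    unfolding clock_def set_lebesgue_integral_def
  proof (rule integral_cong_AE)
    show "AE u in lborel. indicator {0..<S} u *\<^sub>R exp (\<alpha> * X u \<omega>) = indicator {0..S} u *\<^sub>R exp (\<alpha> * X u \<omega>)"
      using AE_lborel_singleton[of S] by eventually_elim (auto simp: indicator_def)
  qed (use X_path_meas[OF \<omega>] in measurable)
  ultimately show ?thesis unfolding sum by simp
qed

lemma uncorrelated_limit:
  fixes W :: "nat \<Rightarrow> 'a \<Rightarrow> complex"
  assumes [measurable]: "\<And>n. W n \<in> borel_measurable M" "W' \<in> borel_measurable M" "H \<in> borel_measurable M"
    and lim: "\<And>\<omega>. \<omega> \<in> space M \<Longrightarrow> (\<lambda>n. W n \<omega>) \<longlonglongrightarrow> W' \<omega>"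
    and bound: "\<And>n \<omega>. cmod (W n \<omega>) \<le> 1" "\<And>\<omega>. cmod (H \<omega>) \<le> 1"
    and uncorrelated: "\<And>n. (CLINT \<omega>|M. W n \<omega> * H \<omega>) = (CLINT \<omega>|M. W n \<omega>) * (CLINT \<omega>|M. H \<omega>)"
  shows "(CLINT \<omega>|M. W' \<omega> * H \<omega>) = (CLINT \<omega>|M. W' \<omega>) * (CLINT \<omega>|M. H \<omega>)"
proof (rule LIMSEQ_unique)
  show "(\<lambda>n. CLINT \<omega>|M. W n \<omega> * H \<omega>) \<longlonglongrightarrow> (CLINT \<omega>|M. W' \<omega> * H \<omega>)"
    by (rule integral_dominated_convergence[where w = "\<lambda>_. 1"])
       (use lim bound in \<open>auto intro!: tendsto_mult_right mult_le_one simp: norm_mult\<close>)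
  have "(\<lambda>n. CLINT \<omega>|M. W n \<omega>) \<longlonglongrightarrow> (CLINT \<omega>|M. W' \<omega>)"
    by (rule integral_dominated_convergence[where w = "\<lambda>_. 1"]) (use lim bound in auto)
  thus "(\<lambda>n. CLINT \<omega>|M. W n \<omega> * H \<omega>) \<longlonglongrightarrow> (CLINT \<omega>|M. W' \<omega>) * (CLINT \<omega>|M. H \<omega>)"
    unfolding uncorrelated by (intro tendsto_intros)
qed

text \<open>The clock at time \<open>s\<close> is a limit of functions of increments before \<open>s\<close>, hence independent of
  the increments after \<open>s\<close>.\<close>

lemma clock_indep:
  fixes h :: "real \<Rightarrow> complex"
  assumes su: "0 \<le> s" "s \<le> u" and h [measurable]: "h \<in> borel_measurable borel" and h1: "\<And>y. cmod (h y) \<le> 1"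
  shows "(CLINT \<omega>|M. of_bool (clock \<alpha> s \<omega> < t) * iexp (\<kappa> * X s \<omega>) * h (X u \<omega> - X s \<omega>))
      = (CLINT \<omega>|M. of_bool (clock \<alpha> s \<omega> < t) * iexp (\<kappa> * X s \<omega>)) * (CLINT \<omega>|M. h (X u \<omega> - X s \<omega>))"
proof (cases "s = 0")
  case True
  show ?thesis unfolding True by (cases "0 < t") (simp_all add: clock_0 X_nonpos prob_space)
next
  case False
  hence s: "0 < s" using su by simp
  define R where "R m \<omega> = s / real (Suc m) * (\<Sum>j<Suc m. exp (\<alpha> * X ((real j + 1) * (s / real (Suc m))) \<omega>))" for m \<omega>
  have [measurable]: "R m \<in> borel_measurable M" for m unfolding R_def[abs_def] by measurable
  \<comment> \<open>Continuous approximation of the indicator of \<open>x < t\<close>, so that it passes to the limit of Riemann sums.\<close>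
  define \<phi> where "\<phi> k x = max 0 (min 1 (real k * (t - x)))" for k x
  have \<phi>: "0 \<le> \<phi> k x" "\<phi> k x \<le> 1" for k x by (auto simp: \<phi>_def)
  have [measurable]: "\<phi> k \<in> borel_measurable borel" for k unfolding \<phi>_def[abs_def] by measurable
  have step: "(CLINT \<omega>|M. (complex_of_real (\<phi> k (R m \<omega>)) * iexp (\<kappa> * X s \<omega>)) * h (X u \<omega> - X s \<omega>))
      = (CLINT \<omega>|M. complex_of_real (\<phi> k (R m \<omega>)) * iexp (\<kappa> * X s \<omega>)) * (CLINT \<omega>|M. h (X u \<omega> - X s \<omega>))" for k m
  proof -
    define l where "l = s / real (Suc m)"
    have l: "0 < l" "real (Suc m) * l = s" using s by (auto simp: l_def)
    define T where "T j = (if j \<le> Suc m then real j * l else u)" for j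
    have "0 \<le> T 0" "mono T"
    proof -
      have "real j * l \<le> s" if "j \<le> Suc m" for j
        unfolding l(2)[symmetric] using that l(1) by (intro mult_right_mono) auto
      thus "mono T" unfolding mono_def T_def using l su by (auto intro!: mult_right_mono order_trans[OF _ su(2)])
    qed (simp add: T_def)
    define D where "D j \<omega> = X (T (Suc j)) \<omega> - X (T j) \<omega>" for j \<omega>
    have indep: "indep_vars (\<lambda>_. borel) D UNIV"
      using X_levy \<open>0 \<le> T 0\<close> \<open>mono T\<close> by (simp add: levy_process_def D_def[abs_def])
    have T0: "X (T 0) \<omega> = 0" for \<omega> by (simp add: T_def X_nonpos)
    have XD: "X ((real j + 1) * l) \<omega> = (\<Sum>i<Suc j. D i \<omega>)" if "j < Suc m" for j \<omega>
    proof -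
      have "(\<Sum>i<Suc j. D i \<omega>) = X (T (Suc j)) \<omega> - X (T 0) \<omega>" unfolding D_def by (rule sum_lessThan_telescope)
      thus ?thesis using that unfolding T0 by (simp add: T_def add.commute)
    qed
    define f1 where "f1 d = complex_of_real (\<phi> k (l * (\<Sum>j<Suc m. exp (\<alpha> * (\<Sum>i<Suc j. d i))))) * iexp (\<kappa> * (\<Sum>i<Suc m. d i))" for d :: "nat \<Rightarrow> real"
    define f2 where "f2 d = h (d (Suc m))" for d :: "nat \<Rightarrow> real"
    have sum_meas: "(\<lambda>d. \<Sum>i<Suc j. d i) \<in> borel_measurable (PiM {..<Suc m} (\<lambda>_. borel :: real measure))" if "j < Suc m" for j
      using that by (intro borel_measurable_sum measurable_component_singleton) auto
    have "indep_var borel (f1 \<circ> (\<lambda>\<omega>. \<lambda>i\<in>{..<Suc m}. D i \<omega>)) borel (f2 \<circ> (\<lambda>\<omega>. \<lambda>i\<in>{Suc m}. D i \<omega>))"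
    proof (rule indep_var_compose[OF indep_var_restrict[OF indep]])
      have [measurable]: "(\<lambda>d. \<Sum>j<Suc m. exp (\<alpha> * (\<Sum>i<Suc j. d i))) \<in> borel_measurable (PiM {..<Suc m} (\<lambda>_. borel :: real measure))"
        by (intro borel_measurable_sum measurable_compose[OF _ borel_measurable_exp] borel_measurable_times sum_meas) auto
      note [measurable] = sum_meas[of m, simplified]
      show "f1 \<in> borel_measurable (PiM {..<Suc m} (\<lambda>_. borel))"
        unfolding f1_def[abs_def] by measurable
      show "f2 \<in> borel_measurable (PiM {Suc m} (\<lambda>_. borel))"
        unfolding f2_def[abs_def]
        by (rule measurable_compose[OF _ h]) (rule measurable_component_singleton, simp)
    qed auto
    moreover have "(f1 \<circ> (\<lambda>\<omega>. \<lambda>i\<in>{..<Suc m}. D i \<omega>)) = (\<lambda>\<omega>. complex_of_real (\<phi> k (R m \<omega>)) * iexp (\<kappa> * X s \<omega>))"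
    proof
      fix \<omega>
      have "(\<Sum>j<Suc m. exp (\<alpha> * (\<Sum>i<Suc j. (\<lambda>i\<in>{..<Suc m}. D i \<omega>) i))) = (\<Sum>j<Suc m. exp (\<alpha> * X ((real j + 1) * l) \<omega>))"
        by (intro sum.cong refl arg_cong[where f = exp] arg_cong[where f = "(*) \<alpha>"]) (auto simp: XD intro!: sum.cong)
      moreover have "(\<Sum>i<Suc m. (\<lambda>i\<in>{..<Suc m}. D i \<omega>) i) = X s \<omega>"
        using XD[of m \<omega>] l(2) by (simp add: add.commute)
      ultimately show "(f1 \<circ> (\<lambda>\<omega>. \<lambda>i\<in>{..<Suc m}. D i \<omega>)) \<omega> = complex_of_real (\<phi> k (R m \<omega>)) * iexp (\<kappa> * X s \<omega>)"
        by (simp only: comp_def f1_def R_def l_def)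
    qed
    moreover have "(f2 \<circ> (\<lambda>\<omega>. \<lambda>i\<in>{Suc m}. D i \<omega>)) = (\<lambda>\<omega>. h (X u \<omega> - X s \<omega>))"
      using l(2) by (auto simp: f2_def D_def T_def fun_eq_iff)
    ultimately have "indep_var borel (\<lambda>\<omega>. complex_of_real (\<phi> k (R m \<omega>)) * iexp (\<kappa> * X s \<omega>)) borel (\<lambda>\<omega>. h (X u \<omega> - X s \<omega>))"
      by simp
    thus ?thesis
      by (rule indep_var_lebesgue_integral) (auto intro!: integrable_const_bound[of _ 1] simp: norm_mult \<phi> h1)
  qed
  have limR: "(CLINT \<omega>|M. (complex_of_real (\<phi> k (clock \<alpha> s \<omega>)) * iexp (\<kappa> * X s \<omega>)) * h (X u \<omega> - X s \<omega>))
      = (CLINT \<omega>|M. complex_of_real (\<phi> k (clock \<alpha> s \<omega>)) * iexp (\<kappa> * X s \<omega>)) * (CLINT \<omega>|M. h (X u \<omega> - X s \<omega>))" for k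
  proof (rule uncorrelated_limit[OF _ _ _ _ _ _ step])
    fix \<omega> assume "\<omega> \<in> space M"
    from clock_riemann[OF this s] have "(\<lambda>m. R m \<omega>) \<longlonglongrightarrow> clock \<alpha> s \<omega>" by (simp only: R_def)
    thus "(\<lambda>m. complex_of_real (\<phi> k (R m \<omega>)) * iexp (\<kappa> * X s \<omega>)) \<longlonglongrightarrow> complex_of_real (\<phi> k (clock \<alpha> s \<omega>)) * iexp (\<kappa> * X s \<omega>)"
      unfolding \<phi>_def by (intro tendsto_intros)
  qed (auto simp: norm_mult \<phi> h1)
  show ?thesis
  proof (rule uncorrelated_limit[OF _ _ _ _ _ _ limR])
    fix \<omega>
    have "(\<lambda>k. \<phi> k x) \<longlonglongrightarrow> of_bool (x < t)" for x
    proof (cases "x < t")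
      case True
      obtain K :: nat where K: "1 / (t - x) < real K" using reals_Archimedean2 by blast
      have "eventually (\<lambda>k. \<phi> k x = 1) sequentially"
        using eventually_ge_at_top[of K]
      proof eventually_elim
        case (elim k)
        hence "1 / (t - x) < real k" using K by linarith
        thus ?case using True by (simp add: \<phi>_def field_simps)
      qed
      thus ?thesis using True by (simp add: tendsto_eventually)
    next
      case False
      hence "\<phi> k x = 0" for k
        using mult_nonneg_nonpos[of "real k" "t - x"] by (simp add: \<phi>_def min_def)
      thus ?thesis using False by simp
    qed
    hence "(\<lambda>k. complex_of_real (\<phi> k (clock \<alpha> s \<omega>))) \<longlonglongrightarrow> complex_of_real (of_bool (clock \<alpha> s \<omega> < t))"
      by (rule tendsto_of_real)
    from tendsto_mult[OF this tendsto_const]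
    show "(\<lambda>k. complex_of_real (\<phi> k (clock \<alpha> s \<omega>)) * iexp (\<kappa> * X s \<omega>)) \<longlonglongrightarrow> of_bool (clock \<alpha> s \<omega> < t) * iexp (\<kappa> * X s \<omega>)"
      by (cases "clock \<alpha> s \<omega> < t") simp_all
  qed (auto simp: norm_mult \<phi> h1)
qed

text \<open>The time at which the clock reaches \<open>t\<close>, cut off at \<open>S\<close>, is the Lebesgue measure of the
  set of times in \<open>{0..<S}\<close> before the clock has reached \<open>t\<close>.\<close>

definition hitting :: "real \<Rightarrow> real \<Rightarrow> real \<Rightarrow> 'a \<Rightarrow> real" where
  "hitting \<alpha> S t \<omega> = (LINT v:{0..<S}|lborel. of_bool (clock \<alpha> v \<omega> < t))"

lemma hitting_eq_lamperti_time:
  assumes \<omega>: "\<omega> \<in> space M" and S: "0 < S" and t: "0 \<le> t" "t \<le> clock \<alpha> S \<omega>"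
  shows "hitting \<alpha> S t \<omega> = lamperti_time \<alpha> (\<lambda>u. X u \<omega>) t"
proof -
  obtain s0 where s0: "0 \<le> s0" "s0 \<le> S" "clock \<alpha> s0 \<omega> = t"
    using IVT'[of "\<lambda>s. clock \<alpha> s \<omega>" 0 t S] clock_continuous[OF \<omega> S, of \<alpha>] t S by (auto simp: clock_0)
  have less: "clock \<alpha> v \<omega> < t \<longleftrightarrow> v < s0" if "0 \<le> v" for v
    using clock_strict_mono[OF \<omega>, of v s0 \<alpha>] clock_strict_mono[OF \<omega>, of s0 v \<alpha>] that s0
    by (cases v s0 rule: linorder_cases) auto
  have "lamperti_set \<alpha> (\<lambda>u. X u \<omega>) t = {s0..}"
    unfolding lamperti_set_def clock_def[symmetric] using less s0(1) by (auto simp: not_less[symmetric])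
  hence "lamperti_time \<alpha> (\<lambda>u. X u \<omega>) t = s0" by (simp add: lamperti_time_def cInf_atLeast)
  moreover have "hitting \<alpha> S t \<omega> = (LINT v|lborel. indicator {0..<s0} v)"
    unfolding hitting_def set_lebesgue_integral_def
    by (rule Bochner_Integration.integral_cong) (use less s0 in \<open>auto simp: indicator_def\<close>)
  ultimately show ?thesis using s0 by simp
qed

lemma X_tendsto_from_right:
  assumes lim: "T \<longlonglongrightarrow> T0" and ge: "\<And>m. T0 \<le> T m"
  shows "(\<lambda>m. X (T m) \<omega>) \<longlonglongrightarrow> X T0 \<omega>"
proof (rule tendstoI)
  fix e :: real assume e: "0 < e"
  have "eventually (\<lambda>s. dist (X s \<omega>) (X T0 \<omega>) < e) (at_right T0)" using X_right e by (rule tendstoD)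
  then obtain b where b: "T0 < b" "\<And>s. T0 < s \<Longrightarrow> s < b \<Longrightarrow> dist (X s \<omega>) (X T0 \<omega>) < e"
    unfolding eventually_at_right_field by blast
  have "eventually (\<lambda>m. T m < b) sequentially" using order_tendstoD(2)[OF lim b(1)] .
  thus "eventually (\<lambda>m. dist (X (T m) \<omega>) (X T0 \<omega>) < e) sequentially"
  proof eventually_elim
    case (elim m)
    show ?case using b(2)[of "T m"] ge[of m] e elim by (cases "T m = T0") auto
  qed
qed

lemma AE_clock_neq:
  assumes \<omega>: "\<omega> \<in> space M"
  shows "AE v in lborel. v \<in> {0..<S} \<longrightarrow> clock \<alpha> v \<omega> \<noteq> t"
proof (cases "\<exists>v0\<in>{0..<S}. clock \<alpha> v0 \<omega> = t")
  case True
  then obtain v0 where v0: "0 \<le> v0" "clock \<alpha> v0 \<omega> = t" by auto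
  show ?thesis using AE_lborel_singleton[of v0]
  proof eventually_elim
    case (elim v)
    show ?case
      using clock_strict_mono[OF \<omega>, of v v0 \<alpha>] clock_strict_mono[OF \<omega>, of v0 v \<alpha>] elim v0 by (auto simp: neq_iff)
  qed
qed auto

lemma clock_grid_limit:
  assumes \<omega>: "\<omega> \<in> space M" and S: "0 < S" and v: "v \<in> {0..<S}" "clock \<alpha> v \<omega> \<noteq> t"
  shows "eventually (\<lambda>m. (clock \<alpha> (real (nat \<lfloor>v / (S / real (Suc m))\<rfloor>) * (S / real (Suc m))) \<omega> < t) = (clock \<alpha> v \<omega> < t)) sequentially"
proof -
  define lo where "lo m = real (nat \<lfloor>v / (S / real (Suc m))\<rfloor>) * (S / real (Suc m))" for m
  have lo: "lo \<longlonglongrightarrow> v" "\<And>m. lo m \<le> v" "\<And>m. 0 \<le> lo m"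
  proof -
    show "lo \<longlonglongrightarrow> v" unfolding lo_def by (rule tendsto_grid_left) (use S v in auto)
    show "lo m \<le> v" for m unfolding lo_def by (rule grid_point(1)) (use S v in auto)
    show "0 \<le> lo m" for m unfolding lo_def using S by (intro mult_nonneg_nonneg) auto
  qed
  have "(\<lambda>m. clock \<alpha> (lo m) \<omega>) \<longlonglongrightarrow> clock \<alpha> v \<omega>"
    by (rule continuous_on_tendsto_compose[OF clock_continuous[OF \<omega> S] lo(1)])
       (use v lo(2,3) in \<open>auto intro!: always_eventually order_trans[OF lo(2)]\<close>)
  note lim = order_tendstoD[OF this]
  show ?thesis
  proof (cases "clock \<alpha> v \<omega> < t")
    case True
    from lim(2)[OF this] show ?thesis unfolding lo_def[symmetric] by eventually_elim (use True in simp)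
  next
    case False
    hence "t < clock \<alpha> v \<omega>" using v(2) by simp
    from lim(1)[OF this] show ?thesis unfolding lo_def[symmetric] by eventually_elim (use False in simp)
  qed
qed

text \<open>Dynkin's formula for the exponential of the process stopped when its clock reaches \<open>t\<close> or
  at time \<open>S\<close>: on a grid it follows from the independence of the next increment, and the mesh
  tends to \<open>0\<close>. The first grid points past the stopping time are used, since the paths are
  right-continuous.\<close>

lemma dynkin_clock:
  assumes S: "0 < S" and t: "0 < t"
  shows "(CLINT \<omega>|M. iexp (\<theta> * X (hitting \<alpha> S t \<omega>) \<omega>)) - 1
      = \<Psi> \<theta> * (CLINT \<omega>|M. (CLINT v:{0..<S}|lborel. of_bool (clock \<alpha> v \<omega> < t) * iexp (\<theta> * X v \<omega>)))"
    "(\<lambda>\<omega>. iexp (\<theta> * X (hitting \<alpha> S t \<omega>) \<omega>)) \<in> borel_measurable M"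
    "(\<lambda>\<omega>. CLINT v:{0..<S}|lborel. of_bool (clock \<alpha> v \<omega> < t) * iexp (\<theta> * X v \<omega>)) \<in> borel_measurable M"
proof -
  define h where "h m = S / real (Suc m)" for m
  have h: "0 < h m" "real (Suc m) * h m = S" for m using S by (auto simp: h_def)
  define lo where "lo m v = real (nat \<lfloor>v / h m\<rfloor>) * h m" for m v
  define hi where "hi m v = (real (nat \<lfloor>v / h m\<rfloor>) + 1) * h m" for m v
  define I where "I m k \<omega> \<longleftrightarrow> clock \<alpha> (real k * h m) \<omega> < t" for m k \<omega>
  have I_meas [measurable]: "Measurable.pred M (I m k)" for m k unfolding I_def[abs_def] by measurable
  define Z where "Z m \<omega> = (\<Sum>k<Suc m. of_bool (I m k \<omega>) * (iexp (\<theta> * X ((real k + 1) * h m) \<omega>) - iexp (\<theta> * X (real k * h m) \<omega>)))" for m \<omega>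
  define V where "V m \<omega> = complex_of_real (h m) * (\<Sum>k<Suc m. of_bool (I m k \<omega>) * iexp (\<theta> * X ((real k + 1) * h m) \<omega>))" for m \<omega>
  define VV where "VV \<omega> = (CLINT v:{0..<S}|lborel. of_bool (clock \<alpha> v \<omega> < t) * iexp (\<theta> * X v \<omega>))" for \<omega>
  define T where "T m \<omega> = h m * (\<Sum>k<Suc m. of_bool (I m k \<omega>))" for m \<omega>
  have [measurable]: "Z m \<in> borel_measurable M" "V m \<in> borel_measurable M" for m
    unfolding Z_def[abs_def] V_def[abs_def] by measurable
  have V_step: "V m \<omega> = (CLINT v|lborel. indicator {0..<S} v *\<^sub>R (of_bool (clock \<alpha> (lo m v) \<omega> < t) * iexp (\<theta> * X (hi m v) \<omega>)))"
    and V_step_meas: "(\<lambda>v. indicator {0..<S} v *\<^sub>R (of_bool (clock \<alpha> (lo m v) \<omega> < t) * iexp (\<theta> * X (hi m v) \<omega>))) \<in> borel_measurable lborel" for m \<omega>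
    using set_integral_step[OF h(1)[of m], of "Suc m" "\<lambda>k. of_bool (I m k \<omega>) * iexp (\<theta> * X ((real k + 1) * h m) \<omega>)"]
    unfolding h(2) set_lebesgue_integral_def set_integrable_def lo_def hi_def I_def V_def scaleR_conv_of_real[of "h m"]
    by (simp_all only: borel_measurable_integrable)
  have T_step: "T m \<omega> = (LINT v|lborel. indicator {0..<S} v *\<^sub>R of_bool (clock \<alpha> (lo m v) \<omega> < t))"
    and T_step_int: "integrable lborel (\<lambda>v. indicator {0..<S} v *\<^sub>R of_bool (clock \<alpha> (lo m v) \<omega> < t) :: real)" for m \<omega>
    using set_integral_step[OF h(1)[of m], of "Suc m" "\<lambda>k. of_bool (I m k \<omega>) :: real"]
    unfolding h(2) set_lebesgue_integral_def set_integrable_def lo_def I_def T_def real_scaleR_def[of "h m"]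
    by (simp_all only:)
  have ind_int: "integrable lborel (\<lambda>v. indicator {0..<S} v :: real)" using S by (intro integrable_real_indicator) auto
  have grid: "eventually (\<lambda>m. (clock \<alpha> (lo m v) \<omega> < t) = (clock \<alpha> v \<omega> < t)) sequentially"
    if "\<omega> \<in> space M" "v \<in> {0..<S}" "clock \<alpha> v \<omega> \<noteq> t" for v \<omega>
    using clock_grid_limit[OF that(1) S that(2,3)] unfolding lo_def h_def .
  have V_lim: "(\<lambda>m. V m \<omega>) \<longlonglongrightarrow> VV \<omega>" if \<omega>: "\<omega> \<in> space M" for \<omega>
    unfolding V_step VV_def set_lebesgue_integral_def
  proof (rule integral_dominated_convergence[where w = "\<lambda>v. indicator {0..<S} v"])
    show "(\<lambda>v. indicator {0..<S} v *\<^sub>R (of_bool (clock \<alpha> v \<omega> < t) * iexp (\<theta> * X v \<omega>))) \<in> borel_measurable lborel"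
      using X_path_meas[OF \<omega>] clock_path_meas[OF \<omega>, of \<alpha>] by measurable
    show "AE v in lborel. (\<lambda>m. indicator {0..<S} v *\<^sub>R (of_bool (clock \<alpha> (lo m v) \<omega> < t) * iexp (\<theta> * X (hi m v) \<omega>)))
        \<longlonglongrightarrow> indicator {0..<S} v *\<^sub>R (of_bool (clock \<alpha> v \<omega> < t) * iexp (\<theta> * X v \<omega>))"
      using AE_clock_neq[OF \<omega>, of S \<alpha> t]
    proof eventually_elim
      case (elim v)
      show ?case
      proof (cases "v \<in> {0..<S}")
        case True
        have "(\<lambda>m. of_bool (clock \<alpha> (lo m v) \<omega> < t) :: complex) \<longlonglongrightarrow> of_bool (clock \<alpha> v \<omega> < t)"
          using grid[OF \<omega> True] elim True by (intro tendsto_eventually) (auto elim: eventually_mono)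
        moreover have "(\<lambda>m. X (hi m v) \<omega>) \<longlonglongrightarrow> X v \<omega>"
          unfolding hi_def h_def using S True by (intro filterlim_compose[OF X_right filterlim_grid_right]) auto
        ultimately show ?thesis by (intro tendsto_intros)
      qed simp
    qed
  qed (use V_step_meas ind_int in \<open>auto simp: indicator_def norm_mult\<close>)
  have T_lim: "(\<lambda>m. T m \<omega>) \<longlonglongrightarrow> hitting \<alpha> S t \<omega>" if \<omega>: "\<omega> \<in> space M" for \<omega>
    unfolding T_step hitting_def set_lebesgue_integral_def
  proof (rule integral_dominated_convergence[where w = "\<lambda>v. indicator {0..<S} v"])
    show "(\<lambda>v. indicator {0..<S} v *\<^sub>R of_bool (clock \<alpha> v \<omega> < t) :: real) \<in> borel_measurable lborel"
      using clock_path_meas[OF \<omega>, of \<alpha>] by measurable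
    show "AE v in lborel. (\<lambda>m. indicator {0..<S} v *\<^sub>R of_bool (clock \<alpha> (lo m v) \<omega> < t) :: real)
        \<longlonglongrightarrow> indicator {0..<S} v *\<^sub>R of_bool (clock \<alpha> v \<omega> < t)"
      using AE_clock_neq[OF \<omega>, of S \<alpha> t]
    proof eventually_elim
      case (elim v)
      show ?case
      proof (cases "v \<in> {0..<S}")
        case True
        thus ?thesis using grid[OF \<omega> True] elim by (intro tendsto_eventually) (auto elim: eventually_mono)
      qed simp
    qed
  qed (use T_step_int ind_int in \<open>auto simp: indicator_def\<close>)
  have T_ge: "hitting \<alpha> S t \<omega> \<le> T m \<omega>" if \<omega>: "\<omega> \<in> space M" for m \<omega>
    unfolding T_step hitting_def set_lebesgue_integral_def
  proof (rule integral_mono[OF _ T_step_int])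
    show "integrable lborel (\<lambda>v. indicator {0..<S} v *\<^sub>R of_bool (clock \<alpha> v \<omega> < t) :: real)"
      by (rule Bochner_Integration.integrable_bound[OF ind_int])
         (use clock_path_meas[OF \<omega>, of \<alpha>] in \<open>auto simp: indicator_def\<close>)
    fix v
    show "indicator {0..<S} v *\<^sub>R of_bool (clock \<alpha> v \<omega> < t) \<le> (indicator {0..<S} v *\<^sub>R of_bool (clock \<alpha> (lo m v) \<omega> < t) :: real)"
    proof (cases "v \<in> {0..<S}")
      case True
      have "lo m v \<le> v" unfolding lo_def using True by (intro grid_point(1) h) auto
      from monoD[OF clock_mono[OF \<omega>] this, of \<alpha>] show ?thesis by (auto simp: indicator_def)
    qed simp
  qed
  \<comment> \<open>The clock increases, so the sum telescopes up to the first grid time past \<open>t\<close>.\<close>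
  have Z_eq: "Z m \<omega> = iexp (\<theta> * X (T m \<omega>) \<omega>) - 1" if \<omega>: "\<omega> \<in> space M" for m \<omega>
  proof -
    have I_anti: "I m j \<omega>" if "I m k \<omega>" "j \<le> k" for j k
    proof -
      have "real j * h m \<le> real k * h m" using that h(1)[of m] by (intro mult_right_mono) auto
      from monoD[OF clock_mono[OF \<omega>] this, of \<alpha>] that show ?thesis by (simp add: I_def)
    qed
    have "\<exists>N\<le>n. \<forall>k<n. I m k \<omega> \<longleftrightarrow> k < N" for n
    proof (induction n)
      case (Suc n)
      then obtain N where N: "N \<le> n" "\<And>k. k < n \<Longrightarrow> I m k \<omega> \<longleftrightarrow> k < N" by blast
      show ?case
      proof (cases "I m n \<omega>")
        case True
        thus ?thesis using I_anti by (intro exI[of _ "Suc n"]) (auto simp: less_Suc_eq)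
      next
        case False
        thus ?thesis using N by (intro exI[of _ N]) (auto simp: less_Suc_eq)
      qed
    qed simp
    then obtain N where N: "N \<le> Suc m" "\<And>k. k < Suc m \<Longrightarrow> I m k \<omega> \<longleftrightarrow> k < N" by blast
    have sub: "(\<Sum>k<Suc m. of_bool (I m k \<omega>) * f k) = (\<Sum>k<N. f k)" for f :: "nat \<Rightarrow> complex"
      using N by (intro sum.mono_neutral_cong_right) auto
    have "(\<Sum>k<Suc m. of_bool (I m k \<omega>) :: real) = (\<Sum>k<N. 1)"
      using N by (intro sum.mono_neutral_cong_right) auto
    hence TN: "T m \<omega> = real N * h m" by (simp add: T_def)
    have "Z m \<omega> = (\<Sum>k<N. iexp (\<theta> * X (real (Suc k) * h m) \<omega>) - iexp (\<theta> * X (real k * h m) \<omega>))"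
      unfolding Z_def sub by (simp add: add.commute)
    also have "\<dots> = iexp (\<theta> * X (real N * h m) \<omega>) - iexp (\<theta> * X (real 0 * h m) \<omega>)"
      by (rule sum_lessThan_telescope)
    finally show ?thesis by (simp add: TN X_nonpos)
  qed
  have Z_lim: "(\<lambda>m. Z m \<omega>) \<longlonglongrightarrow> iexp (\<theta> * X (hitting \<alpha> S t \<omega>) \<omega>) - 1" if \<omega>: "\<omega> \<in> space M" for \<omega>
    unfolding Z_eq[OF \<omega>] by (intro tendsto_intros X_tendsto_from_right T_lim[OF \<omega>] T_ge[OF \<omega>])
  have V_bound: "cmod (V m \<omega>) \<le> S" for m \<omega>
  proof -
    have "cmod (\<Sum>k<Suc m. of_bool (I m k \<omega>) * iexp (\<theta> * X ((real k + 1) * h m) \<omega>)) \<le> (\<Sum>k<Suc m. 1)"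
      by (rule sum_norm_le) (auto simp: norm_mult)
    hence "cmod (V m \<omega>) \<le> h m * real (Suc m)" unfolding V_def norm_mult using h(1)[of m] by (simp add: mult_left_mono)
    thus ?thesis using h(2)[of m] by (simp add: mult.commute)
  qed
  have Z_meas': "(\<lambda>\<omega>. iexp (\<theta> * X (hitting \<alpha> S t \<omega>) \<omega>) - 1) \<in> borel_measurable M"
    by (rule borel_measurable_LIMSEQ_metric[OF _ Z_lim]) measurable
  have "(\<lambda>\<omega>. (iexp (\<theta> * X (hitting \<alpha> S t \<omega>) \<omega>) - 1) + 1) \<in> borel_measurable M"
    by (intro borel_measurable_add Z_meas') simp
  thus meas [measurable]: "(\<lambda>\<omega>. iexp (\<theta> * X (hitting \<alpha> S t \<omega>) \<omega>)) \<in> borel_measurable M" by simp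
  have VV_meas: "VV \<in> borel_measurable M"
    by (rule borel_measurable_LIMSEQ_metric[OF _ V_lim]) measurable
  thus "(\<lambda>\<omega>. CLINT v:{0..<S}|lborel. of_bool (clock \<alpha> v \<omega> < t) * iexp (\<theta> * X v \<omega>)) \<in> borel_measurable M"
    by (simp add: VV_def[abs_def])
  have E_step: "(CLINT \<omega>|M. Z m \<omega>) = ((1 - exp (- (complex_of_real (h m) * \<Psi> \<theta>))) / complex_of_real (h m)) * (CLINT \<omega>|M. V m \<omega>)" for m
  proof -
    let ?c = "exp (complex_of_real (h m) * \<Psi> \<theta>)"
    have int [simp]: "integrable M (\<lambda>\<omega>. of_bool (I m k \<omega>) * iexp (\<theta> * X s \<omega>))" for k s
      by (rule integrable_const_bound[of _ 1]) (auto simp: norm_mult)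
    have one: "(CLINT \<omega>|M. of_bool (I m k \<omega>) * iexp (\<theta> * X ((real k + 1) * h m) \<omega>)) = ?c * (CLINT \<omega>|M. of_bool (I m k \<omega>) * iexp (\<theta> * X (real k * h m) \<omega>))" for k
    proof -
      have le: "0 \<le> real k * h m" "real k * h m \<le> (real k + 1) * h m" using h(1)[of m] by (auto simp: algebra_simps)
      have "(CLINT \<omega>|M. of_bool (I m k \<omega>) * iexp (\<theta> * X ((real k + 1) * h m) \<omega>))
         = (CLINT \<omega>|M. of_bool (clock \<alpha> (real k * h m) \<omega> < t) * iexp (\<theta> * X (real k * h m) \<omega>) * iexp (\<theta> * (X ((real k + 1) * h m) \<omega> - X (real k * h m) \<omega>)))"
        by (intro Bochner_Integration.integral_cong refl) (simp add: I_def exp_add[symmetric] algebra_simps)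
      also have "\<dots> = (CLINT \<omega>|M. of_bool (I m k \<omega>) * iexp (\<theta> * X (real k * h m) \<omega>)) * (CLINT \<omega>|M. iexp (\<theta> * (X ((real k + 1) * h m) \<omega> - X (real k * h m) \<omega>)))"
        unfolding I_def by (rule clock_indep[OF le]) auto
      also have "(CLINT \<omega>|M. iexp (\<theta> * (X ((real k + 1) * h m) \<omega> - X (real k * h m) \<omega>))) = ?c"
        using increments_exponent_single[OF X_incr le, of \<theta>] by (simp add: algebra_simps)
      finally show ?thesis by simp
    qed
    have "(CLINT \<omega>|M. Z m \<omega>) = (\<Sum>k<Suc m. (CLINT \<omega>|M. of_bool (I m k \<omega>) * iexp (\<theta> * X ((real k + 1) * h m) \<omega>))
        - (CLINT \<omega>|M. of_bool (I m k \<omega>) * iexp (\<theta> * X (real k * h m) \<omega>)))"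
      unfolding Z_def right_diff_distrib by (subst Bochner_Integration.integral_sum) (auto simp del: of_real_mult of_real_add sum.lessThan_Suc)
    also have "\<dots> = (\<Sum>k<Suc m. (1 - exp (- (complex_of_real (h m) * \<Psi> \<theta>))) * (CLINT \<omega>|M. of_bool (I m k \<omega>) * iexp (\<theta> * X ((real k + 1) * h m) \<omega>)))"
    proof (intro sum.cong refl)
      fix k
      have "exp (- (complex_of_real (h m) * \<Psi> \<theta>)) * ?c = 1" by (simp add: exp_minus)
      thus "(CLINT \<omega>|M. of_bool (I m k \<omega>) * iexp (\<theta> * X ((real k + 1) * h m) \<omega>)) - (CLINT \<omega>|M. of_bool (I m k \<omega>) * iexp (\<theta> * X (real k * h m) \<omega>))
         = (1 - exp (- (complex_of_real (h m) * \<Psi> \<theta>))) * (CLINT \<omega>|M. of_bool (I m k \<omega>) * iexp (\<theta> * X ((real k + 1) * h m) \<omega>))"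
        unfolding one by (simp add: left_diff_distrib mult.assoc[symmetric])
    qed
    also have "\<dots> = (1 - exp (- (complex_of_real (h m) * \<Psi> \<theta>))) * (CLINT \<omega>|M. (\<Sum>k<Suc m. of_bool (I m k \<omega>) * iexp (\<theta> * X ((real k + 1) * h m) \<omega>)))"
      unfolding sum_distrib_left[symmetric] by (subst Bochner_Integration.integral_sum) (auto simp del: of_real_mult of_real_add sum.lessThan_Suc)
    finally show ?thesis
      unfolding V_def integral_mult_right_zero using h(1)[of m] by simp
  qed
  have "(\<lambda>m. CLINT \<omega>|M. Z m \<omega>) \<longlonglongrightarrow> (CLINT \<omega>|M. iexp (\<theta> * X (hitting \<alpha> S t \<omega>) \<omega>) - 1)"
  proof (rule integral_dominated_convergence[where w = "\<lambda>_. 2"])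
    show "AE \<omega> in M. norm (Z m \<omega>) \<le> 2" for m
      by (rule AE_I2) (simp only: Z_eq cmod_iexp_minus_1_le(2))
    show "AE \<omega> in M. (\<lambda>m. Z m \<omega>) \<longlonglongrightarrow> iexp (\<theta> * X (hitting \<alpha> S t \<omega>) \<omega>) - 1"
      by (rule AE_I2) (rule Z_lim)
  qed (rule Z_meas', simp_all)
  moreover have "(\<lambda>m. CLINT \<omega>|M. Z m \<omega>) \<longlonglongrightarrow> \<Psi> \<theta> * (CLINT \<omega>|M. VV \<omega>)"
    unfolding E_step
  proof (rule tendsto_mult)
    show "(\<lambda>m. CLINT \<omega>|M. V m \<omega>) \<longlonglongrightarrow> (CLINT \<omega>|M. VV \<omega>)"
      by (rule integral_dominated_convergence[where w = "\<lambda>_. S"]) (use V_lim V_bound VV_meas in auto)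
    have "((\<lambda>z. 1 - exp (- (z * \<Psi> \<theta>))) has_field_derivative \<Psi> \<theta>) (at 0)"
      by (auto intro!: derivative_eq_intros)
    hence "((\<lambda>z. (1 - exp (- (z * \<Psi> \<theta>))) / z) \<longlongrightarrow> \<Psi> \<theta>) (at 0)" by (simp add: has_field_derivative_iff)
    moreover have "filterlim (\<lambda>m. complex_of_real (h m)) (at 0) sequentially"
      unfolding filterlim_at
    proof
      have "h \<longlonglongrightarrow> 0" unfolding h_def by (rule tendsto_mesh)
      from tendsto_of_real[OF this] show "(\<lambda>m. complex_of_real (h m)) \<longlonglongrightarrow> 0" by simp
      have "complex_of_real (h m) \<noteq> 0" for m using h(1)[of m] by simp
      thus "\<forall>\<^sub>F m in sequentially. complex_of_real (h m) \<in> UNIV \<and> complex_of_real (h m) \<noteq> 0" by simp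
    qed
    ultimately show "(\<lambda>m. (1 - exp (- (complex_of_real (h m) * \<Psi> \<theta>))) / complex_of_real (h m)) \<longlonglongrightarrow> \<Psi> \<theta>"
      by (rule filterlim_compose)
  qed
  ultimately have "(CLINT \<omega>|M. iexp (\<theta> * X (hitting \<alpha> S t \<omega>) \<omega>) - 1) = \<Psi> \<theta> * (CLINT \<omega>|M. VV \<omega>)"
    by (rule LIMSEQ_unique)
  moreover have "(CLINT \<omega>|M. iexp (\<theta> * X (hitting \<alpha> S t \<omega>) \<omega>) - 1) = (CLINT \<omega>|M. iexp (\<theta> * X (hitting \<alpha> S t \<omega>) \<omega>)) - 1"
  proof (subst Bochner_Integration.integral_diff)
    show "integrable M (\<lambda>\<omega>. iexp (\<theta> * X (hitting \<alpha> S t \<omega>) \<omega>))"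
      by (rule integrable_const_bound[of _ 1]) (use meas in auto)
  qed (auto simp: prob_space)
  ultimately show "(CLINT \<omega>|M. iexp (\<theta> * X (hitting \<alpha> S t \<omega>) \<omega>)) - 1
      = \<Psi> \<theta> * (CLINT \<omega>|M. (CLINT v:{0..<S}|lborel. of_bool (clock \<alpha> v \<omega> < t) * iexp (\<theta> * X v \<omega>)))"
    by (simp add: VV_def[abs_def])
qed

lemma prob_increment:
  assumes "0 \<le> s" "s \<le> u"
  shows "prob {\<omega>\<in>space M. b \<le> \<bar>X u \<omega> - X s \<omega>\<bar>} = prob {\<omega>\<in>space M. b \<le> \<bar>X (u - s) \<omega>\<bar>}"
proof -
  have "prob {\<omega>\<in>space M. b \<le> \<bar>X u \<omega> - X s \<omega>\<bar>} = measure (distr M borel (\<lambda>\<omega>. X u \<omega> - X s \<omega>)) {y. b \<le> \<bar>y\<bar>}"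
    by (subst measure_distr) (auto intro!: arg_cong[where f = prob])
  also have "distr M borel (\<lambda>\<omega>. X u \<omega> - X s \<omega>) = distr M borel (X (u - s))"
    using X_levy assms by (simp add: levy_process_def)
  also have "measure \<dots> {y. b \<le> \<bar>y\<bar>} = prob {\<omega>\<in>space M. b \<le> \<bar>X (u - s) \<omega>\<bar>}"
    by (subst measure_distr) (auto intro!: arg_cong[where f = prob])
  finally show ?thesis .
qed

lemma prob_clock_indep:
  assumes su: "0 \<le> s" "s \<le> u"
  shows "prob {\<omega>\<in>space M. clock \<alpha> s \<omega> < t \<and> b \<le> \<bar>X u \<omega> - X s \<omega>\<bar>}
     = prob {\<omega>\<in>space M. clock \<alpha> s \<omega> < t} * prob {\<omega>\<in>space M. b \<le> \<bar>X u \<omega> - X s \<omega>\<bar>}"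
proof -
  have pr: "complex_of_real (prob {\<omega>\<in>space M. P \<omega>}) = (CLINT \<omega>|M. of_bool (P \<omega>))" if "Measurable.pred M P" for P
  proof -
    have "prob {\<omega>\<in>space M. P \<omega>} = (LINT \<omega>|M. indicator {\<omega>\<in>space M. P \<omega>} \<omega>)" using that by simp
    also have "complex_of_real \<dots> = (CLINT \<omega>|M. complex_of_real (indicator {\<omega>\<in>space M. P \<omega>} \<omega>))"
      by (rule integral_complex_of_real[symmetric])
    also have "\<dots> = (CLINT \<omega>|M. of_bool (P \<omega>))"
      by (rule Bochner_Integration.integral_cong) (auto simp: indicator_def)
    finally show ?thesis .
  qed
  have "(CLINT \<omega>|M. of_bool (clock \<alpha> s \<omega> < t) * iexp (0 * X s \<omega>) * of_bool (b \<le> \<bar>X u \<omega> - X s \<omega>\<bar>))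
    = (CLINT \<omega>|M. of_bool (clock \<alpha> s \<omega> < t) * iexp (0 * X s \<omega>)) * (CLINT \<omega>|M. of_bool (b \<le> \<bar>X u \<omega> - X s \<omega>\<bar>))"
    by (rule clock_indep[OF su]) auto
  hence "complex_of_real (prob {\<omega>\<in>space M. clock \<alpha> s \<omega> < t \<and> b \<le> \<bar>X u \<omega> - X s \<omega>\<bar>})
     = complex_of_real (prob {\<omega>\<in>space M. clock \<alpha> s \<omega> < t} * prob {\<omega>\<in>space M. b \<le> \<bar>X u \<omega> - X s \<omega>\<bar>})"
    unfolding of_real_mult by (subst (1 2 3) pr) (simp_all add: of_bool_conj)
  thus ?thesis by (simp only: of_real_eq_iff)
qed

text \<open>If the clock runs slowly over an interval, then the process is at distance at least \<open>b\<close> from its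
  value at the beginning during at least half of the interval.\<close>

lemma clock_slow_prob:
  assumes \<alpha>: "0 < \<alpha>" and s: "0 \<le> s" and L: "0 < L"
    and p: "\<And>u. 0 \<le> u \<Longrightarrow> u \<le> L \<Longrightarrow> prob {\<omega>\<in>space M. b \<le> \<bar>X u \<omega>\<bar>} \<le> p"
  shows "prob {\<omega>\<in>space M. clock \<alpha> s \<omega> < t \<and> clock \<alpha> (s + L) \<omega> - clock \<alpha> s \<omega> \<le> exp (\<alpha> * X s \<omega>) * (L / 2 * exp (- (\<alpha> * b)))}
     \<le> 2 * prob {\<omega>\<in>space M. clock \<alpha> s \<omega> < t} * p"
proof -
  let ?E = "{\<omega>\<in>space M. clock \<alpha> s \<omega> < t \<and> clock \<alpha> (s + L) \<omega> - clock \<alpha> s \<omega> \<le> exp (\<alpha> * X s \<omega>) * (L / 2 * exp (- (\<alpha> * b)))}"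
  define N where "N = density lborel (\<lambda>u. ennreal (indicator {s<..s + L} u))"
  have emN: "emeasure N (space N) = ennreal L" using L by (simp add: N_def emeasure_density ennreal_indicator)
  interpret N: finite_measure N by (rule finite_measureI) (simp add: emN)
  interpret P: pair_sigma_finite M N ..
  interpret MN: finite_measure "M \<Otimes>\<^sub>M N"
    by (rule finite_measureI) (simp add: space_pair_measure N.emeasure_pair_measure_Times emeasure_space_1 emN)
  have N_cong [measurable_cong]: "sets N = sets borel" by (simp add: N_def)
  have N_int: "(LINT u|N. f u) = (LINT u:{s<..s + L}|lborel. f u)" if "f \<in> borel_measurable borel" for f :: "real \<Rightarrow> real"
    unfolding N_def set_lebesgue_integral_def by (rule integral_density) (use that in auto)
  define G where "G \<omega> u = (of_bool (clock \<alpha> s \<omega> < t \<and> b \<le> \<bar>X u \<omega> - X s \<omega>\<bar>) :: real)" for \<omega> u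
  have "(\<lambda>p. X (snd p) (fst p)) \<in> borel_measurable (M \<Otimes>\<^sub>M lborel)"
    using measurable_compose[OF measurable_Pair[OF measurable_snd measurable_fst] X_joint_meas] by simp
  moreover have "sets (M \<Otimes>\<^sub>M lborel) = sets (M \<Otimes>\<^sub>M N)"
    by (intro sets_pair_measure_cong) (auto simp: N_def)
  ultimately have [measurable]: "(\<lambda>p. X (snd p) (fst p)) \<in> borel_measurable (M \<Otimes>\<^sub>M N)"
    by (simp cong: measurable_cong_sets)
  have int: "integrable (M \<Otimes>\<^sub>M N) (\<lambda>(\<omega>, u). G \<omega> u)"
    by (rule MN.integrable_const_bound[of _ 1]) (auto simp: G_def split_beta')
  have lower: "L / 2 * indicator ?E \<omega> \<le> (LINT u|N. G \<omega> u)" if \<omega>: "\<omega> \<in> space M" for \<omega>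
  proof (cases "\<omega> \<in> ?E")
    case True
    define D where "D = (LINT u:{s<..s + L}|lborel. of_bool (b \<le> \<bar>X u \<omega> - X s \<omega>\<bar>) :: real)"
    note [measurable] = X_path_meas[OF \<omega>]
    have GD: "(LINT u|N. G \<omega> u) = D" unfolding G_def D_def using True by (subst N_int) auto
    have bounded: "set_integrable lborel {s<..s + L} f" if "f \<in> borel_measurable borel" "\<And>u. \<bar>f u\<bar> \<le> 1" for f :: "real \<Rightarrow> real"
      unfolding set_integrable_def
      by (rule integrableI_bounded_set_indicator[where B = 1]) (use that L in \<open>auto simp: emeasure_lborel_Ioc\<close>)
    have low_int: "set_integrable lborel {s<..s + L} (\<lambda>u. 1 - of_bool (b \<le> \<bar>X u \<omega> - X s \<omega>\<bar>) :: real)"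
      "set_integrable lborel {s<..s + L} (\<lambda>u. of_bool (b \<le> \<bar>X u \<omega> - X s \<omega>\<bar>) :: real)"
      "set_integrable lborel {s<..s + L} (\<lambda>u. 1 :: real)"
      by (rule bounded; simp)+
    have "exp (\<alpha> * X s \<omega>) * exp (- (\<alpha> * b)) * (L - D)
        = exp (\<alpha> * X s \<omega>) * exp (- (\<alpha> * b)) * (LINT u:{s<..s + L}|lborel. 1 - of_bool (b \<le> \<bar>X u \<omega> - X s \<omega>\<bar>))"
      using low_int L by (simp add: D_def set_integral_diff(2)) (simp add: set_lebesgue_integral_def)
    also have "\<dots> = (LINT u:{s<..s + L}|lborel. exp (\<alpha> * X s \<omega>) * exp (- (\<alpha> * b)) * (1 - of_bool (b \<le> \<bar>X u \<omega> - X s \<omega>\<bar>)))"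
      by (rule set_integral_mult_right[symmetric])
    also have "\<dots> \<le> (LINT u:{s<..s + L}|lborel. exp (\<alpha> * X u \<omega>))"
    proof (rule set_integral_mono)
      show "set_integrable lborel {s<..s + L} (\<lambda>u. exp (\<alpha> * X u \<omega>))"
        using clock_split(2)[OF \<omega> s, of "s + L"] L by simp
      fix u
      show "exp (\<alpha> * X s \<omega>) * exp (- (\<alpha> * b)) * (1 - of_bool (b \<le> \<bar>X u \<omega> - X s \<omega>\<bar>)) \<le> exp (\<alpha> * X u \<omega>)"
      proof (cases "b \<le> \<bar>X u \<omega> - X s \<omega>\<bar>")
        case False
        hence "X s \<omega> - b \<le> X u \<omega>" by linarith
        hence "\<alpha> * (X s \<omega> - b) \<le> \<alpha> * X u \<omega>" using \<alpha> by (intro mult_left_mono) auto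
        thus ?thesis using False by (simp add: exp_add[symmetric] algebra_simps)
      qed simp
    qed (use low_int in simp)
    also have "\<dots> = clock \<alpha> (s + L) \<omega> - clock \<alpha> s \<omega>"
      using clock_split(1)[OF \<omega> s, of "s + L"] L by simp
    also have "\<dots> \<le> exp (\<alpha> * X s \<omega>) * exp (- (\<alpha> * b)) * (L / 2)" using True by (simp add: mult_ac)
    finally have "L - D \<le> L / 2" by simp
    thus ?thesis using True unfolding GD by simp
  next
    case False
    thus ?thesis by (auto intro!: Bochner_Integration.integral_nonneg simp: G_def)
  qed
  have "L / 2 * prob ?E = (LINT \<omega>|M. L / 2 * indicator ?E \<omega>)" by simp
  also have "\<dots> \<le> (LINT \<omega>|M. (LINT u|N. G \<omega> u))"
  proof (rule integral_mono_AE)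
    show "integrable M (\<lambda>\<omega>. L / 2 * indicator ?E \<omega>)"
      by (intro integrable_mult_right integrable_const_bound[of _ 1]) auto
    show "integrable M (\<lambda>\<omega>. LINT u|N. G \<omega> u)" using P.integrable_fst'[OF int] by simp
  qed (use lower in auto)
  also have "\<dots> = (LINT u|N. (LINT \<omega>|M. G \<omega> u))" using P.Fubini_integral[OF int] by simp
  also have "\<dots> \<le> (LINT u|N. prob {\<omega>\<in>space M. clock \<alpha> s \<omega> < t} * p)"
  proof (rule integral_mono_AE)
    show "integrable N (\<lambda>u. LINT \<omega>|M. G \<omega> u)" using P.integrable_snd[OF int] by simp
    have "(LINT \<omega>|M. G \<omega> u) \<le> prob {\<omega>\<in>space M. clock \<alpha> s \<omega> < t} * p" if u: "u \<in> {s<..s + L}" for u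
    proof -
      have "(LINT \<omega>|M. G \<omega> u) = (LINT \<omega>|M. indicator {\<omega>\<in>space M. clock \<alpha> s \<omega> < t \<and> b \<le> \<bar>X u \<omega> - X s \<omega>\<bar>} \<omega>)"
        by (rule Bochner_Integration.integral_cong) (auto simp: G_def indicator_def)
      also have "\<dots> = prob {\<omega>\<in>space M. clock \<alpha> s \<omega> < t} * prob {\<omega>\<in>space M. b \<le> \<bar>X (u - s) \<omega>\<bar>}"
        using prob_clock_indep[of s u \<alpha> t b] prob_increment[of s u b] s u by simp
      also have "\<dots> \<le> prob {\<omega>\<in>space M. clock \<alpha> s \<omega> < t} * p"
        using u by (intro mult_left_mono p) auto
      finally show ?thesis .
    qed
    thus "AE u in N. (LINT \<omega>|M. G \<omega> u) \<le> prob {\<omega>\<in>space M. clock \<alpha> s \<omega> < t} * p"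
      unfolding N_def by (subst AE_density) (auto simp: indicator_def)
  qed auto
  also have "\<dots> = L * (prob {\<omega>\<in>space M. clock \<alpha> s \<omega> < t} * p)" using emN L by (simp add: measure_def)
  finally show ?thesis using L by (simp add: field_simps)
qed

text \<open>For the clock to be still below \<open>t\<close> at a large multiple of \<open>t\<close>, the process has to
  be at distance at least \<open>c\<close> from \<open>0\<close> at time \<open>4 t\<close>, or the clock has to run slowly over each of two
  successive intervals.\<close>

lemma clock_late_prob:
  assumes \<alpha>: "0 < \<alpha>" and c: "0 < c" and t: "0 < t"
    and B0: "\<And>\<theta>. \<bar>\<theta>\<bar> \<le> 2 * \<alpha> / ln 2 \<Longrightarrow> cmod (\<Psi> \<theta>) \<le> B0"
    and Bc: "\<And>\<theta>. \<bar>\<theta>\<bar> \<le> 2 / c \<Longrightarrow> cmod (\<Psi> \<theta>) \<le> Bc"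
  shows "prob {\<omega>\<in>space M. clock \<alpha> ((4 + 4 * exp (\<alpha> * c)) * t) \<omega> < t} \<le> 8 * t * Bc + 256 * B0\<^sup>2 * exp (\<alpha> * c) * t\<^sup>2"
proof -
  \<comment> \<open>As long as the process does not move by \<open>b\<close>, the speed of the clock falls at most by one half.\<close>
  define b where "b = ln 2 / \<alpha>"
  have b: "0 < b" "exp (- (\<alpha> * b)) = 1 / 2" "2 / b = 2 * \<alpha> / ln 2"
    using \<alpha> by (auto simp: b_def exp_minus inverse_eq_divide)
  have "0 \<le> cmod (\<Psi> 0)" "cmod (\<Psi> 0) \<le> B0" using B0[of 0] \<alpha> by auto
  hence B0_nonneg: "0 \<le> B0" by linarith
  have tail: "prob {\<omega>\<in>space M. b \<le> \<bar>X u \<omega>\<bar>} \<le> 2 * (u * B0)" if "0 \<le> u" for u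
    by (rule levy_process_tail[OF X_levy X_char b(1) that]) (use B0 b(3) in auto)
  have tail_c: "prob {\<omega>\<in>space M. c \<le> \<bar>X (4 * t) \<omega>\<bar>} \<le> 2 * (4 * t * Bc)"
    by (rule levy_process_tail[OF X_levy X_char c]) (use Bc t in auto)
  have tail_L: "prob {\<omega>\<in>space M. b \<le> \<bar>X u \<omega>\<bar>} \<le> 2 * (L * B0)" if "0 \<le> u" "u \<le> L" for u L
    using tail[OF that(1)] mult_right_mono[OF that(2) B0_nonneg] by linarith
  have first: "prob {\<omega>\<in>space M. clock \<alpha> (4 * t) \<omega> < t} \<le> 16 * t * B0"
  proof -
    have "prob {\<omega>\<in>space M. clock \<alpha> (4 * t) \<omega> < t}
        \<le> prob {\<omega>\<in>space M. clock \<alpha> 0 \<omega> < t \<and> clock \<alpha> (0 + 4 * t) \<omega> - clock \<alpha> 0 \<omega> \<le> exp (\<alpha> * X 0 \<omega>) * (4 * t / 2 * exp (- (\<alpha> * b)))}"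
      by (rule finite_measure_mono) (use t in \<open>auto simp: clock_0 X_nonpos b(2)\<close>)
    also have "\<dots> \<le> 2 * prob {\<omega>\<in>space M. clock \<alpha> 0 \<omega> < t} * (2 * (4 * t * B0))"
      by (rule clock_slow_prob[OF \<alpha> _ _ tail_L]) (use t in auto)
    also have "\<dots> = 16 * t * B0" using t by (simp add: clock_0 prob_space)
    finally show ?thesis .
  qed
  define L where "L = 4 * exp (\<alpha> * c) * t"
  have L: "0 < L" "(4 + 4 * exp (\<alpha> * c)) * t = 4 * t + L" using t by (auto simp: L_def algebra_simps)
  let ?E = "{\<omega>\<in>space M. clock \<alpha> (4 * t) \<omega> < t \<and> clock \<alpha> (4 * t + L) \<omega> - clock \<alpha> (4 * t) \<omega> \<le> exp (\<alpha> * X (4 * t) \<omega>) * (L / 2 * exp (- (\<alpha> * b)))}"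
  have "{\<omega>\<in>space M. clock \<alpha> (4 * t + L) \<omega> < t} \<subseteq> {\<omega>\<in>space M. c \<le> \<bar>X (4 * t) \<omega>\<bar>} \<union> ?E"
  proof
    fix \<omega> assume "\<omega> \<in> {\<omega>\<in>space M. clock \<alpha> (4 * t + L) \<omega> < t}"
    hence \<omega>: "\<omega> \<in> space M" and late: "clock \<alpha> (4 * t + L) \<omega> < t" by auto
    have mono: "clock \<alpha> (4 * t) \<omega> \<le> clock \<alpha> (4 * t + L) \<omega>" "0 \<le> clock \<alpha> (4 * t) \<omega>"
      using monoD[OF clock_mono[OF \<omega>], of "4 * t" "4 * t + L" \<alpha>] monoD[OF clock_mono[OF \<omega>], of 0 "4 * t" \<alpha>] L t
      by (auto simp: clock_0)
    show "\<omega> \<in> {\<omega>\<in>space M. c \<le> \<bar>X (4 * t) \<omega>\<bar>} \<union> ?E"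
    proof (cases "c \<le> \<bar>X (4 * t) \<omega>\<bar>")
      case False
      hence "\<alpha> * (- c) \<le> \<alpha> * X (4 * t) \<omega>" using \<alpha> by (intro mult_left_mono) auto
      hence "exp (- (\<alpha> * c)) * (exp (\<alpha> * c) * t) \<le> exp (\<alpha> * X (4 * t) \<omega>) * (exp (\<alpha> * c) * t)"
        using t by (intro mult_right_mono) auto
      moreover have "exp (- (\<alpha> * c)) * (exp (\<alpha> * c) * t) = t" by (simp add: exp_minus)
      moreover have "L / 2 * exp (- (\<alpha> * b)) = exp (\<alpha> * c) * t" unfolding b(2) L_def by simp
      ultimately have "t \<le> exp (\<alpha> * X (4 * t) \<omega>) * (L / 2 * exp (- (\<alpha> * b)))" by (simp only:)
      hence "clock \<alpha> (4 * t + L) \<omega> - clock \<alpha> (4 * t) \<omega> \<le> exp (\<alpha> * X (4 * t) \<omega>) * (L / 2 * exp (- (\<alpha> * b)))"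
        using late mono by linarith
      thus ?thesis using \<omega> late mono by auto
    qed (use \<omega> in auto)
  qed
  hence "prob {\<omega>\<in>space M. clock \<alpha> (4 * t + L) \<omega> < t} \<le> prob ({\<omega>\<in>space M. c \<le> \<bar>X (4 * t) \<omega>\<bar>} \<union> ?E)"
    by (rule finite_measure_mono) measurable
  also have "\<dots> \<le> prob {\<omega>\<in>space M. c \<le> \<bar>X (4 * t) \<omega>\<bar>} + prob ?E"
    by (rule measure_Un_le) measurable
  also have "prob ?E \<le> 2 * prob {\<omega>\<in>space M. clock \<alpha> (4 * t) \<omega> < t} * (2 * (L * B0))"
    by (rule clock_slow_prob[OF \<alpha> _ L(1) tail_L]) (use t in auto)
  also have "\<dots> \<le> 2 * (16 * t * B0) * (2 * (L * B0))"
    using first L B0_nonneg by (intro mult_right_mono mult_left_mono) auto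
  finally show ?thesis using tail_c unfolding L(2) by (simp add: L_def power2_eq_square algebra_simps)
qed

lemma clock_ratio:
  assumes \<omega>: "\<omega> \<in> space M"
  shows "((\<lambda>s. clock \<alpha> s \<omega> / s) \<longlongrightarrow> 1) (at_right 0)"
proof (rule tendstoI)
  fix e :: real assume e: "0 < e"
  have "((\<lambda>s. exp (\<alpha> * X s \<omega>)) \<longlongrightarrow> exp (\<alpha> * X 0 \<omega>)) (at_right 0)" by (intro tendsto_intros X_right)
  hence "eventually (\<lambda>s. dist (exp (\<alpha> * X s \<omega>)) 1 < e / 2) (at_right 0)"
    using e by (intro tendstoD) (auto simp: X_nonpos)
  then obtain d where d: "0 < d" "\<And>s. 0 < s \<Longrightarrow> s < d \<Longrightarrow> dist (exp (\<alpha> * X s \<omega>)) 1 < e / 2"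
    unfolding eventually_at_right_field by auto
  have "dist (clock \<alpha> s \<omega> / s) 1 < e" if s: "0 < s" "s < d" for s
  proof -
    have "1 - e / 2 \<le> exp (\<alpha> * X u \<omega>) \<and> exp (\<alpha> * X u \<omega>) \<le> 1 + e / 2" if "0 < u" "u \<le> s" for u
    proof -
      have "\<bar>exp (\<alpha> * X u \<omega>) - 1\<bar> < e / 2" using d(2)[of u] that s by (simp add: dist_real_def)
      thus ?thesis by linarith
    qed
    from clock_bounds[OF \<omega> order.refl less_imp_le[OF s(1)] this]
    have "(1 - e / 2) * s \<le> clock \<alpha> s \<omega>" "clock \<alpha> s \<omega> \<le> (1 + e / 2) * s" by (auto simp: clock_0)
    hence "1 - e / 2 \<le> clock \<alpha> s \<omega> / s" "clock \<alpha> s \<omega> / s \<le> 1 + e / 2" using s by (auto simp: field_simps)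
    thus ?thesis using e by (auto simp: dist_real_def abs_less_iff)
  qed
  thus "eventually (\<lambda>s. dist (clock \<alpha> s \<omega> / s) 1 < e) (at_right 0)"
    unfolding eventually_at_right_field using d(1) by auto
qed

text \<open>After rescaling time by \<open>tn n\<close>, the clock is the identity in the limit, so only the
  rescaled times in \<open>{0..<1}\<close> remain.\<close>

lemma occupation_limit:
  assumes K: "1 < K" and tn: "\<And>n. 0 < tn n" "tn \<longlonglongrightarrow> 0"
  shows "(\<lambda>n. (CLINT \<omega>|M. (CLINT v:{0..<K * tn n}|lborel. of_bool (clock \<alpha> v \<omega> < tn n) * iexp (\<theta> * X v \<omega>))) / tn n) \<longlonglongrightarrow> 1"
proof -
  have tn_right: "filterlim (\<lambda>n. tn n * w) (at_right 0) sequentially" if "0 < w" for w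
    unfolding filterlim_at using tendsto_mult_left_zero[OF tn(2), of w] tn(1) that
    by (auto intro!: always_eventually simp: less_imp_neq[symmetric])
  define F where "F n \<omega> w = indicator {0..<K} w *\<^sub>R (of_bool (clock \<alpha> (tn n * w) \<omega> < tn n) * iexp (\<theta> * X (tn n * w) \<omega>))" for n \<omega> w
  have scale: "(CLINT v:{0..<K * tn n}|lborel. of_bool (clock \<alpha> v \<omega> < tn n) * iexp (\<theta> * X v \<omega>)) = complex_of_real (tn n) * (CLINT w|lborel. F n \<omega> w)" for n \<omega>
  proof -
    have "(CLINT v:{0..<K * tn n}|lborel. of_bool (clock \<alpha> v \<omega> < tn n) * iexp (\<theta> * X v \<omega>))
       = \<bar>tn n\<bar> *\<^sub>R (CLINT w|lborel. indicator {0..<K * tn n} (0 + tn n * w) *\<^sub>R (of_bool (clock \<alpha> (0 + tn n * w) \<omega> < tn n) * iexp (\<theta> * X (0 + tn n * w) \<omega>)))"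
      unfolding set_lebesgue_integral_def by (rule lborel_integral_real_affine) (use tn(1)[of n] in simp)
    also have "(\<lambda>w. indicator {0..<K * tn n} (0 + tn n * w) *\<^sub>R (of_bool (clock \<alpha> (0 + tn n * w) \<omega> < tn n) * iexp (\<theta> * X (0 + tn n * w) \<omega>))) = F n \<omega>"
      using tn(1)[of n] by (auto simp: F_def fun_eq_iff indicator_def zero_le_mult_iff mult.commute)
    finally show ?thesis using tn(1)[of n] by (simp add: scaleR_conv_of_real)
  qed
  have ind: "integrable lborel (\<lambda>w. indicator {0..<K} w :: real)" using K by (intro integrable_real_indicator) auto
  have F_meas: "F n \<omega> \<in> borel_measurable lborel" if \<omega>: "\<omega> \<in> space M" for n \<omega>
    unfolding F_def[abs_def] using X_path_meas[OF \<omega>] clock_path_meas[OF \<omega>, of \<alpha>] by measurable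
  have F_bound: "cmod (F n \<omega> w) \<le> indicator {0..<K} w" for n \<omega> w by (simp add: F_def indicator_def norm_mult)
  have inner: "(\<lambda>n. CLINT w|lborel. F n \<omega> w) \<longlonglongrightarrow> 1" if \<omega>: "\<omega> \<in> space M" for \<omega>
  proof -
    have "(\<lambda>n. CLINT w|lborel. F n \<omega> w) \<longlonglongrightarrow> (CLINT w|lborel. complex_of_real (indicator {0..<1::real} w))"
    proof (rule integral_dominated_convergence[where w = "indicator {0..<K}"])
      show "AE w in lborel. (\<lambda>n. F n \<omega> w) \<longlonglongrightarrow> complex_of_real (indicator {0..<1} w)"
        using AE_lborel_singleton[of 1] AE_lborel_singleton[of 0]
      proof eventually_elim
        case (elim w)
        show ?case
        proof (cases "w \<in> {0..<K}")
          case True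
          hence w: "0 < w" "w < K" using elim by auto
          have "(\<lambda>n. clock \<alpha> (tn n * w) \<omega> / (tn n * w) * w) \<longlonglongrightarrow> 1 * w"
            by (intro tendsto_intros filterlim_compose[OF clock_ratio[OF \<omega>] tn_right[OF w(1)]])
          hence ratio: "(\<lambda>n. clock \<alpha> (tn n * w) \<omega> / tn n) \<longlonglongrightarrow> w" using w by simp
          have eq: "clock \<alpha> (tn n * w) \<omega> < tn n \<longleftrightarrow> clock \<alpha> (tn n * w) \<omega> / tn n < 1" for n
            using tn(1)[of n] by (simp add: field_simps)
          have "eventually (\<lambda>n. (clock \<alpha> (tn n * w) \<omega> < tn n) = (w < 1)) sequentially"
          proof (cases "w < 1")
            case True
            from order_tendstoD(2)[OF ratio True] show ?thesis unfolding eq by eventually_elim (use True in simp)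
          next
            case False
            hence "1 < w" using elim by simp
            from order_tendstoD(1)[OF ratio this] show ?thesis unfolding eq by eventually_elim (use False in simp)
          qed
          hence "(\<lambda>n. of_bool (clock \<alpha> (tn n * w) \<omega> < tn n) :: complex) \<longlonglongrightarrow> of_bool (w < 1)"
            by (intro tendsto_eventually) (auto elim: eventually_mono)
          moreover have "(\<lambda>n. X (tn n * w) \<omega>) \<longlonglongrightarrow> X 0 \<omega>" by (rule filterlim_compose[OF X_right tn_right[OF w(1)]])
          ultimately have "(\<lambda>n. F n \<omega> w) \<longlonglongrightarrow> indicator {0..<K} w *\<^sub>R (of_bool (w < 1) * iexp (\<theta> * X 0 \<omega>))"
            unfolding F_def by (intro tendsto_intros)
          thus ?thesis using w by (cases "w < 1") (simp_all add: X_nonpos indicator_def)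
        next
          case False
          thus ?thesis using K by (auto simp: F_def indicator_def)
        qed
      qed
    qed (use F_bound F_meas[OF \<omega>] ind in auto)
    moreover have "(CLINT w|lborel. complex_of_real (indicator {0..<1::real} w)) = 1"
      by (subst integral_complex_of_real) simp
    ultimately show ?thesis by simp
  qed
  have F_int_meas: "(\<lambda>\<omega>. CLINT w|lborel. F n \<omega> w) \<in> borel_measurable M" for n
  proof -
    have "(\<lambda>\<omega>. CLINT v:{0..<K * tn n}|lborel. of_bool (clock \<alpha> v \<omega> < tn n) * iexp (\<theta> * X v \<omega>)) \<in> borel_measurable M"
      by (rule dynkin_clock(3)) (use K tn(1)[of n] in auto)
    hence "(\<lambda>\<omega>. (complex_of_real (tn n) * (CLINT w|lborel. F n \<omega> w)) / complex_of_real (tn n)) \<in> borel_measurable M"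
      unfolding scale by (intro borel_measurable_divide) auto
    thus ?thesis using tn(1)[of n] by simp
  qed
  have "(\<lambda>n. CLINT \<omega>|M. (CLINT w|lborel. F n \<omega> w)) \<longlonglongrightarrow> (CLINT \<omega>|M. 1)"
  proof (rule integral_dominated_convergence[where w = "\<lambda>_. K"])
    show "AE \<omega> in M. cmod (CLINT w|lborel. F n \<omega> w) \<le> K" for n
    proof (rule AE_I2)
      fix \<omega> assume \<omega>: "\<omega> \<in> space M"
      have "cmod (CLINT w|lborel. F n \<omega> w) \<le> (LINT w|lborel. cmod (F n \<omega> w))" by (rule integral_norm_bound)
      also have "\<dots> \<le> (LINT w|lborel. indicator {0..<K} w)"
        by (intro integral_mono F_bound ind integrable_norm Bochner_Integration.integrable_bound[OF ind F_meas[OF \<omega>]])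
           (use F_bound in auto)
      also have "\<dots> = K" using K by simp
      finally show "cmod (CLINT w|lborel. F n \<omega> w) \<le> K" .
    qed
  qed (use inner F_int_meas in auto)
  moreover have "(CLINT \<omega>|M. (CLINT v:{0..<K * tn n}|lborel. of_bool (clock \<alpha> v \<omega> < tn n) * iexp (\<theta> * X v \<omega>))) / tn n
      = (CLINT \<omega>|M. (CLINT w|lborel. F n \<omega> w))" for n
    unfolding scale using tn(1)[of n] by simp
  ultimately show ?thesis by (simp add: prob_space)
qed

text \<open>The exponent is recovered from the time-changed process \<open>Y\<close> at small times. The error from
  stopping the clock at \<open>K tn\<close> is at most \<open>tn (e / 4 + O(tn))\<close>.\<close>

lemma exponent_from_small_times:
  assumes \<alpha>: "0 < \<alpha>" and tn: "\<And>n. 0 < tn n" "tn \<longlonglongrightarrow> 0"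
    and Y [measurable]: "\<And>n. Y n \<in> borel_measurable M"
    and YX: "\<And>n S. 0 < S \<Longrightarrow> AE \<omega> in M. tn n \<le> clock \<alpha> S \<omega> \<longrightarrow> Y n \<omega> = X (hitting \<alpha> S (tn n) \<omega>) \<omega>"
  shows "(\<lambda>n. ((CLINT \<omega>|M. iexp (\<theta> * Y n \<omega>)) - 1) / tn n) \<longlonglongrightarrow> \<Psi> \<theta>"
proof (rule tendstoI)
  fix e :: real assume e: "0 < e"
  have "continuous_on {- (2 * \<alpha> / ln 2)..2 * \<alpha> / ln 2} \<Psi>"
    by (intro continuous_at_imp_continuous_on ballI isCont_exponent)
  hence "bounded (\<Psi> ` {- (2 * \<alpha> / ln 2)..2 * \<alpha> / ln 2})"
    by (intro compact_imp_bounded compact_continuous_image) auto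
  then obtain B0 where "\<forall>\<theta>\<in>{- (2 * \<alpha> / ln 2)..2 * \<alpha> / ln 2}. cmod (\<Psi> \<theta>) \<le> B0"
    unfolding bounded_iff by auto
  hence B0: "cmod (\<Psi> \<theta>) \<le> B0" if "\<bar>\<theta>\<bar> \<le> 2 * \<alpha> / ln 2" for \<theta>
    using that by (auto simp: abs_le_iff)
  have "(\<Psi> \<longlongrightarrow> 0) (at 0)" using isCont_exponent[of 0] by (simp add: isCont_def exponent_0)
  hence "eventually (\<lambda>\<theta>. dist (\<Psi> \<theta>) 0 < e / 64) (at 0)" using e by (intro tendstoD) auto
  then obtain d where d: "0 < d" "\<And>\<theta>. \<theta> \<noteq> 0 \<Longrightarrow> \<bar>\<theta>\<bar> < d \<Longrightarrow> cmod (\<Psi> \<theta>) < e / 64"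
    unfolding eventually_at by (auto simp: dist_real_def)
  \<comment> \<open>The level \<open>c\<close> makes \<open>\<Psi>\<close> small on \<open>|\<theta>| \<le> 2 / c\<close>, so that a displacement by \<open>c\<close> is unlikely.\<close>
  define c where "c = 4 / d"
  have c: "0 < c" "2 / c < d" using d by (auto simp: c_def)
  have Bc: "cmod (\<Psi> \<theta>) \<le> e / 64" if "\<bar>\<theta>\<bar> \<le> 2 / c" for \<theta>
    using d(2)[of \<theta>] that c e by (cases "\<theta> = 0") (auto simp: exponent_0)
  define K where "K = 4 + 4 * exp (\<alpha> * c)"
  have K: "1 < K" unfolding K_def using exp_gt_zero[of "\<alpha> * c"] by linarith
  define V where "V n = (CLINT \<omega>|M. (CLINT v:{0..<K * tn n}|lborel. of_bool (clock \<alpha> v \<omega> < tn n) * iexp (\<theta> * X v \<omega>))) / tn n" for n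
  have S: "0 < K * tn n" for n using K tn(1)[of n] by simp
  note dynkin = dynkin_clock[OF S tn(1), where \<theta> = \<theta> and \<alpha> = \<alpha>]
  have diff: "cmod (((CLINT \<omega>|M. iexp (\<theta> * Y n \<omega>)) - 1) / tn n - \<Psi> \<theta> * V n) \<le> e / 4 + 512 * B0\<^sup>2 * exp (\<alpha> * c) * tn n" for n
  proof -
    let ?T = "hitting \<alpha> (K * tn n) (tn n)"
    let ?E = "{\<omega>\<in>space M. clock \<alpha> (K * tn n) \<omega> < tn n}"
    have intY: "integrable M (\<lambda>\<omega>. iexp (\<theta> * Y n \<omega>))" "integrable M (\<lambda>\<omega>. iexp (\<theta> * X (?T \<omega>) \<omega>))"
      by (rule integrable_const_bound[of _ 1]; use dynkin(2) in auto)+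
    have "cmod ((CLINT \<omega>|M. iexp (\<theta> * Y n \<omega>)) - (CLINT \<omega>|M. iexp (\<theta> * X (?T \<omega>) \<omega>)))
        = cmod (CLINT \<omega>|M. iexp (\<theta> * Y n \<omega>) - iexp (\<theta> * X (?T \<omega>) \<omega>))"
      using intY by (simp only: Bochner_Integration.integral_diff)
    also have "\<dots> \<le> (LINT \<omega>|M. cmod (iexp (\<theta> * Y n \<omega>) - iexp (\<theta> * X (?T \<omega>) \<omega>)))"
      by (rule integral_norm_bound)
    also have "\<dots> \<le> (LINT \<omega>|M. 2 * indicator ?E \<omega>)"
    proof (rule integral_mono_AE)
      show "integrable M (\<lambda>\<omega>. 2 * indicator ?E \<omega> :: real)" by (intro integrable_mult_right integrable_const_bound[of _ 1]) auto
      have "AE \<omega> in M. cmod (iexp (\<theta> * Y n \<omega>) - iexp (\<theta> * X (?T \<omega>) \<omega>)) \<le> 2 * indicator ?E \<omega>"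
        using YX[OF S, of n n] AE_space
      proof eventually_elim
        case (elim \<omega>)
        show ?case
        proof (cases "\<omega> \<in> ?E")
          case True
          thus ?thesis using norm_triangle_ineq4[of "iexp (\<theta> * Y n \<omega>)" "iexp (\<theta> * X (?T \<omega>) \<omega>)"] by simp
        qed (use elim in auto)
      qed
      thus "AE \<omega> in M. cmod (iexp (\<theta> * Y n \<omega>) - iexp (\<theta> * X (?T \<omega>) \<omega>)) \<le> 2 * indicator ?E \<omega>" .
      show "integrable M (\<lambda>\<omega>. cmod (iexp (\<theta> * Y n \<omega>) - iexp (\<theta> * X (?T \<omega>) \<omega>)))"
        using intY by (intro integrable_norm Bochner_Integration.integrable_diff)
    qed
    also have "\<dots> = 2 * prob ?E" by simp
    also have "\<dots> \<le> 2 * (8 * tn n * (e / 64) + 256 * B0\<^sup>2 * exp (\<alpha> * c) * (tn n)\<^sup>2)"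
      unfolding K_def by (intro mult_left_mono clock_late_prob[OF \<alpha> c(1) tn(1) B0 Bc]) auto
    also have "\<dots> = (e / 4 + 512 * B0\<^sup>2 * exp (\<alpha> * c) * tn n) * tn n" by (simp add: power2_eq_square algebra_simps)
    finally have *: "cmod ((CLINT \<omega>|M. iexp (\<theta> * Y n \<omega>)) - (CLINT \<omega>|M. iexp (\<theta> * X (?T \<omega>) \<omega>)))
        \<le> (e / 4 + 512 * B0\<^sup>2 * exp (\<alpha> * c) * tn n) * tn n" .
    have "((CLINT \<omega>|M. iexp (\<theta> * Y n \<omega>)) - 1) / tn n - \<Psi> \<theta> * V n
       = ((CLINT \<omega>|M. iexp (\<theta> * Y n \<omega>)) - (CLINT \<omega>|M. iexp (\<theta> * X (?T \<omega>) \<omega>))) / complex_of_real (tn n)"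
      unfolding V_def times_divide_eq_right dynkin(1)[symmetric] diff_divide_distrib[symmetric] by simp
    thus ?thesis using * tn(1)[of n] by (simp add: norm_divide pos_divide_le_eq)
  qed
  have V1: "(\<lambda>n. \<Psi> \<theta> * V n) \<longlonglongrightarrow> \<Psi> \<theta> * 1"
    unfolding V_def by (intro tendsto_intros occupation_limit K tn)
  have "eventually (\<lambda>n. dist (\<Psi> \<theta> * V n) (\<Psi> \<theta> * 1) < e / 4) sequentially"
    using V1 e by (intro tendstoD) auto
  moreover have "(\<lambda>n. 512 * B0\<^sup>2 * exp (\<alpha> * c) * tn n) \<longlonglongrightarrow> 512 * B0\<^sup>2 * exp (\<alpha> * c) * 0"
    by (intro tendsto_intros tn)
  hence "eventually (\<lambda>n. 512 * B0\<^sup>2 * exp (\<alpha> * c) * tn n < e / 4) sequentially"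
    by (rule order_tendstoD(2)) (use e in simp)
  ultimately show "eventually (\<lambda>n. dist (((CLINT \<omega>|M. iexp (\<theta> * Y n \<omega>)) - 1) / tn n) (\<Psi> \<theta>) < e) sequentially"
  proof eventually_elim
    case (elim n)
    have "dist (((CLINT \<omega>|M. iexp (\<theta> * Y n \<omega>)) - 1) / tn n) (\<Psi> \<theta>)
       \<le> dist (((CLINT \<omega>|M. iexp (\<theta> * Y n \<omega>)) - 1) / tn n) (\<Psi> \<theta> * V n) + dist (\<Psi> \<theta> * V n) (\<Psi> \<theta>)"
      by (rule dist_triangle)
    also have "\<dots> < e" using diff[of n] elim e by (simp add: dist_norm)
    finally show ?case .
  qed
qed

end

text \<open>The process is set to \<open>0\<close> at negative times and on a null set that contains all paths that are
  not cadlag or do not start at \<open>0\<close>.\<close>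

lemma cadlag_modification:
  assumes levy: "levy_process M X" and char: "has_char_exponent M X \<Psi>"
  obtains X' where "cadlag_levy M X' \<Psi>" "AE \<omega> in M. \<forall>t\<ge>0. X' t \<omega> = X t \<omega>"
proof -
  interpret prob_space M using levy by (simp add: levy_process_def)
  have meas: "X t \<in> borel_measurable M" if "0 \<le> t" for t using levy that by (simp add: levy_process_def)
  have "AE \<omega> in M. cadlag (\<lambda>t. X t \<omega>)" "AE \<omega> in M. X 0 \<omega> = 0" using levy by (auto simp: levy_process_def)
  hence "AE \<omega> in M. cadlag (\<lambda>t. X t \<omega>) \<and> X 0 \<omega> = 0" by eventually_elim simp
  then obtain N where N: "{\<omega>\<in>space M. \<not> (cadlag (\<lambda>t. X t \<omega>) \<and> X 0 \<omega> = 0)} \<subseteq> N" "N \<in> null_sets M"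
    unfolding eventually_ae_filter by blast
  define X' where "X' t \<omega> = (if 0 < t \<and> \<omega> \<in> space M - N then X t \<omega> else 0)" for t \<omega>
  have good: "cadlag (\<lambda>t. X t \<omega>)" "X 0 \<omega> = 0" if "\<omega> \<in> space M - N" for \<omega> using N(1) that by auto
  have "AE \<omega> in M. \<omega> \<notin> N" by (rule AE_not_in) (rule N(2))
  with AE_space have eq: "AE \<omega> in M. \<forall>t\<ge>0. X' t \<omega> = X t \<omega>"
  proof eventually_elim
    case (elim \<omega>)
    thus ?case using good(2)[of \<omega>] by (auto simp: X'_def not_less)
  qed
  have [measurable]: "X' t \<in> borel_measurable M" for t
  proof (cases "0 < t")
    case True
    have "(\<lambda>\<omega>. if \<omega> \<in> space M - N then X t \<omega> else 0) \<in> borel_measurable M"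
      using N(2) True by (intro measurable_If_set meas) auto
    thus ?thesis using True by (simp add: X'_def[abs_def])
  qed (simp add: X'_def[abs_def])
  have "cadlag_levy M X' \<Psi>"
  proof (unfold_locales)
    fix \<omega>
    show "cadlag (\<lambda>t. X' t \<omega>)"
    proof (cases "\<omega> \<in> space M - N")
      case True
      note g = good[OF True]
      show ?thesis
        unfolding cadlag_def
      proof (intro conjI allI impI)
        fix t :: real assume t: "0 \<le> t"
        have "eventually (\<lambda>s. X' s \<omega> = X s \<omega>) (at_right t)"
          using eventually_at_right_less[of t] by eventually_elim (use t True in \<open>auto simp: X'_def\<close>)
        moreover have "X' t \<omega> = X t \<omega>" using t True g(2) by (auto simp: X'_def)
        ultimately show "((\<lambda>t. X' t \<omega>) \<longlongrightarrow> X' t \<omega>) (at_right t)"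
          using g(1) t by (simp add: cadlag_def tendsto_cong)
      next
        fix t :: real assume t: "0 < t"
        have "eventually (\<lambda>s. X' s \<omega> = X s \<omega>) (at_left t)"
          using eventually_at_left_real[OF t] by eventually_elim (use True in \<open>auto simp: X'_def\<close>)
        thus "\<exists>l. ((\<lambda>t. X' t \<omega>) \<longlongrightarrow> l) (at_left t)"
          using g(1) t by (simp add: cadlag_def tendsto_cong)
      qed
    next
      case False
      hence "(\<lambda>t. X' t \<omega>) = (\<lambda>_. 0)" by (auto simp: X'_def)
      thus ?thesis by (simp add: cadlag_def) blast
    qed
    show "X' t \<omega> = 0" if "t \<le> 0" for t using that by (simp add: X'_def)
    show "X' t \<in> borel_measurable M" for t by measurable
    show "increments_exponent M X' \<Psi>"
      unfolding increments_exponent_def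
    proof (intro allI impI)
      fix t :: "nat \<Rightarrow> real" and \<theta> n assume t: "0 \<le> t 0 \<and> mono t"
      have tk: "0 \<le> t k" for k using t mono_nonneg[of t k] by blast
      have [measurable]: "X (t k) \<in> borel_measurable M" for k using tk by (rule meas)
      have "(CLINT \<omega>|M. \<Prod>k<n. iexp (\<theta> k * (X' (t (Suc k)) \<omega> - X' (t k) \<omega>)))
         = (CLINT \<omega>|M. \<Prod>k<n. iexp (\<theta> k * (X (t (Suc k)) \<omega> - X (t k) \<omega>)))"
      proof (rule integral_cong_AE)
        show "AE \<omega> in M. (\<Prod>k<n. iexp (\<theta> k * (X' (t (Suc k)) \<omega> - X' (t k) \<omega>))) = (\<Prod>k<n. iexp (\<theta> k * (X (t (Suc k)) \<omega> - X (t k) \<omega>)))"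
          using eq by eventually_elim (simp add: tk)
      qed measurable
      thus "(CLINT \<omega>|M. \<Prod>k<n. iexp (\<theta> k * (X' (t (Suc k)) \<omega> - X' (t k) \<omega>)))
         = (\<Prod>k<n. exp (complex_of_real (t (Suc k) - t k) * \<Psi> (\<theta> k)))"
        using increments_exponentD[OF levy_process_increments[OF levy char]] t by simp
    qed
  qed
  thus ?thesis using that eq by blast
qed

theorem lamperti_exponent_limit:
  assumes \<alpha>: "0 < \<alpha>" and r: "0 < r" and rep: "lamperti_representation M \<alpha> r R \<xi>"
    and char: "has_char_exponent M \<xi> \<Psi>"
    and R: "\<And>t. 0 \<le> t \<Longrightarrow> R t \<in> borel_measurable M"
    and tn: "\<And>n. 0 < tn n" "tn \<longlonglongrightarrow> 0"
  shows "(\<lambda>n. ((CLINT \<omega>|M. iexp (\<theta> * ln (R (tn n * r powr \<alpha>) \<omega> / r))) - 1) / tn n) \<longlonglongrightarrow> \<Psi> \<theta>"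
proof -
  have levy: "levy_process M \<xi>" using rep by (simp add: lamperti_representation_def)
  obtain X where X: "cadlag_levy M X \<Psi>" and eq: "AE \<omega> in M. \<forall>t\<ge>0. X t \<omega> = \<xi> t \<omega>"
    using cadlag_modification[OF levy char] .
  interpret cadlag_levy M X \<Psi> by fact
  show ?thesis
  proof (rule exponent_from_small_times[OF \<alpha> tn])
    have "R (tn n * r powr \<alpha>) \<in> borel_measurable M" for n using tn(1)[of n] by (intro R) auto
    thus "(\<lambda>\<omega>. ln (R (tn n * r powr \<alpha>) \<omega> / r)) \<in> borel_measurable M" for n by measurable
    fix n S assume S: "0 < (S :: real)"
    have "AE \<omega> in M. \<forall>t\<ge>0. R t \<omega> = r * exp (\<xi> (lamperti_time \<alpha> (\<lambda>u. \<xi> u \<omega>) (t * r powr (-\<alpha>))) \<omega>)"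
      using rep unfolding lamperti_representation_def by (auto elim: eventually_mono)
    with eq AE_space
    show "AE \<omega> in M. tn n \<le> clock \<alpha> S \<omega> \<longrightarrow> ln (R (tn n * r powr \<alpha>) \<omega> / r) = X (hitting \<alpha> S (tn n) \<omega>) \<omega>"
    proof eventually_elim
      case (elim \<omega>)
      have "(LINT u:{0..s}|lborel. exp (\<alpha> * \<xi> u \<omega>)) = (LINT u:{0..s}|lborel. exp (\<alpha> * X u \<omega>))" for s
        unfolding set_lebesgue_integral_def
        by (rule Bochner_Integration.integral_cong) (use elim(1) in \<open>auto simp: indicator_def\<close>)
      hence time: "lamperti_time \<alpha> (\<lambda>u. \<xi> u \<omega>) t = lamperti_time \<alpha> (\<lambda>u. X u \<omega>) t" for t
        by (simp add: lamperti_time_def lamperti_set_def)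
      have clock_arg: "tn n * r powr \<alpha> * r powr (-\<alpha>) = tn n" using r by (simp add: powr_minus)
      have nn: "0 \<le> tn n * r powr \<alpha>" using tn(1)[of n] by simp
      have R_eq: "R (tn n * r powr \<alpha>) \<omega> = r * exp (\<xi> (lamperti_time \<alpha> (\<lambda>u. X u \<omega>) (tn n)) \<omega>)"
        using elim(3)[rule_format, OF nn] by (simp only: time clock_arg)
      show ?case
      proof
        assume late: "tn n \<le> clock \<alpha> S \<omega>"
        have "hitting \<alpha> S (tn n) \<omega> = lamperti_time \<alpha> (\<lambda>u. X u \<omega>) (tn n)"
          by (rule hitting_eq_lamperti_time[OF elim(2) S _ late]) (use tn(1)[of n] in simp)
        moreover have "0 \<le> hitting \<alpha> S (tn n) \<omega>"
          unfolding hitting_def set_lebesgue_integral_def by (rule Bochner_Integration.integral_nonneg) auto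
        ultimately show "ln (R (tn n * r powr \<alpha>) \<omega> / r) = X (hitting \<alpha> S (tn n) \<omega>) \<omega>"
          using R_eq elim(1) r by simp
      qed
    qed
  qed
qed

section \<open>The jump measure of the symmetric stable process\<close>

text \<open>The Levy measure of the symmetric stable process.\<close>

definition stable_jumps :: "real \<Rightarrow> real measure" where
  "stable_jumps \<alpha> = density lborel (\<lambda>w. ennreal (jump_const \<alpha> * \<bar>w\<bar> powr (-1 - \<alpha>)))"

lemma nn_integral_even:
  fixes f :: "real \<Rightarrow> ennreal"
  assumes [measurable]: "f \<in> borel_measurable borel" and even: "\<And>x. f (- x) = f x"
  shows "(\<integral>\<^sup>+ x. f x \<partial>lborel) = 2 * (\<integral>\<^sup>+ x. f x * indicator {0<..} x \<partial>lborel)"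
proof -
  have "(\<integral>\<^sup>+ x. f x \<partial>lborel) = (\<integral>\<^sup>+ x. f x * indicator {0<..} x + f x * indicator {..<0} x \<partial>lborel)"
    by (rule nn_integral_cong_AE) (use AE_lborel_singleton[of 0] in \<open>auto elim!: eventually_mono simp: indicator_def\<close>)
  also have "\<dots> = (\<integral>\<^sup>+ x. f x * indicator {0<..} x \<partial>lborel) + (\<integral>\<^sup>+ x. f x * indicator {..<0} x \<partial>lborel)"
    by (rule nn_integral_add) measurable
  also have "(\<integral>\<^sup>+ x. f x * indicator {..<0} x \<partial>lborel) = (\<integral>\<^sup>+ x. f x * indicator {0<..} x \<partial>lborel)"
    by (subst nn_integral_real_affine[where c = "-1" and t = 0]) (auto simp: even indicator_def intro!: nn_integral_cong)
  finally show ?thesis by (simp add: mult_2)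
qed

lemma nn_integral_gauss_powr:
  fixes p :: real
  assumes p: "-1 < p"
  shows "(\<integral>\<^sup>+ x. ennreal (x powr p * exp (- (x\<^sup>2) / 2)) * indicator {0<..} x \<partial>lborel)
       = ennreal (2 powr ((p - 1) / 2) * Gamma ((p + 1) / 2))"
proof -
  define s where "s = (p + 1) / 2"
  have s: "0 < s" using p by (simp add: s_def)
  define f where "f t = t powr (s - 1) / exp t" for t :: real
  have [measurable]: "f \<in> borel_measurable borel" unfolding f_def[abs_def] by measurable
  have sub: "(\<integral>\<^sup>+ t. ennreal (f t) * indicator {0..(real n)\<^sup>2 / 2} t \<partial>lborel)
     = (\<integral>\<^sup>+ x. ennreal (f (x\<^sup>2 / 2) * x) * indicator {0..real n} x \<partial>lborel)" for n
  proof -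
    have "(\<integral>\<^sup>+ t. f t * indicator {0\<^sup>2 / 2..(real n)\<^sup>2 / 2} t \<partial>lborel) = (\<integral>\<^sup>+ x. f (x\<^sup>2 / 2) * x * indicator {0..real n} x \<partial>lborel)"
      by (rule nn_integral_substitution[where g = "\<lambda>x. x\<^sup>2 / 2" and g' = "\<lambda>x. x"])
         (auto intro!: derivative_eq_intros continuous_intros simp: set_borel_measurable_def)
    thus ?thesis by (simp add: nn_integral_set_ennreal)
  qed
  have lim1: "(\<lambda>n. \<integral>\<^sup>+ t. ennreal (f t) * indicator {0..(real n)\<^sup>2 / 2} t \<partial>lborel) \<longlonglongrightarrow> (\<integral>\<^sup>+ t. ennreal (f t) * indicator {0..} t \<partial>lborel)"
  proof (rule nn_integral_LIMSEQ)
    show "incseq (\<lambda>n t. ennreal (f t) * indicator {0..(real n)\<^sup>2 / 2} t)"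
    proof (intro incseq_SucI le_funI)
      fix n t
      have "(real n)\<^sup>2 \<le> (real (Suc n))\<^sup>2" by (intro power_mono) auto
      hence imp: "t \<le> (real n)\<^sup>2 / 2 \<Longrightarrow> t \<le> (real (Suc n))\<^sup>2 / 2" for t by linarith
      show "ennreal (f t) * indicator {0..(real n)\<^sup>2 / 2} t \<le> ennreal (f t) * indicator {0..(real (Suc n))\<^sup>2 / 2} t"
        using imp[of t] by (auto simp: indicator_def simp del: of_nat_Suc)
    qed
    fix t :: real
    obtain N :: nat where N: "2 * t + 1 < real N" using reals_Archimedean2 by blast
    have "eventually (\<lambda>n. indicator {0..(real n)\<^sup>2 / 2} t = (indicator {0..} t :: ennreal)) sequentially"
      using eventually_ge_at_top[of "max 1 N"]
    proof eventually_elim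
      case (elim n)
      have "real n * 1 \<le> real n * real n" using elim by (intro mult_left_mono) auto
      moreover have "real N \<le> real n" using elim by simp
      ultimately have "t \<le> (real n)\<^sup>2 / 2 \<or> t < 0" using N unfolding power2_eq_square by linarith
      thus ?case by (auto simp: indicator_def)
    qed
    thus "(\<lambda>n. ennreal (f t) * indicator {0..(real n)\<^sup>2 / 2} t) \<longlonglongrightarrow> ennreal (f t) * indicator {0..} t"
      by (intro tendsto_eventually) (auto elim: eventually_mono)
  qed measurable
  have lim2: "(\<lambda>n. \<integral>\<^sup>+ x. ennreal (f (x\<^sup>2 / 2) * x) * indicator {0..real n} x \<partial>lborel) \<longlonglongrightarrow> (\<integral>\<^sup>+ x. ennreal (f (x\<^sup>2 / 2) * x) * indicator {0..} x \<partial>lborel)"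
  proof (rule nn_integral_LIMSEQ)
    show "incseq (\<lambda>n x. ennreal (f (x\<^sup>2 / 2) * x) * indicator {0..real n} x)"
      by (intro incseq_SucI le_funI) (auto simp: indicator_def)
    fix x :: real
    obtain N :: nat where N: "x < real N" using reals_Archimedean2 by blast
    have "eventually (\<lambda>n. indicator {0..real n} x = (indicator {0..} x :: ennreal)) sequentially"
      using eventually_ge_at_top[of N] by eventually_elim (use N in \<open>auto simp: indicator_def\<close>)
    thus "(\<lambda>n. ennreal (f (x\<^sup>2 / 2) * x) * indicator {0..real n} x) \<longlonglongrightarrow> ennreal (f (x\<^sup>2 / 2) * x) * indicator {0..} x"
      by (intro tendsto_eventually) (auto elim: eventually_mono)
  qed measurable
  have "ennreal (Gamma s) = (\<integral>\<^sup>+ t. ennreal (f t) * indicator {0..} t \<partial>lborel)"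
    unfolding Gamma_conv_nn_integral_real[OF s] by (intro nn_integral_cong) (auto simp: indicator_def f_def)
  also have "\<dots> = (\<integral>\<^sup>+ x. ennreal (f (x\<^sup>2 / 2) * x) * indicator {0..} x \<partial>lborel)"
    by (rule LIMSEQ_unique[OF lim1]) (unfold sub, rule lim2)
  also have "\<dots> = (\<integral>\<^sup>+ x. ennreal (2 powr (1 - s)) * (ennreal (x powr p * exp (- (x\<^sup>2) / 2)) * indicator {0<..} x) \<partial>lborel)"
  proof (rule nn_integral_cong)
    fix x :: real
    show "ennreal (f (x\<^sup>2 / 2) * x) * indicator {0..} x = ennreal (2 powr (1 - s)) * (ennreal (x powr p * exp (- (x\<^sup>2) / 2)) * indicator {0<..} x)"
    proof (cases "0 < x")
      case True
      have "(x\<^sup>2 / 2) powr (s - 1) = (x powr 2) powr (s - 1) * 2 powr (1 - s)"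
      proof -
        have "(x\<^sup>2 / 2) powr (s - 1) = (x\<^sup>2) powr (s - 1) / 2 powr (s - 1)" by (rule powr_divide)
        moreover have "2 powr (1 - s) = inverse (2 powr (s - 1))" using powr_minus[of 2 "s - 1"] by simp
        moreover have "x\<^sup>2 = x powr 2" using True by simp
        ultimately show ?thesis by (simp only: divide_inverse)
      qed
      also have "(x powr 2) powr (s - 1) = x powr (p - 1)" unfolding powr_powr by (rule arg_cong[where f = "(powr) x"]) (simp add: s_def field_simps)
      finally have "f (x\<^sup>2 / 2) * x = 2 powr (1 - s) * ((x powr (p - 1) * x powr 1) * exp (- (x\<^sup>2) / 2))"
        using True by (simp add: f_def exp_minus field_simps)
      also have "x powr (p - 1) * x powr 1 = x powr p" using True by (simp only: powr_add[symmetric]) simp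
      finally show ?thesis using True by (simp add: ennreal_mult)
    qed (auto simp: indicator_def)
  qed
  also have "\<dots> = ennreal (2 powr (1 - s)) * (\<integral>\<^sup>+ x. ennreal (x powr p * exp (- (x\<^sup>2) / 2)) * indicator {0<..} x \<partial>lborel)"
    by (rule nn_integral_cmult) measurable
  finally have eq: "ennreal (Gamma s) = ennreal (2 powr (1 - s)) * (\<integral>\<^sup>+ x. ennreal (x powr p * exp (- (x\<^sup>2) / 2)) * indicator {0<..} x \<partial>lborel)" .
  have "ennreal (2 powr (s - 1)) * ennreal (Gamma s)
      = (ennreal (2 powr (s - 1)) * ennreal (2 powr (1 - s))) * (\<integral>\<^sup>+ x. ennreal (x powr p * exp (- (x\<^sup>2) / 2)) * indicator {0<..} x \<partial>lborel)"
    unfolding eq by (simp add: mult.assoc)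
  also have "ennreal (2 powr (s - 1)) * ennreal (2 powr (1 - s)) = 1"
    by (simp add: ennreal_mult[symmetric] powr_add[symmetric])
  finally show ?thesis using s by (simp add: ennreal_mult Gamma_real_pos less_imp_le s_def diff_divide_distrib add_divide_distrib)
qed

text \<open>\<open>1 - exp (- (w\<^sup>2) / 2)\<close> is written as an integral of \<open>x exp (- (x\<^sup>2) / 2)\<close> over \<open>0 \<le> x \<le> w\<close>, and the
  order of integration is exchanged.\<close>

lemma nn_integral_gauss_defect:
  fixes \<alpha> :: real
  assumes \<alpha>: "0 < \<alpha>" "\<alpha> < 2"
  shows "(\<integral>\<^sup>+ w. ennreal ((1 - exp (- (w\<^sup>2) / 2)) * w powr (-1 - \<alpha>)) * indicator {0<..} w \<partial>lborel)
       = ennreal (2 powr (- \<alpha> / 2) * Gamma (1 - \<alpha> / 2) / \<alpha>)"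
proof -
  define H where "H w x = ennreal (w powr (-1 - \<alpha>)) * indicator {0<..} w * (ennreal (x * exp (- (x\<^sup>2) / 2)) * indicator {0..w} x)" for w x :: real
  have "(\<lambda>p :: real \<times> real. if 0 \<le> snd p \<and> snd p \<le> fst p then 1 else 0 :: ennreal) \<in> borel_measurable (lborel \<Otimes>\<^sub>M lborel)"
    by measurable
  hence [measurable]: "(\<lambda>p :: real \<times> real. indicator {0..fst p} (snd p) :: ennreal) \<in> borel_measurable (lborel \<Otimes>\<^sub>M lborel)"
    by (simp add: indicator_def[abs_def])
  have H [measurable]: "(\<lambda>(w, x). H w x) \<in> borel_measurable (lborel \<Otimes>\<^sub>M lborel)"
    unfolding H_def split_beta' by measurable
  have "(\<integral>\<^sup>+ w. ennreal ((1 - exp (- (w\<^sup>2) / 2)) * w powr (-1 - \<alpha>)) * indicator {0<..} w \<partial>lborel)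
      = (\<integral>\<^sup>+ w. \<integral>\<^sup>+ x. H w x \<partial>lborel \<partial>lborel)"
  proof (rule nn_integral_cong)
    fix w :: real
    show "ennreal ((1 - exp (- (w\<^sup>2) / 2)) * w powr (-1 - \<alpha>)) * indicator {0<..} w = (\<integral>\<^sup>+ x. H w x \<partial>lborel)"
    proof (cases "0 < w")
      case True
      have "(\<integral>\<^sup>+ x. ennreal (x * exp (- (x\<^sup>2) / 2)) * indicator {0..w} x \<partial>lborel) = ennreal (- exp (- (w\<^sup>2) / 2) - - exp (- (0\<^sup>2) / 2))"
        using True by (intro nn_integral_FTC_Icc) (auto intro!: derivative_eq_intros)
      thus ?thesis using True unfolding H_def
        by (subst nn_integral_cmult) (auto simp: ennreal_mult mult.commute)
    qed (simp add: H_def)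
  qed
  also have "\<dots> = (\<integral>\<^sup>+ x. \<integral>\<^sup>+ w. H w x \<partial>lborel \<partial>lborel)"
    by (rule lborel_pair.Fubini'[symmetric]) (rule H)
  also have "\<dots> = (\<integral>\<^sup>+ x. ennreal (1 / \<alpha>) * (ennreal (x powr (1 - \<alpha>) * exp (- (x\<^sup>2) / 2)) * indicator {0<..} x) \<partial>lborel)"
  proof (rule nn_integral_cong_AE)
    show "AE x in lborel. (\<integral>\<^sup>+ w. H w x \<partial>lborel) = ennreal (1 / \<alpha>) * (ennreal (x powr (1 - \<alpha>) * exp (- (x\<^sup>2) / 2)) * indicator {0<..} x)"
      using AE_lborel_singleton[of 0]
    proof eventually_elim
      case (elim x)
      show ?case
      proof (cases "0 < x")
        case True
        have lim: "((\<lambda>w. - (w powr (-\<alpha>)) / \<alpha>) \<longlongrightarrow> - 0 / \<alpha>) at_top"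
          using \<alpha> by (intro tendsto_intros tendsto_neg_powr filterlim_ident) auto
        have "(\<integral>\<^sup>+ w. H w x \<partial>lborel) = (\<integral>\<^sup>+ w. ennreal (x * exp (- (x\<^sup>2) / 2)) * (ennreal (w powr (-1 - \<alpha>)) * indicator {x..} w) \<partial>lborel)"
          unfolding H_def using True by (intro nn_integral_cong) (auto simp: indicator_def mult.commute)
        also have "\<dots> = ennreal (x * exp (- (x\<^sup>2) / 2)) * (\<integral>\<^sup>+ w. ennreal (w powr (-1 - \<alpha>)) * indicator {x..} w \<partial>lborel)"
          by (rule nn_integral_cmult) measurable
        also have "(\<integral>\<^sup>+ w. ennreal (w powr (-1 - \<alpha>)) * indicator {x..} w \<partial>lborel) = ennreal (- 0 / \<alpha> - (- (x powr (-\<alpha>)) / \<alpha>))"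
        proof (rule nn_integral_FTC_atLeast[OF _ _ _ lim])
          fix w assume "x \<le> w"
          hence "0 < w" using True by simp
          have e: "- \<alpha> - 1 = -1 - \<alpha>" by simp
          show "DERIV (\<lambda>w. - (w powr (-\<alpha>)) / \<alpha>) w :> w powr (-1 - \<alpha>)"
            using \<alpha> \<open>0 < w\<close> by (auto intro!: derivative_eq_intros simp: e)
        qed auto
        also have "ennreal (x * exp (- (x\<^sup>2) / 2)) * \<dots> = ennreal (1 / \<alpha>) * ennreal ((x powr 1 * x powr (-\<alpha>)) * exp (- (x\<^sup>2) / 2))"
          using True \<alpha> by (simp add: ennreal_mult[symmetric] field_simps)
        also have "x powr 1 * x powr (-\<alpha>) = x powr (1 - \<alpha>)" by (simp only: powr_add[symmetric]) simp
        finally show ?thesis using True by simp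
      next
        case False
        hence "x < 0" using elim by simp
        thus ?thesis by (simp add: H_def)
      qed
    qed
  qed
  also have "\<dots> = ennreal (1 / \<alpha>) * (\<integral>\<^sup>+ x. ennreal (x powr (1 - \<alpha>) * exp (- (x\<^sup>2) / 2)) * indicator {0<..} x \<partial>lborel)"
    by (rule nn_integral_cmult) measurable
  also have "\<dots> = ennreal (1 / \<alpha>) * ennreal (2 powr (- \<alpha> / 2) * Gamma (1 - \<alpha> / 2))"
    using nn_integral_gauss_powr[of "1 - \<alpha>"] \<alpha> by (simp add: diff_divide_distrib)
  also have "\<dots> = ennreal (2 powr (- \<alpha> / 2) * Gamma (1 - \<alpha> / 2) / \<alpha>)"
    using \<alpha> by (simp add: ennreal_mult[symmetric] Gamma_real_pos less_imp_le)
  finally show ?thesis .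
qed

lemma std_normal_cos:
  "(LINT s|std_normal_distribution. cos (s * w)) = exp (- (w\<^sup>2) / 2)"
proof -
  interpret N: real_distribution std_normal_distribution by (rule real_dist_normal_dist)
  have "(LINT s|std_normal_distribution. cos (s * w)) = (LINT s|std_normal_distribution. Re (iexp (w * s)))"
    by (simp add: Re_exp mult.commute)
  also have "\<dots> = Re (char std_normal_distribution w)"
    unfolding char_def by (rule integral_Re, rule N.integrable_iexp) (simp_all add: Im_complex_of_real)
  finally show ?thesis by (simp add: char_std_normal_distribution)
qed

lemma jump_const_pos: "0 < \<alpha> \<Longrightarrow> \<alpha> < 2 \<Longrightarrow> 0 < jump_const \<alpha>"
  by (auto simp: jump_const_def pochhammer_real_def intro!: divide_pos_pos mult_pos_pos Gamma_real_pos)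

text \<open>The Levy--Khintchine formula of the symmetric stable process. The constant is found by averaging \<open>\<integral> (1 - cos (\<theta> w)) |w| powr (-1 - \<alpha>) dw\<close>, which is a
  multiple of \<open>|\<theta>| powr \<alpha>\<close>, over a standard normal \<open>\<theta>\<close>.\<close>

theorem stable_exponent:
  assumes \<alpha>: "0 < \<alpha>" "\<alpha> < 2"
  shows "(\<integral>\<^sup>+ w. ennreal (1 - cos (\<theta> * w)) \<partial>stable_jumps \<alpha>) = ennreal (\<bar>\<theta>\<bar> powr \<alpha>)"
proof -
  let ?N = std_normal_distribution
  interpret N: real_distribution ?N by (rule real_dist_normal_dist)
  interpret P: pair_sigma_finite ?N lborel
    by (intro pair_sigma_finite.intro N.sigma_finite_measure_axioms lborel.sigma_finite_measure_axioms)
  \<comment> \<open>The integral is \<open>|\<theta>| powr \<alpha> * J 1\<close> by scaling; Gaussian averaging determines \<open>J 1\<close>.\<close>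
  define J where "J \<theta> = (\<integral>\<^sup>+ w. ennreal (1 - cos (\<theta> * w)) * ennreal (\<bar>w\<bar> powr (-1 - \<alpha>)) \<partial>lborel)" for \<theta> :: real
  have J_scale: "J \<theta> = ennreal (\<bar>\<theta>\<bar> powr \<alpha>) * J 1" for \<theta>
  proof (cases "\<theta> = 0")
    case False
    have "J \<theta> = ennreal \<bar>1 / \<theta>\<bar> * (\<integral>\<^sup>+ w. ennreal (1 - cos (\<theta> * (0 + 1 / \<theta> * w))) * ennreal (\<bar>0 + 1 / \<theta> * w\<bar> powr (-1 - \<alpha>)) \<partial>lborel)"
      unfolding J_def by (rule nn_integral_real_affine) (use False in auto)
    also have "(\<lambda>w. ennreal (1 - cos (\<theta> * (0 + 1 / \<theta> * w))) * ennreal (\<bar>0 + 1 / \<theta> * w\<bar> powr (-1 - \<alpha>)))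
        = (\<lambda>w. ennreal (\<bar>\<theta>\<bar> powr (1 + \<alpha>)) * (ennreal (1 - cos (1 * w)) * ennreal (\<bar>w\<bar> powr (-1 - \<alpha>))))"
    proof
      fix w
      have "\<bar>0 + 1 / \<theta> * w\<bar> powr (-1 - \<alpha>) = \<bar>w\<bar> powr (-1 - \<alpha>) / \<bar>\<theta>\<bar> powr (-1 - \<alpha>)"
        by (simp add: abs_mult powr_divide)
      also have "\<dots> = \<bar>\<theta>\<bar> powr (1 + \<alpha>) * \<bar>w\<bar> powr (-1 - \<alpha>)"
        using powr_minus[of "\<bar>\<theta>\<bar>" "1 + \<alpha>"] by (simp add: divide_inverse)
      finally show "ennreal (1 - cos (\<theta> * (0 + 1 / \<theta> * w))) * ennreal (\<bar>0 + 1 / \<theta> * w\<bar> powr (-1 - \<alpha>))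
         = ennreal (\<bar>\<theta>\<bar> powr (1 + \<alpha>)) * (ennreal (1 - cos (1 * w)) * ennreal (\<bar>w\<bar> powr (-1 - \<alpha>)))"
        using False by (simp add: ennreal_mult mult_ac)
    qed
    also have "(\<integral>\<^sup>+ w. ennreal (\<bar>\<theta>\<bar> powr (1 + \<alpha>)) * (ennreal (1 - cos (1 * w)) * ennreal (\<bar>w\<bar> powr (-1 - \<alpha>))) \<partial>lborel) = ennreal (\<bar>\<theta>\<bar> powr (1 + \<alpha>)) * J 1"
      unfolding J_def by (rule nn_integral_cmult) measurable
    also have "ennreal \<bar>1 / \<theta>\<bar> * (ennreal (\<bar>\<theta>\<bar> powr (1 + \<alpha>)) * J 1) = ennreal (\<bar>1 / \<theta>\<bar> * (\<bar>\<theta>\<bar> powr (1 + \<alpha>))) * J 1"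
      by (simp only: ennreal_mult[OF abs_ge_zero powr_ge_zero] mult.assoc)
    also have "\<bar>1 / \<theta>\<bar> * (\<bar>\<theta>\<bar> powr (1 + \<alpha>)) = \<bar>\<theta>\<bar> powr \<alpha>" using False by (simp add: powr_add)
    finally show ?thesis .
  qed (simp add: J_def)
  define a where "a = 2 powr (\<alpha> / 2) * Gamma ((\<alpha> + 1) / 2) / sqrt pi"
  define b where "b = 2 * (2 powr (- \<alpha> / 2) * Gamma (1 - \<alpha> / 2) / \<alpha>)"
  have pos: "0 < Gamma ((\<alpha> + 1) / 2)" "0 < Gamma (1 - \<alpha> / 2)" using \<alpha> by (auto intro!: Gamma_real_pos)
  have moment: "(\<integral>\<^sup>+ s. ennreal (\<bar>s\<bar> powr \<alpha>) \<partial>?N) = ennreal a"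
  proof -
    have "(\<integral>\<^sup>+ s. ennreal (\<bar>s\<bar> powr \<alpha>) \<partial>?N) = (\<integral>\<^sup>+ s. ennreal (std_normal_density s) * ennreal (\<bar>s\<bar> powr \<alpha>) \<partial>lborel)"
      by (rule nn_integral_density) auto
    also have "\<dots> = 2 * (\<integral>\<^sup>+ s. ennreal (std_normal_density s) * ennreal (\<bar>s\<bar> powr \<alpha>) * indicator {0<..} s \<partial>lborel)"
      by (rule nn_integral_even) (auto simp: std_normal_density_def)
    also have "(\<integral>\<^sup>+ s. ennreal (std_normal_density s) * ennreal (\<bar>s\<bar> powr \<alpha>) * indicator {0<..} s \<partial>lborel)
        = (\<integral>\<^sup>+ s. ennreal (1 / sqrt (2 * pi)) * (ennreal (s powr \<alpha> * exp (- (s\<^sup>2) / 2)) * indicator {0<..} s) \<partial>lborel)"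
      by (intro nn_integral_cong) (auto simp: indicator_def std_normal_density_def ennreal_mult[symmetric] mult_ac)
    also have "\<dots> = ennreal (1 / sqrt (2 * pi)) * (\<integral>\<^sup>+ s. ennreal (s powr \<alpha> * exp (- (s\<^sup>2) / 2)) * indicator {0<..} s \<partial>lborel)"
      by (rule nn_integral_cmult) measurable
    also have "\<dots> = ennreal (1 / sqrt (2 * pi)) * ennreal (2 powr ((\<alpha> - 1) / 2) * Gamma ((\<alpha> + 1) / 2))"
      using \<alpha> by (subst nn_integral_gauss_powr) auto
    also have "2 * \<dots> = ennreal (2 * (1 / sqrt (2 * pi) * (2 powr ((\<alpha> - 1) / 2) * Gamma ((\<alpha> + 1) / 2))))"
      unfolding ennreal_numeral[symmetric] using pos by (simp add: ennreal_mult[symmetric] del: ennreal_numeral)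
    also have "2 * (1 / sqrt (2 * pi) * (2 powr ((\<alpha> - 1) / 2) * Gamma ((\<alpha> + 1) / 2))) = a"
    proof -
      have "2 powr ((\<alpha> - 1) / 2) = 2 powr (\<alpha> / 2) / sqrt 2"
        by (simp add: diff_divide_distrib powr_diff powr_half_sqrt)
      moreover have "sqrt (2 * pi) = sqrt 2 * sqrt pi" "sqrt 2 * sqrt 2 = 2" by (simp_all add: real_sqrt_mult)
      moreover have alg: "2 * (1 / (s * q) * (p / s * G)) = 2 / (s * s) * (p * G) / q" for s q p G :: real by simp
      ultimately have "2 * (1 / sqrt (2 * pi) * (2 powr ((\<alpha> - 1) / 2) * Gamma ((\<alpha> + 1) / 2)))
          = 2 / (sqrt 2 * sqrt 2) * (2 powr (\<alpha> / 2) * Gamma ((\<alpha> + 1) / 2)) / sqrt pi"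
        using alg[of "sqrt 2" "sqrt pi"] by simp
      thus ?thesis by (simp add: a_def)
    qed
    finally show ?thesis .
  qed
  have "ennreal a * J 1 = (\<integral>\<^sup>+ s. ennreal (\<bar>s\<bar> powr \<alpha>) * J 1 \<partial>?N)"
    unfolding moment[symmetric] by (rule nn_integral_multc[symmetric]) simp
  also have "\<dots> = (\<integral>\<^sup>+ s. \<integral>\<^sup>+ w. ennreal (1 - cos (s * w)) * ennreal (\<bar>w\<bar> powr (-1 - \<alpha>)) \<partial>lborel \<partial>?N)"
  proof (rule nn_integral_cong)
    show "ennreal (\<bar>s\<bar> powr \<alpha>) * J 1 = (\<integral>\<^sup>+ w. ennreal (1 - cos (s * w)) * ennreal (\<bar>w\<bar> powr (-1 - \<alpha>)) \<partial>lborel)" for s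
      by (subst J_scale[of s, symmetric]) (simp add: J_def)
  qed
  also have "\<dots> = (\<integral>\<^sup>+ w. \<integral>\<^sup>+ s. ennreal (1 - cos (s * w)) * ennreal (\<bar>w\<bar> powr (-1 - \<alpha>)) \<partial>?N \<partial>lborel)"
    by (rule P.Fubini'[symmetric]) measurable
  also have "\<dots> = (\<integral>\<^sup>+ w. ennreal ((1 - exp (- (w\<^sup>2) / 2)) * \<bar>w\<bar> powr (-1 - \<alpha>)) \<partial>lborel)"
  proof (rule nn_integral_cong)
    fix w :: real
    have int: "integrable ?N (\<lambda>s. cos (s * w))" by (rule N.integrable_const_bound[of _ 1]) auto
    have "(\<integral>\<^sup>+ s. ennreal (1 - cos (s * w)) \<partial>?N) = ennreal (LINT s|?N. 1 - cos (s * w))"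
      using int by (intro nn_integral_eq_integral) auto
    also have "(LINT s|?N. 1 - cos (s * w)) = 1 - exp (- (w\<^sup>2) / 2)"
      using int N.prob_space by (simp add: std_normal_cos)
    finally show "(\<integral>\<^sup>+ s. ennreal (1 - cos (s * w)) * ennreal (\<bar>w\<bar> powr (-1 - \<alpha>)) \<partial>?N) = ennreal ((1 - exp (- (w\<^sup>2) / 2)) * \<bar>w\<bar> powr (-1 - \<alpha>))"
      by (subst nn_integral_multc) (auto simp: ennreal_mult)
  qed
  also have "\<dots> = 2 * (\<integral>\<^sup>+ w. ennreal ((1 - exp (- (w\<^sup>2) / 2)) * \<bar>w\<bar> powr (-1 - \<alpha>)) * indicator {0<..} w \<partial>lborel)"
    by (rule nn_integral_even) auto
  also have "(\<integral>\<^sup>+ w. ennreal ((1 - exp (- (w\<^sup>2) / 2)) * \<bar>w\<bar> powr (-1 - \<alpha>)) * indicator {0<..} w \<partial>lborel)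
      = (\<integral>\<^sup>+ w. ennreal ((1 - exp (- (w\<^sup>2) / 2)) * w powr (-1 - \<alpha>)) * indicator {0<..} w \<partial>lborel)"
    by (rule nn_integral_cong) (auto simp: indicator_def)
  also have "2 * \<dots> = ennreal b"
    unfolding nn_integral_gauss_defect[OF \<alpha>] b_def ennreal_numeral[symmetric]
    using pos \<alpha> by (simp add: ennreal_mult[symmetric] del: ennreal_numeral)
  finally have ab: "ennreal a * J 1 = ennreal b" .
  have a: "0 < a" and b: "0 < b" using pos \<alpha> by (auto simp: a_def b_def)
  have "J 1 \<noteq> \<top>"
  proof
    assume "J 1 = \<top>"
    hence "ennreal a * J 1 = \<top>" using a by (simp add: ennreal_mult_eq_top_iff)
    thus False using ab by simp
  qed
  then obtain j where j: "J 1 = ennreal j" "0 \<le> j" by (cases "J 1") auto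
  hence "a * j = b" using ab a b by (simp add: ennreal_mult[symmetric])
  moreover have "jump_const \<alpha> * (b / a) = 1"
  proof -
    have "- \<alpha> / 2 = - (\<alpha> / 2)" "\<alpha> - 1 = \<alpha> / 2 + \<alpha> / 2 - 1" by simp_all
    hence "2 powr (- \<alpha> / 2) = 1 / 2 powr (\<alpha> / 2)" "2 powr (\<alpha> - 1) = 2 powr (\<alpha> / 2) * 2 powr (\<alpha> / 2) / 2"
      by (simp_all only: powr_minus_divide powr_add powr_diff powr_one_gt_zero_iff powr_one zero_less_numeral zero_le_numeral)
    moreover have "1/2 + \<alpha> / 2 = (\<alpha> + 1) / 2" by simp
    moreover have "p * p / 2 * \<alpha> * (g / q) / h * (2 * (1 / p * h / \<alpha>) / (p * g / q)) = 1"
      if "0 < p" "0 < g" "0 < h" "0 < q" for p g h q :: real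
      using that \<alpha> by (simp add: field_simps)
    ultimately show ?thesis
      using pos by (simp only: jump_const_def pochhammer_real_def Gamma_one_half_real a_def b_def)
        (simp only: powr_gt_zero real_sqrt_gt_zero pi_gt_zero)
  qed
  ultimately have cj: "jump_const \<alpha> * j = 1" using a by (auto simp: field_simps)
  have "(\<integral>\<^sup>+ w. ennreal (1 - cos (\<theta> * w)) \<partial>stable_jumps \<alpha>)
      = (\<integral>\<^sup>+ w. ennreal (jump_const \<alpha>) * (ennreal (1 - cos (\<theta> * w)) * ennreal (\<bar>w\<bar> powr (-1 - \<alpha>))) \<partial>lborel)"
    unfolding stable_jumps_def using jump_const_pos[OF \<alpha>]
    by (subst nn_integral_density) (auto intro!: nn_integral_cong simp: ennreal_mult mult_ac)
  also have "\<dots> = ennreal (jump_const \<alpha>) * J \<theta>"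
    unfolding J_def by (rule nn_integral_cmult) measurable
  also have "\<dots> = ennreal (jump_const \<alpha>) * ennreal j * ennreal (\<bar>\<theta>\<bar> powr \<alpha>)"
    by (subst J_scale) (simp add: j mult_ac)
  also have "ennreal (jump_const \<alpha>) * ennreal j = 1"
    using cj j jump_const_pos[OF \<alpha>] by (simp add: ennreal_mult[symmetric])
  finally show ?thesis by simp
qed

section \<open>Weak convergence of weighted jump measures\<close>

text \<open>The weight that turns a jump measure into a finite measure; it is an average of \<open>1 - cos (s w)\<close>
  over a standard normal \<open>s\<close>.\<close>

definition gauss_weight :: "real \<Rightarrow> real" where
  "gauss_weight w = 1 - exp (- (w\<^sup>2) / 2)"

text \<open>The characteristic function of the measure \<open>\<mu>\<close> weighted by \<open>gauss_weight\<close>, in terms of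
  \<open>D \<theta> = \<integral> 1 - cos (\<theta> w) d\<mu>\<close>, for symmetric \<open>\<mu>\<close>.\<close>

definition gauss_difference :: "(real \<Rightarrow> real) \<Rightarrow> real \<Rightarrow> real" where
  "gauss_difference D \<theta> = (LINT s|std_normal_distribution. (D (\<theta> + s) + D (\<theta> - s)) / 2 - D \<theta>)"

lemma gauss_weight_bounds: "0 \<le> gauss_weight w" "gauss_weight w \<le> 1" "min 1 (w\<^sup>2) \<le> 3 * gauss_weight w"
proof -
  show "0 \<le> gauss_weight w" "gauss_weight w \<le> 1" by (auto simp: gauss_weight_def)
  define u where "u = w\<^sup>2 / 2"
  have u: "0 \<le> u" by (simp add: u_def)
  have "1 + u \<le> exp u" by (rule exp_ge_add_one_self)
  hence "exp (- u) \<le> 1 / (1 + u)" using u by (simp add: exp_minus field_simps)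
  hence *: "1 - 1 / (1 + u) \<le> gauss_weight w" by (simp add: gauss_weight_def u_def)
  have "1 - 1 / (1 + u) = u / (1 + u)" using u by (simp add: field_simps)
  moreover have "min 1 (2 * u) \<le> 3 * (u / (1 + u))"
  proof (cases "2 * u \<le> 1")
    case True
    have "2 * u * (1 + u) \<le> 2 * u * (3 / 2)" using True u by (intro mult_left_mono) auto
    thus ?thesis using True u by (simp add: field_simps)
  qed (use u in \<open>simp add: field_simps\<close>)
  ultimately show "min 1 (w\<^sup>2) \<le> 3 * gauss_weight w" using * by (simp add: u_def)
qed

lemma gauss_weight_eq_0_iff: "gauss_weight w = 0 \<longleftrightarrow> w = 0"
  by (simp add: gauss_weight_def)

lemma gauss_weight_measurable [measurable]: "gauss_weight \<in> borel_measurable borel"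
  unfolding gauss_weight_def[abs_def] by measurable

lemma integrable_std_normal_abs: "integrable std_normal_distribution (\<lambda>s. \<bar>s\<bar>)"
proof -
  have "integrable std_normal_distribution (\<lambda>s::real. s)"
    using integrable_std_normal_moment[of 1] by (simp add: integrable_density)
  thus ?thesis by (rule integrable_abs)
qed

lemma gauss_weight_char:
  fixes \<mu> :: "real measure"
  assumes sf: "sigma_finite_measure \<mu>" and sets [measurable_cong]: "sets \<mu> = sets borel"
    and sym: "distr \<mu> borel uminus = \<mu>"
    and D: "\<And>\<theta>. (\<integral>\<^sup>+ w. ennreal (1 - cos (\<theta> * w)) \<partial>\<mu>) = ennreal (D \<theta>)" "\<And>\<theta>. 0 \<le> D \<theta>"
    and D_bound: "\<And>\<theta>. D \<theta> \<le> 1 + \<bar>\<theta>\<bar>"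
  shows "integrable \<mu> gauss_weight"
    and "(CLINT w|\<mu>. gauss_weight w * iexp (\<theta> * w)) = complex_of_real (gauss_difference D \<theta>)"
proof -
  let ?N = std_normal_distribution
  interpret N: real_distribution ?N by (rule real_dist_normal_dist)
  interpret \<mu>: sigma_finite_measure \<mu> by fact
  interpret P: pair_sigma_finite ?N \<mu> by (intro pair_sigma_finite.intro N.sigma_finite_measure_axioms sf)
  have cos_int: "integrable \<mu> (\<lambda>w. 1 - cos (\<theta> * w))" "(LINT w|\<mu>. 1 - cos (\<theta> * w)) = D \<theta>" for \<theta>
  proof -
    show int: "integrable \<mu> (\<lambda>w. 1 - cos (\<theta> * w))"
      by (rule integrableI_nonneg) (auto simp: D)
    show "(LINT w|\<mu>. 1 - cos (\<theta> * w)) = D \<theta>"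
      using nn_integral_eq_integral[OF int] D by simp
  qed
  define f where "f \<theta> s w = complex_of_real (1 - cos (s * w)) * iexp (\<theta> * w)" for \<theta> s w :: real
  have f [measurable]: "(\<lambda>(s, w). f \<theta> s w) \<in> borel_measurable (?N \<Otimes>\<^sub>M \<mu>)" for \<theta>
    unfolding f_def split_beta' by measurable
  have norm_f: "norm (f \<theta> s w) = 1 - cos (s * w)" for \<theta> s w
    by (simp add: f_def norm_mult del: of_real_diff of_real_mult)
  have f_int: "integrable (?N \<Otimes>\<^sub>M \<mu>) (\<lambda>(s, w). f \<theta> s w)" for \<theta>
  proof (rule integrableI_bounded)
    have "(\<integral>\<^sup>+ p. norm (case p of (s, w) \<Rightarrow> f \<theta> s w) \<partial>(?N \<Otimes>\<^sub>M \<mu>)) = (\<integral>\<^sup>+ s. \<integral>\<^sup>+ w. norm (f \<theta> s w) \<partial>\<mu> \<partial>?N)"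
      by (subst \<mu>.nn_integral_fst[symmetric]) auto
    also have "\<dots> = (\<integral>\<^sup>+ s. ennreal (D s) \<partial>?N)" unfolding norm_f D ..
    also have "\<dots> \<le> (\<integral>\<^sup>+ s. ennreal (1 + \<bar>s\<bar>) \<partial>?N)" by (intro nn_integral_mono ennreal_leI D_bound)
    also have "\<dots> = ennreal (LINT s|?N. 1 + \<bar>s\<bar>)"
      using integrable_std_normal_abs by (intro nn_integral_eq_integral) auto
    finally show "(\<integral>\<^sup>+ p. norm (case p of (s, w) \<Rightarrow> f \<theta> s w) \<partial>(?N \<Otimes>\<^sub>M \<mu>)) < \<infinity>"
      by (simp add: le_less_trans)
  qed (rule f)
  have inner_N: "(\<integral>s. f \<theta> s w \<partial>?N) = gauss_weight w * iexp (\<theta> * w)" for \<theta> w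
  proof -
    have int: "integrable ?N (\<lambda>s. cos (s * w))" by (rule N.integrable_const_bound[of _ 1]) auto
    have "(\<integral>s. f \<theta> s w \<partial>?N) = complex_of_real (\<integral>s. 1 - cos (s * w) \<partial>?N) * iexp (\<theta> * w)"
      unfolding f_def by (simp only: integral_mult_left_zero integral_complex_of_real)
    also have "(\<integral>s. 1 - cos (s * w) \<partial>?N) = gauss_weight w"
      using int N.prob_space by (simp add: std_normal_cos gauss_weight_def)
    finally show ?thesis .
  qed
  have inner_\<mu>: "(\<integral>w. f \<theta> s w \<partial>\<mu>) = complex_of_real ((D (\<theta> + s) + D (\<theta> - s)) / 2 - D \<theta>)" for \<theta> s
  proof -
    have int: "integrable \<mu> (\<lambda>w. (1 - cos (s * w)) * cos (\<theta> * w))" "integrable \<mu> (\<lambda>w. (1 - cos (s * w)) * sin (\<theta> * w))"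
      by (rule Bochner_Integration.integrable_bound[OF cos_int(1)[of s]];
          auto simp: abs_mult intro!: mult_left_le)+
    have "(\<integral>w. (1 - cos (s * w)) * sin (\<theta> * w) \<partial>\<mu>) = (\<integral>w. (1 - cos (s * w)) * sin (\<theta> * w) \<partial>distr \<mu> borel uminus)"
      by (simp add: sym)
    also have "\<dots> = (\<integral>w. - ((1 - cos (s * w)) * sin (\<theta> * w)) \<partial>\<mu>)" by (subst integral_distr) auto
    finally have odd: "(\<integral>w. (1 - cos (s * w)) * sin (\<theta> * w) \<partial>\<mu>) = 0" by simp
    have "(\<integral>w. (1 - cos (s * w)) * cos (\<theta> * w) \<partial>\<mu>)
        = (\<integral>w. ((1 - cos ((\<theta> + s) * w)) + (1 - cos ((\<theta> - s) * w))) / 2 - (1 - cos (\<theta> * w)) \<partial>\<mu>)"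
      by (rule Bochner_Integration.integral_cong) (auto simp: distrib_right left_diff_distrib cos_add cos_diff field_simps)
    also have "\<dots> = (D (\<theta> + s) + D (\<theta> - s)) / 2 - D \<theta>"
      by (simp only: Bochner_Integration.integral_diff Bochner_Integration.integral_add integrable_divide_zero
          Bochner_Integration.integrable_add integral_divide_zero cos_int)
    finally have re: "(\<integral>w. (1 - cos (s * w)) * cos (\<theta> * w) \<partial>\<mu>) = (D (\<theta> + s) + D (\<theta> - s)) / 2 - D \<theta>" .
    have "f \<theta> s = (\<lambda>w. complex_of_real ((1 - cos (s * w)) * cos (\<theta> * w)) + \<i> * complex_of_real ((1 - cos (s * w)) * sin (\<theta> * w)))"
      by (rule ext, unfold f_def, rule complex_eqI) (simp_all add: Re_exp Im_exp del: of_real_mult)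
    hence "(\<integral>w. f \<theta> s w \<partial>\<mu>) = complex_of_real (\<integral>w. (1 - cos (s * w)) * cos (\<theta> * w) \<partial>\<mu>) + \<i> * complex_of_real (\<integral>w. (1 - cos (s * w)) * sin (\<theta> * w) \<partial>\<mu>)"
      using int by (simp only: Bochner_Integration.integral_add complex_of_real_integrable_eq integral_complex_of_real integral_mult_right_zero integrable_mult_right)
    thus ?thesis by (simp only: odd re) simp
  qed
  have "integrable \<mu> (\<lambda>w. \<integral>s. f 0 s w \<partial>?N)" using P.integrable_snd[OF f_int[of 0]] by simp
  thus "integrable \<mu> gauss_weight" unfolding inner_N by (simp add: complex_of_real_integrable_eq)
  have "(CLINT w|\<mu>. gauss_weight w * iexp (\<theta> * w)) = (\<integral>w. \<integral>s. f \<theta> s w \<partial>?N \<partial>\<mu>)" unfolding inner_N ..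
  also have "\<dots> = (\<integral>s. \<integral>w. f \<theta> s w \<partial>\<mu> \<partial>?N)" by (rule P.Fubini_integral) (rule f_int)
  also have "\<dots> = complex_of_real (gauss_difference D \<theta>)"
    unfolding inner_\<mu> gauss_difference_def by (rule integral_complex_of_real)
  finally show "(CLINT w|\<mu>. gauss_weight w * iexp (\<theta> * w)) = complex_of_real (gauss_difference D \<theta>)" .
qed

text \<open>The probability measure obtained from \<open>\<mu>\<close> by weighting and normalizing.\<close>

definition gauss_tilt :: "real measure \<Rightarrow> real measure" where
  "gauss_tilt \<mu> = density \<mu> (\<lambda>w. ennreal (gauss_weight w / (LINT w|\<mu>. gauss_weight w)))"

lemma gauss_tilt:
  fixes \<mu> :: "real measure" and h :: "real \<Rightarrow> complex"
  assumes sets [measurable_cong]: "sets \<mu> = sets borel" and int: "integrable \<mu> gauss_weight"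
    and pos: "0 < (LINT w|\<mu>. gauss_weight w)"
  shows "real_distribution (gauss_tilt \<mu>)"
    and "h \<in> borel_measurable borel \<Longrightarrow>
      (LINT w|gauss_tilt \<mu>. h w) = (LINT w|\<mu>. gauss_weight w *\<^sub>R h w) /\<^sub>R (LINT w|\<mu>. gauss_weight w)"
proof -
  define m where "m = (LINT w|\<mu>. gauss_weight w)"
  have m: "0 < m" using pos by (simp add: m_def)
  have eq: "gauss_tilt \<mu> = density \<mu> (\<lambda>w. ennreal (gauss_weight w / m))" by (simp add: gauss_tilt_def m_def)
  have "emeasure (gauss_tilt \<mu>) (space (gauss_tilt \<mu>)) = (\<integral>\<^sup>+ w. ennreal (gauss_weight w / m) \<partial>\<mu>)"
    unfolding eq by (subst emeasure_density) (auto intro!: nn_integral_cong)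
  also have "\<dots> = ennreal (LINT w|\<mu>. gauss_weight w / m)"
    using int m gauss_weight_bounds(1) by (intro nn_integral_eq_integral) auto
  also have "(LINT w|\<mu>. gauss_weight w / m) = 1" using m by (simp add: m_def)
  finally show "real_distribution (gauss_tilt \<mu>)"
    by (intro real_distribution.intro prob_spaceI real_distribution_axioms.intro) (auto simp: eq sets sets_eq_imp_space_eq[OF sets])
  assume [measurable]: "h \<in> borel_measurable borel"
  have "(LINT w|gauss_tilt \<mu>. h w) = (LINT w|\<mu>. (gauss_weight w / m) *\<^sub>R h w)"
    unfolding eq using m gauss_weight_bounds(1) by (intro integral_density) auto
  also have "\<dots> = (LINT w|\<mu>. inverse m *\<^sub>R (gauss_weight w *\<^sub>R h w))"
    by (simp add: divide_inverse mult.commute)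
  also have "\<dots> = (LINT w|\<mu>. gauss_weight w *\<^sub>R h w) /\<^sub>R m" by (rule integral_scaleR_right)
  finally show "(LINT w|gauss_tilt \<mu>. h w) = (LINT w|\<mu>. gauss_weight w *\<^sub>R h w) /\<^sub>R (LINT w|\<mu>. gauss_weight w)"
    by (simp add: m_def)
qed

text \<open>If \<open>D n / t n\<close> tends to \<open>D\<^sub>\<nu>\<close>, the tilted measures converge weakly, because their
  characteristic functions are quotients of Gaussian differences. The masses before normalization,
  divided by \<open>t n\<close>, converge as well.\<close>

theorem jump_measure_limit:
  fixes \<mu> :: "nat \<Rightarrow> real measure" and \<nu> :: "real measure" and f :: "real \<Rightarrow> complex"
  assumes \<mu>: "\<And>n. sigma_finite_measure (\<mu> n)" "\<And>n. sets (\<mu> n) = sets borel" "\<And>n. distr (\<mu> n) borel uminus = \<mu> n"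
      "\<And>n \<theta>. (\<integral>\<^sup>+ w. ennreal (1 - cos (\<theta> * w)) \<partial>\<mu> n) = ennreal (D n \<theta>)"
      "\<And>n. D n \<in> borel_measurable borel"
    and \<nu>: "sigma_finite_measure \<nu>" "sets \<nu> = sets borel" "distr \<nu> borel uminus = \<nu>"
      "\<And>\<theta>. (\<integral>\<^sup>+ w. ennreal (1 - cos (\<theta> * w)) \<partial>\<nu>) = ennreal (D\<^sub>\<nu> \<theta>)"
      "D\<^sub>\<nu> \<in> borel_measurable borel"
    and t: "\<And>n. 0 < t n" "\<And>n. t n \<le> 1"
    and D_bound: "\<And>n \<theta>. 0 \<le> D n \<theta>" "\<And>n \<theta>. D n \<theta> \<le> t n * (1 + \<bar>\<theta>\<bar>)"
    and D_lim: "\<And>\<theta>. (\<lambda>n. D n \<theta> / t n) \<longlonglongrightarrow> D\<^sub>\<nu> \<theta>"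
    and D_pos: "\<And>n. 0 < D n 1" "0 < D\<^sub>\<nu> 1"
    and f [measurable]: "f \<in> borel_measurable borel" and f_bound: "\<And>w. norm (f w) \<le> C * min 1 (w\<^sup>2)"
    and f_cont: "AE w in \<nu>. isCont f w" "AE w in \<nu>. w \<noteq> 0"
    and f_disc: "{w. \<not> isCont f w} \<in> sets borel"
  shows "(\<lambda>n. (CLINT w|\<mu> n. f w) / t n) \<longlonglongrightarrow> (CLINT w|\<nu>. f w)"
proof -
  let ?N = std_normal_distribution
  interpret N: real_distribution ?N by (rule real_dist_normal_dist)
  note [measurable_cong] = \<mu>(2) \<nu>(2) and [measurable] = \<mu>(5) \<nu>(5)
  have D\<nu>: "0 \<le> D\<^sub>\<nu> \<theta>" "D\<^sub>\<nu> \<theta> \<le> 1 + \<bar>\<theta>\<bar>" for \<theta>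
  proof -
    have "0 \<le> D n \<theta> / t n" "D n \<theta> / t n \<le> 1 + \<bar>\<theta>\<bar>" for n
      using t[of n] D_bound[of n \<theta>] by (auto simp: field_simps)
    thus "0 \<le> D\<^sub>\<nu> \<theta>" "D\<^sub>\<nu> \<theta> \<le> 1 + \<bar>\<theta>\<bar>"
      by (auto intro: LIMSEQ_le_const[OF D_lim] LIMSEQ_le_const2[OF D_lim])
  qed
  have Dn: "D n \<theta> \<le> 1 + \<bar>\<theta>\<bar>" for n \<theta>
    using D_bound(2)[of n \<theta>] mult_right_mono[OF t(2)[of n], of "1 + \<bar>\<theta>\<bar>"] by simp
  have int_\<mu>: "integrable (\<mu> n) gauss_weight"
    and char_\<mu>: "(CLINT w|\<mu> n. gauss_weight w * iexp (\<theta> * w)) = complex_of_real (gauss_difference (D n) \<theta>)" for n \<theta>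
    by (rule gauss_weight_char[OF \<mu>(1-4) D_bound(1) Dn])+
  have int_\<nu>: "integrable \<nu> gauss_weight"
    and char_\<nu>: "(CLINT w|\<nu>. gauss_weight w * iexp (\<theta> * w)) = complex_of_real (gauss_difference D\<^sub>\<nu> \<theta>)" for \<theta>
    by (rule gauss_weight_char[OF \<nu>(1-4) D\<nu>])+
  have mass: "(LINT w|\<mu> n. gauss_weight w) = gauss_difference (D n) 0" "(LINT w|\<nu>. gauss_weight w) = gauss_difference D\<^sub>\<nu> 0" for n
    using char_\<mu>[of n 0] char_\<nu>[of 0] by simp_all
  have mass_pos: "0 < (LINT w|\<rho>. gauss_weight w)"
    if "integrable \<rho> gauss_weight" "sets \<rho> = sets borel" "(\<integral>\<^sup>+ w. ennreal (1 - cos (1 * w)) \<partial>\<rho>) = ennreal d" "0 < d" for \<rho> :: "real measure" and d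
  proof (rule ccontr)
    assume "\<not> 0 < (LINT w|\<rho>. gauss_weight w)"
    moreover have "0 \<le> (LINT w|\<rho>. gauss_weight w)" by (simp add: gauss_weight_bounds)
    ultimately have "(LINT w|\<rho>. gauss_weight w) = 0" by linarith
    hence "AE w in \<rho>. gauss_weight w = 0"
      using integral_nonneg_eq_0_iff_AE[OF that(1)] gauss_weight_bounds(1) by simp
    hence "(\<integral>\<^sup>+ w. ennreal (1 - cos (1 * w)) \<partial>\<rho>) = (\<integral>\<^sup>+ w. 0 \<partial>\<rho>)"
      by (intro nn_integral_cong_AE) (auto elim!: eventually_mono simp: gauss_weight_eq_0_iff)
    thus False using that by simp
  qed
  note pos = mass_pos[OF int_\<mu> \<mu>(2) \<mu>(4) D_pos(1)] mass_pos[OF int_\<nu> \<nu>(2) \<nu>(4) D_pos(2)]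
  have diff_lim: "(\<lambda>n. gauss_difference (D n) \<theta> / t n) \<longlonglongrightarrow> gauss_difference D\<^sub>\<nu> \<theta>" for \<theta>
  proof -
    have "(\<lambda>n. LINT s|?N. ((D n (\<theta> + s) + D n (\<theta> - s)) / 2 - D n \<theta>) / t n) \<longlonglongrightarrow> (LINT s|?N. (D\<^sub>\<nu> (\<theta> + s) + D\<^sub>\<nu> (\<theta> - s)) / 2 - D\<^sub>\<nu> \<theta>)"
    proof (rule integral_dominated_convergence[where w = "\<lambda>s. 2 + 2 * \<bar>\<theta>\<bar> + \<bar>s\<bar>"])
      show "AE s in ?N. (\<lambda>n. ((D n (\<theta> + s) + D n (\<theta> - s)) / 2 - D n \<theta>) / t n) \<longlonglongrightarrow> (D\<^sub>\<nu> (\<theta> + s) + D\<^sub>\<nu> (\<theta> - s)) / 2 - D\<^sub>\<nu> \<theta>"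
      proof (intro AE_I2)
        fix s
        have "(\<lambda>n. (D n (\<theta> + s) / t n + D n (\<theta> - s) / t n) / 2 - D n \<theta> / t n) \<longlonglongrightarrow> (D\<^sub>\<nu> (\<theta> + s) + D\<^sub>\<nu> (\<theta> - s)) / 2 - D\<^sub>\<nu> \<theta>"
          by (intro tendsto_intros D_lim) simp
        thus "(\<lambda>n. ((D n (\<theta> + s) + D n (\<theta> - s)) / 2 - D n \<theta>) / t n) \<longlonglongrightarrow> (D\<^sub>\<nu> (\<theta> + s) + D\<^sub>\<nu> (\<theta> - s)) / 2 - D\<^sub>\<nu> \<theta>"
          by (simp add: diff_divide_distrib add_divide_distrib mult.commute)
      qed
      show "AE s in ?N. norm (((D n (\<theta> + s) + D n (\<theta> - s)) / 2 - D n \<theta>) / t n) \<le> 2 + 2 * \<bar>\<theta>\<bar> + \<bar>s\<bar>" for n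
      proof (intro AE_I2)
        fix s :: real
        have tri: "\<bar>(a + b) / 2 - c\<bar> \<le> (a + b) / 2 + c" if "0 \<le> a" "0 \<le> b" "0 \<le> c" for a b c :: real
          using that by (simp add: abs_le_iff add_divide_distrib)
        have "\<bar>(D n (\<theta> + s) + D n (\<theta> - s)) / 2 - D n \<theta>\<bar> \<le> (D n (\<theta> + s) + D n (\<theta> - s)) / 2 + D n \<theta>"
          by (rule tri) (rule D_bound)+
        also have "\<dots> \<le> (t n * (1 + \<bar>\<theta> + s\<bar>) + t n * (1 + \<bar>\<theta> - s\<bar>)) / 2 + t n * (1 + \<bar>\<theta>\<bar>)"
          by (intro add_mono divide_right_mono D_bound) simp
        also have "\<dots> = t n * ((1 + \<bar>\<theta> + s\<bar> + (1 + \<bar>\<theta> - s\<bar>)) / 2 + (1 + \<bar>\<theta>\<bar>))" by (simp add: algebra_simps)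
        also have "\<dots> \<le> t n * (2 + 2 * \<bar>\<theta>\<bar> + \<bar>s\<bar>)"
          using t(1)[of n] by (intro mult_left_mono) (auto simp: abs_if)
        finally show "norm (((D n (\<theta> + s) + D n (\<theta> - s)) / 2 - D n \<theta>) / t n) \<le> 2 + 2 * \<bar>\<theta>\<bar> + \<bar>s\<bar>"
          using t(1)[of n] by (simp add: abs_divide divide_le_eq mult.commute)
      qed
    qed (use integrable_std_normal_abs in auto)
    thus ?thesis by (simp add: gauss_difference_def)
  qed
  note tilt_\<mu> = gauss_tilt[OF \<mu>(2) int_\<mu> pos(1)] and tilt_\<nu> = gauss_tilt[OF \<nu>(2) int_\<nu> pos(2)]
  have weak: "weak_conv_m (\<lambda>n. gauss_tilt (\<mu> n)) (gauss_tilt \<nu>)"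
  proof (rule levy_continuity[OF tilt_\<mu>(1) tilt_\<nu>(1)])
    fix \<theta>
    have "(\<lambda>n. complex_of_real ((gauss_difference (D n) \<theta> / t n) / (gauss_difference (D n) 0 / t n))) \<longlonglongrightarrow> complex_of_real (gauss_difference D\<^sub>\<nu> \<theta> / gauss_difference D\<^sub>\<nu> 0)"
      using pos by (intro tendsto_intros diff_lim) (simp add: mass)
    moreover have "char (gauss_tilt (\<mu> n)) \<theta> = complex_of_real ((gauss_difference (D n) \<theta> / t n) / (gauss_difference (D n) 0 / t n))" for n
    proof -
      have "char (gauss_tilt (\<mu> n)) \<theta> = complex_of_real (gauss_difference (D n) \<theta>) /\<^sub>R gauss_difference (D n) 0"
        unfolding char_def by (subst tilt_\<mu>(2), measurable) (simp only: scaleR_conv_of_real char_\<mu> mass)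
      thus ?thesis using t(1)[of n] by (simp add: scaleR_conv_of_real divide_inverse mult.commute)
    qed
    moreover have "char (gauss_tilt \<nu>) \<theta> = complex_of_real (gauss_difference D\<^sub>\<nu> \<theta> / gauss_difference D\<^sub>\<nu> 0)"
    proof -
      have "char (gauss_tilt \<nu>) \<theta> = complex_of_real (gauss_difference D\<^sub>\<nu> \<theta>) /\<^sub>R gauss_difference D\<^sub>\<nu> 0"
        unfolding char_def by (subst tilt_\<nu>(2), measurable) (simp only: scaleR_conv_of_real char_\<nu> mass)
      thus ?thesis by (simp add: scaleR_conv_of_real divide_inverse mult.commute)
    qed
    ultimately show "(\<lambda>n. char (gauss_tilt (\<mu> n)) \<theta>) \<longlonglongrightarrow> char (gauss_tilt \<nu>) \<theta>" by simp
  qed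
  define h where "h w = f w /\<^sub>R gauss_weight w" for w
  have [measurable]: "h \<in> borel_measurable borel" unfolding h_def[abs_def] by measurable
  have C: "0 \<le> C" using order_trans[OF norm_ge_zero f_bound[of 1]] by simp
  have f0: "f 0 = 0" using f_bound[of 0] by simp
  have wh: "gauss_weight w *\<^sub>R h w = f w" for w
    by (cases "w = 0") (auto simp: h_def f0 gauss_weight_eq_0_iff)
  have "(\<lambda>n. LINT w|gauss_tilt (\<mu> n). h w) \<longlonglongrightarrow> (LINT w|gauss_tilt \<nu>. h w)"
  proof (rule weak_conv_imp_bdd_ae_continuous_conv[OF tilt_\<mu>(1) tilt_\<nu>(1) weak, where B = "3 * C"])
    show "norm (h w) \<le> 3 * C" for w
    proof (cases "w = 0")
      case False
      have "0 < gauss_weight w" using False gauss_weight_eq_0_iff[of w] gauss_weight_bounds(1)[of w] by linarith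
      moreover have "norm (f w) \<le> C * (3 * gauss_weight w)"
        using f_bound[of w] mult_left_mono[OF gauss_weight_bounds(3)[of w] C] by linarith
      ultimately show ?thesis by (simp add: h_def field_simps)
    qed (use C in \<open>simp add: h_def gauss_weight_def\<close>)
    have sub: "{w. \<not> isCont h w} \<subseteq> {w. \<not> isCont f w} \<union> {0}"
      by (auto simp: h_def[abs_def] gauss_weight_def intro!: continuous_intros)
    have "AE w in gauss_tilt \<nu>. isCont f w \<and> w \<noteq> 0"
      using f_cont unfolding gauss_tilt_def by (subst AE_density) (auto elim!: eventually_elim2)
    hence "emeasure (gauss_tilt \<nu>) ({w. \<not> isCont f w} \<union> {0}) = 0"
      using f_disc by (subst (asm) AE_iff_measurable[of "{w. \<not> isCont f w} \<union> {0}"])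
         (auto simp: gauss_tilt_def \<nu>(2) sets_eq_imp_space_eq[OF \<nu>(2)])
    thus "emeasure (gauss_tilt \<nu>) {w. \<not> isCont h w} = 0"
      using f_disc by (intro emeasure_eq_0[OF _ _ sub]) (auto simp: gauss_tilt_def \<nu>(2))
  qed measurable
  moreover have "(\<lambda>n. gauss_difference (D n) 0 / t n) \<longlonglongrightarrow> gauss_difference D\<^sub>\<nu> 0" by (rule diff_lim)
  ultimately have "(\<lambda>n. (gauss_difference (D n) 0 / t n) *\<^sub>R (LINT w|gauss_tilt (\<mu> n). h w)) \<longlonglongrightarrow> gauss_difference D\<^sub>\<nu> 0 *\<^sub>R (LINT w|gauss_tilt \<nu>. h w)"
    by (intro tendsto_scaleR)
  moreover have "(gauss_difference (D n) 0 / t n) *\<^sub>R (LINT w|gauss_tilt (\<mu> n). h w) = (CLINT w|\<mu> n. f w) / t n" for n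
  proof -
    have "(LINT w|gauss_tilt (\<mu> n). h w) = (CLINT w|\<mu> n. f w) /\<^sub>R gauss_difference (D n) 0" by (simp add: tilt_\<mu>(2) wh mass)
    thus ?thesis using pos(1)[of n] by (simp add: mass scaleR_conv_of_real divide_inverse)
  qed
  moreover have "gauss_difference D\<^sub>\<nu> 0 *\<^sub>R (LINT w|gauss_tilt \<nu>. h w) = (CLINT w|\<nu>. f w)"
    using pos(2) by (simp add: tilt_\<nu>(2) wh mass)
  ultimately show ?thesis by simp
qed

section \<open>Small-time behaviour of the logarithm of the radial stable process\<close>

lemma sets_stable_jumps [simp, measurable_cong]: "sets (stable_jumps \<alpha>) = sets borel"
  by (simp add: stable_jumps_def)

lemma space_stable_jumps [simp]: "space (stable_jumps \<alpha>) = UNIV"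
  by (simp add: stable_jumps_def)

lemma sigma_finite_stable_jumps: "sigma_finite_measure (stable_jumps \<alpha>)"
  unfolding stable_jumps_def by (subst sigma_finite_measure.sigma_finite_iff_density_finite[OF lborel.sigma_finite_measure_axioms]) auto

lemma AE_stable_jumps: "AE w in lborel. P w \<Longrightarrow> AE w in stable_jumps \<alpha>. P w"
  unfolding stable_jumps_def by (subst AE_density) (auto elim: eventually_mono)

lemma stable_jumps_symmetric: "distr (stable_jumps \<alpha>) borel uminus = stable_jumps \<alpha>"
proof (rule measure_eqI)
  fix A assume "A \<in> sets (distr (stable_jumps \<alpha>) borel uminus)"
  hence [measurable]: "A \<in> sets borel" by simp
  have "emeasure (distr (stable_jumps \<alpha>) borel uminus) A = (\<integral>\<^sup>+ w. ennreal (jump_const \<alpha> * \<bar>w\<bar> powr (-1 - \<alpha>)) * indicator A (- w) \<partial>lborel)"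
  proof -
    have [measurable]: "uminus -` A \<in> sets borel" by (rule measurable_sets_borel[of _ borel]) auto
    show ?thesis
      by (subst emeasure_distr) (auto simp: stable_jumps_def emeasure_density indicator_def intro!: nn_integral_cong)
  qed
  also have "\<dots> = (\<integral>\<^sup>+ w. ennreal (jump_const \<alpha> * \<bar>w\<bar> powr (-1 - \<alpha>)) * indicator A w \<partial>lborel)"
    by (subst nn_integral_real_affine[where c = "-1" and t = 0]) auto
  also have "\<dots> = emeasure (stable_jumps \<alpha>) A" by (simp add: stable_jumps_def emeasure_density)
  finally show "emeasure (distr (stable_jumps \<alpha>) borel uminus) A = emeasure (stable_jumps \<alpha>) A" .
qed simp

lemma abs_powr_le:
  fixes u \<alpha> :: real
  assumes "0 < \<alpha>" "\<alpha> \<le> 1"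
  shows "\<bar>u\<bar> powr \<alpha> \<le> 1 + \<bar>u\<bar>"
proof (cases "\<bar>u\<bar> \<le> 1")
  case True
  hence "\<bar>u\<bar> powr \<alpha> \<le> 1" using assms by (intro powr_le1) auto
  thus ?thesis by simp
next
  case False
  hence "\<bar>u\<bar> powr \<alpha> \<le> \<bar>u\<bar> powr 1" using assms by (intro powr_mono) auto
  thus ?thesis using False by simp
qed

lemma stable_jumps_integrable:
  assumes "0 < \<alpha>" "\<alpha> \<le> 1"
  shows "integrable (stable_jumps \<alpha>) (\<lambda>w. min 1 (w\<^sup>2))"
proof (rule Bochner_Integration.integrable_bound)
  have "integrable (stable_jumps \<alpha>) gauss_weight"
    by (rule gauss_weight_char(1)[where D = "\<lambda>\<theta>. \<bar>\<theta>\<bar> powr \<alpha>"])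
       (use assms in \<open>auto simp: sigma_finite_stable_jumps stable_jumps_symmetric stable_exponent abs_powr_le\<close>)
  thus "integrable (stable_jumps \<alpha>) (\<lambda>w. 3 * gauss_weight w)" by simp
  show "AE w in stable_jumps \<alpha>. norm (min 1 (w\<^sup>2)) \<le> norm (3 * gauss_weight w)"
    using gauss_weight_bounds by (intro AE_I2) (auto simp: abs_of_nonneg)
qed measurable

lemma ln_one_plus_bound: "\<bar>ln (1 + w)\<bar> \<le> 2 * \<bar>w\<bar>" if "\<bar>w\<bar> \<le> 1 / 2" for w :: real
proof -
  have "\<bar>ln (1 + w) - w\<bar> \<le> 2 * w\<^sup>2" by (rule abs_ln_one_plus_x_minus_x_bound) fact
  moreover have "2 * w\<^sup>2 \<le> \<bar>w\<bar>"
    using mult_right_mono[OF that, of "\<bar>w\<bar>"] by (simp add: power2_eq_square abs_mult[symmetric])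
  ultimately show ?thesis by linarith
qed

lemma min_one_square_ge: "1 / 4 \<le> min 1 (w\<^sup>2)" if "1 / 2 \<le> \<bar>w\<bar>" for w :: real
proof -
  have "(1 / 2)\<^sup>2 \<le> \<bar>w\<bar>\<^sup>2" using that by (intro power_mono) auto
  thus ?thesis by (simp add: power2_eq_square)
qed

text \<open>The increment of \<open>iexp (\<theta> ln R)\<close> when \<open>R\<close> jumps by the relative amount \<open>w\<close>, compensated by a bounded odd
  function; \<open>|1 + w|\<close> accounts for jumps of the stable process across the origin.\<close>

definition radial_jump :: "real \<Rightarrow> real \<Rightarrow> complex" where
  "radial_jump \<theta> w = iexp (\<theta> * ln \<bar>1 + w\<bar>) - 1 - \<i> * complex_of_real (\<theta> * sin w)"

lemma radial_jump_measurable [measurable]: "radial_jump \<theta> \<in> borel_measurable borel"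
  unfolding radial_jump_def[abs_def] by measurable

lemma norm_radial_jump_le: "norm (radial_jump \<theta> w) \<le> (8 + 4 * \<bar>\<theta>\<bar> + 2 * \<theta>\<^sup>2) * min 1 (w\<^sup>2)"
proof (cases "\<bar>w\<bar> \<le> 1 / 2")
  case True
  define y where "y = ln (1 + w)"
  have y: "ln \<bar>1 + w\<bar> = y" using True by (simp add: y_def)
  have sin: "\<bar>sin w - w\<bar> \<le> w\<^sup>2 / 2"
    using abs_Im_le_cmod[of "iexp w - 1 - \<i> * w"] cmod_iexp_minus_linear_le[of w] by (simp add: Im_exp)
  have y1: "\<bar>y - w\<bar> \<le> 2 * w\<^sup>2" unfolding y_def by (rule abs_ln_one_plus_x_minus_x_bound) fact
  have ys: "\<bar>y - sin w\<bar> \<le> 4 * w\<^sup>2" using sin y1 zero_le_power2[of w] by linarith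
  have "\<bar>y\<bar>\<^sup>2 \<le> (2 * \<bar>w\<bar>)\<^sup>2" unfolding y_def by (intro power_mono ln_one_plus_bound True) simp
  hence y2: "y\<^sup>2 \<le> 4 * w\<^sup>2" by (simp add: power_mult_distrib)
  have split: "radial_jump \<theta> w = (iexp (\<theta> * y) - 1 - \<i> * complex_of_real (\<theta> * y)) + \<i> * complex_of_real (\<theta> * (y - sin w))"
    by (simp add: radial_jump_def y algebra_simps)
  have "norm (radial_jump \<theta> w) \<le> norm (iexp (\<theta> * y) - 1 - \<i> * complex_of_real (\<theta> * y)) + norm (\<i> * complex_of_real (\<theta> * (y - sin w)))"
    unfolding split by (rule norm_triangle_ineq)
  also have "\<dots> \<le> (\<theta> * y)\<^sup>2 / 2 + \<bar>\<theta>\<bar> * \<bar>y - sin w\<bar>"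
    by (intro add_mono cmod_iexp_minus_linear_le) (simp add: norm_mult abs_mult del: of_real_mult of_real_diff)
  also have "\<dots> \<le> \<theta>\<^sup>2 * (4 * w\<^sup>2) / 2 + \<bar>\<theta>\<bar> * (4 * w\<^sup>2)"
    unfolding power_mult_distrib
    by (intro add_mono divide_right_mono mult_left_mono y2) (use ys in auto)
  also have "\<dots> = (4 * \<bar>\<theta>\<bar> + 2 * \<theta>\<^sup>2) * w\<^sup>2" by (simp add: algebra_simps)
  also have "\<dots> \<le> (8 + 4 * \<bar>\<theta>\<bar> + 2 * \<theta>\<^sup>2) * w\<^sup>2" by (intro mult_right_mono) auto
  also have "w\<^sup>2 = min 1 (w\<^sup>2)" using True abs_square_le_1[of w] by simp
  finally show ?thesis .
next
  case False
  have "norm (radial_jump \<theta> w) \<le> norm (iexp (\<theta> * ln \<bar>1 + w\<bar>) - 1) + norm (\<i> * complex_of_real (\<theta> * sin w))"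
    unfolding radial_jump_def by (rule norm_triangle_ineq4)
  also have "\<dots> \<le> 2 + \<bar>\<theta>\<bar> * 1"
    by (intro add_mono cmod_iexp_minus_1_le(2)) (simp add: norm_mult abs_mult mult_left_le)
  also have "\<dots> \<le> (8 + 4 * \<bar>\<theta>\<bar> + 2 * \<theta>\<^sup>2) * (1 / 4)" by (simp add: field_simps)
  also have "\<dots> \<le> (8 + 4 * \<bar>\<theta>\<bar> + 2 * \<theta>\<^sup>2) * min 1 (w\<^sup>2)"
    using False by (intro mult_left_mono min_one_square_ge) auto
  finally show ?thesis .
qed

lemma radial_jump_integrable:
  assumes "0 < \<alpha>" "\<alpha> \<le> 1"
  shows "integrable (stable_jumps \<alpha>) (radial_jump \<theta>)"
proof (rule Bochner_Integration.integrable_bound)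
  show "integrable (stable_jumps \<alpha>) (\<lambda>w. (8 + 4 * \<bar>\<theta>\<bar> + 2 * \<theta>\<^sup>2) * min 1 (w\<^sup>2))"
    using stable_jumps_integrable[OF assms] by simp
  show "AE w in stable_jumps \<alpha>. norm (radial_jump \<theta> w) \<le> norm ((8 + 4 * \<bar>\<theta>\<bar> + 2 * \<theta>\<^sup>2) * min 1 (w\<^sup>2))"
    using norm_radial_jump_le by (intro AE_I2) (auto intro: order_trans[OF _ abs_ge_self])
qed measurable

text \<open>\<open>P n\<close> is the law at time \<open>t n\<close> of the symmetric stable process started at \<open>0\<close>; the odd compensator
  has mean \<open>0\<close> under it.\<close>

theorem radial_stable_limit:
  fixes P :: "nat \<Rightarrow> real measure" and t :: "nat \<Rightarrow> real"
  assumes \<alpha>: "0 < \<alpha>" "\<alpha> \<le> 1"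
    and P: "\<And>n. real_distribution (P n)" "\<And>n \<theta>. char (P n) \<theta> = complex_of_real (exp (- t n * \<bar>\<theta>\<bar> powr \<alpha>))"
    and t: "\<And>n. 0 < t n" "\<And>n. t n \<le> 1" "t \<longlonglongrightarrow> 0"
  shows "(\<lambda>n. ((CLINT w|P n. iexp (\<theta> * ln \<bar>1 + w\<bar>)) - 1) / t n) \<longlonglongrightarrow> (CLINT w|stable_jumps \<alpha>. radial_jump \<theta> w)"
proof -
  interpret P: real_distribution "P n" for n by (rule P)
  define D where "D n \<theta> = 1 - exp (- t n * \<bar>\<theta>\<bar> powr \<alpha>)" for n \<theta>
  have D0: "0 \<le> D n \<theta>" for n \<theta> using t(1)[of n] by (simp add: D_def)
  have char_int: "(LINT w|P n. cos (\<theta> * w)) = exp (- t n * \<bar>\<theta>\<bar> powr \<alpha>)" "(LINT w|P n. sin (\<theta> * w)) = 0" for n \<theta>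
  proof -
    have int: "integrable (P n) (\<lambda>w. iexp (\<theta> * w))" by (rule P.integrable_iexp) (simp_all add: Im_complex_of_real)
    have "(LINT w|P n. Re (iexp (\<theta> * w))) = Re (char (P n) \<theta>)" "(LINT w|P n. Im (iexp (\<theta> * w))) = Im (char (P n) \<theta>)"
      unfolding char_def using int by (rule integral_Re, rule integral_Im)
    thus "(LINT w|P n. cos (\<theta> * w)) = exp (- t n * \<bar>\<theta>\<bar> powr \<alpha>)" "(LINT w|P n. sin (\<theta> * w)) = 0"
      by (simp_all add: Re_exp Im_exp P(2) del: of_real_mult exp_of_real of_real_exp)
  qed
  have "(\<lambda>n. (CLINT w|P n. radial_jump \<theta> w) / t n) \<longlonglongrightarrow> (CLINT w|stable_jumps \<alpha>. radial_jump \<theta> w)"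
  proof (rule jump_measure_limit[where D = D and D\<^sub>\<nu> = "\<lambda>\<theta>. \<bar>\<theta>\<bar> powr \<alpha>"])
    show "sigma_finite_measure (P n)" for n by (rule P.sigma_finite_measure_axioms)
    show "sets (P n) = sets borel" for n by simp
    show "distr (P n) borel uminus = P n" for n
    proof (rule Levy_uniqueness[OF _ P(1)])
      show "real_distribution (distr (P n) borel uminus)" by (rule P.real_distribution_distr) simp
      show "char (distr (P n) borel uminus) = char (P n)"
      proof
        fix s
        have "char (distr (P n) borel uminus) s = char (P n) (- s)"
          unfolding char_def by (subst integral_distr) auto
        thus "char (distr (P n) borel uminus) s = char (P n) s" by (simp add: P(2))
      qed
    qed
    show "(\<integral>\<^sup>+ w. ennreal (1 - cos (s * w)) \<partial>P n) = ennreal (D n s)" for n s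
    proof -
      have int: "integrable (P n) (\<lambda>w. cos (s * w))" by (rule P.integrable_const_bound[of _ 1]) auto
      have "(\<integral>\<^sup>+ w. ennreal (1 - cos (s * w)) \<partial>P n) = ennreal (LINT w|P n. 1 - cos (s * w))"
        using int by (intro nn_integral_eq_integral) auto
      also have "(LINT w|P n. 1 - cos (s * w)) = D n s" using int P.prob_space by (simp add: char_int D_def)
      finally show ?thesis .
    qed
    show "D n \<in> borel_measurable borel" for n unfolding D_def[abs_def] by measurable
    show "(\<integral>\<^sup>+ w. ennreal (1 - cos (s * w)) \<partial>stable_jumps \<alpha>) = ennreal (\<bar>s\<bar> powr \<alpha>)" for s
      using \<alpha> by (intro stable_exponent) auto
    show "D n s \<le> t n * (1 + \<bar>s\<bar>)" for n s
    proof -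
      have "D n s \<le> t n * \<bar>s\<bar> powr \<alpha>" using exp_ge_add_one_self[of "- t n * \<bar>s\<bar> powr \<alpha>"] by (simp add: D_def)
      also have "\<dots> \<le> t n * (1 + \<bar>s\<bar>)" using t(1)[of n] by (intro mult_left_mono abs_powr_le \<alpha>) auto
      finally show ?thesis .
    qed
    show "(\<lambda>n. D n s / t n) \<longlonglongrightarrow> \<bar>s\<bar> powr \<alpha>" for s
    proof -
      define b where "b = \<bar>s\<bar> powr \<alpha>"
      have "((\<lambda>h. 1 - exp (- h * b)) has_real_derivative b) (at 0)" by (auto intro!: derivative_eq_intros)
      hence lim: "((\<lambda>h. (1 - exp (- h * b)) / h) \<longlongrightarrow> b) (at 0)" by (simp add: DERIV_def)
      have "filterlim t (at 0) sequentially"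
        using t by (auto simp: filterlim_at intro!: always_eventually) (metis less_irrefl)
      from filterlim_compose[OF lim this] show ?thesis by (simp add: D_def b_def)
    qed
    show "norm (radial_jump \<theta> w) \<le> (8 + 4 * \<bar>\<theta>\<bar> + 2 * \<theta>\<^sup>2) * min 1 (w\<^sup>2)" for w by (rule norm_radial_jump_le)
    have cont: "isCont (radial_jump \<theta>) w" if "w \<noteq> -1" for w
    proof -
      have "\<bar>1 + w\<bar> \<noteq> 0" using that by auto
      thus ?thesis unfolding radial_jump_def[abs_def] by (intro continuous_intros) auto
    qed
    show "AE w in stable_jumps \<alpha>. isCont (radial_jump \<theta>) w"
      by (rule AE_stable_jumps) (use AE_lborel_singleton[of "-1"] cont in \<open>auto elim!: eventually_mono\<close>)
    show "AE w in stable_jumps \<alpha>. w \<noteq> 0" by (rule AE_stable_jumps) (rule AE_lborel_singleton)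
    have "{w. \<not> isCont (radial_jump \<theta>) w} \<subseteq> {-1}" using cont by auto
    hence "finite {w. \<not> isCont (radial_jump \<theta>) w}" by (rule finite_subset) simp
    thus "{w. \<not> isCont (radial_jump \<theta>) w} \<in> sets borel" by (rule borel_closed[OF finite_imp_closed])
  qed (use \<alpha> t D0 in \<open>auto simp: D_def sigma_finite_stable_jumps stable_jumps_symmetric\<close>)
  moreover have "(CLINT w|P n. radial_jump \<theta> w) = (CLINT w|P n. iexp (\<theta> * ln \<bar>1 + w\<bar>)) - 1" for n
  proof -
    have int: "integrable (P n) (\<lambda>w. iexp (\<theta> * ln \<bar>1 + w\<bar>))" by (rule P.integrable_const_bound[of _ 1]) auto
    have int': "integrable (P n) (\<lambda>w. \<i> * complex_of_real (\<theta> * sin w))"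
      by (rule P.integrable_const_bound[of _ "\<bar>\<theta>\<bar>"]) (auto simp: norm_mult abs_mult intro!: mult_left_le)
    have "(CLINT w|P n. \<i> * complex_of_real (\<theta> * sin w)) = \<i> * complex_of_real (\<theta> * (LINT w|P n. sin w))"
      by (simp only: integral_mult_right_zero integral_complex_of_real)
    also have "(LINT w|P n. sin w) = 0" using char_int(2)[of n 1] by simp
    finally show ?thesis unfolding radial_jump_def
      using int int' P.prob_space by (simp only: Bochner_Integration.integral_diff Bochner_Integration.integrable_diff P.integrable_const) simp
  qed
  ultimately show ?thesis by simp
qed

section \<open>The two jump measures of the logarithm\<close>

text \<open>Jumps \<open>w > -1\<close> keep the sign of the stable process and move the logarithm by \<open>ln (1 + w)\<close>;
  jumps \<open>w < -1\<close> change the sign and move it by \<open>ln (-1 - w)\<close>.\<close>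

lemma nn_integral_exp_substitution:
  fixes f :: "real \<Rightarrow> real"
  assumes [measurable]: "f \<in> borel_measurable borel"
  shows "(\<integral>\<^sup>+ u. ennreal (f u) * indicator {0<..} u \<partial>lborel) = (\<integral>\<^sup>+ y. ennreal (f (exp y) * exp y) \<partial>lborel)"
proof -
  have sub: "(\<integral>\<^sup>+ u. ennreal (f u) * indicator {exp (- real n)..exp (real n)} u \<partial>lborel)
     = (\<integral>\<^sup>+ y. ennreal (f (exp y) * exp y) * indicator {- real n..real n} y \<partial>lborel)" for n
  proof -
    have "(\<integral>\<^sup>+ u. f u * indicator {exp (- real n)..exp (real n)} u \<partial>lborel) = (\<integral>\<^sup>+ y. f (exp y) * exp y * indicator {- real n..real n} y \<partial>lborel)"
      by (rule nn_integral_substitution[where g = exp and g' = exp])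
         (auto intro!: derivative_eq_intros continuous_intros simp: set_borel_measurable_def)
    thus ?thesis by (simp add: nn_integral_set_ennreal)
  qed
  have in_window: "eventually (\<lambda>n. y \<in> {- real n..real n}) sequentially" for y :: real
  proof -
    obtain N :: nat where "\<bar>y\<bar> < real N" using reals_Archimedean2 by blast
    thus ?thesis by (auto intro!: eventually_sequentiallyI[of N])
  qed
  have "(\<lambda>n. \<integral>\<^sup>+ u. ennreal (f u) * indicator {exp (- real n)..exp (real n)} u \<partial>lborel) \<longlonglongrightarrow> (\<integral>\<^sup>+ u. ennreal (f u) * indicator {0<..} u \<partial>lborel)"
  proof (rule nn_integral_LIMSEQ)
    show "incseq (\<lambda>n u. ennreal (f u) * indicator {exp (- real n)..exp (real n)} u)"
    proof (intro incseq_SucI le_funI)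
      fix n u
      have "exp (- real (Suc n)) \<le> exp (- real n)" "exp (real n) \<le> exp (real (Suc n))" by simp_all
      thus "ennreal (f u) * indicator {exp (- real n)..exp (real n)} u \<le> ennreal (f u) * indicator {exp (- real (Suc n))..exp (real (Suc n))} u"
        by (auto simp: indicator_def simp del: of_nat_Suc exp_le_cancel_iff)
    qed
    fix u :: real
    have "eventually (\<lambda>n. indicator {exp (- real n)..exp (real n)} u = (indicator {0<..} u :: ennreal)) sequentially"
      using in_window[of "ln u"]
    proof eventually_elim
      case (elim n)
      show ?case
      proof (cases "0 < u")
        case True
        have "exp (- real n) \<le> exp (ln u)" "exp (ln u) \<le> exp (real n)" using elim by simp_all
        thus ?thesis using True by simp
      next
        case False
        hence "\<not> exp (- real n) \<le> u" using exp_gt_zero[of "- real n"] by linarith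
        thus ?thesis using False by (simp add: indicator_def)
      qed
    qed
    thus "(\<lambda>n. ennreal (f u) * indicator {exp (- real n)..exp (real n)} u) \<longlonglongrightarrow> ennreal (f u) * indicator {0<..} u"
      by (intro tendsto_eventually) (auto elim: eventually_mono)
  qed measurable
  moreover have "(\<lambda>n. \<integral>\<^sup>+ y. ennreal (f (exp y) * exp y) * indicator {- real n..real n} y \<partial>lborel) \<longlonglongrightarrow> (\<integral>\<^sup>+ y. ennreal (f (exp y) * exp y) \<partial>lborel)"
  proof (rule nn_integral_LIMSEQ)
    show "incseq (\<lambda>n y. ennreal (f (exp y) * exp y) * indicator {- real n..real n} y)"
      by (intro incseq_SucI le_funI) (auto simp: indicator_def)
    show "(\<lambda>n. ennreal (f (exp y) * exp y) * indicator {- real n..real n} y) \<longlonglongrightarrow> ennreal (f (exp y) * exp y)" for y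
      by (intro tendsto_eventually) (use in_window[of y] in \<open>auto elim!: eventually_mono\<close>)
  qed measurable
  ultimately show ?thesis unfolding sub by (rule LIMSEQ_unique)
qed

lemma Pi1_eq_distr:
  assumes \<alpha>: "0 < \<alpha>" "\<alpha> < 2"
  shows "Pi1 \<alpha> = distr (density (stable_jumps \<alpha>) (\<lambda>w. ennreal (indicator {-1<..} w))) borel (\<lambda>w. ln (1 + w))"
proof (rule measure_eqI)
  fix A assume "A \<in> sets (Pi1 \<alpha>)"
  hence A [measurable]: "A \<in> sets borel" by (simp add: Pi1_def)
  have pre [measurable]: "(\<lambda>w::real. ln (1 + w)) -` A \<in> sets borel"
    by (rule measurable_sets_borel[OF _ A]) measurable
  define f where "f u = jump_const \<alpha> * \<bar>u - 1\<bar> powr (-1 - \<alpha>) * indicator A (ln u)" for u :: real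
  have [measurable]: "f \<in> borel_measurable borel" unfolding f_def[abs_def] by measurable
  have "emeasure (Pi1 \<alpha>) A = (\<integral>\<^sup>+ y. ennreal (f (exp y) * exp y) \<partial>lborel)"
    unfolding Pi1_def
  proof (subst emeasure_density; (measurable; fail)?)
    show "(\<integral>\<^sup>+ y. ennreal (jump_const \<alpha> * (exp y / (exp y - 1) powr (\<alpha> + 1) * indicator {0<..} y +
        exp y / (1 - exp y) powr (\<alpha> + 1) * indicator {..<0} y)) * indicator A y \<partial>lborel) = (\<integral>\<^sup>+ y. ennreal (f (exp y) * exp y) \<partial>lborel)"
    proof (rule nn_integral_cong_AE)
      have m: "z powr (-1 - \<alpha>) = 1 / z powr (\<alpha> + 1)" for z :: real
        proof -
        have "-1 - \<alpha> = - (\<alpha> + 1)" by simp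
        thus ?thesis by (simp only: powr_minus_divide)
      qed
      show "AE y in lborel. ennreal (jump_const \<alpha> * (exp y / (exp y - 1) powr (\<alpha> + 1) * indicator {0<..} y +
          exp y / (1 - exp y) powr (\<alpha> + 1) * indicator {..<0} y)) * indicator A y = ennreal (f (exp y) * exp y)"
        using AE_lborel_singleton[of 0]
      proof eventually_elim
        case (elim y)
        thus ?case
          by (cases "0 < y"; cases "y \<in> A") (simp_all add: f_def m abs_if not_less)
      qed
    qed
  qed
  also have "\<dots> = (\<integral>\<^sup>+ u. ennreal (f u) * indicator {0<..} u \<partial>lborel)"
    by (rule nn_integral_exp_substitution[symmetric]) measurable
  also have "\<dots> = (\<integral>\<^sup>+ w. ennreal (f (1 + 1 * w)) * indicator {0<..} (1 + 1 * w) \<partial>lborel)"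
    by (subst nn_integral_real_affine[where c = 1 and t = 1]) auto
  also have "\<dots> = (\<integral>\<^sup>+ w. ennreal (jump_const \<alpha> * \<bar>w\<bar> powr (-1 - \<alpha>)) * (ennreal (indicator {-1<..} w) * indicator ((\<lambda>w. ln (1 + w)) -` A) w) \<partial>lborel)"
    by (intro nn_integral_cong) (auto simp: f_def indicator_def)
  also have "\<dots> = emeasure (distr (density (stable_jumps \<alpha>) (\<lambda>w. ennreal (indicator {-1<..} w))) borel (\<lambda>w. ln (1 + w))) A"
    unfolding stable_jumps_def
    by (subst emeasure_distr; (measurable; fail)?)
       (simp_all add: emeasure_density nn_integral_density mult.assoc)
  finally show "emeasure (Pi1 \<alpha>) A = emeasure (distr (density (stable_jumps \<alpha>) (\<lambda>w. ennreal (indicator {-1<..} w))) borel (\<lambda>w. ln (1 + w))) A" .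
qed (simp add: Pi1_def)

lemma Pi2_eq_distr:
  assumes \<alpha>: "0 < \<alpha>" "\<alpha> < 2"
  shows "Pi2 \<alpha> = distr (density (stable_jumps \<alpha>) (\<lambda>w. ennreal (indicator {..<-1} w))) borel (\<lambda>w. ln (-1 - w))"
proof (rule measure_eqI)
  fix A assume "A \<in> sets (Pi2 \<alpha>)"
  hence A [measurable]: "A \<in> sets borel" by (simp add: Pi2_def)
  have pre [measurable]: "(\<lambda>w::real. ln (-1 - w)) -` A \<in> sets borel"
    by (rule measurable_sets_borel[OF _ A]) measurable
  define f where "f u = jump_const \<alpha> * \<bar>u + 1\<bar> powr (-1 - \<alpha>) * indicator A (ln u)" for u :: real
  have [measurable]: "f \<in> borel_measurable borel" unfolding f_def[abs_def] by measurable
  have "emeasure (Pi2 \<alpha>) A = (\<integral>\<^sup>+ y. ennreal (f (exp y) * exp y) \<partial>lborel)"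
    unfolding Pi2_def
  proof (subst emeasure_density; (measurable; fail)?)
    have m: "z powr (-1 - \<alpha>) = 1 / z powr (\<alpha> + 1)" for z :: real
      proof -
        have "-1 - \<alpha> = - (\<alpha> + 1)" by simp
        thus ?thesis by (simp only: powr_minus_divide)
      qed
    have p: "\<bar>exp y + 1\<bar> = exp y + 1" for y :: real using exp_gt_zero[of y] by linarith
    show "(\<integral>\<^sup>+ y. ennreal (jump_const \<alpha> * (exp y / (exp y + 1) powr (\<alpha> + 1))) * indicator A y \<partial>lborel) = (\<integral>\<^sup>+ y. ennreal (f (exp y) * exp y) \<partial>lborel)"
      by (rule nn_integral_cong) (simp add: f_def m p split: split_indicator)
  qed
  also have "\<dots> = (\<integral>\<^sup>+ u. ennreal (f u) * indicator {0<..} u \<partial>lborel)"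
    by (rule nn_integral_exp_substitution[symmetric]) measurable
  also have "\<dots> = (\<integral>\<^sup>+ w. ennreal (f (-1 + -1 * w)) * indicator {0<..} (-1 + -1 * w) \<partial>lborel)"
    by (subst nn_integral_real_affine[where c = "-1" and t = "-1"]) auto
  also have "\<dots> = (\<integral>\<^sup>+ w. ennreal (jump_const \<alpha> * \<bar>w\<bar> powr (-1 - \<alpha>)) * (ennreal (indicator {..<-1} w) * indicator ((\<lambda>w. ln (-1 - w)) -` A) w) \<partial>lborel)"
    by (intro nn_integral_cong) (auto simp: f_def indicator_def)
  also have "\<dots> = emeasure (distr (density (stable_jumps \<alpha>) (\<lambda>w. ennreal (indicator {..<-1} w))) borel (\<lambda>w. ln (-1 - w))) A"
    unfolding stable_jumps_def
    by (subst emeasure_distr; (measurable; fail)?)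
       (simp_all add: emeasure_density nn_integral_density mult.assoc)
  finally show "emeasure (Pi2 \<alpha>) A = emeasure (distr (density (stable_jumps \<alpha>) (\<lambda>w. ennreal (indicator {..<-1} w))) borel (\<lambda>w. ln (-1 - w))) A" .
qed (simp add: Pi2_def)

lemma integral_Pi1:
  fixes g :: "real \<Rightarrow> complex"
  assumes \<alpha>: "0 < \<alpha>" "\<alpha> < 2" and [measurable]: "g \<in> borel_measurable borel"
  shows "integrable (Pi1 \<alpha>) g \<longleftrightarrow> integrable (stable_jumps \<alpha>) (\<lambda>w. indicator {-1<..} w *\<^sub>R g (ln (1 + w)))"
    and "(CLINT y|Pi1 \<alpha>. g y) = (CLINT w|stable_jumps \<alpha>. indicator {-1<..} w *\<^sub>R g (ln (1 + w)))"
  unfolding Pi1_eq_distr[OF \<alpha>]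
  by (subst integrable_distr_eq integral_distr; (measurable; fail)?;
      subst integrable_density integral_density; (measurable; fail)?; simp)+

lemma integral_Pi2:
  fixes g :: "real \<Rightarrow> complex"
  assumes \<alpha>: "0 < \<alpha>" "\<alpha> < 2" and [measurable]: "g \<in> borel_measurable borel"
  shows "(CLINT y|Pi2 \<alpha>. g y) = (CLINT w|stable_jumps \<alpha>. indicator {..<-1} w *\<^sub>R g (ln (-1 - w)))"
  unfolding Pi2_eq_distr[OF \<alpha>]
  by (subst integral_distr; (measurable; fail)?; subst integral_density; (measurable; fail)?; simp)

lemma nn_integral_Pi1:
  assumes \<alpha>: "0 < \<alpha>" "\<alpha> < 2" and [measurable]: "g \<in> borel_measurable borel"
  shows "(\<integral>\<^sup>+ y. g y \<partial>Pi1 \<alpha>) = (\<integral>\<^sup>+ w. ennreal (indicator {-1<..} w) * g (ln (1 + w)) \<partial>stable_jumps \<alpha>)"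
  unfolding Pi1_eq_distr[OF \<alpha>] by (simp add: nn_integral_distr nn_integral_density)

lemma stable_jumps_tail:
  assumes \<alpha>: "0 < \<alpha>" "\<alpha> \<le> 1" and d: "0 < d"
  shows "emeasure (stable_jumps \<alpha>) {w. d \<le> \<bar>w\<bar>} < \<infinity>"
proof -
  define m where "m = min 1 (d\<^sup>2)"
  have m: "0 < m" using d by (simp add: m_def)
  have "ennreal m * emeasure (stable_jumps \<alpha>) {w. d \<le> \<bar>w\<bar>} = (\<integral>\<^sup>+ w. ennreal m * indicator {w. d \<le> \<bar>w\<bar>} w \<partial>stable_jumps \<alpha>)"
    by (rule nn_integral_cmult_indicator[symmetric]) measurable
  also have "\<dots> \<le> (\<integral>\<^sup>+ w. ennreal (min 1 (w\<^sup>2)) \<partial>stable_jumps \<alpha>)"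
  proof (intro nn_integral_mono)
    fix w
    have "m \<le> min 1 (w\<^sup>2)" if "d \<le> \<bar>w\<bar>"
      using power_mono[OF that, of 2] d by (auto simp: m_def min_def)
    thus "ennreal m * indicator {w. d \<le> \<bar>w\<bar>} w \<le> ennreal (min 1 (w\<^sup>2))"
      by (auto simp: indicator_def intro!: ennreal_leI)
  qed
  also have "\<dots> < \<infinity>" using stable_jumps_integrable[OF \<alpha>] by (subst nn_integral_eq_integral) auto
  finally show ?thesis using m by (auto simp: ennreal_mult_less_top)
qed

lemma levy_measure_Pi1:
  assumes \<alpha>: "0 < \<alpha>" "\<alpha> \<le> 1"
  shows "levy_measure (Pi1 \<alpha>)"
  unfolding levy_measure_def
proof (intro conjI)
  show "sets (Pi1 \<alpha>) = sets borel" by (simp add: Pi1_def)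
  show "emeasure (Pi1 \<alpha>) {0} = 0" by (simp add: Pi1_def emeasure_density nn_integral_0_iff_AE)
  have "(\<integral>\<^sup>+ y. ennreal (min 1 (y\<^sup>2)) \<partial>Pi1 \<alpha>) = (\<integral>\<^sup>+ w. ennreal (indicator {-1<..} w) * ennreal (min 1 ((ln (1 + w))\<^sup>2)) \<partial>stable_jumps \<alpha>)"
    by (rule nn_integral_Pi1) (use \<alpha> in auto)
  also have "\<dots> \<le> (\<integral>\<^sup>+ w. ennreal (4 * min 1 (w\<^sup>2)) \<partial>stable_jumps \<alpha>)"
  proof (rule nn_integral_mono)
    fix w :: real
    have "min 1 ((ln (1 + w))\<^sup>2) \<le> 4 * min 1 (w\<^sup>2)"
    proof (cases "\<bar>w\<bar> \<le> 1 / 2")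
      case True
      have "(ln (1 + w))\<^sup>2 \<le> (2 * \<bar>w\<bar>)\<^sup>2" using power_mono[OF ln_one_plus_bound[OF True], of 2] by simp
      thus ?thesis by (auto simp: power_mult_distrib min_def)
    qed (use min_one_square_ge[of w] in auto)
    thus "ennreal (indicator {-1<..} w) * ennreal (min 1 ((ln (1 + w))\<^sup>2)) \<le> ennreal (4 * min 1 (w\<^sup>2))"
      by (auto simp: indicator_def intro!: ennreal_leI)
  qed
  also have "\<dots> < \<infinity>" using stable_jumps_integrable[OF \<alpha>] by (subst nn_integral_eq_integral) auto
  finally show "(\<integral>\<^sup>+ y. ennreal (min 1 (y\<^sup>2)) \<partial>Pi1 \<alpha>) < \<infinity>" .
qed

lemma finite_measure_Pi2:
  assumes \<alpha>: "0 < \<alpha>" "\<alpha> \<le> 1"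
  shows "finite_measure (Pi2 \<alpha>)"
proof (rule finite_measureI)
  have "emeasure (Pi2 \<alpha>) (space (Pi2 \<alpha>)) = emeasure (stable_jumps \<alpha>) {..<-1}"
    using \<alpha> by (subst (1) Pi2_eq_distr) (auto simp: Pi2_def emeasure_distr emeasure_density ennreal_indicator)
  also have "\<dots> \<le> emeasure (stable_jumps \<alpha>) {w. 1 \<le> \<bar>w\<bar>}" by (rule emeasure_mono) auto
  also have "\<dots> < \<infinity>" using \<alpha> by (rule stable_jumps_tail) simp
  finally show "emeasure (Pi2 \<alpha>) (space (Pi2 \<alpha>)) \<noteq> \<infinity>" by (rule less_imp_neq)
qed

lemma levy_measure_Pi2:
  assumes \<alpha>: "0 < \<alpha>" "\<alpha> \<le> 1"
  shows "levy_measure (Pi2 \<alpha>)"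
  unfolding levy_measure_def
proof (intro conjI)
  interpret finite_measure "Pi2 \<alpha>" using finite_measure_Pi2[OF \<alpha>] .
  show "sets (Pi2 \<alpha>) = sets borel" by (simp add: Pi2_def)
  show "emeasure (Pi2 \<alpha>) {0} = 0" by (simp add: Pi2_def emeasure_density nn_integral_0_iff_AE)
  have "(\<integral>\<^sup>+ y. ennreal (min 1 (y\<^sup>2)) \<partial>Pi2 \<alpha>) \<le> (\<integral>\<^sup>+ y. 1 \<partial>Pi2 \<alpha>)"
    by (intro nn_integral_mono) (auto simp: min_def)
  also have "\<dots> < \<infinity>" using emeasure_finite[of "space (Pi2 \<alpha>)"] by (simp add: less_top[symmetric])
  finally show "(\<integral>\<^sup>+ y. ennreal (min 1 (y\<^sup>2)) \<partial>Pi2 \<alpha>) < \<infinity>" .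
qed

lemma Pi2_integrable:
  assumes \<alpha>: "0 < \<alpha>" "\<alpha> \<le> 1"
  shows "integrable (Pi2 \<alpha>) (\<lambda>y. iexp (\<theta> * y) - 1)"
proof -
  interpret finite_measure "Pi2 \<alpha>" using finite_measure_Pi2[OF \<alpha>] .
  show ?thesis
    by (rule integrable_const_bound[of _ 2]) (auto simp: Pi2_def cmod_iexp_minus_1_le(2) simp del: of_real_mult)
qed

section \<open>The principal value integral\<close>

lemma truncated_integral_tendsto:
  fixes f :: "real \<Rightarrow> complex"
  assumes int: "integrable \<mu> f" and sets [measurable_cong]: "sets \<mu> = sets borel" and ne: "AE y in \<mu>. y \<noteq> 0"
  shows "((\<lambda>\<epsilon>. CLINT y:{y. \<epsilon> < \<bar>y\<bar>}|\<mu>. f y) \<longlongrightarrow> (CLINT y|\<mu>. f y)) (at_right 0)"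
proof (rule tendsto_at_right_sequentially[of _ 1])
  fix s :: "nat \<Rightarrow> real" assume s: "s \<longlonglongrightarrow> 0"
  have [measurable]: "f \<in> borel_measurable borel" using borel_measurable_integrable[OF int] by simp
  show "(\<lambda>n. CLINT y:{y. s n < \<bar>y\<bar>}|\<mu>. f y) \<longlonglongrightarrow> (CLINT y|\<mu>. f y)"
    unfolding set_lebesgue_integral_def
  proof (rule integral_dominated_convergence[where w = "\<lambda>y. norm (f y)"])
    show "AE y in \<mu>. (\<lambda>n. indicator {y. s n < \<bar>y\<bar>} y *\<^sub>R f y) \<longlonglongrightarrow> f y"
      using ne
    proof eventually_elim
      case (elim y)
      hence "eventually (\<lambda>n. s n < \<bar>y\<bar>) sequentially" by (intro order_tendstoD(2)[OF s]) simp
      thus ?case by (intro tendsto_eventually) (auto elim: eventually_mono)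
    qed
  qed (use int in \<open>auto intro!: AE_I2 split: split_indicator\<close>)
qed simp

text \<open>For \<open>\<alpha> < 1\<close> the jumps are summable, so that no compensation is needed.\<close>

lemma Pi1_integrable:
  assumes \<alpha>: "0 < \<alpha>" "\<alpha> < 1"
  shows "integrable (Pi1 \<alpha>) (\<lambda>y. iexp (\<theta> * y) - 1)"
proof -
  have \<alpha>': "\<alpha> \<le> 1" "\<alpha> < 2" using \<alpha> by auto
  have c: "0 < jump_const \<alpha>" using \<alpha>(1) \<alpha>'(2) by (rule jump_const_pos)
  have near: "(\<integral>\<^sup>+ w. ennreal (\<bar>w\<bar> * indicator {-1..1} w) \<partial>stable_jumps \<alpha>) < \<infinity>"
  proof -
    have "(\<integral>\<^sup>+ w. ennreal (\<bar>w\<bar> * indicator {-1..1} w) \<partial>stable_jumps \<alpha>)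
        = (\<integral>\<^sup>+ w. ennreal (jump_const \<alpha> * \<bar>w\<bar> powr (-1 - \<alpha>)) * ennreal (\<bar>w\<bar> * indicator {-1..1} w) \<partial>lborel)"
      unfolding stable_jumps_def by (rule nn_integral_density) auto
    also have "\<dots> = 2 * (\<integral>\<^sup>+ w. ennreal (jump_const \<alpha> * \<bar>w\<bar> powr (-1 - \<alpha>)) * ennreal (\<bar>w\<bar> * indicator {-1..1} w) * indicator {0<..} w \<partial>lborel)"
      by (rule nn_integral_even) (auto simp: indicator_def)
    also have "(\<integral>\<^sup>+ w. ennreal (jump_const \<alpha> * \<bar>w\<bar> powr (-1 - \<alpha>)) * ennreal (\<bar>w\<bar> * indicator {-1..1} w) * indicator {0<..} w \<partial>lborel)
        = (\<integral>\<^sup>+ w. ennreal (jump_const \<alpha>) * ennreal (indicator {0..1} w * w powr (- \<alpha>)) \<partial>lborel)"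
    proof (rule nn_integral_cong)
      fix w :: real
      show "ennreal (jump_const \<alpha> * \<bar>w\<bar> powr (-1 - \<alpha>)) * ennreal (\<bar>w\<bar> * indicator {-1..1} w) * indicator {0<..} w = ennreal (jump_const \<alpha>) * ennreal (indicator {0..1} w * w powr (- \<alpha>))"
      proof (cases "0 < w \<and> w \<le> 1")
        case True
        have "w powr (- \<alpha>) = w powr (-1 - \<alpha>) * w powr 1" by (simp only: powr_add[symmetric]) simp
        thus ?thesis using True c by (simp add: ennreal_mult[symmetric] mult.assoc)
      qed (auto simp: indicator_def)
    qed
    also have "\<dots> = ennreal (jump_const \<alpha>) * (\<integral>\<^sup>+ w. ennreal (indicator {0..1} w * w powr (- \<alpha>)) \<partial>lborel)"
      by (rule nn_integral_cmult) measurable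
    also have "(\<integral>\<^sup>+ w. ennreal (indicator {0..1} w * w powr (- \<alpha>)) \<partial>lborel) = ennreal (1 powr (- \<alpha> + 1) / (- \<alpha> + 1))"
      by (rule nn_integral_has_integral_lebesgue[OF _ has_integral_powr_from_0]) (use \<alpha> in auto)
    finally show ?thesis by (simp add: ennreal_mult_less_top)
  qed
  have "integrable (stable_jumps \<alpha>) (\<lambda>w. \<bar>w\<bar> * indicator {-1..1} w)"
    by (rule integrableI_nonneg[OF _ _ near]) auto
  hence dom: "integrable (stable_jumps \<alpha>) (\<lambda>w. 2 * \<bar>\<theta>\<bar> * (\<bar>w\<bar> * indicator {-1..1} w) + 8 * min 1 (w\<^sup>2))"
    using stable_jumps_integrable[OF \<alpha>(1) \<alpha>'(1)] by simp
  have "integrable (stable_jumps \<alpha>) (\<lambda>w. indicator {-1<..} w *\<^sub>R (iexp (\<theta> * ln (1 + w)) - 1))"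
  proof (rule Bochner_Integration.integrable_bound[OF dom])
    show "AE w in stable_jumps \<alpha>. norm (indicator {-1<..} w *\<^sub>R (iexp (\<theta> * ln (1 + w)) - 1)) \<le> norm (2 * \<bar>\<theta>\<bar> * (\<bar>w\<bar> * indicator {-1..1} w) + 8 * min 1 (w\<^sup>2))"
    proof (intro AE_I2)
      fix w :: real
      have "norm (iexp (\<theta> * ln (1 + w)) - 1) \<le> 2 * \<bar>\<theta>\<bar> * (\<bar>w\<bar> * indicator {-1..1} w) + 8 * min 1 (w\<^sup>2)"
      proof (cases "\<bar>w\<bar> \<le> 1 / 2")
        case True
        have in1: "w \<in> {-1..1}" using True by auto
        have "norm (iexp (\<theta> * ln (1 + w)) - 1) \<le> \<bar>\<theta>\<bar> * \<bar>ln (1 + w)\<bar>"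
          using cmod_iexp_minus_1_le(1)[of "\<theta> * ln (1 + w)"] by (simp add: abs_mult)
        also have "\<dots> \<le> \<bar>\<theta>\<bar> * (2 * \<bar>w\<bar>)" by (intro mult_left_mono ln_one_plus_bound True) simp
        also have "\<dots> = 2 * \<bar>\<theta>\<bar> * (\<bar>w\<bar> * indicator {-1..1} w) + 0" using in1 by simp
        also have "\<dots> \<le> 2 * \<bar>\<theta>\<bar> * (\<bar>w\<bar> * indicator {-1..1} w) + 8 * min 1 (w\<^sup>2)" by (intro add_left_mono) simp
        finally show ?thesis .
      next
        case False
        have "norm (iexp (\<theta> * ln (1 + w)) - 1) \<le> 0 + 8 * min 1 (w\<^sup>2)"
          using cmod_iexp_minus_1_le(2)[of "\<theta> * ln (1 + w)"] min_one_square_ge[of w] False by simp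
        also have "\<dots> \<le> 2 * \<bar>\<theta>\<bar> * (\<bar>w\<bar> * indicator {-1..1} w) + 8 * min 1 (w\<^sup>2)" by (intro add_right_mono) simp
        finally show ?thesis .
      qed
      moreover have "norm (indicator {-1<..} w *\<^sub>R (iexp (\<theta> * ln (1 + w)) - 1)) \<le> norm (iexp (\<theta> * ln (1 + w)) - 1)"
        by (simp split: split_indicator)
      ultimately show "norm (indicator {-1<..} w *\<^sub>R (iexp (\<theta> * ln (1 + w)) - 1)) \<le> norm (2 * \<bar>\<theta>\<bar> * (\<bar>w\<bar> * indicator {-1..1} w) + 8 * min 1 (w\<^sup>2))"
        unfolding real_norm_def by linarith
    qed
  qed measurable
  thus ?thesis by (subst integral_Pi1(1)[OF \<alpha>(1) \<alpha>'(2)]) auto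
qed

text \<open>Jumps with \<open>|ln (1 + w)| \<le> \<epsilon>\<close>. This interval is not symmetric about the origin, but the excess is of
  second order in \<open>\<epsilon>\<close>.\<close>

definition small_jumps :: "real \<Rightarrow> real set" where
  "small_jumps \<epsilon> = {exp (- \<epsilon>) - 1..exp \<epsilon> - 1}"

lemma sin_outside_small_jumps:
  assumes \<alpha>: "0 < \<alpha>" "\<alpha> \<le> 1" and \<epsilon>: "0 < \<epsilon>"
  shows "integrable (stable_jumps \<alpha>) (\<lambda>w. indicator (- small_jumps \<epsilon>) w * sin w)"
    and "\<bar>LINT w|stable_jumps \<alpha>. indicator (- small_jumps \<epsilon>) w * sin w\<bar> \<le> jump_const \<alpha> * (exp \<epsilon> - 1)"
proof -
  \<comment> \<open>Over \<open>|w| > d\<close> the integral vanishes by symmetry, which leaves the interval \<open>{d<..e}\<close>, of length \<open>d (exp \<epsilon> - 1)\<close>.\<close>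
  define d where "d = 1 - exp (- \<epsilon>)"
  define e where "e = exp \<epsilon> - 1"
  have c: "0 < jump_const \<alpha>" using \<alpha> by (intro jump_const_pos) auto
  have d: "0 < d" "d \<le> 1" using \<epsilon> by (simp_all add: d_def)
  have ed: "(e - d) / d = exp \<epsilon> - 1" and de: "d \<le> e"
  proof -
    define x where "x = exp \<epsilon>"
    have x: "1 < x" using \<epsilon> by (simp add: x_def)
    have "d = (x - 1) / x" "e = x - 1" using x by (simp_all add: d_def e_def x_def exp_minus field_simps)
    moreover have "((x - 1) - (x - 1) / x) / ((x - 1) / x) = x - 1" using x by (simp add: field_simps)
    moreover have "(x - 1) / x \<le> x - 1" using x mult_left_mono[of 1 x "x - 1"] by (simp add: field_simps)
    ultimately show "(e - d) / d = exp \<epsilon> - 1" "d \<le> e" by (simp_all add: x_def)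
  qed
  have big: "integrable (stable_jumps \<alpha>) (\<lambda>w. indicator {w. d \<le> \<bar>w\<bar>} w :: real)"
    using stable_jumps_tail[OF \<alpha> d(1)] by (intro integrable_real_indicator) auto
  have int: "integrable (stable_jumps \<alpha>) (\<lambda>w. indicator B w * sin w)"
    if [measurable]: "B \<in> sets borel" and B: "B \<subseteq> {w. d \<le> \<bar>w\<bar>}" for B
    by (rule Bochner_Integration.integrable_bound[OF big]) (use B in \<open>auto simp: indicator_def\<close>)
  have S: "small_jumps \<epsilon> = {- d..e}" by (simp add: small_jumps_def d_def e_def)
  have split: "indicator (- small_jumps \<epsilon>) w * sin w = indicator {w. d < \<bar>w\<bar>} w * sin w - indicator {d<..e} w * sin w" for w
    using d de by (auto simp: indicator_def S abs_if)
  have sub: "- small_jumps \<epsilon> \<subseteq> {w. d \<le> \<bar>w\<bar>}" using de by (auto simp: S abs_if)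
  have [measurable]: "small_jumps \<epsilon> \<in> sets borel" by (simp add: small_jumps_def)
  show "integrable (stable_jumps \<alpha>) (\<lambda>w. indicator (- small_jumps \<epsilon>) w * sin w)"
    by (rule int[OF _ sub]) measurable
  have int1: "integrable (stable_jumps \<alpha>) (\<lambda>w. indicator {w. d < \<bar>w\<bar>} w * sin w)"
    by (rule int) auto
  have int2: "integrable (stable_jumps \<alpha>) (\<lambda>w. indicator {d<..e} w * sin w)"
    by (rule int) (use d in auto)
  have "(LINT w|stable_jumps \<alpha>. indicator {w. d < \<bar>w\<bar>} w * sin w) = (LINT w|distr (stable_jumps \<alpha>) borel uminus. indicator {w. d < \<bar>w\<bar>} w * sin w)"
    by (simp add: stable_jumps_symmetric)
  also have "\<dots> = (LINT w|stable_jumps \<alpha>. - (indicator {w. d < \<bar>w\<bar>} w * sin w))"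
    by (subst integral_distr) (auto simp: indicator_def intro!: Bochner_Integration.integral_cong)
  finally have odd: "(LINT w|stable_jumps \<alpha>. indicator {w. d < \<bar>w\<bar>} w * sin w) = 0" by simp
  have "ennreal (norm (LINT w|stable_jumps \<alpha>. indicator {d<..e} w * sin w)) \<le> (\<integral>\<^sup>+ w. norm (indicator {d<..e} w * sin w) \<partial>stable_jumps \<alpha>)"
    by (rule integral_norm_bound_ennreal[OF int2])
  also have "\<dots> = (\<integral>\<^sup>+ w. ennreal (jump_const \<alpha> * \<bar>w\<bar> powr (-1 - \<alpha>)) * ennreal (norm (indicator {d<..e} w * sin w)) \<partial>lborel)"
    unfolding stable_jumps_def by (rule nn_integral_density) auto
  also have "\<dots> \<le> (\<integral>\<^sup>+ w. ennreal (jump_const \<alpha> / d) * indicator {d<..e} w \<partial>lborel)"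
  proof (rule nn_integral_mono)
    fix w :: real
    show "ennreal (jump_const \<alpha> * \<bar>w\<bar> powr (-1 - \<alpha>)) * ennreal (norm (indicator {d<..e} w * sin w)) \<le> ennreal (jump_const \<alpha> / d) * indicator {d<..e} w"
    proof (cases "w \<in> {d<..e}")
      case True
      hence w: "d < w" "0 < w" using d by auto
      have "\<bar>w\<bar> powr (-1 - \<alpha>) * \<bar>sin w\<bar> \<le> w powr (-1 - \<alpha>) * w powr 1"
        using w abs_sin_x_le_abs_x[of w] by (auto intro!: mult_left_mono)
      also have "\<dots> = w powr (- \<alpha>)" by (simp only: powr_add[symmetric]) simp
      also have "\<dots> \<le> d powr (- \<alpha>)" using \<alpha> d w by (intro powr_mono2') auto
      also have "\<dots> \<le> d powr (-1)" using \<alpha> d by (intro powr_mono') auto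
      also have "\<dots> = 1 / d" using d by (simp add: powr_minus_divide)
      finally have "jump_const \<alpha> * (\<bar>w\<bar> powr (-1 - \<alpha>) * \<bar>sin w\<bar>) \<le> jump_const \<alpha> * (1 / d)"
        using c by (intro mult_left_mono) auto
      hence "ennreal (jump_const \<alpha> * (\<bar>w\<bar> powr (-1 - \<alpha>) * \<bar>sin w\<bar>)) \<le> ennreal (jump_const \<alpha> * (1 / d))"
        by (rule ennreal_leI)
      thus ?thesis using True c by (simp add: ennreal_mult[symmetric] mult.assoc)
    qed simp
  qed
  also have "\<dots> = ennreal (jump_const \<alpha> / d) * ennreal (e - d)" using de by (simp add: nn_integral_cmult_indicator)
  also have "\<dots> = ennreal (jump_const \<alpha> * ((e - d) / d))" using c d de by (simp add: ennreal_mult[symmetric])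
  finally have "norm (LINT w|stable_jumps \<alpha>. indicator {d<..e} w * sin w) \<le> jump_const \<alpha> * (exp \<epsilon> - 1)"
    unfolding ed using c \<epsilon> by (subst (asm) ennreal_le_iff) auto
  thus "\<bar>LINT w|stable_jumps \<alpha>. indicator (- small_jumps \<epsilon>) w * sin w\<bar> \<le> jump_const \<alpha> * (exp \<epsilon> - 1)"
    unfolding split using int1 int2 odd by simp
qed

theorem Pi1_has_pv_integral:
  assumes \<alpha>: "0 < \<alpha>" "\<alpha> \<le> 1"
  shows "has_pv_integral (Pi1 \<alpha>) (\<lambda>y. iexp (\<theta> * y) - 1)
    ((CLINT w|stable_jumps \<alpha>. radial_jump \<theta> w) - (CLINT y|Pi2 \<alpha>. iexp (\<theta> * y) - 1))"
proof -
  let ?J = "stable_jumps \<alpha>"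
  have \<alpha>2: "\<alpha> < 2" using \<alpha> by simp
  define K where "K w = iexp (\<theta> * ln \<bar>1 + w\<bar>) - 1" for w
  have [measurable]: "K \<in> borel_measurable borel" unfolding K_def[abs_def] by measurable
  have [measurable]: "small_jumps \<epsilon> \<in> sets borel" for \<epsilon> by (simp add: small_jumps_def)
  have K_bound: "norm (K w) \<le> 2" for w unfolding K_def by (rule cmod_iexp_minus_1_le)
  have K_int: "integrable ?J (\<lambda>w. indicator B w *\<^sub>R K w)"
    if [measurable]: "B \<in> sets borel" and B: "B \<subseteq> {w. d \<le> \<bar>w\<bar>}" and d: "0 < d" for B d
  proof (rule Bochner_Integration.integrable_bound)
    show "integrable ?J (\<lambda>w. 2 * indicator {w. d \<le> \<bar>w\<bar>} w :: real)"
      using stable_jumps_tail[OF \<alpha> d] by (intro integrable_mult_right integrable_real_indicator) auto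
    show "AE w in ?J. norm (indicator B w *\<^sub>R K w) \<le> norm (2 * indicator {w. d \<le> \<bar>w\<bar>} w :: real)"
      using B K_bound by (intro AE_I2) (auto simp: indicator_def)
  qed measurable
  have trunc: "indicator {-1<..} w *\<^sub>R (indicator {y. \<epsilon> < \<bar>y\<bar>} (ln (1 + w)) *\<^sub>R (iexp (\<theta> * ln (1 + w)) - 1))
      = indicator ({-1<..} - small_jumps \<epsilon>) w *\<^sub>R K w" for \<epsilon> w
  proof (cases "-1 < w")
    case True
    define u where "u = ln (1 + w)"
    have w: "w = exp u - 1" using True by (simp add: u_def)
    have "\<epsilon> < \<bar>u\<bar> \<longleftrightarrow> w \<notin> small_jumps \<epsilon>" unfolding w small_jumps_def by auto
    thus ?thesis using True by (simp add: K_def u_def[symmetric] indicator_def del: of_real_mult)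
  qed simp
  have outer: "{-1<..} - small_jumps \<epsilon> \<subseteq> {w. 1 - exp (- \<epsilon>) \<le> \<bar>w\<bar>}" if "0 < \<epsilon>" for \<epsilon>
  proof -
    have "1 - exp (- \<epsilon>) \<le> exp \<epsilon> - 1"
      using exp_ge_add_one_self[of \<epsilon>] exp_ge_add_one_self[of "- \<epsilon>"] by linarith
    thus ?thesis by (auto simp: small_jumps_def abs_if)
  qed
  have pv_int: "set_integrable (Pi1 \<alpha>) {y. \<epsilon> < \<bar>y\<bar>} (\<lambda>y. iexp (\<theta> * y) - 1)" if \<epsilon>: "0 < \<epsilon>" for \<epsilon>
  proof -
    have "integrable ?J (\<lambda>w. indicator ({-1<..} - small_jumps \<epsilon>) w *\<^sub>R K w)"
      by (rule K_int[OF _ outer[OF \<epsilon>]]) (use \<epsilon> in auto)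
    moreover have "integrable (Pi1 \<alpha>) (\<lambda>y. indicator {y. \<epsilon> < \<bar>y\<bar>} y *\<^sub>R (iexp (\<theta> * y) - 1))
        \<longleftrightarrow> integrable ?J (\<lambda>w. indicator {-1<..} w *\<^sub>R (indicator {y. \<epsilon> < \<bar>y\<bar>} (ln (1 + w)) *\<^sub>R (iexp (\<theta> * ln (1 + w)) - 1)))"
      by (rule integral_Pi1(1)[OF \<alpha>(1) \<alpha>2]) measurable
    ultimately show ?thesis by (simp only: set_integrable_def trunc)
  qed
  \<comment> \<open>The four terms are all jumps, the jumps across the origin, the jumps that are cut off, and the compensator outside them.\<close>
  have pv: "(CLINT y:{y. \<epsilon> < \<bar>y\<bar>}|Pi1 \<alpha>. iexp (\<theta> * y) - 1)
      = (CLINT w|?J. radial_jump \<theta> w) - (CLINT y|Pi2 \<alpha>. iexp (\<theta> * y) - 1)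
        - (CLINT w|?J. indicator (small_jumps \<epsilon>) w *\<^sub>R radial_jump \<theta> w)
        + \<i> * complex_of_real (\<theta> * (LINT w|?J. indicator (- small_jumps \<epsilon>) w * sin w))" if \<epsilon>: "0 < \<epsilon>" for \<epsilon>
  proof -
    have int1: "integrable ?J (radial_jump \<theta>)" by (rule radial_jump_integrable[OF \<alpha>])
    have int2: "integrable ?J (\<lambda>w. indicator {..<-1} w *\<^sub>R K w)" by (rule K_int[where d = 1]) auto
    have int3: "integrable ?J (\<lambda>w. indicator (small_jumps \<epsilon>) w *\<^sub>R radial_jump \<theta> w)"
      using int1 by (rule integrable_mult_indicator[rotated]) simp
    have int4: "integrable ?J (\<lambda>w. \<i> * complex_of_real (\<theta> * (indicator (- small_jumps \<epsilon>) w * sin w)))"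
      using sin_outside_small_jumps(1)[OF \<alpha> \<epsilon>] by (intro integrable_mult_right) (simp only: complex_of_real_integrable_eq integrable_mult_right)
    have "(CLINT y:{y. \<epsilon> < \<bar>y\<bar>}|Pi1 \<alpha>. iexp (\<theta> * y) - 1) = (CLINT w|?J. indicator ({-1<..} - small_jumps \<epsilon>) w *\<^sub>R K w)"
      unfolding set_lebesgue_integral_def by (subst integral_Pi1(2)[OF \<alpha>(1) \<alpha>2], measurable) (unfold trunc, rule refl)
    also have "\<dots> = (CLINT w|?J. radial_jump \<theta> w - indicator {..<-1} w *\<^sub>R K w - indicator (small_jumps \<epsilon>) w *\<^sub>R radial_jump \<theta> w
        + \<i> * complex_of_real (\<theta> * (indicator (- small_jumps \<epsilon>) w * sin w)))"
    proof (rule integral_cong_AE)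
      have "AE w in ?J. w \<noteq> -1" by (rule AE_stable_jumps) (rule AE_lborel_singleton)
      thus "AE w in ?J. indicator ({-1<..} - small_jumps \<epsilon>) w *\<^sub>R K w = radial_jump \<theta> w - indicator {..<-1} w *\<^sub>R K w - indicator (small_jumps \<epsilon>) w *\<^sub>R radial_jump \<theta> w
        + \<i> * complex_of_real (\<theta> * (indicator (- small_jumps \<epsilon>) w * sin w))"
      proof eventually_elim
        case (elim w)
        have rj: "radial_jump \<theta> w = K w - \<i> * complex_of_real (\<theta> * sin w)" by (simp add: radial_jump_def K_def)
        have "w \<in> small_jumps \<epsilon> \<Longrightarrow> -1 < w" using exp_gt_zero[of "- \<epsilon>"] by (auto simp: small_jumps_def simp del: exp_gt_zero)
        thus ?case using elim unfolding rj by (cases "w \<in> small_jumps \<epsilon>"; cases "-1 < w") auto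
      qed
    qed measurable
    also have "\<dots> = (CLINT w|?J. radial_jump \<theta> w) - (CLINT w|?J. indicator {..<-1} w *\<^sub>R K w)
        - (CLINT w|?J. indicator (small_jumps \<epsilon>) w *\<^sub>R radial_jump \<theta> w)
        + (CLINT w|?J. \<i> * complex_of_real (\<theta> * (indicator (- small_jumps \<epsilon>) w * sin w)))"
      using int1 int2 int3 int4
      by (simp only: Bochner_Integration.integral_add Bochner_Integration.integral_diff Bochner_Integration.integrable_diff)
    also have "(CLINT w|?J. \<i> * complex_of_real (\<theta> * (indicator (- small_jumps \<epsilon>) w * sin w)))
        = \<i> * complex_of_real (\<theta> * (LINT w|?J. indicator (- small_jumps \<epsilon>) w * sin w))"
      by (simp only: integral_mult_right_zero integral_complex_of_real)
    also have "(CLINT w|?J. indicator {..<-1} w *\<^sub>R K w) = (CLINT y|Pi2 \<alpha>. iexp (\<theta> * y) - 1)"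
    proof (subst integral_Pi2[OF \<alpha>(1) \<alpha>2])
      show "(CLINT w|?J. indicator {..<-1} w *\<^sub>R K w) = (CLINT w|?J. indicator {..<-1} w *\<^sub>R (iexp (\<theta> * ln (-1 - w)) - 1))"
      proof (rule Bochner_Integration.integral_cong)
        fix w :: real
        have "\<bar>1 + w\<bar> = -1 - w" if "w < -1" using that by simp
        thus "indicator {..<-1} w *\<^sub>R K w = indicator {..<-1} w *\<^sub>R (iexp (\<theta> * ln (-1 - w)) - 1)"
          by (auto simp: K_def indicator_def)
      qed simp
    qed measurable
    finally show ?thesis .
  qed
  have small: "((\<lambda>\<epsilon>. CLINT w|?J. indicator (small_jumps \<epsilon>) w *\<^sub>R radial_jump \<theta> w) \<longlongrightarrow> 0) (at_right 0)"
  proof (rule tendsto_at_right_sequentially[of _ 1])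
    fix s :: "nat \<Rightarrow> real" assume s: "s \<longlonglongrightarrow> 0"
    have "(\<lambda>n. CLINT w|?J. indicator (small_jumps (s n)) w *\<^sub>R radial_jump \<theta> w) \<longlonglongrightarrow> (CLINT w|?J. 0)"
    proof (rule integral_dominated_convergence[where w = "\<lambda>w. norm (radial_jump \<theta> w)"])
      have "AE w in ?J. w \<noteq> 0" by (rule AE_stable_jumps) (rule AE_lborel_singleton)
      thus "AE w in ?J. (\<lambda>n. indicator (small_jumps (s n)) w *\<^sub>R radial_jump \<theta> w) \<longlonglongrightarrow> 0"
      proof eventually_elim
        case (elim w)
        have "(\<lambda>n. exp (s n) - 1) \<longlonglongrightarrow> exp 0 - 1" "(\<lambda>n. exp (- s n) - 1) \<longlonglongrightarrow> exp (- 0) - 1" by (intro tendsto_intros s)+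
        hence lim: "(\<lambda>n. exp (s n) - 1) \<longlonglongrightarrow> 0" "(\<lambda>n. exp (- s n) - 1) \<longlonglongrightarrow> 0" by simp_all
        have "eventually (\<lambda>n. w \<notin> small_jumps (s n)) sequentially"
        proof (cases "0 < w")
          case True
          show ?thesis using order_tendstoD(2)[OF lim(1) True] by eventually_elim (simp add: small_jumps_def)
        next
          case False
          hence "w < 0" using elim by simp
          show ?thesis using order_tendstoD(1)[OF lim(2) \<open>w < 0\<close>] by eventually_elim (simp add: small_jumps_def)
        qed
        thus ?case by (intro tendsto_eventually) (auto elim: eventually_mono)
      qed
    qed (use radial_jump_integrable[OF \<alpha>] in \<open>auto intro!: AE_I2 split: split_indicator\<close>)
    thus "(\<lambda>n. CLINT w|?J. indicator (small_jumps (s n)) w *\<^sub>R radial_jump \<theta> w) \<longlonglongrightarrow> 0" by simp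
  qed simp
  have sin: "((\<lambda>\<epsilon>. LINT w|?J. indicator (- small_jumps \<epsilon>) w * sin w) \<longlongrightarrow> 0) (at_right 0)"
  proof (rule Lim_null_comparison)
    show "eventually (\<lambda>\<epsilon>. norm (LINT w|?J. indicator (- small_jumps \<epsilon>) w * sin w) \<le> jump_const \<alpha> * (exp \<epsilon> - 1)) (at_right 0)"
      using eventually_at_right_less[of 0] by eventually_elim (simp add: sin_outside_small_jumps(2)[OF \<alpha>])
    have "((\<lambda>\<epsilon>. jump_const \<alpha> * (exp \<epsilon> - 1)) \<longlongrightarrow> jump_const \<alpha> * (exp 0 - 1)) (at_right 0)"
      by (intro tendsto_intros)
    thus "((\<lambda>\<epsilon>. jump_const \<alpha> * (exp \<epsilon> - 1)) \<longlongrightarrow> 0) (at_right 0)" by simp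
  qed
  have "((\<lambda>\<epsilon>. (CLINT w|?J. radial_jump \<theta> w) - (CLINT y|Pi2 \<alpha>. iexp (\<theta> * y) - 1)
        - (CLINT w|?J. indicator (small_jumps \<epsilon>) w *\<^sub>R radial_jump \<theta> w)
        + \<i> * complex_of_real (\<theta> * (LINT w|?J. indicator (- small_jumps \<epsilon>) w * sin w))) \<longlongrightarrow>
      (CLINT w|?J. radial_jump \<theta> w) - (CLINT y|Pi2 \<alpha>. iexp (\<theta> * y) - 1) - 0 + \<i> * complex_of_real (\<theta> * 0)) (at_right 0)"
    by (intro tendsto_intros small sin)
  moreover have "eventually (\<lambda>\<epsilon>. (CLINT w|?J. radial_jump \<theta> w) - (CLINT y|Pi2 \<alpha>. iexp (\<theta> * y) - 1)
        - (CLINT w|?J. indicator (small_jumps \<epsilon>) w *\<^sub>R radial_jump \<theta> w)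
        + \<i> * complex_of_real (\<theta> * (LINT w|?J. indicator (- small_jumps \<epsilon>) w * sin w))
        = (CLINT y:{y. \<epsilon> < \<bar>y\<bar>}|Pi1 \<alpha>. iexp (\<theta> * y) - 1)) (at_right 0)"
    using eventually_at_right_less[of 0] by eventually_elim (rule pv[symmetric])
  ultimately have "((\<lambda>\<epsilon>. CLINT y:{y. \<epsilon> < \<bar>y\<bar>}|Pi1 \<alpha>. iexp (\<theta> * y) - 1) \<longlongrightarrow>
      (CLINT w|?J. radial_jump \<theta> w) - (CLINT y|Pi2 \<alpha>. iexp (\<theta> * y) - 1) - 0 + \<i> * complex_of_real (\<theta> * 0)) (at_right 0)"
    by (rule Lim_transform_eventually)
  thus ?thesis using pv_int by (simp add: has_pv_integral_def)
qed

section \<open>The characteristic exponent of the underlying Levy process\<close>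

theorem radial_exponent:
  assumes \<alpha>: "0 < \<alpha>" "\<alpha> \<le> 1" and x: "x \<noteq> 0"
    and Z: "symmetric_stable_process M \<alpha> x Z"
    and rep: "lamperti_representation M \<alpha> \<bar>x\<bar> (\<lambda>t \<omega>. \<bar>Z t \<omega>\<bar>) \<xi>"
    and \<xi>: "has_char_exponent M \<xi> \<Psi>"
  shows "\<Psi> \<theta> = (CLINT w|stable_jumps \<alpha>. radial_jump \<theta> w)"
proof -
  have levy: "levy_process M (\<lambda>t \<omega>. Z t \<omega> - x)"
    and expo: "has_char_exponent M (\<lambda>t \<omega>. Z t \<omega> - x) (\<lambda>\<theta>. - complex_of_real (\<bar>\<theta>\<bar> powr \<alpha>))"
    using Z by (simp_all add: symmetric_stable_process_def)
  interpret M: prob_space M using levy by (simp add: levy_process_def)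
  have meas: "(\<lambda>\<omega>. Z t \<omega> - x) \<in> borel_measurable M" if "0 \<le> t" for t
    using levy that by (simp add: levy_process_def)
  have Zm: "Z t \<in> borel_measurable M" if "0 \<le> t" for t
  proof -
    have "(\<lambda>\<omega>. (Z t \<omega> - x) + x) \<in> borel_measurable M" by (intro borel_measurable_add meas that) simp
    thus ?thesis by simp
  qed
  define t where "t n = 1 / real (Suc n)" for n
  have t: "0 < t n" "t n \<le> 1" "t \<longlonglongrightarrow> 0" for n
    using LIMSEQ_inverse_real_of_nat by (simp_all add: t_def[abs_def] inverse_eq_divide)
  define s where "s n = t n * \<bar>x\<bar> powr \<alpha>" for n
  have s: "0 \<le> s n" for n using t(1)[of n] by (simp add: s_def)
  \<comment> \<open>By scaling, the relative displacement at time \<open>t |x| powr \<alpha>\<close> is a stable variable at time \<open>t\<close>.\<close>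
  define W where "W n \<omega> = (Z (s n) \<omega> - x) / x" for n \<omega>
  have W [measurable]: "W n \<in> borel_measurable M" for n
    unfolding W_def by (intro borel_measurable_divide meas s) simp
  have law: "char (distr M borel (W n)) \<theta> = complex_of_real (exp (- t n * \<bar>\<theta>\<bar> powr \<alpha>))" for n \<theta>
  proof -
    have "char (distr M borel (W n)) \<theta> = (CLINT \<omega>|M. iexp (\<theta> * W n \<omega>))" by (rule M.char_distr) simp
    also have "\<dots> = (CLINT \<omega>|M. iexp ((\<theta> / x) * (Z (s n) \<omega> - x)))" by (simp add: W_def)
    also have "\<dots> = char (distr M borel (\<lambda>\<omega>. Z (s n) \<omega> - x)) (\<theta> / x)"
      by (rule M.char_distr[symmetric]) (rule meas[OF s])
    also have "\<dots> = exp (complex_of_real (s n) * - complex_of_real (\<bar>\<theta> / x\<bar> powr \<alpha>))"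
      using expo s[of n] by (simp add: has_char_exponent_def)
    also have "\<dots> = complex_of_real (exp (- (s n * \<bar>\<theta> / x\<bar> powr \<alpha>)))"
      by (simp add: exp_of_real[symmetric])
    also have "s n * \<bar>\<theta> / x\<bar> powr \<alpha> = t n * \<bar>\<theta>\<bar> powr \<alpha>"
      using x by (simp add: s_def abs_divide powr_divide)
    finally show ?thesis by simp
  qed
  have "(\<lambda>n. ((CLINT w|distr M borel (W n). iexp (\<theta> * ln \<bar>1 + w\<bar>)) - 1) / t n) \<longlonglongrightarrow> (CLINT w|stable_jumps \<alpha>. radial_jump \<theta> w)"
    by (rule radial_stable_limit[OF \<alpha> M.real_distribution_distr[OF W] law t])
  moreover have "(CLINT w|distr M borel (W n). iexp (\<theta> * ln \<bar>1 + w\<bar>)) = (CLINT \<omega>|M. iexp (\<theta> * ln (\<bar>Z (s n) \<omega>\<bar> / \<bar>x\<bar>)))" for n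
  proof -
    have "1 + W n \<omega> = Z (s n) \<omega> / x" for \<omega> using x by (simp add: W_def field_simps)
    hence "\<bar>1 + W n \<omega>\<bar> = \<bar>Z (s n) \<omega>\<bar> / \<bar>x\<bar>" for \<omega> by (simp add: abs_divide)
    thus ?thesis by (subst integral_distr) auto
  qed
  moreover have "(\<lambda>n. ((CLINT \<omega>|M. iexp (\<theta> * ln (\<bar>Z (t n * \<bar>x\<bar> powr \<alpha>) \<omega>\<bar> / \<bar>x\<bar>))) - 1) / t n) \<longlonglongrightarrow> \<Psi> \<theta>"
    by (rule lamperti_exponent_limit[OF \<alpha>(1) _ rep \<xi> _ t(1,3)]) (use x Zm in auto)
  ultimately show ?thesis by (simp only: s_def) (rule LIMSEQ_unique)
qed

theorem proposition1:
  fixes \<alpha> x :: real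
    and M :: "'a measure"
    and Z \<xi> :: "real \<Rightarrow> 'a \<Rightarrow> real"
    and \<Psi> :: "real \<Rightarrow> complex"
  assumes "0 < \<alpha>" and "\<alpha> \<le> 1"
    and "x \<noteq> 0"
    and "symmetric_stable_process M \<alpha> x Z"
    and "lamperti_representation M \<alpha> \<bar>x\<bar> (\<lambda>t \<omega>. \<bar>Z t \<omega>\<bar>) \<xi>"
    and "has_char_exponent M \<xi> \<Psi>"
  shows "(\<forall>\<theta>. integrable (Pi2 \<alpha>) (\<lambda>y. iexp (\<theta> * y) - 1) \<and>
            (\<exists>I. has_pv_integral (Pi1 \<alpha>) (\<lambda>y. iexp (\<theta> * y) - 1) I \<and>
                 (\<alpha> < 1 \<longrightarrow>
                    integrable (Pi1 \<alpha>) (\<lambda>y. iexp (\<theta> * y) - 1) \<and>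
                    I = (CLINT y|Pi1 \<alpha>. iexp (\<theta> * y) - 1)) \<and>
                 \<Psi> \<theta> = I + (CLINT y|Pi2 \<alpha>. iexp (\<theta> * y) - 1))) \<and>
         (\<exists>(M1 :: (nat \<Rightarrow> real) measure) X1.
            lamperti_levy_process_0_1 \<alpha> M1 X1 \<and> has_levy_measure M1 X1 (Pi1 \<alpha>)) \<and>
         (\<exists>(M2 :: (nat \<Rightarrow> real) measure) X2.
            compound_poisson_process M2 X2 \<and> has_levy_measure M2 X2 (Pi2 \<alpha>))"
proof (intro conjI allI)
  note \<alpha> = \<open>0 < \<alpha>\<close> \<open>\<alpha> \<le> 1\<close>
  fix \<theta> :: real
  show "integrable (Pi2 \<alpha>) (\<lambda>y. iexp (\<theta> * y) - 1)" by (rule Pi2_integrable[OF \<alpha>])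
  define I where "I = (CLINT w|stable_jumps \<alpha>. radial_jump \<theta> w) - (CLINT y|Pi2 \<alpha>. iexp (\<theta> * y) - 1)"
  have pv: "has_pv_integral (Pi1 \<alpha>) (\<lambda>y. iexp (\<theta> * y) - 1) I"
    unfolding I_def by (rule Pi1_has_pv_integral[OF \<alpha>])
  have "integrable (Pi1 \<alpha>) (\<lambda>y. iexp (\<theta> * y) - 1) \<and> I = (CLINT y|Pi1 \<alpha>. iexp (\<theta> * y) - 1)" if "\<alpha> < 1"
  proof
    show int: "integrable (Pi1 \<alpha>) (\<lambda>y. iexp (\<theta> * y) - 1)" by (rule Pi1_integrable[OF \<alpha>(1) that])
    have sets: "sets (Pi1 \<alpha>) = sets borel" by (simp add: Pi1_def)
    have ne: "AE y in Pi1 \<alpha>. y \<noteq> 0"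
      unfolding Pi1_def by (subst AE_density) (use AE_lborel_singleton[of 0] in \<open>auto elim: eventually_mono\<close>)
    have "((\<lambda>\<epsilon>. CLINT y:{y. \<epsilon> < \<bar>y\<bar>}|Pi1 \<alpha>. iexp (\<theta> * y) - 1) \<longlongrightarrow> I) (at_right 0)"
      using pv by (simp add: has_pv_integral_def)
    thus "I = (CLINT y|Pi1 \<alpha>. iexp (\<theta> * y) - 1)"
      by (rule tendsto_unique[OF trivial_limit_at_right_real _ truncated_integral_tendsto[OF int sets ne]])
  qed
  moreover have "\<Psi> \<theta> = I + (CLINT y|Pi2 \<alpha>. iexp (\<theta> * y) - 1)"
    unfolding I_def using radial_exponent[OF \<alpha> assms(3-6), of \<theta>] by simp
  ultimately show "\<exists>I. has_pv_integral (Pi1 \<alpha>) (\<lambda>y. iexp (\<theta> * y) - 1) I \<and>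
      (\<alpha> < 1 \<longrightarrow> integrable (Pi1 \<alpha>) (\<lambda>y. iexp (\<theta> * y) - 1) \<and> I = (CLINT y|Pi1 \<alpha>. iexp (\<theta> * y) - 1)) \<and>
      \<Psi> \<theta> = I + (CLINT y|Pi2 \<alpha>. iexp (\<theta> * y) - 1)"
    using pv by blast
next
  show "\<exists>(M1 :: (nat \<Rightarrow> real) measure) X1. lamperti_levy_process_0_1 \<alpha> M1 X1 \<and> has_levy_measure M1 X1 (Pi1 \<alpha>)"
    using levy_process_exists[OF levy_measure_Pi1] assms(1,2) by (simp add: lamperti_levy_process_0_1_def)
next
  show "\<exists>(M2 :: (nat \<Rightarrow> real) measure) X2. compound_poisson_process M2 X2 \<and> has_levy_measure M2 X2 (Pi2 \<alpha>)"
    using assms(1,2) by (intro finite_levy_measure_compound_poisson levy_measure_Pi2 finite_measure_Pi2)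
qed

end
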